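(* Let $N\ge2$, $0<\alpha<1$, let $\Omega\subset\mathbb{R}^N$ be a bounded domain with connected boundary $\Gamma$ of class $C^{2,\alpha}$, and suppose the mean curvature $H$ of $\Gamma$ satisfies $H>0$ on $\Gamma$. Let $u$ be the solution of $\Delta u=N$ in $\Omega$, $u=0$ on $\Gamma$, and $M=\max_{\overline\Omega}|\nabla u|$. There exist constants $k_N,\alpha_N>0$ depending only on $N$ and a point $z\in\Omega$ such that, with $\rho_i=\min_{x\in\Gamma}|x-z|$, $\rho_e=\max_{x\in\Gamma}|x-z|$ and $\mu_0(\Omega)$ computed with respect to $x_0=z$: (i) if $N=2$ or $3$, $\rho_e-\rho_i\le C\big(\int_\Gamma\frac{dS_x}{H}-N|\Omega|\big)^{1/2}$ with $C=k_N\,c\,\frac{d_\Omega^\gamma}{|\Omega|^{1/N}}\frac{1+\mu_0(\Omega)}{\mu_0(\Omega)}$; (ii) if $N\ge4$, $\rho_e-\rho_i\le C\big(\int_\Gamma\frac{dS_x}{H}-N|\Omega|\big)^{1/(N+2)}$ whenever $\int_\Gamma\frac{dS_x}{H}-N|\Omega|<\varepsilon$, with $C=k_N\frac{M^{N/(N+2)}}{\mu_0(\Omega)^{2/(N+2)}|\Omega|^{1/N}}$ and $\varepsilon=\alpha_N\,\mu_0(\Omega)^2M^2r_i^{N+2}$.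
   Context: $|\Omega|$ volume, $d_\Omega$ diameter. $H=\frac1{N-1}\mathrm{div}\,\nu$ with $\nu$ the outward normal (sphere of radius $\rho$ has $H=1/\rho$). $r_i>0$ is a radius of the uniform interior sphere condition (for every $p\in\Gamma$ a ball of radius $r_i$ in $\Omega$ has closure meeting $\Gamma$ only at $p$). For $x_0\in\Omega$, $\mu_0(\Omega)=\inf\{\int_\Omega|\nabla v|^2:\ v\in W^{1,2}(\Omega),\ \Delta v=0,\ \int_\Omega v^2=1,\ v(x_0)=0\}>0$. For $N=2$, $\gamma\in(0,1)$ is fixed; for $N=3$, $\gamma=1/2$; $c$ satisfies $|v(x)-v(y)|\le c\|v\|_{W^{2,2}(\Omega)}|x-y|^\gamma$ for all $v\in W^{2,2}(\Omega)$, $x,y\in\overline\Omega$. *)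

theory Defs
  imports "HOL-Analysis.Analysis"
begin

definition pd :: "('a::euclidean_space \<Rightarrow> real) \<Rightarrow> 'a \<Rightarrow> 'a \<Rightarrow> real" where
  "pd f b x = deriv (\<lambda>t. f (x + t *\<^sub>R b)) 0"

definition grad :: "('a::euclidean_space \<Rightarrow> real) \<Rightarrow> 'a \<Rightarrow> 'a" where
  "grad f x = (\<Sum>b\<in>Basis. pd f b x *\<^sub>R b)"

definition lap :: "('a::euclidean_space \<Rightarrow> real) \<Rightarrow> 'a \<Rightarrow> real" where
  "lap f x = (\<Sum>b\<in>Basis. pd (pd f b) b x)"

definition C1_on :: "'a::euclidean_space set \<Rightarrow> ('a \<Rightarrow> real) \<Rightarrow> bool" where
  "C1_on U f \<longleftrightarrow> (\<forall>x\<in>U. f differentiable (at x)) \<and> (\<forall>b\<in>Basis. continuous_on U (pd f b))"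

definition C2_on :: "'a::euclidean_space set \<Rightarrow> ('a \<Rightarrow> real) \<Rightarrow> bool" where
  "C2_on U f \<longleftrightarrow> C1_on U f \<and> (\<forall>b\<in>Basis. C1_on U (pd f b))"

fun pdl :: "('a::euclidean_space \<Rightarrow> real) \<Rightarrow> 'a list \<Rightarrow> 'a \<Rightarrow> real" where
  "pdl f [] = f"
| "pdl f (b # bs) = pd (pdl f bs) b"

definition smooth_on :: "'a::euclidean_space set \<Rightarrow> ('a \<Rightarrow> real) \<Rightarrow> bool" where
  "smooth_on U f \<longleftrightarrow> (\<forall>bs. set bs \<subseteq> Basis \<longrightarrow> (\<forall>x\<in>U. pdl f bs differentiable (at x)))"

text \<open>Local defining function of class C^2 at a boundary point p:
  near p, the domain is the sublevel set {phi < 0}, with non-vanishing gradient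
  (so grad phi points outward).\<close>
definition local_defn :: "'a::euclidean_space set \<Rightarrow> 'a \<Rightarrow> real \<Rightarrow> ('a \<Rightarrow> real) \<Rightarrow> bool" where
  "local_defn \<Omega> p r \<phi> \<longleftrightarrow> r > 0 \<and> C2_on (ball p r) \<phi> \<and>
     (\<forall>x\<in>ball p r. grad \<phi> x \<noteq> 0) \<and>
     \<Omega> \<inter> ball p r = {x\<in>ball p r. \<phi> x < 0}"

definition C2alpha_boundary :: "'a::euclidean_space set \<Rightarrow> real \<Rightarrow> bool" where
  "C2alpha_boundary \<Omega> \<alpha> \<longleftrightarrow> (\<forall>p\<in>frontier \<Omega>. \<exists>r \<phi> L. local_defn \<Omega> p r \<phi> \<and>
     (\<forall>b\<in>Basis. \<forall>b'\<in>Basis. \<forall>x\<in>ball p r. \<forall>y\<in>ball p r.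
        \<bar>pd (pd \<phi> b) b' x - pd (pd \<phi> b) b' y\<bar> \<le> L * dist x y powr \<alpha>))"

definition div_normal :: "('a::euclidean_space \<Rightarrow> real) \<Rightarrow> 'a \<Rightarrow> real" where
  "div_normal \<phi> x = (\<Sum>b\<in>Basis. pd (\<lambda>y. pd \<phi> b y / norm (grad \<phi> y)) b x)"

text \<open>Mean curvature H = div(nu)/(N-1) at a boundary point (independent of the chosen
  local defining function).\<close>
definition mean_curv :: "'a::euclidean_space set \<Rightarrow> 'a \<Rightarrow> real" where
  "mean_curv \<Omega> x = (SOME h. \<exists>r \<phi>. local_defn \<Omega> x r \<phi> \<and>
       h = div_normal \<phi> x / (real DIM('a) - 1))"

definition hausdorff_content :: "real \<Rightarrow> real \<Rightarrow> 'a::metric_space set \<Rightarrow> ennreal" where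
  "hausdorff_content s \<delta> A = (INF C \<in> {C :: nat \<Rightarrow> 'a set. A \<subseteq> (\<Union>i. C i) \<and>
        (\<forall>i. bounded (C i) \<and> diameter (C i) \<le> \<delta>)}.
      (\<Sum>i. ennreal (unit_ball_vol s * (diameter (C i) / 2) powr s)))"

definition hausdorff_outer :: "real \<Rightarrow> 'a::metric_space set \<Rightarrow> ennreal" where
  "hausdorff_outer s A = (SUP \<delta>\<in>{0<..}. hausdorff_content s \<delta> A)"

definition surface_measure :: "'a::euclidean_space set \<Rightarrow> 'a measure" where
  "surface_measure S = measure_of S ((\<inter>) S ` sets borel) (hausdorff_outer (real DIM('a) - 1))"

definition surface_integral :: "'a::euclidean_space set \<Rightarrow> ('a \<Rightarrow> real) \<Rightarrow> real" where
  "surface_integral S f = integral\<^sup>L (surface_measure S) f"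

definition L2 :: "'a::euclidean_space set \<Rightarrow> ('a \<Rightarrow> real) \<Rightarrow> bool" where
  "L2 \<Omega> f \<longleftrightarrow> set_borel_measurable lebesgue \<Omega> f \<and> set_integrable lebesgue \<Omega> (\<lambda>x. (f x)\<^sup>2)"

definition test_fun :: "'a::euclidean_space set \<Rightarrow> ('a \<Rightarrow> real) \<Rightarrow> bool" where
  "test_fun \<Omega> \<phi> \<longleftrightarrow> smooth_on UNIV \<phi> \<and> compact (closure {x. \<phi> x \<noteq> 0}) \<and>
     closure {x. \<phi> x \<noteq> 0} \<subseteq> \<Omega>"

definition weak_pd :: "'a::euclidean_space set \<Rightarrow> ('a \<Rightarrow> real) \<Rightarrow> 'a \<Rightarrow> ('a \<Rightarrow> real) \<Rightarrow> bool" where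
  "weak_pd \<Omega> f b g \<longleftrightarrow> set_integrable lebesgue \<Omega> f \<and> set_integrable lebesgue \<Omega> g \<and>
     (\<forall>\<phi>. test_fun \<Omega> \<phi> \<longrightarrow>
        (LINT x:\<Omega>|lebesgue. f x * pd \<phi> b x) = - (LINT x:\<Omega>|lebesgue. g x * \<phi> x))"

definition W22_data :: "'a::euclidean_space set \<Rightarrow> ('a \<Rightarrow> real) \<Rightarrow> ('a \<Rightarrow> 'a \<Rightarrow> real)
    \<Rightarrow> ('a \<Rightarrow> 'a \<Rightarrow> 'a \<Rightarrow> real) \<Rightarrow> bool" where
  "W22_data \<Omega> v g G \<longleftrightarrow> L2 \<Omega> v \<and>
     (\<forall>b\<in>Basis. L2 \<Omega> (g b) \<and> weak_pd \<Omega> v b (g b)) \<and>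
     (\<forall>b\<in>Basis. \<forall>b'\<in>Basis. L2 \<Omega> (G b b') \<and> weak_pd \<Omega> (g b) b' (G b b'))"

definition W22_norm :: "'a::euclidean_space set \<Rightarrow> ('a \<Rightarrow> real) \<Rightarrow> ('a \<Rightarrow> 'a \<Rightarrow> real)
    \<Rightarrow> ('a \<Rightarrow> 'a \<Rightarrow> 'a \<Rightarrow> real) \<Rightarrow> real" where
  "W22_norm \<Omega> v g G = sqrt ((LINT x:\<Omega>|lebesgue. (v x)\<^sup>2)
      + (\<Sum>b\<in>Basis. LINT x:\<Omega>|lebesgue. (g b x)\<^sup>2)
      + (\<Sum>b\<in>Basis. \<Sum>b'\<in>Basis. LINT x:\<Omega>|lebesgue. (G b b' x)\<^sup>2))"

definition sobolev_holder_const :: "'a::euclidean_space set \<Rightarrow> real \<Rightarrow> real \<Rightarrow> bool" where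
  "sobolev_holder_const \<Omega> \<gamma> c \<longleftrightarrow> (\<forall>v g G. W22_data \<Omega> v g G \<longrightarrow>
     (\<exists>w. continuous_on (closure \<Omega>) w \<and> (AE x in lebesgue. x \<in> \<Omega> \<longrightarrow> w x = v x) \<and>
        (\<forall>x\<in>closure \<Omega>. \<forall>y\<in>closure \<Omega>.
           \<bar>w x - w y\<bar> \<le> c * W22_norm \<Omega> v g G * dist x y powr \<gamma>)))"

text \<open>Harmonic functions in W^{1,2}(\<Omega>) (for smooth v, the weak gradient is the classical one).\<close>
definition harmonic_W12 :: "'a::euclidean_space set \<Rightarrow> ('a \<Rightarrow> real) \<Rightarrow> bool" where
  "harmonic_W12 \<Omega> v \<longleftrightarrow> C2_on \<Omega> v \<and> (\<forall>x\<in>\<Omega>. lap v x = 0) \<and>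
     L2 \<Omega> v \<and> (\<forall>b\<in>Basis. L2 \<Omega> (pd v b))"

definition mu0 :: "'a::euclidean_space set \<Rightarrow> 'a \<Rightarrow> real" where
  "mu0 \<Omega> x0 = Inf {LINT x:\<Omega>|lebesgue. (norm (grad v x))\<^sup>2 | v.
      harmonic_W12 \<Omega> v \<and> (LINT x:\<Omega>|lebesgue. (v x)\<^sup>2) = 1 \<and> v x0 = 0}"

definition interior_sphere_radius :: "'a::euclidean_space set \<Rightarrow> real \<Rightarrow> bool" where
  "interior_sphere_radius \<Omega> r \<longleftrightarrow> r > 0 \<and>
     (\<forall>p\<in>frontier \<Omega>. \<exists>y. ball y r \<subseteq> \<Omega> \<and> cball y r \<inter> frontier \<Omega> = {p})"

end

theory Submission
  imports Defs
begin

text \<open>Put \<open>h = |x - z|^2 / 2 - u\<close>, harmonic, with \<open>z\<close> a critical point of \<open>u\<close>. Integrating Reilly's identity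
against cutoffs of a global defining function bounds the integral of \<open>|D^2 h|^2\<close> by \<open>N - 1\<close> times the deficit.
The surface measure is a Hausdorff measure; it dominates fluxes through the boundary because of the isodiametric
inequality, which follows from Prekopa-Leindler. The definition of \<open>\<mu>\<^sub>0\<close>, applied to \<open>h\<close> and its derivatives,
controls \<open>h\<close> in \<open>W^{2,2}\<close>. As \<open>h = |x - z|^2 / 2\<close> on the boundary, its oscillation bounds \<open>\<rho>\<^sub>e - \<rho>\<^sub>i\<close>: use the
Hoelder embedding for \<open>N = 2, 3\<close> and mean values over interior balls for \<open>N \<ge> 4\<close>.\<close>

text \<open>The solution \<open>u\<close> is only continuous up to the boundary, so
  \<open>grad u\<close> has no boundary values and the boundary terms of Reilly's identity survive
  as volume integrals over layers of depth \<open>dl^3\<close>. They would disappear if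
  \<open>grad u\<close> were normal there. Barriers for difference quotients show that its
  tangential part is of order \<open>dl^2\<close>; as \<open>cutoff'\<close> is of order
  \<open>dl^-3\<close> and the layer has volume of order \<open>dl^3\<close>, Young's inequality
  leaves an error of order \<open>dl^2 + dl / \<kappa>\<close>, which can be sent to 0. The square
  completed on the way is \<open>(S w - (N - 1))^2 / S >= 0\<close>, with \<open>S\<close> the trace
  of the shape operator, equal to \<open>(N - 1) H\<close> on the boundary, and \<open>w\<close> the
  normal derivative of \<open>u\<close>. Since \<open>grad u z = 0\<close>, not only
  \<open>h - h z\<close> but each partial derivative of \<open>h\<close> vanishes at
  \<open>z\<close>; so \<open>mu0\<close> can be used twice. For N >= 4 the frontier points are
  moved inward by a radius \<open>s\<close>; taking \<open>M^2 s^(N+2)\<close> equal to the L2 bound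
  of \<open>h - h z\<close> balances the mean value bound for \<open>h\<close> against the bound
  \<open>M s\<close> for \<open>u\<close>, and this is the origin of the exponent
  \<open>1 / (N + 2)\<close>.\<close>

notation inner (infix "*." 70)
notation scaleR (infixr "*R" 75)
notation divideR (infixl "'/R" 70)

abbreviation lborel_integral :: "('a::euclidean_space => ennreal) => ennreal" (binder "II " 10) where
 "lborel_integral f == nn_integral lborel f"

section \<open>Traces, gradients and Hessians built from partial derivatives\<close>

definition tr :: "('a::euclidean_space => 'a) => real" where
 "tr L = (SUM b:Basis. L b *. b)"

text \<open>The second derivative as a map of vectors: it is the derivative of the field
  \<open>grad f\<close>, so the divergence of a gradient field is
  \<open>tr (hess f x)\<close>.\<close>

definition hess :: "('a::euclidean_space => real) => 'a => 'a => 'a" where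
 "hess f x v = (SUM b:Basis. (grad (pd f b) x *. v) *R b)"

lemma pd_eq_inner:
 assumes "(f has_derivative (%v. g *. v)) (at x)"
 shows "pd f b x = g *. b" proof -
 have "((%t. f (x + t *R b)) has_derivative (%t. g *. (t *R b))) (at 0)" by (rule has_derivative_compose[of _ _ 0 UNIV f, simplified]) (auto intro!: derivative_eq_intros assms)
 hence "((%t. f (x + t *R b)) has_field_derivative (g *. b)) (at 0)" unfolding has_field_derivative_def by (rule has_derivative_eq_rhs) (auto simp: fun_eq_iff)
 thus ?thesis unfolding pd_def by (rule DERIV_imp_deriv) qed

lemma grad_inner_Basis: "b : Basis ==> grad f x *. b = pd f b x" by (simp add: grad_def inner_sum_left inner_Basis if_distrib cong: if_cong)

lemma grad_eqI:
 assumes "(f has_derivative (%v. g *. v)) (at x)"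
 shows "grad f x = g" by (rule euclidean_eqI) (simp add: grad_inner_Basis pd_eq_inner[OF assms])

lemma differentiable_has_grad:
 assumes "f differentiable (at x)"
 shows "(f has_derivative (%v. grad f x *. v)) (at x)" proof -
 from assms obtain D where D: "(f has_derivative D) (at x)" by (auto simp: differentiable_def)
 interpret linear D using D by (rule has_derivative_linear)
 have "D = (%v. (SUM b:Basis. D b *R b) *. v)" proof
  fix v
  have "D v = D (SUM b:Basis. (v *. b) *R b)" by (simp add: euclidean_representation)
  also have "... = (SUM b:Basis. D b *R b) *. v" by (simp add: sum scale inner_sum_left inner_commute[of v] mult.commute)
  finally show "D v = (SUM b:Basis. D b *R b) *. v" . qed
 with D grad_eqI show ?thesis by metis qed

lemma C1_on_has_grad: "C1_on U f ==> x : U ==> (f has_derivative (%v. grad f x *. v)) (at x)" by (auto simp: C1_on_def intro: differentiable_has_grad)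

lemma C1_on_continuous_grad: "C1_on U f ==> continuous_on U (grad f)" unfolding grad_def C1_on_def by (auto intro!: continuous_intros)

lemma C1_onI:
 assumes "!!x. x : U ==> (f has_derivative (%v. G x *. v)) (at x)" and "continuous_on U G"
 shows "C1_on U f" unfolding C1_on_def proof (intro conjI ballI)
 fix b :: 'a assume "b : Basis"
 have "continuous_on U (%x. G x *. b)" using assms(2) by (intro continuous_intros)
 thus "continuous_on U (pd f b)" by (rule continuous_on_eq) (simp add: pd_eq_inner[OF assms(1)]) qed (use assms in "auto simp: differentiable_def")

lemma C1_on_subset: "C1_on U f ==> V <= U ==> C1_on V f" by (auto simp: C1_on_def intro: continuous_on_subset)

lemma C2_on_subset: "C2_on U f ==> V <= U ==> C2_on V f" by (auto simp: C2_on_def intro: C1_on_subset)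

lemma C1_on_continuous: "C1_on U f ==> continuous_on U f" unfolding C1_on_def by (meson continuous_at_imp_continuous_on differentiable_imp_continuous_within)

lemma C2_on_C1: "C2_on U f ==> C1_on U f" by (simp add: C2_on_def)

lemma hess_inner_Basis: "b : Basis ==> hess f x v *. b = grad (pd f b) x *. v" by (simp add: hess_def inner_sum_left inner_Basis if_distrib cong: if_cong)

lemma C2_on_has_hess:
 assumes "C2_on U f" "x : U"
 shows "(grad f has_derivative hess f x) (at x)" proof -
 have "((%x. SUM b:Basis. pd f b x *R b) has_derivative (%v. SUM b:Basis. (grad (pd f b) x *. v) *R b)) (at x)" by (intro has_derivative_sum has_derivative_scaleR_left C1_on_has_grad[of U])
   (use assms in "auto simp: C2_on_def")
 thus ?thesis unfolding grad_def[abs_def] hess_def[abs_def] . qed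

lemma C2_on_continuous_hess: "C2_on U f ==> continuous_on U (%x. hess f x v)" unfolding hess_def C2_on_def by (auto intro!: continuous_intros C1_on_continuous_grad)

lemma lap_eq_tr_hess: "lap f x = tr (hess f x)" by (simp add: lap_def tr_def hess_inner_Basis grad_inner_Basis)

text \<open>Second partial derivatives at \<open>x\<close> depend on the values of
  \<open>pd f b\<close> near \<open>x\<close>, so the gradient formula is required on an open
  neighbourhood.\<close>

lemma hess_eqI:
 assumes "open U" "x : U" "!!y. y : U ==> (f has_derivative (%v. G y *. v)) (at y)"
  and "(G has_derivative H) (at x)"
 shows "hess f x = H" proof
 fix v
 show "hess f x v = H v" proof (rule euclidean_eqI)
  fix b :: 'a assume b: "b : Basis"
  have "((%y. G y *. b) has_derivative (%v. H v *. b)) (at x)" using assms(4) by (intro derivative_intros)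
  hence "(pd f b has_derivative (%v. H v *. b)) (at x)" by (rule has_derivative_transform_within_open[OF _ assms(1,2)]) (simp add: pd_eq_inner[OF assms(3)])
  moreover from this have "(pd f b has_derivative (%v. grad (pd f b) x *. v)) (at x)" by (intro differentiable_has_grad) (auto simp: differentiable_def)
  ultimately have "(%v. H v *. b) = (%v. grad (pd f b) x *. v)" by (rule has_derivative_unique)
  thus "hess f x v *. b = H v *. b" by (simp add: hess_inner_Basis b fun_eq_iff) qed qed

lemma C2_onI:
 assumes U: "open U" and G: "!!x. x : U ==> (f has_derivative (%v. G x *. v)) (at x)"
  and H: "!!x. x : U ==> (G has_derivative H x) (at x)"
  and c: "!!v. continuous_on U (%x. H x v)"
 shows "C2_on U f" unfolding C2_on_def proof (intro conjI ballI)
 have "continuous_on U G" using H by (meson continuous_at_imp_continuous_on has_derivative_continuous)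
 with G show "C1_on U f" by (rule C1_onI)
 fix b :: 'a assume b: "b : Basis"
 show "C1_on U (pd f b)" proof (rule C1_onI)
  fix x assume x: "x : U"
  have "((%y. G y *. b) has_derivative (%v. H x v *. b)) (at x)" using H[OF x] by (intro derivative_intros)
  hence "(pd f b has_derivative (%v. H x v *. b)) (at x)" by (rule has_derivative_transform_within_open[OF _ U x]) (simp add: pd_eq_inner[OF G])
  moreover from this have "(pd f b has_derivative (%v. grad (pd f b) x *. v)) (at x)" by (intro differentiable_has_grad) (auto simp: differentiable_def)
  ultimately have "!!v. H x v *. b = grad (pd f b) x *. v" by (metis has_derivative_unique)
  hence "grad (pd f b) x = (SUM c:Basis. (H x c *. b) *R c)" by (simp add: euclidean_representation)
  with \<open>(pd f b has_derivative (%v. grad (pd f b) x *. v)) (at x)\<close>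
  show "(pd f b has_derivative (%v. (SUM c:Basis. (H x c *. b) *R c) *. v)) (at x)" by simp qed (use c in "intro continuous_intros") qed


lemma linear_tr_sum:
 fixes L :: "'a::euclidean_space => 'a"
 assumes "linear L"
 shows "L v *. b = (SUM c:Basis. (L c *. b) *R c) *. v" proof -
 have "L v = L (SUM c:Basis. (v *. c) *R c)" by (simp add: euclidean_representation)
 thus ?thesis by (simp add: linear_sum[OF assms] linear_scale[OF assms] inner_sum_left inner_commute[of v] mult.commute) qed

section \<open>Divergence theorem for fields with compact support\<close>

lemma integral_translation:
 fixes f :: "'a::euclidean_space => 'b::{banach, second_countable_topology}"
 assumes "f : borel_measurable lborel"
 shows "integral\<^sup>L lborel (%x. f (c + x)) = integral\<^sup>L lborel f" proof -
 have "integral\<^sup>L (distr lborel borel ((+) c)) f = integral\<^sup>L lborel (%x. f (c + x))" using assms by (intro integral_distr) auto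
 thus ?thesis by (simp add: lborel_distr_plus) qed

lemma integrable_translation:
 fixes f :: "'a::euclidean_space => 'b::{banach, second_countable_topology}"
 assumes "integrable lborel f"
 shows "integrable lborel (%x. f (c + x))" proof -
 have "integrable (distr lborel borel ((+) c)) f" using assms by (simp add: lborel_distr_plus)
 thus ?thesis by (rule integrable_distr[rotated]) auto qed

lemma integrable_continuous_compact_support:
 fixes f :: "'a::euclidean_space => 'b::euclidean_space"
 assumes "continuous_on UNIV f" "compact K" "!!x. x ~: K ==> f x = 0"
 shows "integrable lborel f" proof -
 have "integrable lborel (%x. indicator K x *R f x)" by (rule borel_integrable_compact) (use assms in "auto intro: continuous_on_subset")
 moreover have "(%x. indicator K x *R f x) = f" using assms(3) by (auto simp: indicator_def)
 ultimately show ?thesis by simp qed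

text \<open>Translation invariance makes the integral of each difference quotient \<open>s n\<close>
  zero; a global Lipschitz bound and the compact support dominate the quotients, so the zero passes
  to the limit.\<close>

lemma integral_grad_zero:
 fixes f :: "'a::euclidean_space => real"
 assumes der: "!!x. (f has_derivative (%v. G x *. v)) (at x)" and cont: "continuous_on UNIV G"
  and K: "compact K" and f0: "!!x. x ~: K ==> f x = 0"
 shows "integrable lborel (%x. G x *. b)" "integral\<^sup>L lborel (%x. G x *. b) = 0" proof -
 have G0: "G x = 0" if "x ~: K" for x proof -
  have "(f has_derivative (%v. 0)) (at x)" by (rule has_derivative_transform_within_open[where s="- K" and f="%_. 0"]) (use K f0 that in "auto simp: compact_imp_closed open_Compl")
  with der[of x] have "(%v. G x *. v) = (%v. 0)" by (rule has_derivative_unique)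
  thus "G x = 0" by (metis inner_eq_zero_iff) qed
 have cf: "continuous_on UNIV f" using der by (meson continuous_at_imp_continuous_on has_derivative_continuous)
 have contb: "continuous_on UNIV (%x. G x *. b)" by (intro continuous_intros cont)
 show "integrable lborel (%x. G x *. b)" by (rule integrable_continuous_compact_support[OF contb K]) (simp add: G0)
 have "bounded (G ` K)" using K cont by (meson compact_continuous_image compact_imp_bounded continuous_on_subset subset_UNIV)
 then obtain C where C: "!!x. x : K ==> norm (G x) <= C" "C > 0" by (auto simp: bounded_pos)
 hence C': "norm (G x) <= C" for x using G0[of x] by (cases "x : K") auto
 have lip: "\<bar>f y - f x\<bar> <= C * norm (y - x)" for x y proof -
  have "norm (f y - f x) <= C * norm (y - x)" proof (rule differentiable_bound[where S=UNIV and f'="%x v. G x *. v"])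
   show "onorm (%v. G x *. v) <= C" for x by (rule onorm_le) (metis C' Cauchy_Schwarz_ineq2 mult_right_mono norm_ge_zero order_trans real_norm_def) qed (use der in auto)
  thus ?thesis by simp qed
 define s where "s n x = real (Suc n) * (f (b /R real (Suc n) + x) - f x)" for n x
 \<comment> \<open>All quotients have steps no longer than \<open>norm b\<close>, so they vanish
   outside this enlargement of \<open>K\<close>.\<close>
 define K' where "K' = (%(x, y). x + y) ` (K \<times> cball 0 (norm b))"
 have K': "compact K'" unfolding K'_def by (intro compact_continuous_image compact_Times K compact_cball) (auto simp: case_prod_unfold intro!: continuous_intros)
 have intf: "integrable lborel f" by (rule integrable_continuous_compact_support[OF cf K f0])
 have s0: "integral\<^sup>L lborel (s n) = 0" for n unfolding s_def using intf integrable_translation[OF intf] integral_translation[of f] by (simp add: borel_measurable_integrable)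
 have lim: "(%n. integral\<^sup>L lborel (s n)) \<longlonglongrightarrow> integral\<^sup>L lborel (%x. G x *. b)"
 proof (rule integral_dominated_convergence[where w="%x. C * norm b * indicator K' x"])
  show "(%x. G x *. b) : borel_measurable lborel" using contb by (simp add: borel_measurable_continuous_onI)
  show "s n : borel_measurable lborel" for n unfolding s_def by (intro borel_measurable_times borel_measurable_diff borel_measurable_const
   borel_measurable_integrable[OF intf] borel_measurable_integrable[OF integrable_translation[OF intf]])
  show "integrable lborel (%x. C * norm b * indicator K' x)" using K' by (intro integrable_mult_right integrable_real_indicator)
   (use emeasure_compact_finite[OF K'] in "auto simp: borel_compact")
  have "(%n. s n x) \<longlonglongrightarrow> G x *. b" for x proof -
   have "((%t. f (x + t *R b)) has_derivative (%t. G x *. (t *R b))) (at 0)" by (rule has_derivative_compose[of _ _ 0 UNIV f, simplified]) (auto intro!: derivative_eq_intros der)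
   hence "((%t. f (x + t *R b)) has_field_derivative (G x *. b)) (at 0)" unfolding has_field_derivative_def by (rule has_derivative_eq_rhs) (auto simp: fun_eq_iff)
   hence "(%h. (f (x + h *R b) - f x) / h) \<midarrow>0\<rightarrow> G x *. b" by (simp add: DERIV_def)
   moreover have "filterlim (%n. inverse (real (Suc n))) (at 0) sequentially" using LIMSEQ_inverse_real_of_nat by (auto simp: filterlim_at simp del: of_nat_Suc)
   ultimately have "((%n. (f (x + inverse (real (Suc n)) *R b) - f x) / inverse (real (Suc n)))) \<longlonglongrightarrow> G x *. b" by (rule filterlim_compose)
   thus ?thesis unfolding s_def by (simp add: divide_inverse mult.commute add.commute del: of_nat_Suc) qed
  thus "AE x in lborel. (%n. s n x) \<longlonglongrightarrow> G x *. b" by simp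
  have "norm (s n x) <= C * norm b * indicator K' x" for n x proof (cases "x : K'")
   case True
   have "norm (s n x) = real (Suc n) * \<bar>f (b /R real (Suc n) + x) - f x\<bar>" unfolding s_def by (simp add: abs_mult del: of_nat_Suc)
   also have "... <= real (Suc n) * (C * norm (b /R real (Suc n)))" using lip[of "b /R real (Suc n) + x" x] by (intro mult_left_mono) auto
   also have "... = C * norm b" by (simp del: of_nat_Suc)
   finally show ?thesis using True by simp
  next
   case False
   have "x ~: K" using False unfolding K'_def by force
   moreover have "b /R real (Suc n) + x ~: K" proof
   assume "b /R real (Suc n) + x : K"
   moreover have "- (b /R real (Suc n)) : cball 0 (norm b)" by (simp add: divide_simps mult_left_le del: of_nat_Suc) (simp add: mult_le_cancel_left1)
   ultimately have "(%(x, y). x + y) (b /R real (Suc n) + x, - (b /R real (Suc n))) : K'" unfolding K'_def by (intro imageI) simp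
   hence "x : K'" by simp
   with False show False by simp qed
   ultimately show ?thesis using False f0 by (simp add: s_def) qed
  thus "AE x in lborel. norm (s n x) <= C * norm b * indicator K' x" for n by simp qed
 thus "integral\<^sup>L lborel (%x. G x *. b) = 0" by (simp add: s0 LIMSEQ_const_iff) qed

text \<open>\<open>U\<close> and the complement of \<open>K\<close> are open sets covering the
  space, so the components extended by zero are C1 everywhere. The later integrations by parts are
  instances, the compact set being supplied by a bump, a cutoff or a test function.\<close>

lemma integral_tr_zero:
 fixes F :: "'a::euclidean_space => 'a"
 assumes U: "open U" and K: "compact K" "K <= U"
  and der: "!!x. x : U ==> (F has_derivative F' x) (at x)"
  and cont: "!!v. continuous_on U (%x. F' x v)"
  and F0: "!!x. x : U ==> x ~: K ==> F x = 0"
 shows "set_integrable lborel U (%x. tr (F' x))" "(LINT x:U|lborel. tr (F' x)) = 0" proof -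
 define g where "g b x = (if x : U then SUM c:Basis. (F' x c *. b) *R c else 0)" for b x
 define f where "f b x = (if x : U then F x *. b else 0)" for b x
 have F'0: "F' x v = 0" if "x : U" "x ~: K" for x v proof -
  have "(F has_derivative (%v. 0)) (at x)" by (rule has_derivative_transform_within_open[where s="U - K" and f="%_. 0"]) (use K F0 that U in "auto simp: compact_imp_closed open_Diff")
  with der[OF that(1)] have "F' x = (%v. 0)" by (rule has_derivative_unique)
  thus ?thesis by simp qed
 have UK: "open (- K)" "U Un - K = UNIV" using K by (auto simp: compact_imp_closed open_Compl)
 have der': "(f b has_derivative (%v. g b x *. v)) (at x)" for b x proof (cases "x : U")
  case True
  have "((%x. F x *. b) has_derivative (%v. F' x v *. b)) (at x)" by (intro derivative_intros der True)
  moreover have "F' x v *. b = g b x *. v" for v using True linear_tr_sum[OF has_derivative_linear[OF der[OF True]], of v b] by (simp add: g_def)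
  ultimately have "((%x. F x *. b) has_derivative (%v. g b x *. v)) (at x)" by simp
  thus ?thesis by (rule has_derivative_transform_within_open[OF _ U True]) (simp add: f_def)
 next
  case False
  hence x: "x : - K" using K by auto
  have f0: "0 = f b y" if "y : - K" for y using that F0 by (auto simp: f_def)
  have "((%_. 0) has_derivative (%v. g b x *. v)) (at x)" using False by (simp add: g_def)
  thus ?thesis by (rule has_derivative_transform_within_open[OF _ UK(1) x f0]) qed
 have cont': "continuous_on UNIV (g b)" for b proof -
  have "continuous_on U (g b)" by (rule continuous_on_eq[where f="%x. SUM c:Basis. (F' x c *. b) *R c"]) (auto simp: g_def intro!: continuous_intros cont)
  moreover have "continuous_on (- K) (g b)" by (rule continuous_on_eq[where f="%x. 0"]) (auto simp: g_def F'0)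
  ultimately have "continuous_on (U Un - K) (g b)" by (rule continuous_on_open_Un[OF U UK(1)])
  thus ?thesis by (simp only: UK(2)) qed
 have f0: "f b x = 0" if "x ~: K" for b x using that F0 by (auto simp: f_def)
 note I = integral_grad_zero[OF der' cont' K(1) f0]
 have eq: "indicator U x *R tr (F' x) = (SUM b:Basis. g b x *. b)" for x proof (cases "x : U")
  case True
  have "g b x *. b = F' x b *. b" if "b : Basis" for b using True that by (simp add: g_def inner_sum_left inner_Basis if_distrib cong: if_cong)
  thus ?thesis using True by (simp add: tr_def) qed (simp add: g_def)
 show "set_integrable lborel U (%x. tr (F' x))" unfolding set_integrable_def eq by (intro Bochner_Integration.integrable_sum I)
 show "(LINT x:U|lborel. tr (F' x)) = 0" unfolding set_lebesgue_integral_def eq by (subst Bochner_Integration.integral_sum) (auto intro: I simp: I) qed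

section \<open>The one-dimensional sumset inequality and Prekopa-Leindler\<close>

lemma emeasure_sumset_compact_real:
 fixes S T D :: "real set"
 assumes S: "compact S" "S ~= {}" and T: "compact T" "T ~= {}" and D: "D : sets borel"
  and sub: "!!s t. s : S ==> t : T ==> s + t : D"
 shows "emeasure lborel S + emeasure lborel T <= emeasure lborel D" proof -
 obtain a where a: "a : S" "!!s. s : S ==> s <= a" using compact_attains_sup[OF S] by blast
 obtain b where b: "b : T" "!!t. t : T ==> b <= t" using compact_attains_inf[OF T] by blast
 \<comment> \<open>\<open>S'\<close> and \<open>T'\<close> are the translates \<open>b + S\<close>
   and \<open>a + T\<close>, with \<open>a\<close> the maximum of \<open>S\<close> and
   \<open>b\<close> the minimum of \<open>T\<close>. Both lie in the sumset and overlap at most in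
   the point \<open>a + b\<close>.\<close>
 define S' where "S' = (%x. - b + x) -` S"
 define T' where "T' = (%x. - a + x) -` T"
 have Sb: "S : sets borel" "T : sets borel" using S T by (auto simp: borel_compact)
 have "(%x. c + x) -` A : sets borel" if "A : sets borel" for c and A :: "real set" proof -
  have "(%x. c + x) : borel_measurable borel" by simp
  from measurable_sets[OF this that] show ?thesis by simp qed
 hence mS: "S' : sets borel" "T' : sets borel" unfolding S'_def T'_def using Sb by blast+
 have e: "emeasure lborel ((%x. c + x) -` A) = emeasure lborel A" if "A : sets borel" for c and A :: "real set"
  using that emeasure_distr[of "(+) c" lborel borel A] by (simp add: lborel_distr_plus)
 have eS: "emeasure lborel S' = emeasure lborel S" "emeasure lborel T' = emeasure lborel T" unfolding S'_def T'_def by (rule e[OF Sb(1)], rule e[OF Sb(2)])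
 have "emeasure lborel S' + emeasure lborel T' = emeasure lborel S' + emeasure lborel (T' - {a + b})" using mS by (subst emeasure_Diff_null_set) auto
 also have "... = emeasure lborel (S' Un (T' - {a + b}))" proof (rule plus_emeasure)
  show "S' Int (T' - {a + b}) = {}" using a b unfolding S'_def T'_def by (force simp: algebra_simps) qed (use mS in auto)
 also have "... <= emeasure lborel D" proof (rule emeasure_mono)
  have "x : D" if "x : S'" for x using sub[of "- b + x" b] that b(1) by (simp add: S'_def)
  moreover have "x : D" if "x : T'" for x using sub[of a "- a + x"] that a(1) by (simp add: T'_def)
  ultimately show "S' Un (T' - {a + b}) <= D" by auto qed (use D in simp)
 finally show ?thesis by (simp add: eS) qed

lemma lborel_inner_compact:
 fixes S :: "'a::euclidean_space set"
 assumes "S : sets borel" "bounded S" "e > 0"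
 obtains K where "compact K" "K <= S" "emeasure lborel S <= emeasure lborel K + ennreal e" proof -
 obtain T where T: "closed T" "T <= S" "emeasure lebesgue (S - T) < ennreal e" by (rule sets_lebesgue_inner_closed[of S e]) (use assms in auto)
 have Tb: "T : sets borel" using T(1) by simp
 have "emeasure lborel S <= emeasure lborel (T Un (S - T))" by (intro emeasure_mono) (use assms(1) Tb in auto)
 also have "... <= emeasure lborel T + emeasure lborel (S - T)" by (intro emeasure_subadditive) (use assms(1) Tb in auto)
 also have "... <= emeasure lborel T + ennreal e" using T(3) assms(1) Tb by (intro add_left_mono) auto
 finally have "emeasure lborel S <= emeasure lborel T + ennreal e" .
 moreover have "compact T" using T assms(2) bounded_subset compact_eq_bounded_closed by blast
 ultimately show ?thesis using that T(2) by blast qed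

text \<open>\<open>D\<close> stands for a Borel superset of the sumset, which itself need not be
  Borel. Compact sets exhaust \<open>S\<close> and \<open>T\<close> from inside, first on bounded
  pieces.\<close>

lemma emeasure_sumset_real:
 fixes S T D :: "real set"
 assumes S: "S : sets borel" "S ~= {}" and T: "T : sets borel" "T ~= {}" and D: "D : sets borel"
  and sub: "!!s t. s : S ==> t : T ==> s + t : D"
 shows "emeasure lborel S + emeasure lborel T <= emeasure lborel D" proof -
 obtain s0 t0 where st: "s0 : S" "t0 : T" using S T by auto
 define B where "B n = {- real n..real n}" for n
 have n: "emeasure lborel (S Int B n) + emeasure lborel (T Int B n) <= emeasure lborel D" for n proof (rule ennreal_le_epsilon)
  fix e :: real assume e: "0 < e"
  have b: "bounded (S Int B n)" "bounded (T Int B n)" "S Int B n : sets borel" "T Int B n : sets borel"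
   using S(1) T(1) bounded_closed_interval[of "- real n" "real n"] by (auto simp: B_def intro: bounded_Int)
  obtain K where K: "compact K" "K <= S Int B n" "emeasure lborel (S Int B n) <= emeasure lborel K + ennreal (e/2)" by (rule lborel_inner_compact[OF b(3,1), of "e/2"]) (use e in auto)
  obtain L where L: "compact L" "L <= T Int B n" "emeasure lborel (T Int B n) <= emeasure lborel L + ennreal (e/2)" by (rule lborel_inner_compact[OF b(4,2), of "e/2"]) (use e in auto)
  \<comment> \<open>The inner approximants may be empty, so one point of each set is added before
    the compact case applies.\<close>
  have "emeasure lborel (insert s0 K) + emeasure lborel (insert t0 L) <= emeasure lborel D" by (rule emeasure_sumset_compact_real) (use K L st sub D in "auto simp: subset_eq")
  moreover have "emeasure lborel K <= emeasure lborel (insert s0 K)" "emeasure lborel L <= emeasure lborel (insert t0 L)" using K L by (auto intro!: emeasure_mono simp: borel_compact)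
  ultimately have "emeasure lborel K + emeasure lborel L <= emeasure lborel D" using add_mono order_trans by blast
  moreover have "emeasure lborel (S Int B n) + emeasure lborel (T Int B n) <= (emeasure lborel K + ennreal (e/2)) + (emeasure lborel L + ennreal (e/2))" using K L by (intro add_mono)
  moreover have "... = (emeasure lborel K + emeasure lborel L) + ennreal e" using e by (simp add: algebra_simps flip: ennreal_plus)
  ultimately show "emeasure lborel (S Int B n) + emeasure lborel (T Int B n) <= emeasure lborel D + ennreal e" by (metis add_right_mono order_trans) qed
 have lim: "(%n. emeasure lborel (A Int B n)) \<longlonglongrightarrow> emeasure lborel A" if "A : sets borel" for A proof -
  have "(\<Union>n. A Int B n) = A" proof safe
   fix x assume "x : A"
   moreover obtain n where "\<bar>x\<bar> <= real n" using real_arch_simple by blast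
   ultimately show "x : (\<Union>n. A Int B n)" by (auto simp: B_def intro!: exI[of _ n]) qed
  moreover have "incseq (%n. A Int B n)" by (auto simp: incseq_def B_def)
  moreover have "range (%n. A Int B n) <= sets lborel" using that by (auto simp: B_def)
  ultimately show ?thesis using Lim_emeasure_incseq[of "%n. A Int B n" lborel] by simp qed
 show ?thesis by (rule LIMSEQ_le_const2[OF tendsto_add[OF lim[OF S(1)] lim[OF T(1)]]]) (use n in auto) qed

lemma nn_integral_layer_cake:
 fixes f :: "'b => real"
 assumes "sigma_finite_measure M" and f[measurable]: "f : borel_measurable M" and le: "!!x. 0 <= f x" "!!x. f x <= 1"
 shows "(\<integral>\<^sup>+x. ennreal (f x) \<partial>M) = (II t. indicator {0<..<1} t * emeasure M {x\<in>space M. t < f x})" proof -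
 interpret M: sigma_finite_measure M by fact
 interpret P: pair_sigma_finite M "lborel :: real measure" ..
 let ?k = "%x t. if 0 < t & t < 1 & t < f x then 1 else 0 :: ennreal"
 have "(\<integral>\<^sup>+x. ennreal (f x) \<partial>M) = (\<integral>\<^sup>+x. (II t. ?k x t) \<partial>M)" proof (rule nn_integral_cong)
  fix x
  have "(II t. ?k x t) = (II t. indicator {0<..<f x} t)" using le[of x] by (intro nn_integral_cong) (auto simp: indicator_def)
  thus "ennreal (f x) = (II t. ?k x t)" using le[of x] by simp qed
 also have "... = (\<integral>\<^sup>+t. (\<integral>\<^sup>+x. ?k x t \<partial>M) \<partial>lborel)" proof (rule P.Fubini'[symmetric])
  have "Measurable.pred (M \<Otimes>\<^sub>M lborel) (%p. 0 < snd p & snd p < 1 & snd p < f (fst p))" by measurable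
  thus "case_prod ?k : borel_measurable (M \<Otimes>\<^sub>M lborel)" unfolding case_prod_unfold by (intro measurable_If measurable_const) (auto simp: pred_def) qed
 also have "... = (II t. indicator {0<..<1} t * emeasure M {x\<in>space M. t < f x})" proof (rule nn_integral_cong)
  fix t :: real
  have "(\<integral>\<^sup>+x. ?k x t \<partial>M) = (\<integral>\<^sup>+x. indicator {0<..<1} t * indicator {x\<in>space M. t < f x} x \<partial>M)"
   by (intro nn_integral_cong) (simp add: indicator_def)
  also have "... = indicator {0<..<1} t * (\<integral>\<^sup>+x. indicator {x\<in>space M. t < f x} x \<partial>M)" by (rule nn_integral_cmult) simp
  also have "(\<integral>\<^sup>+x. indicator {x\<in>space M. t < f x} x \<partial>M) = emeasure M {x\<in>space M. t < f x}" by (rule nn_integral_indicator) simp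
  finally show "(\<integral>\<^sup>+x. ?k x t \<partial>M) = indicator {0<..<1} t * emeasure M {x\<in>space M. t < f x}" . qed
 finally show ?thesis . qed

text \<open>The sumset inequality compares superlevel sets level by level. Suprema equal to 1 keep
  them nonempty at every level below 1, without which that inequality would fail. The outcome is a
  sum, from which the product form follows by the arithmetic-geometric mean inequality.\<close>

lemma Prekopa_Leindler_normalized:
 fixes f g h :: "real => real"
 assumes [measurable]: "f : borel_measurable borel" "g : borel_measurable borel" "h : borel_measurable borel"
  and f: "!!x. 0 <= f x" "!!x. f x <= 1" "!!t. t < 1 ==> EX x. t < f x"
  and g: "!!x. 0 <= g x" "!!x. g x <= 1" "!!t. t < 1 ==> EX x. t < g x"
  and h: "!!x. 0 <= h x" "!!x y. f x * g y <= (h ((x + y) / 2))^2"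
 shows "(II x. ennreal (f x)) + (II x. ennreal (g x)) <= 2 * (II x. ennreal (h x))" proof -
 \<comment> \<open>\<open>h\<close> may exceed 1, while the layer cake formula runs over levels up
   to 1.\<close>
 define h1 where "h1 x = min (h x) 1" for x
 have [measurable]: "h1 : borel_measurable borel" unfolding h1_def by measurable
 have key: "emeasure lborel {x. t < f x} + emeasure lborel {x. t < g x} <= 2 * emeasure lborel {x. t < h1 x}"
  if t: "0 < t" "t < 1" for t proof -
  have "emeasure lborel {x. t < f x} + emeasure lborel {x. t < g x} <= emeasure lborel {x. t < h1 (x/2)}" proof (rule emeasure_sumset_real)
   show "{x. t < f x} ~= {}" "{x. t < g x} ~= {}" using f(3)[OF t(2)] g(3)[OF t(2)] by auto
   fix x y assume "x : {x. t < f x}" "y : {x. t < g x}"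
   hence "t * t < f x * g y" using t by (auto intro!: mult_strict_mono)
   also have "... <= (h ((x + y) / 2))^2" by (rule h)
   finally have "t < h ((x+y)/2)" using h(1)[of "(x+y)/2"] power_less_imp_less_base[of t 2 "h ((x+y)/2)"] by (simp add: power2_eq_square)
   thus "x + y : {x. t < h1 (x/2)}" using t by (simp add: h1_def) qed measurable
  also have "... = 2 * emeasure lborel {x. t < h1 x}" proof -
   have "emeasure lborel {x. t < h1 (x/2)} = (II x. indicator {x. t < h1 x} (x/2))" proof -
   have "(II x. indicator {x. t < h1 (x/2)} x) = emeasure lborel {x. t < h1 (x/2)}" by (rule nn_integral_indicator) measurable
   thus ?thesis by (simp add: indicator_def) qed
   also have "... = ennreal \<bar>2\<bar> * (II x. indicator {x. t < h1 x} ((0 + 2 * x)/2))" by (rule nn_integral_real_affine) auto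
   also have "... = 2 * emeasure lborel {x. t < h1 x}" by simp
   finally show ?thesis . qed
  finally show ?thesis . qed
 have m: "(%t. emeasure lborel {x. t < k x}) : borel_measurable borel" if [measurable]: "k : borel_measurable borel" for k :: "real => real" proof -
  have "{p : space (lborel \<Otimes>\<^sub>M lborel). fst p < k (snd p)} : sets (lborel \<Otimes>\<^sub>M (lborel :: real measure))" by measurable
  hence "(%t. emeasure lborel (Pair t -` {p. fst p < k (snd p)})) : borel_measurable lborel" by (intro lborel.measurable_emeasure_Pair) (simp add: space_pair_measure)
  thus ?thesis by (simp add: vimage_def) qed
 have sf: "sigma_finite_measure (lborel :: real measure)" by (rule sigma_finite_lborel)
 note lc = nn_integral_layer_cake[OF sf, simplified]
 have "(II x. ennreal (f x)) + (II x. ennreal (g x)) = (II t. indicator {0<..<1} t * emeasure lborel {x. t < f x}) + (II t. indicator {0<..<1} t * emeasure lborel {x. t < g x})"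
  using f g by (subst (1 2) lc) auto
 also have "... = (II t. indicator {0<..<1} t * (emeasure lborel {x. t < f x} + emeasure lborel {x. t < g x}))" proof (subst nn_integral_add[symmetric])
  show "(%t. indicator {0<..<1} t * emeasure lborel {x. t < f x}) : borel_measurable lborel"
   "(%t. indicator {0<..<1} t * emeasure lborel {x. t < g x}) : borel_measurable lborel" using m[of f] m[of g] by auto qed (simp add: distrib_left)
 also have "... <= (II t. 2 * (indicator {0<..<1} t * emeasure lborel {x. t < h1 x}))" by (intro nn_integral_mono) (use key in "auto simp: indicator_def")
 also have "... = 2 * (II t. (indicator {0<..<1} t * emeasure lborel {x. t < h1 x}))" by (rule nn_integral_cmult) (use m[of h1] in simp)
 also have "... = 2 * (II x. ennreal (h1 x))" using h by (subst lc) (auto simp: h1_def)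
 also have "... <= 2 * (II x. ennreal (h x))" by (intro mult_left_mono nn_integral_mono ennreal_leI) (auto simp: h1_def)
 finally show ?thesis . qed

lemma ennreal_four_mult_le_square_add:
 fixes a b :: ennreal
 shows "4 * (a * b) <= (a + b)^2" proof (cases "a = top | b = top")
 case True
 thus ?thesis by (auto simp: power2_eq_square ennreal_top_mult ennreal_mult_top)
next
 case False
 then obtain x y where "a = ennreal x" "0 <= x" "b = ennreal y" "0 <= y" by (metis ennreal_cases)
 moreover have "ennreal (4 * (x * y)) <= ennreal ((x + y)^2)" using zero_le_power2[of "x - y"] by (intro ennreal_leI) (simp add: power2_eq_square algebra_simps)
 ultimately show ?thesis by (simp add: ennreal_power ennreal_mult flip: ennreal_plus) qed

text \<open>Dividing \<open>f\<close> and \<open>g\<close> by their suprema and \<open>h\<close> by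
  the geometric mean \<open>c\<close> of these reduces to the normalised case. If a supremum is 0,
  the left side is 0.\<close>

lemma Prekopa_Leindler_bounded:
 fixes f g h :: "real => real"
 assumes [measurable]: "f : borel_measurable borel" "g : borel_measurable borel" "h : borel_measurable borel"
  and f: "!!x. 0 <= f x" "bdd_above (range f)"
  and g: "!!x. 0 <= g x" "bdd_above (range g)"
  and h: "!!x. 0 <= h x" "!!x y. f x * g y <= (h ((x + y) / 2))^2"
 shows "(II x. ennreal (f x)) * (II x. ennreal (g x)) <= (II x. ennreal (h x))^2" proof -
 define F where "F = Sup (range f)"
 define G where "G = Sup (range g)"
 have fF: "f x <= F" "g x <= G" for x unfolding F_def G_def using f g by (auto intro: cSUP_upper)
 consider "F <= 0" | "G <= 0" | "F > 0" "G > 0" by linarith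
 thus ?thesis proof cases
  case 1
  hence "f x = 0" for x using fF(1)[of x] f(1)[of x] by linarith
  thus ?thesis by simp
 next
  case 2
  hence "g x = 0" for x using fF(2)[of x] g(1)[of x] by linarith
  thus ?thesis by simp
 next
  case 3
  define c where "c = sqrt (F * G)"
  have c: "c > 0" "c^2 = F * G" using 3 by (auto simp: c_def)
  have PL: "(II x. ennreal (f x / F)) + (II x. ennreal (g x / G)) <= 2 * (II x. ennreal (h x / c))" proof (rule Prekopa_Leindler_normalized)
   show "EX x. t < f x / F" if "t < 1" for t proof -
   have "t * F < F" using that 3 by simp
   then obtain y where "t * F < f y" unfolding F_def using less_cSUP_iff[OF _ f(2)] by auto
   thus ?thesis using 3 by (auto simp: field_simps) qed
   show "EX x. t < g x / G" if "t < 1" for t proof -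
   have "t * G < G" using that 3 by simp
   then obtain y where "t * G < g y" unfolding G_def using less_cSUP_iff[OF _ g(2)] by auto
   thus ?thesis using 3 by (auto simp: field_simps) qed
   show "f x / F * (g y / G) <= (h ((x + y) / 2) / c)^2" for x y using h(2)[of x y] 3 by (simp add: power_divide c divide_right_mono)
  qed (use 3 c(1) f(1) g(1) h(1) fF in "simp_all add: divide_le_eq")
  define a b e where "a = (II x. ennreal (f x / F))" and "b = (II x. ennreal (g x / G))"
   and "e = (II x. ennreal (h x / c))"
  have sc: "(II x. ennreal (k x)) = ennreal C * (II x. ennreal (k x / C))"
   if "C > 0" and [measurable]: "k : borel_measurable borel" for k :: "real => real" and C proof -
   have "(II x. ennreal (k x)) = (II x. ennreal C * ennreal (k x / C))" using that(1) by (intro nn_integral_cong) (simp flip: ennreal_mult')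
   thus ?thesis by (simp add: nn_integral_cmult) qed
  have "4 * (a * b) <= (2 * e)^2" using ennreal_four_mult_le_square_add[of a b] PL power_mono[of "a + b" "2 * e" 2] unfolding a_def b_def e_def by (meson order_trans zero_le)
  hence "4 * (a * b) <= 4 * e^2" by (simp add: power_mult_distrib)
  hence ab: "a * b <= e^2" by (subst (asm) ennreal_mult_le_mult_iff) auto
  have "(ennreal F * a) * (ennreal G * b) = ennreal (c^2) * (a * b)" using 3 by (simp add: c(2) ennreal_mult mult_ac)
  also have "... <= ennreal (c^2) * e^2" using ab by (rule mult_left_mono) simp
  also have "... = (ennreal c * e)^2" using c by (simp add: power_mult_distrib ennreal_power)
  finally show ?thesis using sc[of F f] sc[of G g] sc[of c h] 3 c unfolding a_def b_def e_def by simp qed qed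

lemma nn_integral_SUP_min_nat:
 fixes f :: "'b => ennreal"
 assumes [measurable]: "f : borel_measurable M"
 shows "(SUP n::nat. (\<integral>\<^sup>+x. min (f x) (of_nat n) \<partial>M)) = (\<integral>\<^sup>+x. f x \<partial>M)" proof -
 have "(SUP n::nat. min (f x) (of_nat n)) = f x" for x proof -
  have "(SUP n::nat. inf (f x) (of_nat n)) = inf (f x) (SUP n::nat. of_nat n)" by (rule inf_SUP[symmetric])
  thus ?thesis by (simp add: ennreal_SUP_of_nat_eq_top inf_min) qed
 moreover have "(\<integral>\<^sup>+x. (SUP n::nat. min (f x) (of_nat n)) \<partial>M) = (SUP n::nat. (\<integral>\<^sup>+x. min (f x) (of_nat n) \<partial>M))"
  by (rule nn_integral_monotone_convergence_SUP) (auto simp: incseq_def le_fun_def intro: order_trans[OF min.cobounded2 of_nat_mono])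
 ultimately show ?thesis by simp qed

text \<open>Cutting all three functions at the same level \<open>n\<close> preserves the hypothesis:
  where \<open>h\<close> is cut, the square of its cut value is \<open>n^2\<close>, which bounds the
  product of the other two.\<close>

lemma Prekopa_Leindler_real:
 fixes f g h :: "real => ennreal"
 assumes m[measurable]: "f : borel_measurable lborel" "g : borel_measurable lborel" "h : borel_measurable borel"
  and h: "!!x y. f x * g y <= (h ((x + y) / 2))^2"
 shows "(II x. f x) * (II x. g x) <= (II x. h x)^2" proof -
 have n: "(II x. min (f x) (of_nat n)) * (II x. min (g x) (of_nat n)) <= (II x. h x)^2" for n proof -
  define t where "t k x = enn2real (min (k x) (of_nat n :: ennreal))" for k :: "real => ennreal" and x
  have t: "ennreal (t k x) = min (k x) (of_nat n)" for k x unfolding t_def by (rule ennreal_enn2real) (simp add: min_less_iff_disj of_nat_less_top)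
  have tn: "0 <= t k x" "t k x <= n" for k x unfolding t_def by (auto intro!: enn2real_leI simp flip: ennreal_of_nat_eq_real_of_nat)
  have "(II x. ennreal (t f x)) * (II x. ennreal (t g x)) <= (II x. ennreal (t h x))^2" proof (rule Prekopa_Leindler_bounded)
   show "t f : borel_measurable borel" "t g : borel_measurable borel" "t h : borel_measurable borel" unfolding t_def by measurable
   show "bdd_above (range (t f))" "bdd_above (range (t g))" by (rule bdd_aboveI2, rule tn(2))+
   fix x y
   have "ennreal (t f x * t g y) <= ennreal ((t h ((x + y) / 2))^2)" proof (cases "h ((x+y)/2) <= of_nat n")
   case True
   have "ennreal (t f x * t g y) <= f x * g y" unfolding ennreal_mult[OF tn(1) tn(1)] t by (intro mult_mono) auto
   also note h[of x y]
   also have "(h ((x + y) / 2))^2 = ennreal ((t h ((x + y) / 2))^2)" using True tn(1) by (simp add: t min_def flip: ennreal_power)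
   finally show ?thesis .
   next
   case False
   hence "ennreal (t h ((x+y)/2)) = ennreal (of_nat n)" by (simp add: t min_def ennreal_of_nat_eq_real_of_nat)
   hence "t h ((x+y)/2) = n" using tn(1) by (simp add: ennreal_inj)
   moreover have "t f x * t g y <= real n * real n" by (intro mult_mono tn) auto
   ultimately show ?thesis by (intro ennreal_leI) (simp add: power2_eq_square) qed
   thus "t f x * t g y <= (t h ((x + y) / 2))^2" by (simp add: ennreal_le_iff) qed (rule tn)+
  also have "... <= (II x. h x)^2" by (intro power_mono nn_integral_mono) (auto simp: t)
  finally show ?thesis by (simp add: t) qed
 \<comment> \<open>Separate levels \<open>k\<close> and \<open>l\<close>, because the product of the
   two limits is written as an iterated supremum.\<close>
 have n': "(II x. min (f x) (of_nat k)) * (II x. min (g x) (of_nat l)) <= (II x. h x)^2" for k l proof -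
  have "(II x. min (f x) (of_nat k)) * (II x. min (g x) (of_nat l)) <= (II x. min (f x) (of_nat (max k l))) * (II x. min (g x) (of_nat (max k l)))"
   by (intro mult_mono nn_integral_mono min.mono) auto
  thus ?thesis using n order_trans by blast qed
 have "(II x. f x) * (II x. g x) = (SUP l. SUP k. (II x. min (f x) (of_nat k)) * (II x. min (g x) (of_nat l)))"
  unfolding nn_integral_SUP_min_nat[OF m(1), symmetric] nn_integral_SUP_min_nat[OF m(2), symmetric] by (simp only: SUP_mult_left_ennreal SUP_mult_right_ennreal)
 also have "... <= (II x. h x)^2" by (intro SUP_least n')
 finally show ?thesis . qed

text \<open>Induction on the coordinates: the sections in coordinate \<open>i\<close> satisfy the
  one-dimensional hypothesis, so their integrals satisfy the hypothesis with one coordinate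
  less.\<close>

lemma Prekopa_Leindler_PiM:
 fixes f g h :: "('i => real) => ennreal"
 assumes "finite I"
  and "f : borel_measurable (Pi\<^sub>M I (%_. lborel))" "g : borel_measurable (Pi\<^sub>M I (%_. lborel))"
  "h : borel_measurable (Pi\<^sub>M I (%_. lborel))"
  and "!!x y. x : I \<rightarrow>\<^sub>E UNIV ==> y : I \<rightarrow>\<^sub>E UNIV ==> f x * g y <= (h (\<lambda>i\<in>I. (x i + y i) / 2))^2"
 shows "(\<integral>\<^sup>+x. f x \<partial>Pi\<^sub>M I (%_. lborel)) * (\<integral>\<^sup>+x. g x \<partial>Pi\<^sub>M I (%_. lborel)) <= (\<integral>\<^sup>+x. h x \<partial>Pi\<^sub>M I (%_. lborel))^2"
 using assms proof (induction I arbitrary: f g h rule: finite_induct)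
 case empty
 interpret product_sigma_finite "%_. lborel :: real measure" by standard
 from empty(4)[of "%_. undefined" "%_. undefined"] show ?case by (simp add: PiM_empty nn_integral_count_space_finite restrict_def)
next
 case (insert i I)
 interpret product_sigma_finite "%_. lborel :: real measure" by standard
 note [measurable] = insert.prems(1-3)
 define T where "T k x = (II y. k (x(i := y)))" for k :: "('i => real) => ennreal" and x
 have eq: "(\<integral>\<^sup>+x. k x \<partial>Pi\<^sub>M (insert i I) (%_. lborel)) = (\<integral>\<^sup>+x. T k x \<partial>Pi\<^sub>M I (%_. lborel))"
  if "k : borel_measurable (Pi\<^sub>M (insert i I) (%_. lborel))" for k unfolding T_def by (rule product_nn_integral_insert) (use insert.hyps that in auto)
 have T[measurable]: "T k : borel_measurable (Pi\<^sub>M I (%_. lborel))"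
  if [measurable]: "k : borel_measurable (Pi\<^sub>M (insert i I) (%_. lborel))" for k proof -
  have "(%(x, y). k (x(i := y))) : borel_measurable (Pi\<^sub>M I (%_. lborel) \<Otimes>\<^sub>M lborel)"
   using measurable_compose[OF measurable_add_dim that] by (simp add: case_prod_unfold comp_def)
  thus ?thesis unfolding T_def by (rule lborel.borel_measurable_nn_integral) qed
 have sl: "(%y. k (x(i := y))) : borel_measurable borel"
  if "k : borel_measurable (Pi\<^sub>M (insert i I) (%_. lborel))" "x : I \<rightarrow>\<^sub>E UNIV" for k :: "('i => real) => ennreal" and x proof -
  have "(%y. x(i := y)) : measurable lborel (Pi\<^sub>M (insert i I) (%_. lborel))" by (rule measurable_fun_upd[where J=I]) (use that(2) in "auto simp: space_PiM")
  from measurable_compose[OF this that(1)] show ?thesis by simp qed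
 have "(\<integral>\<^sup>+x. T f x \<partial>Pi\<^sub>M I (%_. lborel)) * (\<integral>\<^sup>+x. T g x \<partial>Pi\<^sub>M I (%_. lborel)) <= (\<integral>\<^sup>+x. T h x \<partial>Pi\<^sub>M I (%_. lborel))^2"
 proof (rule insert.IH)
  fix x y :: "'i => real" assume x: "x : I \<rightarrow>\<^sub>E UNIV" and y: "y : I \<rightarrow>\<^sub>E UNIV"
  let ?m = "\<lambda>i\<in>I. (x i + y i) / 2"
  have m: "?m : I \<rightarrow>\<^sub>E UNIV" by auto
  show "T f x * T g y <= (T h ?m)^2" unfolding T_def proof (rule Prekopa_Leindler_real)
   fix s t :: real
   have "x(i := s) : insert i I \<rightarrow>\<^sub>E UNIV" "y(i := t) : insert i I \<rightarrow>\<^sub>E UNIV" using x y by (auto simp: PiE_iff extensional_def)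
   hence "f (x(i := s)) * g (y(i := t)) <= (h (\<lambda>j\<in>insert i I. ((x(i := s)) j + (y(i := t)) j) / 2))^2" by (rule insert.prems)
   moreover have "(\<lambda>j\<in>insert i I. ((x(i := s)) j + (y(i := t)) j) / 2) = ?m(i := (s + t) / 2)" using insert.hyps by (auto simp: fun_eq_iff restrict_def)
   ultimately show "f (x(i := s)) * g (y(i := t)) <= (h (?m(i := (s + t) / 2)))^2" by simp qed (use sl x y m insert.prems(1-3) in auto) qed (use insert.prems in auto)
 thus ?case by (simp add: eq insert.prems) qed

lemma emeasure_lborel_eq_PiM:
 fixes A :: "'a::euclidean_space set"
 assumes "A : sets borel"
 shows "emeasure lborel A = (\<integral>\<^sup>+f. indicator A (SUM b:Basis. f b *R b) \<partial>Pi\<^sub>M Basis (%_. lborel))"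
  and "(%f. indicator A (SUM b:Basis. f b *R b) :: ennreal) : borel_measurable (Pi\<^sub>M Basis (%_. lborel))" proof -
 have m: "(%f. SUM b:Basis. f b *R b) : measurable (Pi\<^sub>M Basis (%_. lborel)) (borel :: 'a measure)" by measurable
 have "emeasure lborel A = (\<integral>\<^sup>+x. indicator A x \<partial>distr (Pi\<^sub>M Basis (%_. lborel)) borel (%f. SUM b:Basis. f b *R b))" using assms by (subst lborel_eq) simp
 also have "... = (\<integral>\<^sup>+f. indicator A (SUM b:Basis. f b *R b) \<partial>Pi\<^sub>M Basis (%_. lborel))" using assms by (intro nn_integral_distr m) auto
 finally show "emeasure lborel A = (\<integral>\<^sup>+f. indicator A (SUM b:Basis. f b *R b) \<partial>Pi\<^sub>M Basis (%_. lborel))" .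
 have "(indicator A :: 'a => ennreal) : borel_measurable borel" using assms by simp
 from measurable_compose[OF m this]
 show "(%f. indicator A (SUM b:Basis. f b *R b) :: ennreal) : borel_measurable (Pi\<^sub>M Basis (%_. lborel))" . qed

text \<open>Prekopa-Leindler for indicator functions. The product form is enough because it is
  applied to two sets of equal measure.\<close>

lemma Brunn_Minkowski_mult:
 fixes A B C :: "'a::euclidean_space set"
 assumes "A : sets borel" "B : sets borel" "C : sets borel"
  and sub: "!!x y. x : A ==> y : B ==> (x + y) /R 2 : C"
 shows "emeasure lborel A * emeasure lborel B <= (emeasure lborel C)^2" proof -
 let ?E = "%f. SUM b:Basis. f b *R b :: 'a"
 have mid: "?E (\<lambda>i\<in>Basis. (f i + g i) / 2) = (?E f + ?E g) /R 2" for f g :: "'a => real" proof -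
  have "?E (\<lambda>i\<in>Basis. (f i + g i) / 2) = (SUM b:Basis. inverse 2 *R (f b *R b + g b *R b))" proof (intro sum.cong refl)
   fix b :: 'a assume "b : Basis"
   moreover have "((f b + g b) / 2) *R b = inverse 2 *R (f b *R b + g b *R b)" by (simp only: scaleR_left_distrib[symmetric] scaleR_scaleR divide_inverse_commute)
   ultimately show "(\<lambda>i\<in>Basis. (f i + g i) / 2) b *R b = inverse 2 *R (f b *R b + g b *R b)" by simp qed
  also have "... = (?E f + ?E g) /R 2" by (simp only: scaleR_sum_right[symmetric] sum.distrib)
  finally show ?thesis . qed
 have *: "indicator A (?E f) * indicator B (?E g) <= (indicator C (?E (\<lambda>i\<in>Basis. (f i + g i) / 2)) :: ennreal)^2"
  for f g :: "'a => real" unfolding mid using sub[of "?E f" "?E g"] by (cases "?E f : A"; cases "?E g : B") simp_all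
 show ?thesis using Prekopa_Leindler_PiM[OF finite_Basis emeasure_lborel_eq_PiM(2)[OF assms(1)] emeasure_lborel_eq_PiM(2)[OF assms(2)]
   emeasure_lborel_eq_PiM(2)[OF assms(3)], OF *] by (simp only: emeasure_lborel_eq_PiM(1)[OF assms(1)] emeasure_lborel_eq_PiM(1)[OF assms(2)] emeasure_lborel_eq_PiM(1)[OF assms(3)]) qed

lemma emeasure_lborel_uminus:
 fixes A :: "'a::euclidean_space set"
 assumes "A : sets borel"
 shows "emeasure lborel (uminus -` A) = emeasure lborel A" proof -
 have "(lborel :: 'a measure) = distr lborel borel uminus" using lborel_affine[of "-1" "0::'a"] by (simp add: density_1)
 hence "emeasure lborel A = emeasure (distr lborel borel uminus) A" by (rule arg_cong)
 also have "... = emeasure lborel (uminus -` A)" using assms by (subst emeasure_distr) auto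
 finally show ?thesis by simp qed

lemma ennreal_power2_le_imp_le:
 fixes a c :: ennreal
 assumes "a^2 <= c^2"
 shows "a <= c" proof (cases c rule: ennreal_cases)
 case (real y)
 show ?thesis proof (cases a rule: ennreal_cases)
  case (real x)
  with assms \<open>c = ennreal y\<close> \<open>0 <= y\<close> have "x^2 <= y^2" by (simp add: ennreal_power ennreal_le_iff)
  hence "x <= y" using \<open>0 <= y\<close> by (rule power2_le_imp_le)
  thus ?thesis using real \<open>c = ennreal y\<close> by (simp add: ennreal_leI)
 next
  case top
  hence "a^2 = top" by (simp add: power2_eq_square ennreal_mult_top)
  moreover have "c^2 < top" using real by (simp add: ennreal_power)
  ultimately show ?thesis using assms by simp qed qed simp

text \<open>Brunn-Minkowski for \<open>A\<close> and \<open>- A\<close>. Passing to half the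
  difference body turns a bound on distances between points into a bound on norms, which is how a
  diameter controls a volume.\<close>

lemma emeasure_le_half_difference_body:
 fixes A C :: "'a::euclidean_space set"
 assumes "A : sets borel" "C : sets borel"
  and sub: "!!x y. x : A ==> y : A ==> (x - y) /R 2 : C"
 shows "emeasure lborel A <= emeasure lborel C" proof -
 have "uminus : borel_measurable (borel :: 'a measure)" by simp
 from measurable_sets[OF this assms(1)] have m: "uminus -` A : sets borel" by simp
 have "emeasure lborel A * emeasure lborel (uminus -` A) <= (emeasure lborel C)^2" by (rule Brunn_Minkowski_mult[OF assms(1) m assms(2)]) (use sub[of _ "- y" for y] in auto)
 hence "(emeasure lborel A)^2 <= (emeasure lborel C)^2" using assms(1) by (simp add: emeasure_lborel_uminus power2_eq_square)
 thus ?thesis by (rule ennreal_power2_le_imp_le) qed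

section \<open>Cylinders and tubes: the isodiametric inequality across a direction\<close>

lemma nn_integral_translation:
 fixes f :: "'a::euclidean_space => ennreal"
 assumes "f : borel_measurable borel"
 shows "(II x. f (c + x)) = (II x. f x)" proof -
 have "(\<integral>\<^sup>+x. f x \<partial>distr lborel borel ((+) c)) = (II x. f (c + x))" using assms by (intro nn_integral_distr) auto
 thus ?thesis by (simp add: lborel_distr_plus) qed

text \<open>Averaging the product of two indicators over translations shows that a translation
 invariant measure is determined by its value on one ball.\<close>

lemma lborel_distr_isometry:
 fixes T :: "'a::euclidean_space => 'a"
 assumes lin: "linear T" and nT: "!!x. norm (T x) = norm x"
 shows "distr lborel borel T = lborel" proof (rule measure_eqI)
 have mT[measurable]: "T : borel_measurable borel" using lin by (intro borel_measurable_continuous_onI linear_continuous_on) (simp add: linear_conv_bounded_linear)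
 have "inj T" using nT lin by (simp add: linear_injective_0) (metis norm_eq_zero)
 hence surj: "surj T" using lin by (simp add: linear_injective_imp_surjective)
 fix B assume "B : sets (distr lborel borel T)"
 hence B[measurable]: "B : sets borel" by simp
 define K where "K = cball (0::'a) 1"
 have K[measurable]: "K : sets borel" by (simp add: K_def)
 have TB[measurable]: "T -` B : sets borel" using measurable_sets[OF mT B] by simp
 let ?iB = "%x. indicator B x :: ennreal" and ?iK = "%x. indicator K x :: ennreal"
 have "emeasure lborel (T -` B) * emeasure lborel K = (II x. ?iB (T x) * emeasure lborel K)" proof -
  have "(II x. ?iB (T x) * emeasure lborel K) = (II x. ?iB (T x)) * emeasure lborel K" by (rule nn_integral_multc) measurable
  also have "(II x. ?iB (T x)) = (II x. indicator (T -` B) x)" by (rule nn_integral_cong) (simp add: indicator_def)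
  finally show ?thesis by simp qed
 also have "... = (II x. (II y. ?iB (T x) * ?iK (- T x + y)))" proof (rule nn_integral_cong)
  fix x
  have "(II y. ?iB (T x) * ?iK (- T x + y)) = (II y. ?iB (T x) * ?iK y)" by (rule nn_integral_translation) measurable
  also have "... = ?iB (T x) * (II y. ?iK y)" by (rule nn_integral_cmult) simp
  finally show "?iB (T x) * emeasure lborel K = (II y. ?iB (T x) * ?iK (- T x + y))" by simp qed
 also have "... = (II y. (II x. ?iB (T x) * ?iK (- T x + y)))" by (rule lborel_pair.Fubini'[symmetric]) measurable
 also have "... = (II y. (II x. ?iB (y + T x) * ?iK (- T x)))" proof (rule nn_integral_cong)
  fix y :: 'a
  obtain z where z: "T z = y" using surj by (metis surjD)
  have "(II x. ?iB (T (z + x)) * ?iK (- T (z + x) + y)) = (II x. ?iB (T x) * ?iK (- T x + y))" by (rule nn_integral_translation) measurable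
  thus "(II x. ?iB (T x) * ?iK (- T x + y)) = (II x. ?iB (y + T x) * ?iK (- T x))" by (simp add: linear_add[OF lin] z) qed
 also have "... = (II x. (II y. ?iB (y + T x) * ?iK (- T x)))" by (rule lborel_pair.Fubini'[symmetric]) measurable
 also have "... = (II x. emeasure lborel B * ?iK x)" proof (rule nn_integral_cong)
  fix x
  have "(II y. ?iB (y + T x) * ?iK (- T x)) = (II y. ?iB (T x + y)) * ?iK (- T x)" by (subst nn_integral_multc) (auto simp: add.commute)
  also have "(II y. ?iB (T x + y)) = (II y. ?iB y)" by (rule nn_integral_translation) measurable
  also have "(II y. ?iB y) * ?iK (- T x) = emeasure lborel B * ?iK x" proof -
   have "?iK (- T x) = ?iK x" by (simp add: K_def indicator_def nT)
   moreover have "(II y. ?iB y) = emeasure lborel B" by simp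
   ultimately show ?thesis by (simp only:) qed
  finally show "(II y. ?iB (y + T x) * ?iK (- T x)) = emeasure lborel B * ?iK x" . qed
 also have "... = emeasure lborel B * emeasure lborel K" by (simp add: nn_integral_cmult)
 finally have "emeasure lborel K * emeasure lborel (T -` B) = emeasure lborel K * emeasure lborel B" by (simp only: mult.commute)
 moreover have "0 < emeasure lborel K" "emeasure lborel K < top" unfolding K_def by (auto simp: emeasure_cball)
 ultimately have "emeasure lborel (T -` B) = emeasure lborel B" by (auto simp: ennreal_mult_cancel_left)
 moreover have "emeasure (distr lborel borel T) B = emeasure lborel (T -` B)" by (simp add: emeasure_distr)
 ultimately show "emeasure (distr lborel borel T) B = emeasure lborel B" by simp qed simp

definition cylinder :: "'a::euclidean_space => real => real => 'a set" where
 "cylinder e L r = {v. \<bar>v *. e\<bar> <= L & norm (v - (v *. e) *R e) <= r}"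

lemma closed_cylinder: "closed (cylinder e L r)" unfolding cylinder_def Collect_conj_eq by (intro closed_Int closed_Collect_le continuous_intros)

lemma emeasure_cylinder_Basis:
 fixes b :: "'a::euclidean_space"
 assumes b: "b : Basis" and r: "r > 0" and L: "L > 0"
 shows "emeasure lborel (cylinder b L r) = ennreal (2 * L * (unit_ball_vol (real (DIM('a) - 1)) * r ^ (DIM('a) - 1)))" proof -
 interpret product_sigma_finite "%_. lborel :: real measure" by standard
 define I where "I = Basis - {b}"
 have I: "finite I" "b ~: I" "insert b I = Basis" "card I = DIM('a) - 1" using b by (auto simp: I_def)
 let ?E = "%f. SUM i:Basis. f i *R i :: 'a"
 let ?S = "{f. sqrt (SUM i:I. (f i)^2) <= r} Int space (Pi\<^sub>M I (%_. lborel :: real measure))"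
 have cb: "cylinder b L r : sets borel" by (simp add: closed_cylinder)
 have E: "?E (f(b := y)) : cylinder b L r \<longleftrightarrow> \<bar>y\<bar> <= L & sqrt (SUM i:I. (f i)^2) <= r" for f y proof -
  define w where "w = (SUM i:I. f i *R i)"
  have "?E (f(b := y)) = y *R b + (SUM i:I. (f(b := y)) i *R i)" unfolding I(3)[symmetric] using I by (subst sum.insert) auto
  also have "(SUM i:I. (f(b := y)) i *R i) = w" unfolding w_def using I(2) by (intro sum.cong) auto
  finally have Ef: "?E (f(b := y)) = y *R b + w" .
  have wb: "w *. j = (if j = b then 0 else f j)" if "j : Basis" for j proof -
   have "w *. j = (SUM i:I. if i = j then f i else 0)" unfolding w_def inner_sum_left using that I_def by (intro sum.cong) (auto simp: inner_Basis)
   thus ?thesis using that I by (auto simp: I_def) qed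
  have "norm w = sqrt (SUM j:Basis. (w *. j) * (w *. j))" unfolding norm_eq_sqrt_inner by (subst euclidean_inner) simp
  also have "(SUM j:Basis. (w *. j) * (w *. j)) = (SUM j:I. (w *. j) * (w *. j))" unfolding I(3)[symmetric] using I wb[OF b] by (subst sum.insert) auto
  also have "... = (SUM j:I. (f j)^2)" using wb by (intro sum.cong) (auto simp: I_def power2_eq_square)
  finally have "norm w = sqrt (SUM j:I. (f j)^2)" .
  moreover have "(y *R b + w) *. b = y" using b wb[OF b] by (simp add: inner_add_left)
  ultimately show ?thesis unfolding Ef cylinder_def by simp qed
 have S: "?S : sets (Pi\<^sub>M I (%_. lborel))" by measurable
 have m: "(%f. indicator (cylinder b L r) (?E f) :: ennreal) : borel_measurable (Pi\<^sub>M (insert b I) (%_. lborel))" unfolding I(3) by (rule emeasure_lborel_eq_PiM(2)[OF cb])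
 have "emeasure lborel (cylinder b L r) = (\<integral>\<^sup>+f. indicator (cylinder b L r) (?E f) \<partial>Pi\<^sub>M (insert b I) (%_. lborel))"
  unfolding I(3) by (rule emeasure_lborel_eq_PiM(1)[OF cb])
 also have "... = (\<integral>\<^sup>+x. (II y. indicator (cylinder b L r) (?E (x(b := y)))) \<partial>Pi\<^sub>M I (%_. lborel))" by (rule product_nn_integral_insert[OF I(1,2) m])
 also have "... = (\<integral>\<^sup>+x. ennreal (2 * L) * indicator ?S x \<partial>Pi\<^sub>M I (%_. lborel))" proof (rule nn_integral_cong)
  fix x assume x: "x : space (Pi\<^sub>M I (%_. lborel :: real measure))"
  have "(II y. indicator (cylinder b L r) (?E (x(b := y)))) = (II y. indicator ?S x * indicator {- L..L} y)" proof (rule nn_integral_cong)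
   fix y
   have "?E (x(b := y)) : cylinder b L r \<longleftrightarrow> x : ?S & y : {-L..L}" unfolding E using x by (auto simp: abs_le_iff)
   thus "indicator (cylinder b L r) (?E (x(b := y))) = (indicator ?S x * indicator {- L..L} y :: ennreal)" by (simp only: indicator_def) auto qed
  also have "... = indicator ?S x * (II y. indicator {- L..L} y)" by (rule nn_integral_cmult) simp
  also have "(II y. indicator {- L..L} y) = ennreal (2 * L)" using L by simp
  finally show "(II y. indicator (cylinder b L r) (?E (x(b := y)))) = ennreal (2 * L) * indicator ?S x" by (simp only: mult.commute) qed
 also have "... = ennreal (2 * L) * emeasure (Pi\<^sub>M I (%_. lborel)) ?S" by (rule nn_integral_cmult_indicator[OF S])
 also have "emeasure (Pi\<^sub>M I (%_. lborel)) ?S = ennreal (unit_ball_vol (real (card I)) * r ^ card I)" by (rule emeasure_cball_aux[OF I(1) r])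
 finally show ?thesis using L r by (simp add: I(4) ennreal_mult) qed

lemma emeasure_cylinder:
 fixes e :: "'a::euclidean_space"
 assumes e: "norm e = 1" and r: "r > 0" and L: "L > 0"
 shows "emeasure lborel (cylinder e L r) = ennreal (2 * L * (unit_ball_vol (real (DIM('a) - 1)) * r ^ (DIM('a) - 1)))" proof -
 obtain b :: 'a where b: "b : Basis" using nonempty_Basis by (metis ex_in_conv)
 have nb: "norm b = 1" using b by simp
 show ?thesis proof (cases "e = b")
  case True thus ?thesis using emeasure_cylinder_Basis[OF b r L] by simp
 next
  case False
  define w where "w = e - b"
  \<comment> \<open>The reflection in the hyperplane orthogonal to \<open>e - b\<close>; it
    exchanges the unit vectors \<open>e\<close> and \<open>b\<close>.\<close>
  define T where "T x = x - (2 * (x *. w) / (w *. w)) *R w" for x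
  have ww: "w *. w > 0" using False by (simp add: w_def)
  have lin: "linear T" unfolding T_def by (rule linearI) (auto simp: inner_add_left algebra_simps add_divide_distrib)
  have TT: "T x *. T y = x *. y" for x y unfolding T_def using ww by (simp add: inner_diff_left inner_diff_right inner_commute field_simps)
  have nT: "norm (T x) = norm x" for x by (simp add: norm_eq_sqrt_inner TT)
  have ee: "e *. e = 1" "b *. b = 1" using e nb by (simp_all add: dot_square_norm)
  have "2 * (e *. w) = w *. w" unfolding w_def using ee by (simp add: inner_diff_left inner_diff_right inner_commute)
  hence Te: "T e = b" unfolding T_def using ww by (simp add: w_def)
  have eq: "T -` cylinder b L r = cylinder e L r" proof -
   have "T v - (T v *. b) *R b = T (v - (v *. e) *R e)" for v using TT[of v e] Te by (simp add: linear_diff[OF lin] linear_scale[OF lin])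
   thus ?thesis unfolding cylinder_def using TT[of _ e] Te by (auto simp: nT) qed
  have "T : borel_measurable borel" using lin by (intro borel_measurable_continuous_onI linear_continuous_on) (simp add: linear_conv_bounded_linear)
  hence "emeasure (distr lborel borel T) (cylinder b L r) = emeasure lborel (cylinder e L r)" by (subst emeasure_distr) (auto simp: eq closed_cylinder)
  thus ?thesis using emeasure_cylinder_Basis[OF b r L] by (simp add: lborel_distr_isometry[OF lin nT]) qed qed

text \<open>Radius 0 arises from covering pieces consisting of one point. The cylinder is then a
  null segment, since \<open>q ^ (N - 1) <= q\<close> for \<open>q <= 1\<close>, which relies on
  \<open>N >= 2\<close>.\<close>

lemma emeasure_cylinder_le:
 fixes e :: "'a::euclidean_space"
 assumes e: "norm e = 1" and r: "r >= 0" and L: "L > 0" and dim: "DIM('a) >= 2"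
 shows "emeasure lborel (cylinder e L r) <= ennreal (2 * L * (unit_ball_vol (real (DIM('a) - 1)) * r ^ (DIM('a) - 1)))" proof (cases "r = 0")
 case True
 define W where "W = 2 * L * unit_ball_vol (real (DIM('a) - 1))"
 have W: "W > 0" using L by (simp add: W_def)
 have "emeasure lborel (cylinder e L 0) <= 0 + ennreal t" if t: "t > 0" for t proof -
  define q where "q = min 1 (t / W)"
  have q: "0 < q" "q <= 1" "q <= t / W" using t W by (auto simp: q_def)
  have "emeasure lborel (cylinder e L 0) <= emeasure lborel (cylinder e L q)" proof (rule emeasure_mono)
   show "cylinder e L 0 <= cylinder e L q" unfolding cylinder_def using q(1) by auto qed (simp add: closed_cylinder)
  also have "... = ennreal (W * q ^ (DIM('a) - 1))" using emeasure_cylinder[OF e q(1) L] by (simp add: W_def mult.assoc)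
  also have "... <= ennreal t" proof (rule ennreal_leI)
   have "q ^ (DIM('a) - 1) <= q ^ 1" by (rule power_decreasing) (use q dim in auto)
   hence "W * q ^ (DIM('a) - 1) <= W * (t / W)" using q W by (intro mult_left_mono) auto
   thus "W * q ^ (DIM('a) - 1) <= t" using W by simp qed
  finally show ?thesis by simp qed
 hence "emeasure lborel (cylinder e L 0) <= 0" by (rule ennreal_le_epsilon)
 thus ?thesis unfolding True by (rule order_trans) (rule zero_le)
next
 case False
 with r have "r > 0" by simp
 from emeasure_cylinder[OF e this L] show ?thesis by (rule eq_refl) qed

lemma norm_orthogonal_part_le:
 fixes e :: "'a::real_inner"
 assumes "norm e = 1"
 shows "norm (x - (x *. e) *R e) <= norm x" proof -
 have "e *. e = 1" using assms by (simp add: dot_square_norm)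
 hence "(x - (x *. e) *R e) *. (x - (x *. e) *R e) = x *. x - (x *. e)^2" by (simp add: inner_diff_left inner_diff_right inner_commute power2_eq_square)
 thus ?thesis by (simp add: norm_eq_sqrt_inner) qed

definition tube :: "'a::real_vector => real => 'a set => 'a set" where
 "tube e L A = (%(a, s). a + s *R e) ` (A \<times> {0..L})"

lemma compact_tube:
 fixes A :: "'a::euclidean_space set"
 shows "compact A ==> compact (tube e L A)" unfolding tube_def by (intro compact_continuous_image compact_Times compact_Icc) (auto simp: case_prod_unfold intro!: continuous_intros)

text \<open>The difference of two points of \<open>A\<close> has norm at most \<open>D\<close>, so
  half the difference body of the tube fits into a cylinder of radius \<open>D / 2\<close> whose
  half length is \<open>(L + D) / 2\<close>.\<close>

lemma emeasure_tube_le: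
 fixes A :: "'a::euclidean_space set"
 assumes A: "compact A" "diameter A <= D" and e: "norm e = 1" and L: "L > 0" and dim: "DIM('a) >= 2" and D: "D >= 0"
 shows "emeasure lborel (tube e L A) <= ennreal ((L + D) * (unit_ball_vol (real (DIM('a) - 1)) * (D / 2) ^ (DIM('a) - 1)))" proof -
 have "emeasure lborel (tube e L A) <= emeasure lborel (cylinder e ((L + D) / 2) (D / 2))" proof (rule emeasure_le_half_difference_body)
  fix x y assume "x : tube e L A" "y : tube e L A"
  then obtain a s a' s' where xy: "x = a + s *R e" "y = a' + s' *R e" "a : A" "a' : A" "s : {0..L}" "s' : {0..L}" by (auto simp: tube_def)
  have ee: "e *. e = 1" using e by (simp add: dot_square_norm)
  have nD: "norm (a - a') <= D" using diameter_bounded_bound[of A a a'] A xy by (simp add: compact_imp_bounded dist_norm)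
  have "\<bar>(a - a') *. e\<bar> <= D" using Cauchy_Schwarz_ineq2[of "a - a'" e] e nD by simp
  moreover have "\<bar>s - s'\<bar> <= L" using xy by auto
  moreover have "(x - y) *. e = (a - a') *. e + (s - s')" unfolding xy using ee by (simp add: inner_diff_left inner_add_left algebra_simps)
  ultimately have 1: "\<bar>(x - y) *. e\<bar> <= L + D" by linarith
  have "(x - y) - ((x - y) *. e) *R e = (a - a') - ((a - a') *. e) *R e" unfolding xy using ee by (simp add: inner_diff_left inner_add_left algebra_simps)
  hence 2: "norm ((x - y) - ((x - y) *. e) *R e) <= D" using norm_orthogonal_part_le[OF e, of "a - a'"] nD by simp
  have "q /R 2 : cylinder e ((L + D) / 2) (D / 2)"
   if q: "\<bar>q *. e\<bar> <= L + D" "norm (q - (q *. e) *R e) <= D" for q proof -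
   have "q /R 2 - ((q /R 2) *. e) *R e = (1 / 2) *R (q - (q *. e) *R e)" by (simp add: scaleR_diff_right)
   hence "norm (q /R 2 - ((q /R 2) *. e) *R e) = norm (q - (q *. e) *R e) / 2" by simp
   with q show ?thesis by (simp add: cylinder_def abs_mult) qed
  from this[OF 1 2] show "(x - y) /R 2 : cylinder e ((L + D) / 2) (D / 2)" . qed (use A in "auto simp: closed_cylinder intro: compact_tube borel_compact")
 also have "... <= ennreal (2 * ((L + D) / 2) * (unit_ball_vol (real (DIM('a) - 1)) * (D / 2) ^ (DIM('a) - 1)))" by (rule emeasure_cylinder_le) (use e D L dim in auto)
 also have "2 * ((L + D) / 2) = L + D" by simp
 finally show ?thesis . qed

text \<open>Averaging over long segments in the direction \<open>e\<close> turns the isodiametric bound for tubes into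
 a bound by the \<open>(N-1)\<close>-dimensional isodiametric volume of the base.\<close>

lemma nn_integral_le_by_lines:
 fixes g :: "'a::euclidean_space => ennreal"
 assumes g[measurable]: "g : borel_measurable borel" and A: "compact A" "diameter A <= D" and e: "norm e = 1"
  and dim: "DIM('a) >= 2" and D: "D >= 0" and s1: "s1 >= 0" and c: "c >= 0"
  and supp: "!!x. g x ~= 0 ==> EX s:{0..s1}. x + s *R e : A"
  and line: "!!x. (II s. g (x + s *R e)) <= ennreal c"
 shows "(II x. g x) <= ennreal (c * (unit_ball_vol (real (DIM('a) - 1)) * (D / 2) ^ (DIM('a) - 1)))" proof -
 define W where "W = c * (unit_ball_vol (real (DIM('a) - 1)) * (D / 2) ^ (DIM('a) - 1))"
 have W: "W >= 0" unfolding W_def using c D by simp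
 define k where "k = s1 + D"
 have k: "k >= 0" using s1 D by (simp add: k_def)
 have main: "(II x. g x) <= ennreal ((1 + k / L) * W)" if L: "L > 0" for L proof -
  \<comment> \<open>A point contributes if a shift in \<open>[0, L]\<close> and a further one in
    \<open>[0, s1]\<close> along \<open>e\<close> lead into \<open>A\<close>; this is the tube of
    length \<open>L + s1\<close> in the opposite direction.\<close>
  define Z where "Z = tube (- e) (L + s1) A"
  have Z[measurable]: "Z : sets borel" unfolding Z_def using A by (intro borel_compact compact_tube)
  have "ennreal L * (II x. g x) = (II s. indicator {0..L} s * (II x. g x))" using L by (simp add: nn_integral_multc)
  also have "... = (II s. (II x. indicator {0..L} s * g (x + s *R e)))" proof (rule nn_integral_cong)
   fix s
   have "(II x. indicator {0..L} s * g (x + s *R e)) = indicator {0..L} s * (II x. g (s *R e + x))" by (subst nn_integral_cmult[symmetric]) (auto simp: add.commute)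
   thus "indicator {0..L} s * (II x. g x) = (II x. indicator {0..L} s * g (x + s *R e))" by (simp only: nn_integral_translation[OF g]) qed
  also have "... = (II x. (II s. indicator {0..L} s * g (x + s *R e)))" by (rule lborel_pair.Fubini') measurable
  also have "... <= (II x. ennreal c * indicator Z x)" proof (rule nn_integral_mono)
   fix x
   show "(II s. indicator {0..L} s * g (x + s *R e)) <= ennreal c * indicator Z x" proof (cases "x : Z")
   case True
   have "(II s. indicator {0..L} s * g (x + s *R e)) <= (II s. g (x + s *R e))" by (intro nn_integral_mono) (simp add: indicator_def)
   also note line
   finally show ?thesis using True by simp
   next
   case False
   have "indicator {0..L} s * g (x + s *R e) = 0" for s proof (rule ccontr)
   assume "~ ?thesis"
   hence s: "s : {0..L}" "g (x + s *R e) ~= 0" by (auto simp: indicator_def split: if_splits)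
   then obtain s' where s': "s' : {0..s1}" "x + s *R e + s' *R e : A" using supp by blast
   have "(%(a, s). a + s *R (- e)) (x + s *R e + s' *R e, s + s') : Z" unfolding Z_def tube_def by (intro imageI) (use s s' in auto)
   moreover have "(%(a, s). a + s *R (- e)) (x + s *R e + s' *R e, s + s') = x" by (simp add: scaleR_left_distrib)
   ultimately have "x : Z" by (simp only:)
   thus False using False by simp qed
   hence "(II s. indicator {0..L} s * g (x + s *R e)) = (\<integral>\<^sup>+(s::real). 0 \<partial>lborel)" by (intro nn_integral_cong)
   thus ?thesis by (simp only: nn_integral_const mult_zero_left zero_le) qed qed
  also have "... = ennreal c * emeasure lborel Z" by (rule nn_integral_cmult_indicator) simp
  also have "... <= ennreal c * ennreal ((L + s1 + D) * (unit_ball_vol (real (DIM('a) - 1)) * (D / 2) ^ (DIM('a) - 1)))"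
   unfolding Z_def by (intro mult_left_mono emeasure_tube_le) (use A e dim D s1 L in auto)
  also have "... = ennreal ((L + k) * W)" unfolding W_def k_def using c by (subst ennreal_mult'[symmetric]) (auto simp: algebra_simps)
  finally have "ennreal L * (II x. g x) <= ennreal ((L + k) * W)" .
  hence "ennreal (1 / L) * (ennreal L * (II x. g x)) <= ennreal (1 / L) * ennreal ((L + k) * W)" by (rule mult_left_mono) simp
  moreover have "ennreal (1 / L) * (ennreal L * (II x. g x)) = (II x. g x)" using L by (simp add: mult.assoc[symmetric] ennreal_mult'[symmetric])
  moreover have "ennreal (1 / L) * ennreal ((L + k) * W) = ennreal ((1 + k / L) * W)" using L by (subst ennreal_mult'[symmetric]) (auto simp: field_simps)
  ultimately show ?thesis by simp qed
 have "(II x. g x) <= ennreal W" proof (rule ennreal_le_epsilon)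
  fix t :: real assume t: "0 < t"
  \<comment> \<open>Makes the excess \<open>k * W / L\<close> of the averaged bound at most
    \<open>t\<close>.\<close>
  define L where "L = k * W / t + 1"
  have L: "L > 0" using k W t by (simp add: L_def add_nonneg_pos)
  have "(1 + k / L) * W = W + k * W / L" by (simp add: field_simps)
  moreover have "k * W / L <= t" proof -
   have "k * W <= t * L" unfolding L_def using t by (simp add: field_simps)
   thus ?thesis using L by (simp add: divide_le_eq) qed
  ultimately have "ennreal ((1 + k / L) * W) <= ennreal (W + t)" by (intro ennreal_leI) simp
  also have "... = ennreal W + ennreal t" using W t by simp
  finally show "(II x. g x) <= ennreal W + ennreal t" using main[OF L] by simp qed
 thus ?thesis by (simp add: W_def) qed

section \<open>The Hausdorff outer measure as a Borel measure\<close>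

lemma hausdorff_content_le:
 fixes C :: "nat => 'a::metric_space set"
 assumes "A <= (\<Union>i. C i)" "!!i. bounded (C i)" "!!i. diameter (C i) <= dl"
 shows "hausdorff_content s dl A <= (\<Sum>i. ennreal (unit_ball_vol s * (diameter (C i) / 2) powr s))" unfolding hausdorff_content_def by (rule INF_lower) (use assms in auto)

lemma hausdorff_content_less:
 fixes A :: "'a::metric_space set"
 assumes "hausdorff_content s dl A < x"
 obtains C :: "nat => 'a set" where "A <= (\<Union>i. C i)" "!!i. bounded (C i)" "!!i. diameter (C i) <= dl"
  "(\<Sum>i. ennreal (unit_ball_vol s * (diameter (C i) / 2) powr s)) < x" proof -
 from assms have "EX C:{C :: nat => 'a set. A <= (\<Union>i. C i) & (ALL i. bounded (C i) & diameter (C i) <= dl)}. (\<Sum>i. ennreal (unit_ball_vol s * (diameter (C i) / 2) powr s)) < x"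
  unfolding hausdorff_content_def by (simp only: INF_less_iff)
 thus ?thesis using that by blast qed

lemma hausdorff_content_antimono:
 "dl <= dl' ==> hausdorff_content s dl' A <= hausdorff_content s dl A" unfolding hausdorff_content_def by (rule INF_superset_mono) (auto intro: order_trans)

lemma hausdorff_content_mono:
 "A <= B ==> hausdorff_content s dl A <= hausdorff_content s dl B" unfolding hausdorff_content_def by (rule INF_superset_mono) auto

lemma hausdorff_content_empty: "dl >= 0 ==> hausdorff_content s dl ({} :: 'a::metric_space set) = 0" using hausdorff_content_le[of "{}" "%_. {}:: 'a set" dl s] by simp

lemma hausdorff_content_countably_subadditive:
 fixes A :: "nat => 'a::metric_space set"
 shows "hausdorff_content s dl (\<Union>n. A n) <= (\<Sum>n. hausdorff_content s dl (A n))" proof (rule ennreal_le_epsilon)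
 fix e :: real
 assume fin: "(\<Sum>n. hausdorff_content s dl (A n)) < top" and e: "0 < e"
 let ?m = "%C :: 'a set. ennreal (unit_ball_vol s * (diameter C / 2) powr s)"
 have "EX C. A n <= (\<Union>i. C i) & (ALL i. bounded (C i) & diameter (C i) <= dl) & (\<Sum>i. ?m (C i)) <= hausdorff_content s dl (A n) + ennreal (e * (1/2) ^ Suc n)" for n proof -
  have "hausdorff_content s dl (A n) <= (\<Sum>n. hausdorff_content s dl (A n))" using sum_le_suminf[of "%n. hausdorff_content s dl (A n)" "{n}"] by simp
  hence "hausdorff_content s dl (A n) < top" using fin by (rule le_less_trans)
  hence "hausdorff_content s dl (A n) < hausdorff_content s dl (A n) + ennreal (e * (1/2) ^ Suc n)"
   using e by (cases "hausdorff_content s dl (A n)" rule: ennreal_cases) (auto simp: ennreal_less_iff simp flip: ennreal_plus)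
  from hausdorff_content_less[OF this] show ?thesis by (metis less_imp_le) qed
 then obtain C where C: "!!n. A n <= (\<Union>i. C n i)" "!!n i. bounded (C n i)" "!!n i. diameter (C n i) <= dl"
  "!!n. (\<Sum>i. ?m (C n i)) <= hausdorff_content s dl (A n) + ennreal (e * (1/2) ^ Suc n)" by metis
 define K where "K k = (case prod_decode k of (n, i) => C n i)" for k
 have "hausdorff_content s dl (\<Union>n. A n) <= (\<Sum>k. ?m (K k))" proof (rule hausdorff_content_le)
  show "(\<Union>n. A n) <= (\<Union>k. K k)" proof
   fix x assume "x : (\<Union>n. A n)"
   then obtain n i where "x : C n i" using C(1) by blast
   hence "x : K (prod_encode (n, i))" by (simp add: K_def)
   thus "x : (\<Union>k. K k)" by blast qed qed (auto simp: K_def C split: prod.split)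
 also have "... = (\<Sum>k. (%(n, i). ?m (C n i)) (prod_decode k))" by (intro suminf_cong) (simp add: K_def split: prod.split)
 also have "... = (\<Sum>n. \<Sum>i. ?m (C n i))" by (rule suminf_ennreal_2dimen) simp
 also have "... <= (\<Sum>n. hausdorff_content s dl (A n) + ennreal (e * (1/2) ^ Suc n))" by (intro suminf_le C) auto
 also have "... = (\<Sum>n. hausdorff_content s dl (A n)) + (\<Sum>n. ennreal (e * (1/2) ^ Suc n))" by (intro suminf_add[symmetric]) auto
 also have "(\<Sum>n. ennreal (e * (1/2) ^ Suc n)) = ennreal e" proof (rule suminf_ennreal_eq)
  show "(%n. e * (1/2) ^ Suc n) sums e" using sums_mult[OF power_half_series, of e] by simp qed (use e in auto)
 finally show "hausdorff_content s dl (\<Union>n. A n) <= (\<Sum>n. hausdorff_content s dl (A n)) + ennreal e" . qed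

lemma hausdorff_content_le_outer: "dl > 0 ==> hausdorff_content s dl A <= hausdorff_outer s A" unfolding hausdorff_outer_def by (rule SUP_upper) auto

lemma hausdorff_outer_mono: "A <= B ==> hausdorff_outer s A <= hausdorff_outer s B" unfolding hausdorff_outer_def by (intro SUP_mono) (auto intro: hausdorff_content_mono)

lemma hausdorff_outer_empty: "hausdorff_outer s ({}::'a::metric_space set) = 0" proof -
 have "hausdorff_outer s ({}::'a set) <= 0" unfolding hausdorff_outer_def by (rule SUP_least) (simp add: hausdorff_content_empty)
 thus ?thesis by simp qed

lemma hausdorff_outer_countably_subadditive:
 fixes A :: "nat => 'a::metric_space set"
 shows "hausdorff_outer s (\<Union>n. A n) <= (\<Sum>n. hausdorff_outer s (A n))" unfolding hausdorff_outer_def[of s "\<Union>n. A n"] proof (rule SUP_least)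
 fix dl :: real assume "dl : {0<..}"
 hence "(\<Sum>n. hausdorff_content s dl (A n)) <= (\<Sum>n. hausdorff_outer s (A n))" by (intro suminf_le hausdorff_content_le_outer) auto
 thus "hausdorff_content s dl (\<Union>n. A n) <= (\<Sum>n. hausdorff_outer s (A n))" using hausdorff_content_countably_subadditive order_trans by blast qed

lemma hausdorff_outer_Un_le:
 fixes A B :: "'a::metric_space set"
 shows "hausdorff_outer s (A Un B) <= hausdorff_outer s A + hausdorff_outer s B" proof -
 define F where "F n = (if n = 0 then A else if n = Suc 0 then B else {})" for n :: nat
 have "(\<Union>n. F n) = A Un B" by (auto simp: F_def split: if_splits)
 moreover have "(\<Sum>n. hausdorff_outer s (F n)) = (SUM n:{0, Suc 0}. hausdorff_outer s (F n))" by (rule suminf_finite) (auto simp: F_def hausdorff_outer_empty)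
 ultimately show ?thesis using hausdorff_outer_countably_subadditive[of s F] by (simp add: F_def) qed

text \<open>A covering set of diameter below \<open>d\<close> meets at most one of \<open>A\<close>
  and \<open>B\<close>, so fine covers of the union split into two.\<close>

lemma hausdorff_outer_separated:
 fixes A B :: "'a::metric_space set"
 assumes d: "d > 0" "!!x y. x : A ==> y : B ==> d <= dist x y"
 shows "hausdorff_outer s A + hausdorff_outer s B <= hausdorff_outer s (A Un B)" proof -
 let ?m = "%C :: 'a set. ennreal (unit_ball_vol s * (diameter C / 2) powr s)"
 have content: "hausdorff_content s dl A + hausdorff_content s dl B <= hausdorff_content s dl (A Un B)"
  if dl: "0 < dl" "dl < d" for dl unfolding hausdorff_content_def[of s dl "A Un B"] proof (rule INF_greatest)
  fix C :: "nat => 'a set"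
  assume "C : {C. A Un B <= (\<Union>i. C i) & (ALL i. bounded (C i) & diameter (C i) <= dl)}"
  hence C: "A Un B <= (\<Union>i. C i)" "!!i. bounded (C i)" "!!i. diameter (C i) <= dl" by auto
  define CA where "CA i = (if C i Int A = {} then {} else C i)" for i
  define CB where "CB i = (if C i Int B = {} then {} else C i)" for i
  have "hausdorff_content s dl A <= (\<Sum>i. ?m (CA i))" proof (rule hausdorff_content_le)
   show "A <= (\<Union>i. CA i)" proof
   fix x assume x: "x : A"
   then obtain i where "x : C i" using C(1) by blast
   hence "x : CA i" using x by (auto simp: CA_def)
   thus "x : (\<Union>i. CA i)" by blast qed qed (use C dl in "auto simp: CA_def")
  moreover have "hausdorff_content s dl B <= (\<Sum>i. ?m (CB i))" proof (rule hausdorff_content_le)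
   show "B <= (\<Union>i. CB i)" proof
   fix x assume x: "x : B"
   then obtain i where "x : C i" using C(1) by blast
   hence "x : CB i" using x by (auto simp: CB_def)
   thus "x : (\<Union>i. CB i)" by blast qed qed (use C dl in "auto simp: CB_def")
  ultimately have "hausdorff_content s dl A + hausdorff_content s dl B <= (\<Sum>i. ?m (CA i)) + (\<Sum>i. ?m (CB i))" by (rule add_mono)
  also have "... = (\<Sum>i. ?m (CA i) + ?m (CB i))" by (intro suminf_add) auto
  also have "... <= (\<Sum>i. ?m (C i))" proof (rule suminf_le)
   fix i
   have "C i Int A = {} | C i Int B = {}" proof (rule ccontr)
   assume "~ ?thesis"
   then obtain x y where "x : C i" "x : A" "y : C i" "y : B" by auto
   with d(2)[of x y] diameter_bounded_bound[OF C(2)[of i], of x y] C(3)[of i] dl show False by auto qed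
   thus "?m (CA i) + ?m (CB i) <= ?m (C i)" by (auto simp: CA_def CB_def) qed auto
  finally show "hausdorff_content s dl A + hausdorff_content s dl B <= (\<Sum>i. ?m (C i))" . qed
 have *: "hausdorff_content s dl1 A + hausdorff_content s dl2 B <= hausdorff_outer s (A Un B)"
  if "dl1 : {0<..}" "dl2 : {0<..}" for dl1 dl2 proof -
  define dl where "dl = min (min dl1 dl2) (d / 2)"
  have dl: "0 < dl" "dl < d" "dl <= dl1" "dl <= dl2" using that d by (auto simp: dl_def)
  have "hausdorff_content s dl1 A + hausdorff_content s dl2 B <= hausdorff_content s dl A + hausdorff_content s dl B" by (intro add_mono hausdorff_content_antimono dl)
  also have "... <= hausdorff_outer s (A Un B)" using content[OF dl(1,2)] hausdorff_content_le_outer[OF dl(1)] order_trans by blast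
  finally show ?thesis . qed
 have "hausdorff_content s dl1 A + hausdorff_outer s B <= hausdorff_outer s (A Un B)" if "dl1 : {0<..}" for dl1 proof -
  have "(SUP dl2\<in>{0<..}. hausdorff_content s dl2 B + hausdorff_content s dl1 A) <= hausdorff_outer s (A Un B)" by (rule SUP_least) (use *[OF that] in "simp add: add.commute")
  thus ?thesis unfolding hausdorff_outer_def[of s B] by (subst (asm) ennreal_SUP_add_left) (auto simp: add.commute intro: exI[of _ 1]) qed
 hence "(SUP dl1\<in>{0<..}. hausdorff_content s dl1 A + hausdorff_outer s B) <= hausdorff_outer s (A Un B)" by (rule SUP_least)
 thus ?thesis unfolding hausdorff_outer_def[of s A] by (subst (asm) ennreal_SUP_add_left) (auto intro: exI[of _ 1]) qed

lemma suminf_ennreal_tail: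
 fixes f :: "nat => ennreal"
 assumes fin: "(\<Sum>n. f n) ~= top" and e: "e > 0"
 shows "EX N. (\<Sum>n. f (n + N)) <= ennreal e" proof -
 have ft: "f n ~= top" for n using sum_le_suminf[of f "{n}"] fin by (auto simp: top_unique)
 define g where "g n = enn2real (f n)" for n
 have fg: "f n = ennreal (g n)" "0 <= g n" for n using ft[of n] by (simp_all add: g_def less_top ennreal_enn2real)
 have sg: "summable g" by (rule summable_suminf_not_top) (use fg fin in "auto simp: fg(1)[symmetric]")
 then obtain N where N: "norm (\<Sum>i. g (i + N)) < e" using suminf_exist_split[OF e] by blast
 have "(\<Sum>n. f (n + N)) = ennreal (\<Sum>n. g (n + N))" unfolding fg(1) by (rule suminf_ennreal2) (use fg sg in "auto simp: summable_iff_shift")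
 also have "... <= ennreal e" using N by (intro ennreal_leI) auto
 finally show ?thesis by blast qed

text \<open>Caratheodory's criterion. The part of \<open>A\<close> outside \<open>F\<close> is cut
  into shells \<open>R k\<close> by the distance to \<open>F\<close>. Shells of equal parity are
  separated, so the measures of each parity class add up to at most that of \<open>A\<close>. Hence
  the shells close to \<open>F\<close> have small total measure, and the remaining part
  \<open>B N\<close> is separated from \<open>F\<close>.\<close>

lemma hausdorff_outer_closed_split:
 fixes A F :: "'a::metric_space set"
 assumes F: "closed F"
 shows "hausdorff_outer s (A Int F) + hausdorff_outer s (A - F) <= hausdorff_outer s A" proof (cases "F = {} | hausdorff_outer s A = top")
 case True
 thus ?thesis by (auto simp: hausdorff_outer_empty)
next
 case False
 hence F0: "F ~= {}" and fin: "hausdorff_outer s A ~= top" by auto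
 define R where "R k = {x\<in>A. 1 / real (k + 2) <= infdist x F & infdist x F < 1 / real (k + 1)}" for k
 define B where "B n = {x\<in>A. 1 / real (n + 1) <= infdist x F}" for n
 have sepR: "1 / real (k + 2) - 1 / real (l + 1) <= dist x y" if "x : R k" "y : R l" for k l x y proof -
  have "infdist x F <= infdist y F + dist x y" by (rule infdist_triangle)
  thus ?thesis using that unfolding R_def by auto qed
 have sumR: "(\<Sum>j<m. hausdorff_outer s (R (2 * j + i))) <= hausdorff_outer s (\<Union>j<m. R (2 * j + i))" for m i proof (induction m)
  case (Suc m)
  show ?case proof (cases "m = 0")
   case False
   have "(\<Sum>j<Suc m. hausdorff_outer s (R (2 * j + i))) <= hausdorff_outer s (\<Union>j<m. R (2 * j + i)) + hausdorff_outer s (R (2 * m + i))" using Suc by (simp add: add_right_mono)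
   also have "... <= hausdorff_outer s ((\<Union>j<m. R (2 * j + i)) Un R (2 * m + i))" proof (rule hausdorff_outer_separated)
   fix x y assume "x : (\<Union>j<m. R (2 * j + i))" and y: "y : R (2 * m + i)"
   then obtain j where j: "j < m" "x : R (2 * j + i)" by auto
   have "1 / real (2 * m + i) <= 1 / real (2 * j + i + 2)" using j by (intro divide_left_mono) auto
   thus "1 / real (2 * m + i) - 1 / real (2 * m + i + 1) <= dist x y" using sepR[OF j(2) y] by linarith
   next
   show "0 < 1 / real (2 * m + i) - 1 / real (2 * m + i + 1)" using False by (simp add: divide_strict_left_mono) qed
   also have "(\<Union>j<m. R (2 * j + i)) Un R (2 * m + i) = (\<Union>j<Suc m. R (2 * j + i))" by (auto simp: less_Suc_eq)
   finally show ?thesis . qed (simp add: lessThan_Suc) qed (simp add: hausdorff_outer_empty)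
 have "(\<Sum>j. hausdorff_outer s (R (2 * j + i))) <= hausdorff_outer s A" for i proof (rule suminf_le_const[OF summableI])
  fix m
  have "hausdorff_outer s (\<Union>j<m. R (2 * j + i)) <= hausdorff_outer s A" by (rule hausdorff_outer_mono) (auto simp: R_def)
  with sumR show "(\<Sum>j<m. hausdorff_outer s (R (2 * j + i))) <= hausdorff_outer s A" by (rule order_trans) qed
 note half = this[of 0] this[of 1]
 have double: "(\<Sum>n. f n) <= (\<Sum>j. f (2 * j)) + (\<Sum>j. f (2 * j + 1))" for f :: "nat => ennreal" proof (rule suminf_le_const[OF summableI])
  fix m
  have "(\<Sum>n<m. f n) <= (\<Sum>n<2 * m. f n)" by (intro sum_mono2) auto
  also have "... = (\<Sum>j<m. f (2 * j)) + (\<Sum>j<m. f (2 * j + 1))" by (induction m) (auto simp: add_ac)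
  also have "... <= (\<Sum>j. f (2 * j)) + (\<Sum>j. f (2 * j + 1))" by (intro add_mono sum_le_suminf) auto
  finally show "(\<Sum>n<m. f n) <= (\<Sum>j. f (2 * j)) + (\<Sum>j. f (2 * j + 1))" . qed
 have "(\<Sum>n. hausdorff_outer s (R n)) <= hausdorff_outer s A + hausdorff_outer s A" using double[of "%n. hausdorff_outer s (R n)"] add_mono[OF half] by simp
 hence Rfin: "(\<Sum>n. hausdorff_outer s (R n)) ~= top" using fin by (auto simp: top_unique)
 show ?thesis proof (rule ennreal_le_epsilon)
  fix e :: real assume e: "0 < e"
  obtain N where N: "(\<Sum>n. hausdorff_outer s (R (n + N))) <= ennreal e" using suminf_ennreal_tail[OF Rfin e] by blast
  have "A - F <= B N Un (\<Union>n. R (n + N))" proof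
   fix x assume x: "x : A - F"
   hence pos: "infdist x F > 0" using F F0 infdist_pos_not_in_closed by blast
   show "x : B N Un (\<Union>n. R (n + N))" proof (cases "1 / real (N + 1) <= infdist x F")
   case False
   define P where "P n \<longleftrightarrow> 1 / real (n + 2) <= infdist x F" for n
   have ex: "EX n. P n" proof -
   obtain n where n: "inverse (real (Suc n)) < infdist x F" using reals_Archimedean[OF pos] by blast
   have "1 / real (n + 2) <= inverse (real (Suc n))" by (simp add: field_simps)
   thus ?thesis using n unfolding P_def by (intro exI[of _ n]) linarith qed
   define k where "k = (LEAST n. P n)"
   have k: "P k" unfolding k_def using ex by (rule LeastI_ex)
   have kN: "N <= k" proof (rule ccontr)
   assume "~ N <= k"
   hence "1 / real (N + 1) <= 1 / real (k + 2)" by (intro divide_left_mono) auto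
   thus False using k False unfolding P_def by linarith qed
   have "infdist x F < 1 / real (k + 1)" proof (cases "k = N")
   case True thus ?thesis using False by simp
   next
   case False
   hence "k - 1 < k" using kN by simp
   hence "~ P (k - 1)" unfolding k_def by (rule not_less_Least)
   moreover have "real (k - 1 + 2) = real (k + 1)" using False kN by simp
   ultimately show ?thesis unfolding P_def by simp qed
   hence "x : R k" using x k unfolding R_def P_def by auto
   moreover have "k = (k - N) + N" using kN by simp
   ultimately show ?thesis by (metis UN_I UNIV_I UnI2) qed (use x in "auto simp: B_def") qed
  hence "hausdorff_outer s (A - F) <= hausdorff_outer s (B N Un (\<Union>n. R (n + N)))" by (rule hausdorff_outer_mono)
  also have "... <= hausdorff_outer s (B N) + hausdorff_outer s (\<Union>n. R (n + N))" by (rule hausdorff_outer_Un_le)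
  also have "... <= hausdorff_outer s (B N) + ennreal e" by (intro add_left_mono order_trans[OF hausdorff_outer_countably_subadditive N])
  finally have "hausdorff_outer s (A Int F) + hausdorff_outer s (A - F) <= (hausdorff_outer s (A Int F) + hausdorff_outer s (B N)) + ennreal e" by (simp add: add.assoc add_left_mono)
  also have "hausdorff_outer s (A Int F) + hausdorff_outer s (B N) <= hausdorff_outer s (A Int F Un B N)" proof (rule hausdorff_outer_separated)
   fix x y assume "x : A Int F" "y : B N"
   thus "1 / real (N + 1) <= dist x y" using infdist_le[of x F y] by (auto simp: B_def dist_commute) qed simp
  also have "... <= hausdorff_outer s A" by (rule hausdorff_outer_mono) (auto simp: B_def)
  finally show "hausdorff_outer s (A Int F) + hausdorff_outer s (A - F) <= hausdorff_outer s A + ennreal e" by (simp add: add_right_mono) qed qed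

definition hausdorff_measure :: "real => 'a::metric_space measure" where
 "hausdorff_measure s = measure_of UNIV (sets borel) (hausdorff_outer s)"

lemma measure_space_hausdorff_outer:
 "measure_space (UNIV :: 'a::metric_space set) (sets borel) (hausdorff_outer s)" proof -
 let ?f = "hausdorff_outer s :: 'a set => ennreal"
 interpret sigma_algebra "UNIV :: 'a set" "Pow UNIV" by (rule sigma_algebra_Pow)
 have oms: "outer_measure_space (Pow UNIV) ?f" unfolding outer_measure_space_def positive_def increasing_def countably_subadditive_def
  by (auto simp: hausdorff_outer_empty intro: hausdorff_outer_mono hausdorff_outer_countably_subadditive)
 have ms: "measure_space UNIV (lambda_system UNIV (Pow UNIV) ?f) ?f" by (rule caratheodory_lemma[OF oms])
 hence sa: "sigma_algebra UNIV (lambda_system UNIV (Pow UNIV) ?f)" by (simp add: measure_space_def)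
 have "Collect closed <= lambda_system UNIV (Pow UNIV) ?f" proof
  fix F :: "'a set" assume "F : Collect closed"
  hence F: "closed F" by simp
  have "?f (A Int F) + ?f (A - F) = ?f A" for A proof (rule antisym)
   have "A = (A Int F) Un (A - F)" by auto
   thus "?f A <= ?f (A Int F) + ?f (A - F)" by (metis hausdorff_outer_Un_le) qed (rule hausdorff_outer_closed_split[OF F])
  moreover have "F Int A = A Int F" "(UNIV - F) Int A = A - F" for A by blast+
  ultimately have "?f (F Int A) + ?f ((UNIV - F) Int A) = ?f A" for A by (simp only:)
  thus "F : lambda_system UNIV (Pow UNIV) ?f" by (auto simp: lambda_system_def) qed
 hence "sigma_sets UNIV (Collect closed) <= lambda_system UNIV (Pow UNIV) ?f" by (rule sigma_algebra.sigma_sets_subset[OF sa])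
 moreover have "sets (borel :: 'a measure) = sigma_sets UNIV (Collect closed)" unfolding borel_eq_closed by simp
 ultimately have "sets (borel :: 'a measure) <= lambda_system UNIV (Pow UNIV) ?f" by simp
 moreover have "sigma_algebra UNIV (sets (borel :: 'a measure))" using sets.sigma_algebra_axioms[of "borel :: 'a measure"] by simp
 ultimately show ?thesis using measure_down[OF ms] by blast qed

lemma sets_hausdorff_measure [simp, measurable_cong]: "sets (hausdorff_measure s :: 'a::metric_space measure) = sets borel"
 unfolding hausdorff_measure_def using sets.sigma_sets_eq[of "borel :: 'a measure"] by (simp add: sets_measure_of_conv)

lemma space_hausdorff_measure [simp]: "space (hausdorff_measure s :: 'a::metric_space measure) = UNIV" unfolding hausdorff_measure_def by (simp add: space_measure_of_conv)

lemma emeasure_hausdorff_measure: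
 fixes A :: "'a::metric_space set"
 assumes "A : sets borel"
 shows "emeasure (hausdorff_measure s) A = hausdorff_outer s A" proof (rule emeasure_measure_of[OF hausdorff_measure_def])
 show "positive (sets (hausdorff_measure s :: 'a measure)) (hausdorff_outer s)"
  "countably_additive (sets (hausdorff_measure s :: 'a measure)) (hausdorff_outer s)" using measure_space_hausdorff_outer[of s, where 'a='a] by (auto simp: measure_space_def)
qed (use assms in auto)

text \<open>\<open>measure_of\<close> returns the prescribed values only if these form a measure;
  for the surface measure this is settled by comparison with the restriction of the Borel
  measure.\<close>

lemma surface_measure_eq:
 fixes S :: "'a::euclidean_space set"
 assumes "S : sets borel"
 shows "surface_measure S = restrict_space (hausdorff_measure (real DIM('a) - 1)) S"
 unfolding surface_measure_def restrict_space_def sets_hausdorff_measure space_hausdorff_measure Int_UNIV_right proof (rule measure_of_eq)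
 show "(\<inter>) S ` sets borel <= Pow S" by auto
 have sub: "(\<inter>) S ` sets borel <= sets borel" using assms by auto
 fix X assume "X : sigma_sets S ((\<inter>) S ` sets borel)"
 moreover have "sigma_sets S ((\<inter>) S ` sets borel) <= sets borel" using sets.sigma_sets_subset'[OF sub] assms by simp
 ultimately show "hausdorff_outer (real DIM('a) - 1) X = emeasure (hausdorff_measure (real DIM('a) - 1)) X" by (subst emeasure_hausdorff_measure) auto qed

section \<open>Symmetry of second derivatives\<close>

lemma has_derivative_inner_D:
 assumes "(f has_derivative (%v. g *. v)) (at (x + t *R b))"
 shows "((%t. f (x + t *R b)) has_field_derivative (g *. b)) (at t within S)" proof -
 have "((%t. f (x + t *R b)) has_derivative (%t. g *. (t *R b))) (at t within S)"
  by (rule has_derivative_compose[where f="%t. x + t *R b" and g=f, OF _ assms]) (auto intro!: derivative_eq_intros)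
 thus ?thesis unfolding has_field_derivative_def by (rule has_derivative_eq_rhs) (auto simp: fun_eq_iff) qed

lemma second_difference_mean_value:
 fixes f :: "'a::euclidean_space => real"
 assumes f: "C2_on (ball x r) f" and b: "b : Basis" "c : Basis" and h: "0 < h" "2 * h < r"
 shows "EX s t. 0 < s & s < h & 0 < t & t < h &
  f (x + h *R b + h *R c) - f (x + h *R b) - (f (x + h *R c) - f x) = h * h * pd (pd f b) c (x + s *R b + t *R c)" proof -
 have nb: "norm b = 1" "norm c = 1" using b by auto
 have inb: "x + s *R b + t *R c : ball x r" if "0 <= s" "s <= h" "0 <= t" "t <= h" for s t proof -
  have "norm (s *R b + t *R c) <= s + t" using norm_triangle_ineq[of "s *R b" "t *R c"] that nb by simp
  moreover have "x - (x + s *R b + t *R c) = - (s *R b + t *R c)" by simp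
  ultimately have "norm (x - (x + s *R b + t *R c)) < r" using that h by (simp only: norm_minus_cancel)
  thus ?thesis by (simp only: mem_ball dist_norm) qed
 have d1: "((%s. f (y + s *R b)) has_field_derivative pd f b (y + s *R b)) (at s)"
  if "y + s *R b : ball x r" for y s using has_derivative_inner_D[OF C1_on_has_grad[OF C2_on_C1[OF f] that]] b by (simp add: grad_inner_Basis)
 have d2: "((%s. pd f b (y + s *R c)) has_field_derivative pd (pd f b) c (y + s *R c)) (at s)"
  if "y + s *R c : ball x r" for y s using has_derivative_inner_D[OF C1_on_has_grad[of "ball x r" "pd f b", OF _ that]] b f by (simp add: grad_inner_Basis C2_on_def)
 define g where "g s = f ((x + h *R c) + s *R b) - f (x + s *R b)" for s
 have "EX s. 0 < s & s < h & g h - g 0 = (h - 0) * (pd f b ((x + h *R c) + s *R b) - pd f b (x + s *R b))" proof (rule MVT2[OF h(1)])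
  fix s assume s: "0 <= s" "s <= h"
  show "(g has_real_derivative pd f b ((x + h *R c) + s *R b) - pd f b (x + s *R b)) (at s)" unfolding g_def
   by (intro DERIV_diff d1) (use inb[OF s, of h] inb[OF s, of 0] h in "simp_all add: add_ac") qed
 then obtain s where s: "0 < s" "s < h" "g h - g 0 = h * (pd f b ((x + h *R c) + s *R b) - pd f b (x + s *R b))" by auto
 have "EX t. 0 < t & t < h & pd f b ((x + s *R b) + h *R c) - pd f b ((x + s *R b) + 0 *R c) = (h - 0) * pd (pd f b) c ((x + s *R b) + t *R c)"
  by (rule MVT2[OF h(1)], rule d2, rule inb) (use s in auto)
 then obtain t where t: "0 < t" "t < h" "pd f b ((x + s *R b) + h *R c) - pd f b (x + s *R b) = h * pd (pd f b) c ((x + s *R b) + t *R c)" by auto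
 have "g h - g 0 = h * h * pd (pd f b) c (x + s *R b + t *R c)" using s(3) t(3) by (simp add: add_ac mult_ac)
 moreover have "g h - g 0 = f (x + h *R b + h *R c) - f (x + h *R b) - (f (x + h *R c) - f x)" unfolding g_def by (simp add: add_ac)
 ultimately show ?thesis using s t by metis qed

text \<open>The second difference over a small square is \<open>h * h\<close> times either mixed
  derivative at some nearby point; continuity equates the two at \<open>x\<close>.\<close>

lemma pd_commute:
 fixes f :: "'a::euclidean_space => real"
 assumes f: "C2_on U f" and U: "open U" "x : U" and b: "b : Basis" "c : Basis"
 shows "pd (pd f b) c x = pd (pd f c) b x" proof (rule ccontr)
 assume neq: "pd (pd f b) c x ~= pd (pd f c) b x"
 define e where "e = \<bar>pd (pd f b) c x - pd (pd f c) b x\<bar> / 2"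
 have e: "e > 0" using neq by (simp add: e_def)
 obtain r where r: "r > 0" "ball x r <= U" using U open_contains_ball by blast
 have c1: "continuous_on U (pd (pd f b) c)" "continuous_on U (pd (pd f c) b)" using f b by (auto simp: C2_on_def C1_on_def)
 hence "isCont (pd (pd f b) c) x" "isCont (pd (pd f c) b) x" using U continuous_on_eq_continuous_at by blast+
 then obtain d1 d2 where d: "d1 > 0" "d2 > 0"
  "!!y. dist y x < d1 ==> dist (pd (pd f b) c y) (pd (pd f b) c x) < e"
  "!!y. dist y x < d2 ==> dist (pd (pd f c) b y) (pd (pd f c) b x) < e" using e unfolding continuous_at_eps_delta by metis
 define h where "h = min r (min d1 d2) / 3"
 have h: "0 < h" "2 * h < r" "2 * h < d1" "2 * h < d2" using r d by (auto simp: h_def)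
 have fr: "C2_on (ball x r) f" using f r(2) by (rule C2_on_subset)
 have nb: "norm b = 1" "norm c = 1" using b by auto
 obtain s t where st: "0 < s" "s < h" "0 < t" "t < h"
  "f (x + h *R b + h *R c) - f (x + h *R b) - (f (x + h *R c) - f x) = h * h * pd (pd f b) c (x + s *R b + t *R c)" using second_difference_mean_value[OF fr b h(1,2)] by blast
 obtain s' t' where st': "0 < s'" "s' < h" "0 < t'" "t' < h"
  "f (x + h *R c + h *R b) - f (x + h *R c) - (f (x + h *R b) - f x) = h * h * pd (pd f c) b (x + s' *R c + t' *R b)" using second_difference_mean_value[OF fr b(2,1) h(1,2)] by blast
 have "h * h * pd (pd f b) c (x + s *R b + t *R c) = h * h * pd (pd f c) b (x + s' *R c + t' *R b)" proof -
  have comm: "x + h *R c + h *R b = x + h *R b + h *R c" by (simp add: add_ac)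
  show ?thesis using st(5) st'(5)[unfolded comm] by linarith qed
 hence eq: "pd (pd f b) c (x + s *R b + t *R c) = pd (pd f c) b (x + s' *R c + t' *R b)" using h by simp
 have "norm (s *R b + t *R c) < 2 * h" "norm (s' *R c + t' *R b) < 2 * h" using norm_triangle_ineq[of "s *R b" "t *R c"] norm_triangle_ineq[of "s' *R c" "t' *R b"] st st' nb by auto
 hence "dist (x + s *R b + t *R c) x < d1" "dist (x + s' *R c + t' *R b) x < d2" using h by (simp_all add: dist_norm add.assoc)
 from d(3)[OF this(1)] d(4)[OF this(2)] eq
 have "\<bar>pd (pd f c) b (x + s' *R c + t' *R b) - pd (pd f b) c x\<bar> < e"
  "\<bar>pd (pd f c) b (x + s' *R c + t' *R b) - pd (pd f c) b x\<bar> < e" unfolding dist_real_def by simp_all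
 moreover have "\<bar>a - b\<bar> <= \<bar>p - a\<bar> + \<bar>p - b\<bar>" for a b p :: real by linarith
 ultimately have "\<bar>pd (pd f b) c x - pd (pd f c) b x\<bar> < e + e" by (meson add_strict_mono order_le_less_trans)
 thus False by (simp add: e_def) qed

lemma hess_symmetric:
 assumes f: "C2_on U f" and U: "open U" "x : U"
 shows "hess f x v *. w = hess f x w *. v" proof -
 have *: "hess f x v *. w = (SUM b:Basis. SUM c:Basis. (v *. c) * (w *. b) * pd (pd f b) c x)" for v w proof -
  have "grad (pd f b) x *. v = (SUM c:Basis. pd (pd f b) c x * (v *. c))" for b unfolding grad_def inner_sum_left by (intro sum.cong) (simp_all add: inner_commute)
  thus ?thesis unfolding hess_def inner_sum_left inner_scaleR_left by (intro sum.cong refl) (simp add: sum_distrib_left sum_distrib_right inner_commute mult_ac) qed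
 have "hess f x w *. v = (SUM b:Basis. SUM c:Basis. (w *. c) * (v *. b) * pd (pd f b) c x)" by (rule *)
 also have "... = (SUM c:Basis. SUM b:Basis. (w *. c) * (v *. b) * pd (pd f b) c x)" by (rule sum.swap)
 also have "... = (SUM c:Basis. SUM b:Basis. (v *. b) * (w *. c) * pd (pd f c) b x)" using pd_commute[OF f U] by (intro sum.cong refl) (simp add: mult_ac)
 also have "... = hess f x v *. w" by (rule *[symmetric])
 finally show ?thesis by simp qed

lemma linear_hess: "linear (hess f x)" unfolding hess_def by (rule linearI) (auto simp: inner_add_right algebra_simps sum.distrib scaleR_sum_right)

section \<open>Polynomial bumps, the weighted mean value property and interior estimates\<close>

definition pos_pow :: "nat => real => real" where
 "pos_pow n t = (max 0 t) ^ n"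

lemma pos_pow_nonneg [simp]: "0 <= pos_pow n t" by (simp add: pos_pow_def)

lemma continuous_on_pos_pow [continuous_intros]:
 "continuous_on S f ==> continuous_on S (%x. pos_pow n (f x))" unfolding pos_pow_def by (intro continuous_intros)

lemma DERIV_pos_pow:
 "(pos_pow (Suc (Suc n)) has_field_derivative (real (Suc (Suc n)) * pos_pow (Suc n) t)) (at t)" proof -
 consider "t > 0" | "t < 0" | "t = 0" by linarith
 thus ?thesis proof cases
  case 1
  have "((%t. t ^ Suc (Suc n)) has_field_derivative (real (Suc (Suc n)) * pos_pow (Suc n) t)) (at t)" using 1 DERIV_pow[of "Suc (Suc n)" t] by (simp add: pos_pow_def)
  thus ?thesis by (rule has_field_derivative_transform_within_open[where S="{0<..}"]) (use 1 in "auto simp: pos_pow_def")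
 next
  case 2
  have "((%t. 0) has_field_derivative (real (Suc (Suc n)) * pos_pow (Suc n) t)) (at t)" using 2 by (auto simp: pos_pow_def)
  thus ?thesis by (rule has_field_derivative_transform_within_open[where S="{..<0}"]) (use 2 in "auto simp: pos_pow_def")
 next
  case 3
  have "((%h. pos_pow (Suc n) h) \<longlongrightarrow> pos_pow (Suc n) 0) (at 0)" using continuous_on_pos_pow[OF continuous_on_id, of UNIV "Suc n"]
   by (simp add: continuous_on_eq_continuous_at isCont_def)
  moreover
  have pp: "pos_pow (Suc n) h = (pos_pow (Suc (Suc n)) (0 + h) - pos_pow (Suc (Suc n)) 0) / h" if "h ~= 0" for h using that by (auto simp: pos_pow_def max_def)
  have "eventually (%h. pos_pow (Suc n) h = (pos_pow (Suc (Suc n)) (0 + h) - pos_pow (Suc (Suc n)) 0) / h) (at 0)" using pp by (auto simp: eventually_at intro!: exI[of _ 1])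
  ultimately have "((%h. (pos_pow (Suc (Suc n)) (0 + h) - pos_pow (Suc (Suc n)) 0) / h) \<longlongrightarrow> pos_pow (Suc n) 0) (at 0)" by (rule Lim_transform_eventually)
  thus ?thesis using 3 by (simp add: DERIV_def pos_pow_def) qed qed

text \<open>Only finitely smooth, but its gradient is \<open>z\<close> times a multiple of the bump
  of the next lower power, which makes radial integrations by parts explicit.\<close>

definition bump :: "nat => 'a::real_inner => real" where
 "bump n z = pos_pow n (1 - z *. z)"

lemma bump_nonneg [simp]: "0 <= bump n z" by (simp add: bump_def)

lemma bump_le_1: "bump n z <= 1" unfolding bump_def pos_pow_def by (rule power_le_one) auto

lemma bump_eq_0: "1 <= norm z ==> n > 0 ==> bump n z = 0" using one_le_power[of "norm z" 2] by (simp add: bump_def pos_pow_def power2_norm_eq_inner)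

lemma bump_pos: "norm z < 1 ==> 0 < bump n z" using power_less_one_iff[of "norm z" 2] by (simp add: bump_def pos_pow_def power2_norm_eq_inner)

lemma continuous_on_bump [continuous_intros]:
 "continuous_on S f ==> continuous_on S (%x. bump n (f x))" unfolding bump_def by (intro continuous_intros)

lemma has_derivative_bump:
 "(bump (Suc (Suc n)) has_derivative (%v. (- 2 * real (Suc (Suc n)) * bump (Suc n) z) *R z *. v)) (at z)" proof -
 have "((%z. 1 - z *. z) has_derivative (%v. - 2 * (z *. v))) (at z)" by (auto intro!: derivative_eq_intros simp: inner_commute)
 from has_derivative_compose[OF this DERIV_pos_pow[unfolded has_field_derivative_def, of n "1 - z *. z"]]
 show ?thesis unfolding bump_def by (rule has_derivative_eq_rhs) (auto simp: fun_eq_iff algebra_simps) qed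

text \<open>A box containing the unit ball, where the bumps live; integrals with a parameter over
  boxes are differentiated by \<open>leibniz_rule\<close>.\<close>

abbreviation unit_cube :: "'a::euclidean_space set" where
 "unit_cube == cbox (- One) One"

lemma norm_unit_cube:
 fixes z :: "'a::euclidean_space"
 assumes "z : unit_cube" shows "norm z <= real DIM('a)" proof -
 have "norm z <= (SUM b:Basis. \<bar>z *. b\<bar>)" by (rule norm_le_l1)
 also have "... <= (SUM b:(Basis::'a set). 1)" using assms by (intro sum_mono) (auto simp: mem_box abs_le_iff)
 finally show ?thesis by simp qed

lemma mem_unit_cube_if_norm_le: "norm z <= 1 ==> z : unit_cube" using Basis_le_norm[of _ z] by (auto simp: mem_box abs_le_iff) (smt (verit))+

definition bump_int :: "'a::euclidean_space itself => real" where
 "bump_int _ = integral (unit_cube :: 'a set) (bump 2)"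

lemma bump_int_pos: "bump_int TYPE('a::euclidean_space) > 0" proof -
 have c: "continuous_on (unit_cube :: 'a set) (bump 2)" by (intro continuous_intros)
 have "integral (unit_cube :: 'a set) (bump 2) ~= 0" proof
  assume "integral (unit_cube :: 'a set) (bump 2) = 0"
  hence "ALL x:(unit_cube :: 'a set). bump 2 x = 0" by (subst (asm) integral_cbox_eq_0_iff) (use c in "auto simp: box_ne_empty")
  moreover have "(0::'a) : unit_cube" by (simp add: mem_box)
  ultimately show False using bump_pos[of "0::'a" 2] by auto qed
 moreover have "integral (unit_cube :: 'a set) (bump 2) >= 0" by (rule integral_nonneg) (use c in "auto intro: integrable_continuous")
 ultimately show ?thesis by (simp add: bump_int_def) qed

lemma integral_unit_cube_affine:
 fixes h :: "'a::euclidean_space => 'b::euclidean_space"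
 assumes r: "r > 0" and h: "h integrable_on cbox (x - r *R One) (x + r *R One)"
 shows "((%z. h (x + r *R z)) has_integral (1 / r ^ DIM('a)) *R integral (cbox (x - r *R One) (x + r *R One)) h) unit_cube" proof -
 have "((%z. h (r *R z + x)) has_integral (1 / \<bar>r\<bar> ^ DIM('a)) *R integral (cbox (x - r *R One) (x + r *R One)) h)
  ((%z. (1 / r) *R z + - ((1 / r) *R x)) ` cbox (x - r *R One) (x + r *R One))" by (rule has_integral_affinity[OF integrable_integral[OF h]]) (use r in simp)
 moreover have "(%z. (1 / r) *R z + - ((1 / r) *R x)) ` cbox (x - r *R One) (x + r *R One) = unit_cube" proof -
  have "x : cbox (x - r *R One) (x + r *R One)" using r by (simp add: mem_box inner_diff_left inner_add_left)
  hence "cbox (x - r *R One) (x + r *R One) ~= {}" by auto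
  thus ?thesis using r by (subst image_affinity_cbox) (auto simp: algebra_simps) qed
 ultimately show ?thesis using r by (simp add: add.commute) qed

text \<open>The weight \<open>bump 2\<close> allows differentiation under the integral. The ball of
  radius \<open>real DIM('a) * r\<close> contains every \<open>x + r *R z\<close> with
  \<open>z\<close> in the cube, by \<open>norm_unit_cube\<close>.\<close>

definition mean_value_property :: "'a::euclidean_space set => ('a => real) => bool" where
 "mean_value_property Om f \<longleftrightarrow> continuous_on Om f & (ALL x r. 0 <= r --> cball x (real DIM('a) * r) <= Om -->
   integral unit_cube (%z. f (x + r *R z) * bump 2 z) = f x * bump_int TYPE('a))"

lemma mem_cball_scaled:
 fixes z :: "'a::euclidean_space"
 assumes "cball x (real DIM('a) * r) <= Om" "0 <= s" "s <= r" "z : unit_cube"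
 shows "x + s *R z : Om" proof -
 have "norm (s *R z) <= r * real DIM('a)" using norm_unit_cube[OF assms(4)] assms(2,3) by (simp add: mult_mono)
 hence "x + s *R z : cball x (real DIM('a) * r)" by (simp add: dist_norm mult.commute)
 thus ?thesis using assms(1) by blast qed

lemma LINT_eq_integral_compact_support:
 fixes f :: "'a::euclidean_space => real"
 assumes c: "continuous_on (cbox a b) f" and U: "U : sets borel"
  and 0: "!!z. z : U ==> z ~: cbox a b ==> f z = 0" "!!z. z : cbox a b ==> z ~: U ==> f z = 0"
 shows "(LINT z:U|lborel. f z) = integral (cbox a b) f" proof -
 have "set_integrable lborel (cbox a b) f" unfolding set_integrable_def by (rule borel_integrable_compact) (use c in auto)
 hence "(LINT z:cbox a b|lborel. f z) = integral (cbox a b) f" by (rule set_borel_integral_eq_integral)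
 moreover have "(%z. indicator U z *R f z) = (%z. indicator (cbox a b) z *R f z)" proof
  fix z show "indicator U z *R f z = indicator (cbox a b) z *R f z" using 0[of z] by (cases "z : U"; cases "z : cbox a b") simp_all qed
 ultimately show ?thesis by (simp only: set_lebesgue_integral_def) qed

text \<open>\<open>bump 2 z *R z\<close> is \<open>- 1 / 6\<close> times the gradient of
  \<open>bump 3\<close>. So the derivative of the weighted mean in the radius is a multiple of the
  integral of the divergence of \<open>bump 3 z\<close> times \<open>grad f\<close>, the Laplacian
  term being zero.\<close>

lemma harmonic_mean_value_property:
 fixes f :: "'a::euclidean_space => real"
 assumes O: "open Om" and f: "C2_on Om f" and harm: "!!x. x : Om ==> lap f x = 0"
 shows "mean_value_property Om f" unfolding mean_value_property_def proof (intro conjI allI impI)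
 show cf: "continuous_on Om f" using C1_on_continuous[OF C2_on_C1[OF f]] .
 fix x r assume r: "0 <= r" and sub: "cball x (real DIM('a) * r) <= Om"
 let ?Q = "unit_cube :: 'a set"
 have inO: "x + s *R z : Om" if "s : {0..r}" "z : ?Q" for s z using mem_cball_scaled[OF sub] that by auto
 define F where "F s = integral ?Q (%z. f (x + s *R z) * bump 2 z)" for s
 have cg: "continuous_on Om (grad f)" by (rule C1_on_continuous_grad[OF C2_on_C1[OF f]])
 have zero: "integral ?Q (%z. (grad f (x + s *R z) *. z) * bump 2 z) = 0" if s: "s : {0..r}" for s proof -
  define U where "U = (%z. x + s *R z) -` Om"
  have U: "open U" unfolding U_def by (intro open_vimage O continuous_intros)
  have KU: "cball 0 1 <= U" unfolding U_def proof
   fix z :: 'a assume "z : cball 0 1"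
   hence "z : ?Q" by (intro mem_unit_cube_if_norm_le) simp
   thus "z : (%z. x + s *R z) -` Om" using inO[OF s] by simp qed
  define V where "V z = bump 3 z *R grad f (x + s *R z)" for z
  define V' where "V' z v = (((- 6 * bump 2 z) *R z) *. v) *R grad f (x + s *R z) + bump 3 z *R hess f (x + s *R z) (s *R v)" for z v
  have b3: "(bump 3 has_derivative (%v. ((- 6 * bump 2 z) *R z) *. v)) (at z)" for z :: 'a using has_derivative_bump[of 1 z] by (simp add: numeral_eq_Suc)
  have dV: "(V has_derivative V' z) (at z)" if "z : U" for z proof -
   have "((%z. x + s *R z) has_derivative (%v. s *R v)) (at z)" by (auto intro!: derivative_eq_intros)
   from has_derivative_compose[OF this C2_on_has_hess[OF f]] that
   have "((%z. grad f (x + s *R z)) has_derivative (%v. hess f (x + s *R z) (s *R v))) (at z)" by (simp add: U_def)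
   from has_derivative_scaleR[OF b3 this] show ?thesis unfolding V_def V'_def by (rule has_derivative_eq_rhs) (auto simp: fun_eq_iff add.commute) qed
  have cV: "continuous_on U (%z. V' z v)" for v unfolding V'_def U_def by (intro continuous_intros continuous_on_compose2[OF cg] continuous_on_compose2[OF C2_on_continuous_hess[OF f]]) auto
  have "(LINT z:U|lborel. tr (V' z)) = 0" by (rule integral_tr_zero[OF U compact_cball KU dV cV]) (auto simp: V_def bump_eq_0)
  moreover have tr: "tr (V' z) = - 6 * ((grad f (x + s *R z) *. z) * bump 2 z)" if "z : U" for z proof -
   have "tr (V' z) = (SUM b:Basis. (- 6 * bump 2 z) * ((z *. b) * (grad f (x + s *R z) *. b))) + (SUM b:Basis. bump 3 z * s * (hess f (x + s *R z) b *. b))"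
   unfolding tr_def V'_def sum.distrib[symmetric] by (intro sum.cong refl) (simp add: inner_add_left inner_diff_left linear_scale[OF linear_hess] mult_ac)
   also have "(SUM b:Basis. bump 3 z * s * (hess f (x + s *R z) b *. b)) = bump 3 z * s * lap f (x + s *R z)" by (simp add: lap_eq_tr_hess tr_def sum_distrib_left)
   also have "... = 0" using harm that by (simp add: U_def)
   also have "(SUM b:Basis. (- 6 * bump 2 z) * ((z *. b) * (grad f (x + s *R z) *. b))) = - 6 * bump 2 z * (z *. grad f (x + s *R z))"
   by (subst euclidean_inner[of z]) (simp add: sum_distrib_left)
   finally show ?thesis by (simp add: inner_commute) qed
  moreover have "(LINT z:U|lborel. - 6 * ((grad f (x + s *R z) *. z) * bump 2 z)) = integral ?Q (%z. - 6 * ((grad f (x + s *R z) *. z) * bump 2 z))"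
  proof (rule LINT_eq_integral_compact_support)
   show "continuous_on ?Q (%z. - 6 * ((grad f (x + s *R z) *. z) * bump 2 z))" using inO[OF s] by (intro continuous_intros continuous_on_compose2[OF cg]) auto
   show "- 6 * ((grad f (x + s *R z) *. z) * bump 2 z) = 0" if "z ~: ?Q" for z proof -
   have "1 <= norm z" using that mem_unit_cube_if_norm_le[of z] by linarith
   thus ?thesis by (simp add: bump_eq_0) qed
   show "- 6 * ((grad f (x + s *R z) *. z) * bump 2 z) = 0" if "z : ?Q" "z ~: U" for z using that inO[OF s] by (auto simp: U_def) qed (use U in simp)
  moreover have "(LINT z:U|lborel. tr (V' z)) = (LINT z:U|lborel. - 6 * ((grad f (x + s *R z) *. z) * bump 2 z))" by (intro set_lebesgue_integral_cong) (use U tr in auto)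
  ultimately have "integral ?Q (%z. - 6 * ((grad f (x + s *R z) *. z) * bump 2 z)) = 0" by simp
  thus ?thesis by simp qed
 have dF: "(F has_field_derivative 0) (at s within {0..r})" if s: "s : {0..r}" for s proof -
  have "(F has_field_derivative integral ?Q (%z. (grad f (x + s *R z) *. z) * bump 2 z)) (at s within {0..r})" unfolding F_def proof (rule leibniz_rule_field_derivative[where U="{0..r}"])
   fix s z assume "s : {0..r}" "z : ?Q"
   hence "((%s. f (x + s *R z)) has_field_derivative (grad f (x + s *R z) *. z)) (at s within {0..r})" by (intro has_derivative_inner_D C1_on_has_grad[OF C2_on_C1[OF f]] inO)
   thus "((%s. f (x + s *R z) * bump 2 z) has_field_derivative (grad f (x + s *R z) *. z) * bump 2 z) (at s within {0..r})" by (rule DERIV_cmult_right)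
  next
   fix s assume "s : {0..r}"
   thus "(%z. f (x + s *R z) * bump 2 z) integrable_on ?Q" using inO by (intro integrable_continuous continuous_intros continuous_on_compose2[OF cf]) auto
  next
   show "continuous_on ({0..r} \<times> ?Q) (%(s, z). (grad f (x + s *R z) *. z) * bump 2 z)" unfolding case_prod_unfold
   by (intro continuous_intros continuous_on_compose2[OF cg]) (use inO in auto) qed (use s in auto)
  thus ?thesis using zero[OF s] by simp qed
 then obtain c where c: "!!s. s : {0..r} ==> F s = c" using has_field_derivative_zero_constant[of "{0..r}" F] by auto
 have "F r = F 0" using c[of r] c[of 0] r by simp
 also have "F 0 = f x * bump_int TYPE('a)" unfolding F_def bump_int_def by simp
 finally show "integral ?Q (%z. f (x + r *R z) * bump 2 z) = f x * bump_int TYPE('a)" unfolding F_def . qed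

lemma mem_unit_cube_scaled_iff:
 assumes r: "r > 0"
 shows "y : cbox (x - r *R One) (x + r *R One) \<longleftrightarrow> (y - x) /R r : unit_cube" using r unfolding mem_box by (auto simp: inner_diff_left inner_add_left field_simps)

lemma norm_scaleR_inverse: "r > 0 ==> norm (v /R r) = norm v / r" by (simp add: divide_inverse_commute)

lemma has_derivative_bump_scaled:
 fixes x y :: "'a::euclidean_space"
 assumes r: "r ~= 0"
 shows "((%x. bump 2 ((y - x) /R r)) has_derivative (%v. ((4 / r * bump 1 ((y - x) /R r)) *R ((y - x) /R r)) *. v)) (at x within S)" proof -
 have "((%x. (y - x) /R r) has_derivative (%v. - (v /R r))) (at x within S)" by (auto intro!: derivative_eq_intros)
 moreover have "(bump 2 has_derivative (%v. ((- 4 * bump 1 z) *R z) *. v)) (at z)" for z :: 'a using has_derivative_bump[of 0 z] by (simp add: numeral_2_eq_2)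
 ultimately have "((%x. bump 2 ((y - x) /R r)) has_derivative (%v. ((- 4 * bump 1 ((y - x) /R r)) *R ((y - x) /R r)) *. (- (v /R r)))) (at x within S)" by (rule has_derivative_compose)
 moreover have "((- 4 * \<beta>) *R w) *. (- (v /R r)) = ((4 / r * \<beta>) *R w) *. v" for \<beta> and v w :: 'a by (simp add: divide_inverse)
 ultimately show ?thesis by (simp only:) qed

lemma C1_on_locally:
 assumes "!!x. x : U ==> EX V. open V & x : V & C1_on V f"
 shows "C1_on U f" unfolding C1_on_def proof (intro conjI ballI)
 show "f differentiable at x" if "x : U" for x using assms[OF that] by (auto simp: C1_on_def)
 fix b :: 'a assume b: "b : Basis"
 show "continuous_on U (pd f b)" proof (rule continuous_at_imp_continuous_on, rule ballI)
  fix x assume "x : U"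
  then obtain V where "open V" "x : V" "C1_on V f" using assms by blast
  thus "isCont (pd f b) x" using b continuous_on_eq_continuous_at unfolding C1_on_def by blast qed qed

text \<open>The mean value property represents \<open>g\<close> locally as a convolution in which
  \<open>x\<close> occurs in the kernel only, so the derivative falls on the bump.\<close>

lemma mean_value_property_imp_C1:
 fixes g :: "'a::euclidean_space => real"
 assumes O: "open Om" and mv: "mean_value_property Om g"
 shows "C1_on Om g" proof (rule C1_on_locally)
 fix x0 assume x0: "x0 : Om"
 let ?N = "real DIM('a)" and ?I = "bump_int TYPE('a)"
 have N: "?N >= 1" using DIM_positive[where 'a='a] by (simp add: Suc_le_eq)
 obtain R where R: "R > 0" "cball x0 R <= Om" using O x0 open_contains_cball by blast
 \<comment> \<open>With \<open>(2 N + 1) r = R\<close>, both the fixed box \<open>B\<close> and all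
   balls of radius \<open>N r\<close> about points of \<open>ball x0 r\<close> lie in
   \<open>cball x0 R\<close>.\<close>
 define r where "r = R / (2 * ?N + 1)"
 have r: "r > 0" unfolding r_def using R N by simp
 have rR: "(2 * ?N + 1) * r = R" unfolding r_def using N by simp
 define B where "B = cbox (x0 - (2 * r) *R One) (x0 + (2 * r) *R One)"
 have BO: "B <= Om" proof
  fix y assume "y : B"
  hence "(y - x0) /R (2 * r) : unit_cube" unfolding B_def using mem_unit_cube_scaled_iff[of "2 * r" y x0] r by simp
  from norm_unit_cube[OF this] have "norm (y - x0) <= ?N * (2 * r)" using r by (simp only: norm_scaleR_inverse[of "2 * r" "y - x0"] pos_divide_le_eq)
  also have "... <= R" unfolding rR[symmetric] using r by (simp add: algebra_simps)
  finally have "y : cball x0 R" by (simp add: dist_norm norm_minus_commute)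
  thus "y : Om" using R by blast qed
 have cg: "continuous_on Om g" using mv by (simp add: mean_value_property_def)
 have cgB: "continuous_on B g" using cg BO by (rule continuous_on_subset)
 define J where "J x = integral B (%y. g y * bump 2 ((y - x) /R r))" for x
 have rep: "g x = (1 / (?I * r ^ DIM('a))) * J x" if x: "x : ball x0 r" for x proof -
  have sub: "cball x (?N * r) <= Om" proof
   fix y assume "y : cball x (?N * r)"
   hence "dist x0 y <= r + ?N * r" using x dist_triangle[of x0 y x] by (simp add: dist_commute)
   also have "... <= R" unfolding rR[symmetric] using r N by (simp add: algebra_simps)
   finally show "y : Om" using R by auto qed
  let ?C = "cbox (x - r *R One) (x + r *R One)"
  have CB: "?C <= B" proof
   fix y assume y: "y : ?C"
   show "y : B" unfolding B_def mem_box proof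
   fix i :: 'a assume i: "i : Basis"
   have "\<bar>(x - x0) *. i\<bar> < r" using Basis_le_norm[OF i, of "x - x0"] x by (simp add: dist_norm norm_minus_commute)
   moreover have "x *. i - r <= y *. i" "y *. i <= x *. i + r" using y i unfolding mem_box by (auto simp: inner_diff_left inner_add_left)
   ultimately show "(x0 - (2 * r) *R One) *. i <= y *. i & y *. i <= (x0 + (2 * r) *R One) *. i" using i by (auto simp: inner_diff_left inner_add_left abs_less_iff) qed qed
  define h where "h y = g y * bump 2 ((y - x) /R r)" for y
  have ch: "continuous_on B h" unfolding h_def by (intro continuous_intros cgB)
  have hC: "h integrable_on ?C" using ch CB by (intro integrable_continuous) (rule continuous_on_subset)
  have "g x * ?I = integral unit_cube (%z. g (x + r *R z) * bump 2 z)" using mv sub r unfolding mean_value_property_def by simp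
  also have "... = integral unit_cube (%z. h (x + r *R z))" using r by (simp add: h_def)
  also have "... = (1 / r ^ DIM('a)) *R integral ?C h" by (rule integral_unique[OF integral_unit_cube_affine[OF r hC]])
  also have "integral ?C h = integral B h" proof -
   have "h y = 0" if "y ~: ?C" for y proof -
   have "(y - x) /R r ~: unit_cube" using that mem_unit_cube_scaled_iff[OF r, of y x] by simp
   have "1 <= norm ((y - x) /R r)" proof (rule ccontr)
   assume "~ 1 <= norm ((y - x) /R r)"
   hence "norm ((y - x) /R r) <= 1" by (rule less_imp_le[OF not_le_imp_less])
   hence "(y - x) /R r : unit_cube" by (rule mem_unit_cube_if_norm_le)
   with \<open>(y - x) /R r ~: unit_cube\<close> show False by (rule notE) qed
   thus ?thesis by (simp add: h_def bump_eq_0) qed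
   hence "(h has_integral integral ?C h) B" by (intro has_integral_on_superset[OF integrable_integral[OF hC] _ CB]) auto
   thus ?thesis by (rule integral_unique[symmetric]) qed
  finally show ?thesis using bump_int_pos[where 'a='a] r unfolding J_def h_def by (simp add: field_simps) qed
 define w where "w x y = (g y * (4 / r * bump 1 ((y - x) /R r))) *R ((y - x) /R r)" for x y
 define G where "G x = (1 / (?I * r ^ DIM('a))) *R integral B (w x)" for x
 have cw: "continuous_on (ball x0 r \<times> B) (%(x, y). w x y)" unfolding w_def case_prod_unfold by (intro continuous_intros continuous_on_compose2[OF cgB]) (use r in auto)
 have cw1: "continuous_on B (w x)" for x unfolding w_def by (intro continuous_intros cgB)
 have dJ: "(J has_derivative (%v. integral B (w x) *. v)) (at x)" if x: "x : ball x0 r" for x proof -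
  have "(J has_derivative blinfun_apply (integral B (%y. blinfun_inner_right (w x y)))) (at x within ball x0 r)" unfolding J_def B_def proof (rule leibniz_rule[where U="ball x0 r"])
   fix x y
   show "((%x. g y * bump 2 ((y - x) /R r)) has_derivative blinfun_apply (blinfun_inner_right (w x y))) (at x within ball x0 r)" proof (rule has_derivative_eq_rhs)
   show "((%x. g y * bump 2 ((y - x) /R r)) has_derivative (%v. g y * (((4 / r * bump 1 ((y - x) /R r)) *R ((y - x) /R r)) *. v))) (at x within ball x0 r)"
   using r by (intro has_derivative_mult_right has_derivative_bump_scaled) simp
   show "(%v. g y * (((4 / r * bump 1 ((y - x) /R r)) *R ((y - x) /R r)) *. v)) = blinfun_apply (blinfun_inner_right (w x y))"
   unfolding w_def blinfun_inner_right.rep_eq inner_scaleR_left by (simp only: mult.assoc) qed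
  next
   fix x
   show "(%y. g y * bump 2 ((y - x) /R r)) integrable_on cbox (x0 - (2 * r) *R One) (x0 + (2 * r) *R One)" using cgB unfolding B_def by (intro integrable_continuous continuous_intros)
  next
   show "continuous_on (ball x0 r \<times> cbox (x0 - (2 * r) *R One) (x0 + (2 * r) *R One)) (%(x, t). blinfun_inner_right (w x t))"
   using bounded_linear.continuous_on[OF bounded_linear_blinfun_inner_right cw] unfolding B_def by (simp add: case_prod_unfold) qed (use x in auto)
  moreover have "integral B (%y. blinfun_inner_right (w x y)) = blinfun_inner_right (integral B (w x))"
   using integral_linear[OF integrable_continuous[OF cw1[unfolded B_def]] bounded_linear_blinfun_inner_right] unfolding B_def by (simp add: o_def)
  ultimately have "(J has_derivative blinfun_apply (blinfun_inner_right (integral B (w x)))) (at x within ball x0 r)" by (simp only:)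
  thus ?thesis by (simp only: blinfun_inner_right.rep_eq at_within_open[OF x open_ball]) qed
 have "C1_on (ball x0 r) g" proof (rule C1_onI)
  fix x assume x: "x : ball x0 r"
  have "((%x. (1 / (?I * r ^ DIM('a))) * J x) has_derivative (%v. (1 / (?I * r ^ DIM('a))) * (integral B (w x) *. v))) (at x)" by (intro has_derivative_mult_right dJ x)
  hence "((%x. (1 / (?I * r ^ DIM('a))) * J x) has_derivative (%v. G x *. v)) (at x)" by (simp add: G_def)
  thus "(g has_derivative (%v. G x *. v)) (at x)" by (rule has_derivative_transform_within_open[OF _ open_ball x]) (simp add: rep)
 next
  show "continuous_on (ball x0 r) G" unfolding G_def using integral_continuous_on_param[OF cw[unfolded B_def]] by (intro continuous_intros) (simp add: B_def) qed
 thus "EX V. open V & x0 : V & C1_on V g" using r by (intro exI[of _ "ball x0 r"]) auto qed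

text \<open>Inheritance by derivatives, which with \<open>mean_value_property_imp_C1\<close>
  bootstraps to higher regularity.\<close>

lemma mean_value_property_pd:
 fixes g :: "'a::euclidean_space => real"
 assumes O: "open Om" and mv: "mean_value_property Om g" and b: "b : Basis"
 shows "mean_value_property Om (pd g b)" unfolding mean_value_property_def proof (intro conjI allI impI)
 let ?N = "real DIM('a)" and ?I = "bump_int TYPE('a)"
 have C1: "C1_on Om g" by (rule mean_value_property_imp_C1[OF O mv])
 show cpd: "continuous_on Om (pd g b)" using C1 b by (simp add: C1_on_def)
 have cg: "continuous_on Om g" using C1_on_continuous[OF C1] .
 fix x r assume r: "0 <= r" and sub: "cball x (?N * r) <= Om"
 obtain e where e: "e > 0" "(UN y:cball x (?N * r). cball y e) <= Om" by (rule compact_subset_open_imp_cball_epsilon_subset[OF compact_cball O sub])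
 have nb: "norm b = 1" using b by simp
 have subt: "cball (x + t *R b) (?N * r) <= Om" if "\<bar>t\<bar> <= e" for t proof
  fix y assume y: "y : cball (x + t *R b) (?N * r)"
  have "y - t *R b : cball x (?N * r)" using y by (simp add: dist_norm algebra_simps)
  moreover have "y : cball (y - t *R b) e" using that nb by (simp add: dist_norm)
  ultimately show "y : Om" using e(2) by blast qed
 have inO: "x + r *R z + t *R b : Om" if "t : {-e..e}" "z : unit_cube" for t z using mem_cball_scaled[OF subt, of t r z] that r by (auto simp: add_ac abs_le_iff)
 define F where "F t = integral unit_cube (%z. g (x + r *R z + t *R b) * bump 2 z)" for t
 have dF: "(F has_field_derivative integral unit_cube (%z. pd g b (x + r *R z + 0 *R b) * bump 2 z)) (at 0 within {-e..e})" unfolding F_def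
 proof (rule leibniz_rule_field_derivative[where U="{-e..e}"])
  fix t and z :: 'a assume "t : {-e..e}" "z : unit_cube"
  hence "((%t. g (x + r *R z + t *R b)) has_field_derivative (grad g (x + r *R z + t *R b) *. b)) (at t within {-e..e})" by (intro has_derivative_inner_D C1_on_has_grad[OF C1] inO)
  thus "((%t. g (x + r *R z + t *R b) * bump 2 z) has_field_derivative pd g b (x + r *R z + t *R b) * bump 2 z) (at t within {-e..e})"
   unfolding grad_inner_Basis[OF b] by (rule DERIV_cmult_right)
 next
  fix t assume "t : {-e..e}"
  thus "(%z. g (x + r *R z + t *R b) * bump 2 z) integrable_on unit_cube" using inO by (intro integrable_continuous continuous_intros continuous_on_compose2[OF cg]) auto
 next
  show "continuous_on ({-e..e} \<times> unit_cube) (%(t, z). pd g b (x + r *R z + t *R b) * bump 2 z)" unfolding case_prod_unfold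
   by (intro continuous_intros continuous_on_compose2[OF cpd]) (use inO in auto) qed (use e in auto)
 have "F t = ?I * g (x + t *R b)" if "t : {-e..e}" for t proof -
  have "integral unit_cube (%z. g (x + t *R b + r *R z) * bump 2 z) = g (x + t *R b) * ?I" using mv r subt[of t] that unfolding mean_value_property_def by (simp add: abs_le_iff)
  thus ?thesis unfolding F_def by (simp add: add_ac mult.commute) qed
 note Feq = this
 have x: "x : Om" using sub r by auto
 have "((%t. g (x + t *R b)) has_field_derivative (grad g (x + 0 *R b) *. b)) (at 0 within {-e..e})" by (intro has_derivative_inner_D C1_on_has_grad[OF C1]) (use x in simp)
 hence "((%t. ?I * g (x + t *R b)) has_field_derivative ?I * pd g b x) (at 0 within {-e..e})" using grad_inner_Basis[OF b, of g x] by (intro DERIV_cmult) simp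
 hence "(F has_field_derivative ?I * pd g b x) (at 0 within {-e..e})" by (rule has_field_derivative_transform_within[where d=1]) (use Feq e in auto)
 moreover have "at 0 within {-e..e} = at (0::real)" using e by (intro at_within_interior) auto
 ultimately have "integral unit_cube (%z. pd g b (x + r *R z + 0 *R b) * bump 2 z) = ?I * pd g b x" using dF by (simp only:) (rule DERIV_unique)
 thus "integral unit_cube (%z. pd g b (x + r *R z) * bump 2 z) = pd g b x * ?I" by (simp add: mult.commute) qed

lemma mean_value_property_imp_C2:
 fixes g :: "'a::euclidean_space => real"
 assumes "open Om" "mean_value_property Om g"
 shows "C2_on Om g" using assms by (auto simp: C2_on_def intro: mean_value_property_imp_C1 mean_value_property_pd)

text \<open>Third derivatives have to be interchanged; each \<open>pd f c\<close> is C2 because it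
  has the mean value property again.\<close>

lemma lap_pd_eq_0:
 fixes f :: "'a::euclidean_space => real"
 assumes O: "open Om" and f: "C2_on Om f" and harm: "!!x. x : Om ==> lap f x = 0"
  and b: "b : Basis" and x: "x : Om"
 shows "lap (pd f b) x = 0" proof -
 have mv: "mean_value_property Om f" by (rule harmonic_mean_value_property[OF O f harm])
 have C2: "C2_on Om (pd f c)" if "c : Basis" for c by (intro mean_value_property_imp_C2[OF O] mean_value_property_pd[OF O mv] that)
 have pdcong: "pd F c x = pd F' c x" if "!!y. y : Om ==> F y = F' y" "C1_on Om F" "c : Basis" for F F' :: "'a => real" and c proof -
  have "(F has_derivative (%v. grad F x *. v)) (at x)" by (rule C1_on_has_grad[OF that(2) x])
  hence "(F' has_derivative (%v. grad F x *. v)) (at x)" by (rule has_derivative_transform_within_open[OF _ O x]) (use that in auto)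
  thus ?thesis using pd_eq_inner grad_inner_Basis[OF that(3), of F x] by metis qed
 have C1: "C1_on Om (pd (pd f c) d)" if "c : Basis" "d : Basis" for c d using C2[OF that(1)] that by (simp add: C2_on_def)
 have "lap (pd f b) x = (SUM c:Basis. pd (pd (pd f c) c) b x)" unfolding lap_def proof (rule sum.cong[OF refl])
  fix c :: 'a assume c: "c : Basis"
  have "pd (pd (pd f b) c) c x = pd (pd (pd f c) b) c x" by (rule pdcong) (use pd_commute[OF f O] b c C1 in auto)
  also have "... = pd (pd (pd f c) c) b x" by (rule pd_commute[OF C2[OF c] O x b c])
  finally show "pd (pd (pd f b) c) c x = pd (pd (pd f c) c) b x" . qed
 also have "... = pd (%y. 0) b x" proof -
  have "((%y. SUM c:Basis. pd (pd f c) c y) has_derivative (%v. SUM c:Basis. grad (pd (pd f c) c) x *. v)) (at x)" by (intro has_derivative_sum C1_on_has_grad[OF C1 x])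
  hence "((%y. 0) has_derivative (%v. SUM c:Basis. grad (pd (pd f c) c) x *. v)) (at x)" by (rule has_derivative_transform_within_open[OF _ O x]) (use harm in "simp add: lap_def")
  moreover have "((%y. 0) has_derivative (%v. 0)) (at x)" by simp
  ultimately have "(%v. SUM c:Basis. grad (pd (pd f c) c) x *. v) = (%v. 0)" by (rule has_derivative_unique)
  hence "(SUM c:Basis. grad (pd (pd f c) c) x *. b) = 0" by meson
  thus ?thesis using b by (simp add: grad_inner_Basis pd_def) qed
 also have "... = 0" by (simp add: pd_def)
 finally show ?thesis . qed

text \<open>Jensen's inequality, obtained by expanding the weighted integral of the square of
  \<open>f (x + r *R z) - f x\<close>; as the weight is at most 1, the unweighted L2 norm bounds the
  result.\<close>

lemma mean_value_square_le:
 fixes f :: "'a::euclidean_space => real"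
 assumes mv: "mean_value_property Om f" and O: "open Om" and r: "r > 0" and sub: "cball x (real DIM('a) * r) <= Om"
  and int: "set_integrable lborel Om (%y. (f y)^2)"
 shows "(f x)^2 <= (LINT y:Om|lborel. (f y)^2) / (bump_int TYPE('a) * r ^ DIM('a))" proof -
 let ?I = "bump_int TYPE('a)"
 have cf: "continuous_on Om f" and m: "integral unit_cube (%z. f (x + r *R z) * bump 2 z) = f x * ?I" using mv sub r by (auto simp: mean_value_property_def)
 have inO: "x + r *R z : Om" if "z : unit_cube" for z using mem_cball_scaled[OF sub _ order_refl that] r by simp
 have cfz: "continuous_on unit_cube (%z. f (x + r *R z))" using inO by (intro continuous_intros continuous_on_compose2[OF cf]) auto
 note I = integrable_continuous
 have "0 <= integral unit_cube (%z. (f (x + r *R z) - f x)^2 * bump 2 z)" by (intro integral_nonneg I continuous_intros cfz) auto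
 also have "... = integral unit_cube (%z. (f (x + r *R z))^2 * bump 2 z - 2 * f x * (f (x + r *R z) * bump 2 z) + (f x)^2 * bump 2 z)"
  by (rule integral_cong) (simp add: power2_eq_square algebra_simps)
 also have "... = integral unit_cube (%z. (f (x + r *R z))^2 * bump 2 z) - 2 * f x * (f x * ?I) + (f x)^2 * ?I"
  by (subst integral_add integral_diff | intro I continuous_intros cfz)+ (simp add: m bump_int_def)
 finally have "(f x)^2 * ?I <= integral unit_cube (%z. (f (x + r *R z))^2 * bump 2 z)" by (simp add: power2_eq_square mult_ac)
 also have "... <= integral unit_cube (%z. (f (x + r *R z))^2)" by (intro integral_le I continuous_intros cfz) (auto intro: mult_left_le bump_le_1)
 also have "... = (1 / r ^ DIM('a)) *R integral (cbox (x - r *R One) (x + r *R One)) (%y. (f y)^2)" proof (rule integral_unique[OF integral_unit_cube_affine[OF r]])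
  show "(%y. (f y)^2) integrable_on cbox (x - r *R One) (x + r *R One)" proof (intro I continuous_intros continuous_on_subset[OF cf] subsetI)
   fix y assume "y : cbox (x - r *R One) (x + r *R One)"
   hence "(y - x) /R r : unit_cube" using mem_unit_cube_scaled_iff[OF r] by blast
   from inO[OF this] show "y : Om" using r by simp qed qed
 also have "integral (cbox (x - r *R One) (x + r *R One)) (%y. (f y)^2) <= (LINT y:Om|lborel. (f y)^2)" proof -
  let ?C = "cbox (x - r *R One) (x + r *R One)"
  have sub: "?C <= Om" proof
   fix y assume "y : ?C"
   hence "(y - x) /R r : unit_cube" using mem_unit_cube_scaled_iff[OF r] by blast
   from inO[OF this] show "y : Om" using r by simp qed
  have si: "set_integrable lborel ?C (%y. (f y)^2)" by (rule set_integrable_subset[OF int]) (use sub in auto)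
  have "integral ?C (%y. (f y)^2) = (LINT y:?C|lborel. (f y)^2)" by (rule set_borel_integral_eq_integral(2)[OF si, symmetric])
  also have "... <= (LINT y:Om|lborel. (f y)^2)" unfolding set_lebesgue_integral_def by (rule integral_mono) (use si int sub in "auto simp: set_integrable_def indicator_def")
  finally show ?thesis . qed
 finally have "(f x)^2 * ?I <= (1 / r ^ DIM('a)) * (LINT y:Om|lborel. (f y)^2)" using r by (simp add: divide_right_mono)
 thus ?thesis using r bump_int_pos[where 'a='a] by (simp add: field_simps) qed

text \<open>The factor 4 comes from the gradient of \<open>bump 2\<close>, the volume from bounding
  an integral over the cube, and the dimension from summing over coordinates.\<close>

definition grad_bound_const :: "'a::euclidean_space itself => real" where
 "grad_bound_const _ = real DIM('a) * (4 * measure lborel (unit_cube :: 'a set)) / bump_int TYPE('a)"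

text \<open>The mean value property of \<open>pd f b\<close> followed by an integration by parts:
  the derivative moves from \<open>f\<close> to the bump at the price of a factor
  \<open>1 / r\<close>.\<close>

lemma harmonic_gradient_bound:
 fixes f :: "'a::euclidean_space => real"
 assumes O: "open Om" and f: "C2_on Om f" and harm: "!!x. x : Om ==> lap f x = 0"
  and r: "r > 0" and sub: "cball x (real DIM('a) * r) <= Om"
  and B: "!!y. y : cball x (real DIM('a) * r) ==> \<bar>f y\<bar> <= B"
 shows "norm (grad f x) <= grad_bound_const TYPE('a) / r * B" proof -
 let ?I = "bump_int TYPE('a)" and ?Q = "unit_cube :: 'a set"
 have I: "?I > 0" by (rule bump_int_pos)
 have C1: "C1_on Om f" by (rule C2_on_C1[OF f])
 have cf: "continuous_on Om f" using C1_on_continuous[OF C1] .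
 have cg: "continuous_on Om (grad f)" by (rule C1_on_continuous_grad[OF C1])
 have inB: "x + r *R z : cball x (real DIM('a) * r)" if "z : ?Q" for z using norm_unit_cube[OF that] r by (simp add: dist_norm mult.commute mult_left_mono)
 hence inO: "x + r *R z : Om" if "z : ?Q" for z using that sub by blast
 have B0: "B >= 0" using B[of x] r by (metis abs_ge_zero centre_in_cball mult_nonneg_nonneg of_nat_0_le_iff order_less_imp_le order_trans)
 have pdb: "\<bar>pd f b x\<bar> <= 4 * measure lborel ?Q / ?I / r * B" if b: "b : Basis" for b proof -
  have mvb: "integral ?Q (%z. pd f b (x + r *R z) * bump 2 z) = pd f b x * ?I" using mean_value_property_pd[OF O harmonic_mean_value_property[OF O f harm] b] r sub
   unfolding mean_value_property_def by simp
  define U where "U = (%z. x + r *R z) -` Om"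
  have U: "open U" unfolding U_def by (intro open_vimage O continuous_intros)
  have KU: "cball 0 1 <= U" unfolding U_def proof
   fix z :: 'a assume "z : cball 0 1"
   hence "z : ?Q" by (intro mem_unit_cube_if_norm_le) simp
   thus "z : (%z. x + r *R z) -` Om" using inO by simp qed
  define V where "V z = (f (x + r *R z) * bump 2 z) *R b" for z
  define V' where "V' z v = (f (x + r *R z) * (((- 4 * bump 1 z) *R z) *. v) + (grad f (x + r *R z) *. (r *R v)) * bump 2 z) *R b" for z v
  have b2: "(bump 2 has_derivative (%v. ((- 4 * bump 1 z) *R z) *. v)) (at z)" for z :: 'a using has_derivative_bump[of 0 z] by (simp add: numeral_2_eq_2)
  have dV: "(V has_derivative V' z) (at z)" if "z : U" for z proof -
   have "((%z. x + r *R z) has_derivative (%v. r *R v)) (at z)" by (auto intro!: derivative_eq_intros)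
   from has_derivative_compose[OF this C1_on_has_grad[OF C1]] that
   have "((%z. f (x + r *R z)) has_derivative (%v. grad f (x + r *R z) *. (r *R v))) (at z)" by (simp add: U_def)
   from has_derivative_scaleR_left[OF has_derivative_mult[OF this b2]] show ?thesis unfolding V_def V'_def . qed
  have cV: "continuous_on U (%z. V' z v)" for v unfolding V'_def U_def by (intro continuous_intros continuous_on_compose2[OF cg] continuous_on_compose2[OF cf]) auto
  have z: "(LINT z:U|lborel. tr (V' z)) = 0" by (rule integral_tr_zero[OF U compact_cball KU dV cV]) (auto simp: V_def bump_eq_0)
  define W where "W z = r * (pd f b (x + r *R z) * bump 2 z) - 4 * (f (x + r *R z) * bump 1 z * (z *. b))" for z
  have trW: "tr (V' z) = W z" for z proof -
   have "tr (V' z) = (SUM c:Basis. if c = b then W z else 0)" unfolding tr_def V'_def W_def using b by (intro sum.cong refl) (auto simp: inner_Basis grad_inner_Basis algebra_simps)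
   thus ?thesis using b by simp qed
  have cpd: "continuous_on Om (pd f b)" using C1 b by (simp add: C1_on_def)
  note ci = continuous_intros continuous_on_compose2[OF cpd] continuous_on_compose2[OF cf]
  have "(LINT z:U|lborel. W z) = integral ?Q W" proof (rule LINT_eq_integral_compact_support)
   show "continuous_on ?Q W" unfolding W_def using inO by (intro ci) auto
   show "W z = 0" if "z ~: ?Q" for z proof -
   have "1 <= norm z" using that mem_unit_cube_if_norm_le[of z] by linarith
   thus ?thesis by (simp add: bump_eq_0 W_def) qed
   show "W z = 0" if "z : ?Q" "z ~: U" for z using that inO by (auto simp: U_def) qed (use U in simp)
  hence "integral ?Q W = 0" using z by (simp add: trW)
  moreover have "integral ?Q W = r * (pd f b x * ?I) - 4 * integral ?Q (%z. f (x + r *R z) * bump 1 z * (z *. b))" proof -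
   have "integral ?Q W = integral ?Q (%z. r * (pd f b (x + r *R z) * bump 2 z)) - integral ?Q (%z. 4 * (f (x + r *R z) * bump 1 z * (z *. b)))"
   unfolding W_def using inO by (intro integral_diff integrable_continuous ci) auto
   thus ?thesis by (simp add: mvb) qed
  ultimately have "r * (pd f b x * ?I) = 4 * integral ?Q (%z. f (x + r *R z) * bump 1 z * (z *. b))" by simp
  moreover have "norm (integral ?Q (%z. f (x + r *R z) * bump 1 z * (z *. b))) <= B * measure lborel ?Q" proof (rule integrable_bound[OF B0])
   show "(%z. f (x + r *R z) * bump 1 z * (z *. b)) integrable_on ?Q" using inO by (intro integrable_continuous ci) auto
   fix z assume zQ: "z : ?Q"
   have "\<bar>z *. b\<bar> <= 1" using zQ b unfolding mem_box by (auto simp: abs_le_iff)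
   hence "\<bar>f (x + r *R z)\<bar> * bump 1 z * \<bar>z *. b\<bar> <= B * 1 * 1" using B[OF inB[OF zQ]] by (intro mult_mono bump_le_1) auto
   thus "norm (f (x + r *R z) * bump 1 z * (z *. b)) <= B" by (simp add: abs_mult) qed
  ultimately have "\<bar>r * (pd f b x * ?I)\<bar> <= 4 * (B * measure lborel ?Q)" by (simp add: abs_mult)
  hence "\<bar>pd f b x\<bar> * (r * ?I) <= 4 * measure lborel ?Q * B" using r I by (simp add: abs_mult mult_ac)
  thus ?thesis using r I by (simp add: field_simps) qed
 have "norm (grad f x) <= (SUM b:Basis. \<bar>grad f x *. b\<bar>)" by (rule norm_le_l1)
 also have "... <= (SUM b:(Basis::'a set). 4 * measure lborel ?Q / ?I / r * B)" proof (rule sum_mono)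
  fix b :: 'a assume "b : Basis"
  thus "\<bar>grad f x *. b\<bar> <= 4 * measure lborel ?Q / ?I / r * B" using pdb[of b] by (simp only: grad_inner_Basis) qed
 also have "... = grad_bound_const TYPE('a) / r * B" by (simp add: grad_bound_const_def)
 finally show ?thesis . qed

section \<open>Maximum principle and comparison outside a ball\<close>

lemma second_derivative_at_max:
 fixes f :: "'a::euclidean_space => real"
 assumes S: "open S" "x : S" and G: "!!y. y : S ==> (f has_derivative (%v. G y *. v)) (at y)"
  and H: "(G has_derivative H) (at x)" and max: "!!y. y : S ==> f y <= f x"
 shows "H v *. v <= 0" proof (rule ccontr)
 assume "~ H v *. v <= 0"
 hence pos: "0 < H v *. v" by simp
 obtain e where e: "e > 0" "ball x e <= S" using S open_contains_ball by blast
 define d0 where "d0 = e / (norm v + 1)"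
 have d0: "d0 > 0" unfolding d0_def using e by (simp add: add_nonneg_pos)
 have inS: "x + t *R v : S" if "\<bar>t\<bar> < d0" for t proof -
  have "\<bar>t\<bar> * norm v <= \<bar>t\<bar> * (norm v + 1)" by (simp add: mult_left_mono)
  also have "... < e" using that unfolding d0_def by (simp add: pos_less_divide_eq add_nonneg_pos)
  finally show ?thesis using e(2) by (auto simp: dist_norm) qed
 define p where "p t = f (x + t *R v)" for t
 define q where "q t = G (x + t *R v) *. v" for t
 have dp: "(p has_field_derivative q t) (at t)" if "\<bar>t\<bar> < d0" for t unfolding p_def q_def by (rule has_derivative_inner_D[OF G[OF inS[OF that]]])
 have dq: "(q has_field_derivative H v *. v) (at 0)" proof -
  have "((%t. x + t *R v) has_derivative (%t. t *R v)) (at 0)" by (auto intro!: derivative_eq_intros)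
  moreover have "(G has_derivative H) (at (x + 0 *R v))" using H by simp
  ultimately have "((%t. G (x + t *R v)) has_derivative (%t. H (t *R v))) (at 0)" by (rule has_derivative_compose)
  hence "(q has_derivative (%t. H (t *R v) *. v)) (at 0)" unfolding q_def by (rule has_derivative_inner_left)
  thus ?thesis unfolding has_field_derivative_def by (rule has_derivative_eq_rhs) (simp add: fun_eq_iff linear_scale[OF has_derivative_linear[OF H]]) qed
 have q0: "q 0 = 0" proof (rule DERIV_local_max[of p _ 0 d0])
  show "ALL y. \<bar>0 - y\<bar> < d0 --> p y <= p 0" using max inS by (auto simp: p_def) qed (use dp[of 0] d0 in auto)
 obtain d where d: "d > 0" "!!h. 0 < h ==> h < d ==> q 0 < q h" using DERIV_pos_inc_right[OF dq pos] by auto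
 define h where "h = min d d0 / 2"
 have h: "0 < h" "h < d" "h < d0" using d d0 by (auto simp: h_def)
 have "EX z. 0 < z & z < h & p h - p 0 = (h - 0) * q z" by (rule MVT2[OF h(1)]) (use dp h in auto)
 then obtain z where "0 < z" "z < h" "p h - p 0 = h * q z" by auto
 hence "p h > p 0" using d(2)[of z] q0 h by (smt (verit) mult_pos_pos)
 thus False using max[OF inS[of h]] h by (simp add: p_def) qed

text \<open>Adding \<open>ep * (y *. y)\<close> makes the Laplacian positive, which excludes
  interior maxima. Gradient and Hessian fields are arguments, so that explicit barriers can be
  inserted directly.\<close>

lemma maximum_principle:
 fixes f :: "'a::euclidean_space => real"
 assumes S: "open S" "bounded S" and cf: "continuous_on (closure S) f"
  and G: "!!y. y : S ==> (f has_derivative (%v. G y *. v)) (at y)"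
  and H: "!!y. y : S ==> (G has_derivative H y) (at y)"
  and lap: "!!y. y : S ==> 0 <= tr (H y)"
  and bd: "!!y. y : frontier S ==> f y <= B" and x: "x : S"
 shows "f x <= B" proof (rule ccontr)
 assume "~ f x <= B"
 hence fx: "f x > B" by simp
 obtain R where R: "R > 0" "closure S <= cball 0 R" proof -
  obtain R where "R > 0" "ALL x:closure S. norm x <= R" using bounded_closure[OF S(2)] bounded_pos by metis
  thus ?thesis by (intro that[of R]) (auto simp: subset_iff) qed
 \<comment> \<open>Small enough that the added term cannot lift the boundary values up to the value
   at \<open>x\<close>.\<close>
 define ep where "ep = (f x - B) / (2 * R^2)"
 have ep: "ep > 0" "ep * R^2 < f x - B" using fx R by (simp_all add: ep_def)
 define g where "g y = f y + ep * (y *. y)" for y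
 have 1: "compact (closure S)" using S by simp
 have 2: "continuous_on (closure S) g" unfolding g_def by (intro continuous_intros cf)
 have 3: "closure S ~= {}" using x by auto
 obtain y0 where y0: "y0 : closure S" "ALL y:closure S. g y <= g y0" using continuous_attains_sup[OF 1 3 2] by metis
 show False proof (cases "y0 : S")
  case True
  have Gg: "(g has_derivative (%v. (G y + (2 * ep) *R y) *. v)) (at y)" if "y : S" for y proof -
   have "((%y. ep * (y *. y)) has_derivative (%v. ep * (y *. v + v *. y))) (at y)" by (intro has_derivative_mult_right has_derivative_inner has_derivative_ident)
   from has_derivative_add[OF G[OF that] this] show ?thesis unfolding g_def by (rule has_derivative_eq_rhs) (simp add: fun_eq_iff inner_add_left inner_commute[of _ y]) qed
  have Hg: "((%y. G y + (2 * ep) *R y) has_derivative (%v. H y0 v + (2 * ep) *R v)) (at y0)" by (intro has_derivative_add H[OF True] derivative_intros)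
  have "(SUM b:Basis. (H y0 b + (2 * ep) *R b) *. b) <= 0" proof (rule sum_nonpos)
   fix b :: 'a
   show "(H y0 b + (2 * ep) *R b) *. b <= 0" by (rule second_derivative_at_max[OF S(1) True Gg Hg]) (use y0 closure_subset in auto) qed
  moreover have "(SUM b:Basis. (H y0 b + (2 * ep) *R b) *. b) = tr (H y0) + 2 * ep * real DIM('a)" by (simp add: inner_add_left sum.distrib tr_def)
  moreover have "2 * ep * real DIM('a) > 0" using ep by simp
  ultimately show False using lap[OF True] by linarith
 next
  case False
  hence fr: "y0 : frontier S" using y0 S by (simp add: frontier_def interior_open)
  have "norm y0 <= R" using y0 R by auto
  hence "y0 *. y0 <= R^2" by (simp add: power2_norm_eq_inner[symmetric] power_mono)
  hence "g y0 <= B + ep * R^2" unfolding g_def using bd[OF fr] ep by (intro add_mono mult_left_mono) auto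
  also have "... < f x" using ep by linarith
  also have "... <= g x" using ep by (simp add: g_def)
  also have "... <= g y0" using y0 x closure_subset by blast
  finally show False by simp qed qed

lemma torsion_nonpos:
 fixes u :: "'a::euclidean_space => real"
 assumes O: "open Om" "bounded Om" and u: "C2_on Om u" "continuous_on (closure Om) u"
  and lap: "!!x. x : Om ==> lap u x = real DIM('a)" and bd: "!!x. x : frontier Om ==> u x = 0"
  and x: "x : closure Om"
 shows "u x <= 0" proof (cases "x : Om")
 case True
 show ?thesis by (rule maximum_principle[OF O u(2) C1_on_has_grad[OF C2_on_C1[OF u(1)]] C2_on_has_hess[OF u(1)] _ _ True]) (use lap bd in "auto simp: lap_eq_tr_hess[symmetric]")
next
 case False
 hence "x : frontier Om" using x O by (simp add: frontier_def interior_open)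
 thus ?thesis using bd by simp qed

text \<open>Comparison with \<open>1 - exp (- a (\<bar>x - c\<bar>^2 - \<rho>^2))\<close>, which is superharmonic outside the ball
 for \<open>a\<close> large.\<close>

lemma exterior_ball_estimate:
 fixes u :: "'a::euclidean_space => real"
 assumes O: "open Om" "bounded Om" and u: "C2_on Om u" "continuous_on (closure Om) u"
  and lap: "!!x. x : Om ==> lap u x = real DIM('a)" and bd: "!!x. x : frontier Om ==> u x = 0"
  and \<rho>: "\<rho> > 0"
 shows "EX K>0. ALL c. ball c \<rho> Int Om = {} --> (ALL x:Om. dist c x <= R) --> (ALL x:closure Om. \<bar>u x\<bar> <= K * ((norm (x - c))^2 - \<rho>^2))" proof -
 let ?N = "real DIM('a)"
 have N: "?N > 0" by simp
 \<comment> \<open>\<open>a\<close> makes \<open>4 a^2 rho^2 - 2 a N\<close> equal to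
   \<open>2 N^2 / rho^2\<close>, hence positive; \<open>K\<close> below then makes the Laplacian of
   \<open>K * E y\<close> at least \<open>N\<close> on the domain. Neither constant depends on the
   centre \<open>c\<close>.\<close>
 define a where "a = ?N / \<rho>^2"
 have a: "a > 0" using \<rho> by (simp add: a_def)
 define K where "K = \<rho>^2 * exp (a * R^2) / (2 * ?N)"
 have K: "K > 0" using \<rho> by (simp add: K_def)
 show ?thesis proof (intro exI[of _ "K * a"] conjI allI impI ballI)
  show "K * a > 0" using K a by simp
  fix c x assume c: "ball c \<rho> Int Om = {}" and R: "ALL x:Om. dist c x <= R" and x: "x : closure Om"
  have far: "\<rho>^2 <= (y - c) *. (y - c)" if "y : closure Om" for y proof -
   have "closure Om <= - ball c \<rho>" using c by (intro closure_minimal) auto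
   hence "\<rho> <= norm (y - c)" using that by (auto simp: dist_norm norm_minus_commute)
   thus ?thesis using \<rho> by (simp add: power2_norm_eq_inner[symmetric] power_mono) qed
  define E where "E y = exp (- a * ((y - c) *. (y - c) - \<rho>^2))" for y
  define f where "f y = - u y - K * (1 - E y)" for y
  define G where "G y = - grad u y - (K * (2 * a * E y)) *R (y - c)" for y
  define H where "H y v = - hess u y v - ((K * (2 * a * E y)) *R v - (K * (4 * a^2 * E y) * ((y - c) *. v)) *R (y - c))" for y v
  have dE: "(E has_derivative (%v. - (2 * a * E y) * ((y - c) *. v))) (at y)" for y proof -
   have 1: "((%y. y - c) has_derivative (%v. v)) (at y)" by (auto intro!: derivative_eq_intros)
   have "((%y. - a * ((y - c) *. (y - c) - \<rho>^2)) has_derivative (%v. - a * ((y - c) *. v + v *. (y - c) - 0))) (at y)"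
   by (intro has_derivative_mult_right has_derivative_diff has_derivative_inner 1 has_derivative_const)
   also have "(%v. - a * ((y - c) *. v + v *. (y - c) - 0)) = (%v. - (2 * a) * ((y - c) *. v))" proof
   fix v show "- a * ((y - c) *. v + v *. (y - c) - 0) = - (2 * a) * ((y - c) *. v)" unfolding inner_commute[of v] by (simp only: diff_0_right mult_2[symmetric]) qed
   finally have 2: "((%y. - a * ((y - c) *. (y - c) - \<rho>^2)) has_derivative (%v. - (2 * a) * ((y - c) *. v))) (at y)" .
   from has_derivative_exp[OF 2] show ?thesis unfolding E_def by (rule has_derivative_eq_rhs) (simp only: mult_ac minus_mult_left[symmetric] mult_minus_left mult_minus_right) qed
  have G: "(f has_derivative (%v. G y *. v)) (at y)" if "y : Om" for y unfolding f_def by (rule has_derivative_eq_rhs, rule has_derivative_diff, rule has_derivative_minus,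
   rule C1_on_has_grad[OF C2_on_C1[OF u(1)] that], rule has_derivative_mult_right, rule has_derivative_diff, rule has_derivative_const, rule dE)
   (simp add: fun_eq_iff G_def inner_diff_left algebra_simps)
  have H: "(G has_derivative H y) (at y)" if "y : Om" for y unfolding G_def by (rule has_derivative_eq_rhs, rule has_derivative_diff, rule has_derivative_minus,
   rule C2_on_has_hess[OF u(1) that], rule has_derivative_scaleR, (rule has_derivative_mult_right, rule has_derivative_mult_right, rule dE),
   rule has_derivative_diff, rule has_derivative_ident, rule has_derivative_const) (simp add: fun_eq_iff H_def algebra_simps power2_eq_square)
  have "f x <= 0" proof (cases "x : Om")
   case True
   show ?thesis proof (rule maximum_principle[OF O _ G H _ _ True])
   show "continuous_on (closure Om) f" unfolding f_def E_def by (intro continuous_intros u(2))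
   show "f y <= 0" if "y : frontier Om" for y proof -
   have "y : closure Om" using that by (simp add: frontier_def)
   hence "E y <= 1" using far[of y] a unfolding E_def by (simp add: mult_nonneg_nonneg)
   thus ?thesis using bd[OF that] K unfolding f_def by simp qed
   fix y assume y: "y : Om"
   have fy: "\<rho>^2 <= (y - c) *. (y - c)" using far[of y] y closure_subset by blast
   have Ry: "(y - c) *. (y - c) <= R^2" proof -
   have "norm (y - c) <= R" using R y by (metis dist_commute dist_norm)
   thus ?thesis by (simp add: power2_norm_eq_inner[symmetric] power_mono) qed
   have trH: "tr (H y) = - ?N - K * (2 * a * E y) * ?N + K * (4 * a^2 * E y) * ((y - c) *. (y - c))" proof -
   have "tr (H y) = (SUM b:Basis. - (hess u y b *. b)) + (SUM b:(Basis::'a set). - (K * (2 * a * E y)) * (b *. b)) + (SUM b:(Basis::'a set). K * (4 * a^2 * E y) * (((y - c) *. b) * ((y - c) *. b)))"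
   unfolding tr_def H_def sum.distrib[symmetric] by (intro sum.cong refl) (simp add: inner_diff_left inner_add_left algebra_simps)
   also have "(SUM b:Basis. - (hess u y b *. b)) = - ?N" using lap[OF y] by (simp add: sum_negf lap_eq_tr_hess tr_def)
   also have "(SUM b:(Basis::'a set). K * (4 * a^2 * E y) * (((y - c) *. b) * ((y - c) *. b))) = K * (4 * a^2 * E y) * ((y - c) *. (y - c))"
   by (subst euclidean_inner[of "y - c"]) (simp add: sum_distrib_left)
   finally show ?thesis by simp qed
   have "?N <= K * E y * (2 * ?N^2 / \<rho>^2)" proof -
   have "a * ((y - c) *. (y - c) - \<rho>^2) <= a * R^2" using Ry a zero_le_power2[of \<rho>] by (intro mult_left_mono) linarith+
   hence "exp (- a * R^2) <= E y" unfolding E_def by simp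
   hence "K * exp (- a * R^2) * (2 * ?N^2 / \<rho>^2) <= K * E y * (2 * ?N^2 / \<rho>^2)" using K by (intro mult_right_mono mult_left_mono) auto
   moreover have "K * exp (- a * R^2) * (2 * ?N^2 / \<rho>^2) = ?N" unfolding K_def using \<rho> N by (simp add: exp_minus field_simps power2_eq_square)
   ultimately show ?thesis by simp qed
   also have "... = K * E y * (4 * a^2 * \<rho>^2 - 2 * a * ?N)" unfolding a_def using \<rho> by (simp add: field_simps power2_eq_square)
   also have "... <= K * E y * (4 * a^2 * ((y - c) *. (y - c)) - 2 * a * ?N)" proof -
   have "4 * a^2 * \<rho>^2 <= 4 * a^2 * ((y - c) *. (y - c))" using fy by (intro mult_left_mono) auto
   moreover have "0 <= K * E y" using K by (simp add: E_def)
   ultimately show ?thesis by (intro mult_left_mono) linarith+ qed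
   finally show "0 <= tr (H y)" unfolding trH by (simp add: algebra_simps) qed
  next
   case False
   hence fr: "x : frontier Om" using x O by (simp add: frontier_def interior_open)
   have "E x <= 1" using far[OF x] a unfolding E_def by (simp add: mult_nonneg_nonneg)
   thus ?thesis using bd[OF fr] K unfolding f_def by simp qed
  hence "- u x <= K * (1 - E x)" by (simp add: f_def)
  also have "... <= K * (a * ((x - c) *. (x - c) - \<rho>^2))" using exp_ge_add_one_self[of "- a * ((x - c) *. (x - c) - \<rho>^2)"] K unfolding E_def by (intro mult_left_mono) linarith+
  finally have "- u x <= K * a * ((norm (x - c))^2 - \<rho>^2)" by (simp add: power2_norm_eq_inner)
  thus "\<bar>u x\<bar> <= K * a * ((norm (x - c))^2 - \<rho>^2)" using torsion_nonpos[OF O u lap bd x] by linarith qed qed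

section \<open>From local defining functions to a global one\<close>

lemma pd_cong:
 assumes V: "open V" "x : V" and eq: "!!y. y : V ==> f y = g y" and f: "f differentiable (at x)"
 shows "pd g b x = pd f b x" proof -
 have "(f has_derivative (%v. grad f x *. v)) (at x)" by (rule differentiable_has_grad[OF f])
 hence "(g has_derivative (%v. grad f x *. v)) (at x)" by (rule has_derivative_transform_within_open[OF _ V]) (rule eq)
 from pd_eq_inner[OF this] pd_eq_inner[OF differentiable_has_grad[OF f]] show ?thesis by simp qed

lemma C1_on_cong:
 assumes V: "open V" and eq: "!!y. y : V ==> f y = g y" and f: "C1_on V f"
 shows "C1_on V g" proof (rule C1_onI)
 show "(g has_derivative (%v. grad f x *. v)) (at x)" if "x : V" for x by (rule has_derivative_transform_within_open[OF C1_on_has_grad[OF f that] V that]) (rule eq)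
qed (rule C1_on_continuous_grad[OF f])

lemma C2_on_cong:
 assumes V: "open V" and eq: "!!y. y : V ==> f y = g y" and f: "C2_on V f"
 shows "C2_on V g" unfolding C2_on_def proof (intro conjI ballI)
 show "C1_on V g" by (rule C1_on_cong[OF V eq C2_on_C1[OF f]])
 fix b :: 'a assume b: "b : Basis"
 have "pd f b y = pd g b y" if "y : V" for y by (rule pd_cong[OF V that eq, symmetric]) (use C2_on_C1[OF f] that in "auto simp: C1_on_def")
 thus "C1_on V (pd g b)" by (rule C1_on_cong[OF V]) (use f b in "auto simp: C2_on_def") qed

lemma C2_on_locally:
 assumes "!!x. x : U ==> EX V. open V & x : V & C2_on V f"
 shows "C2_on U f" unfolding C2_on_def proof (intro conjI ballI)
 show "C1_on U f" by (rule C1_on_locally) (use assms C2_on_C1 in blast)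
 show "C1_on U (pd f b)" if "b : Basis" for b using assms that unfolding C2_on_def by (intro C1_on_locally) meson qed

lemma C1_on_add:
 assumes f: "C1_on U f" and g: "C1_on U g"
 shows "C1_on U (%x. f x + g x)" proof (rule C1_onI)
 show "((%x. f x + g x) has_derivative (%v. (grad f x + grad g x) *. v)) (at x)" if "x : U" for x
  using has_derivative_add[OF C1_on_has_grad[OF f that] C1_on_has_grad[OF g that]] by (simp add: inner_add_left) qed (intro continuous_intros C1_on_continuous_grad f g)

lemma C1_on_mult:
 assumes f: "C1_on U f" and g: "C1_on U g"
 shows "C1_on U (%x. f x * g x)" proof (rule C1_onI)
 show "((%x. f x * g x) has_derivative (%v. (f x *R grad g x + g x *R grad f x) *. v)) (at x)" if "x : U" for x
  using has_derivative_mult[OF C1_on_has_grad[OF f that] C1_on_has_grad[OF g that]] by (simp add: inner_add_left mult.commute)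
qed (intro continuous_intros C1_on_continuous_grad C1_on_continuous f g)

lemma pd_add:
 assumes f: "C1_on U f" and g: "C1_on U g" and x: "x : U"
 shows "pd (%x. f x + g x) b x = pd f b x + pd g b x" proof -
 have "((%x. f x + g x) has_derivative (%v. (grad f x + grad g x) *. v)) (at x)" using has_derivative_add[OF C1_on_has_grad[OF f x] C1_on_has_grad[OF g x]] by (simp add: inner_add_left)
 from pd_eq_inner[OF this] show ?thesis using pd_eq_inner[OF C1_on_has_grad[OF f x]] pd_eq_inner[OF C1_on_has_grad[OF g x]] by (simp add: inner_add_left) qed

lemma pd_mult:
 assumes f: "C1_on U f" and g: "C1_on U g" and x: "x : U"
 shows "pd (%x. f x * g x) b x = f x * pd g b x + g x * pd f b x" proof -
 have "((%x. f x * g x) has_derivative (%v. (f x *R grad g x + g x *R grad f x) *. v)) (at x)"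
  using has_derivative_mult[OF C1_on_has_grad[OF f x] C1_on_has_grad[OF g x]] by (simp add: inner_add_left mult.commute)
 from pd_eq_inner[OF this] show ?thesis using pd_eq_inner[OF C1_on_has_grad[OF f x]] pd_eq_inner[OF C1_on_has_grad[OF g x]] by (simp add: inner_add_left) qed

lemma C2_on_add:
 assumes U: "open U" and f: "C2_on U f" and g: "C2_on U g"
 shows "C2_on U (%x. f x + g x)" unfolding C2_on_def proof (intro conjI ballI)
 note C = C2_on_C1[OF f] C2_on_C1[OF g]
 show "C1_on U (%x. f x + g x)" by (intro C1_on_add C)
 fix b :: 'a assume b: "b : Basis"
 have "C1_on U (%x. pd f b x + pd g b x)" using f g b by (intro C1_on_add) (auto simp: C2_on_def)
 thus "C1_on U (pd (%x. f x + g x) b)" by (rule C1_on_cong[OF U, rotated]) (simp add: pd_add[OF C]) qed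

lemma C2_on_mult:
 assumes U: "open U" and f: "C2_on U f" and g: "C2_on U g"
 shows "C2_on U (%x. f x * g x)" unfolding C2_on_def proof (intro conjI ballI)
 note C = C2_on_C1[OF f] C2_on_C1[OF g]
 show "C1_on U (%x. f x * g x)" by (intro C1_on_mult C)
 fix b :: 'a assume b: "b : Basis"
 have "C1_on U (%x. f x * pd g b x + g x * pd f b x)" using f g b C by (intro C1_on_add C1_on_mult) (auto simp: C2_on_def)
 thus "C1_on U (pd (%x. f x * g x) b)" by (rule C1_on_cong[OF U, rotated]) (simp add: pd_mult[OF C]) qed

lemma C2_on_const: "open U ==> C2_on U (%_. c)" by (rule C2_onI[where G="%_. 0" and H="%_ _. 0"]) auto

lemma C2_on_sum:
 assumes U: "open U" and "finite I" "!!i. i : I ==> C2_on U (f i)"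
 shows "C2_on U (%x. SUM i:I. f i x)" using assms(2,3) by (induction I rule: finite_induct) (auto intro: C2_on_add[OF U] C2_on_const[OF U])

lemma C2_on_bump_scaled:
 fixes p :: "'a::euclidean_space"
 shows "C2_on UNIV (%x. bump 3 (c *R (x - p)))" proof (rule C2_onI)
 have lin: "((%x. c *R (x - p)) has_derivative (%v. c *R v)) (at x)" for x by (auto intro!: derivative_eq_intros)
 have b3: "(bump 3 has_derivative (%v. ((- 6 * bump 2 z) *R z) *. v)) (at z)" for z :: 'a using has_derivative_bump[of 1 z] by (simp add: numeral_eq_Suc)
 have b2: "(bump 2 has_derivative (%v. ((- 4 * bump 1 z) *R z) *. v)) (at z)" for z :: 'a using has_derivative_bump[of 0 z] by (simp add: numeral_2_eq_2)
 let ?z = "%x. c *R (x - p)"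
 show "((%x. bump 3 (?z x)) has_derivative (%v. ((- 6 * c * bump 2 (?z x)) *R ?z x) *. v)) (at x)" for x
  using has_derivative_compose[OF lin b3] by (rule has_derivative_eq_rhs) (simp add: fun_eq_iff)
 show "((%x. (- 6 * c * bump 2 (?z x)) *R ?z x) has_derivative (%v. (- 6 * c * bump 2 (?z x)) *R (c *R v) + (- 6 * c * (((- 4 * bump 1 (?z x)) *R ?z x) *. (c *R v))) *R ?z x)) (at x)" for x
  by (intro has_derivative_scaleR has_derivative_mult_right has_derivative_compose[OF lin b2] lin)
 show "continuous_on UNIV (%x. (- 6 * c * bump 2 (?z x)) *R (c *R v) + (- 6 * c * (((- 4 * bump 1 (?z x)) *R ?z x) *. (c *R v))) *R ?z x)" for v by (intro continuous_intros) qed simp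

definition localize :: "'a::euclidean_space => real => ('a => real) => 'a => real" where
 "localize p r f x = (if x : ball p r then bump 3 ((2 / r) *R (x - p)) * f x else 0)"

lemma localize_eq_0:
 assumes "r > 0" "r / 2 <= dist p x"
 shows "localize p r f x = 0" proof -
 have "1 <= (2 / r) * norm (x - p)" using assms by (simp add: dist_norm norm_minus_commute field_simps)
 hence "bump 3 ((2 / r) *R (x - p)) = 0" using assms by (intro bump_eq_0) auto
 thus ?thesis by (simp add: localize_def) qed

text \<open>The bump already vanishes from radius \<open>r / 2\<close> on, so the extension by zero
  is C2 on two overlapping open sets; the power 3 supplies two continuous derivatives.\<close>

lemma C2_on_localize:
 assumes r: "r > 0" and f: "C2_on (ball p r) f"
 shows "C2_on UNIV (localize p r f)" proof (rule C2_on_locally)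
 fix x :: 'a
 show "EX V. open V & x : V & C2_on V (localize p r f)" proof (cases "x : ball p r")
  case True
  have "C2_on (ball p r) (%x. bump 3 ((2 / r) *R (x - p)) * f x)" by (intro C2_on_mult f C2_on_subset[OF C2_on_bump_scaled]) auto
  hence "C2_on (ball p r) (localize p r f)" by (rule C2_on_cong[OF open_ball, rotated]) (simp add: localize_def)
  with True show ?thesis by blast
 next
  case False
  have "open (- cball p (r / 2))" by (simp add: open_Compl)
  moreover have "C2_on (- cball p (r / 2)) (localize p r f)" proof (rule C2_on_cong[OF _ _ C2_on_const[of _ 0]])
   show "0 = localize p r f y" if "y : - cball p (r / 2)" for y using localize_eq_0[OF r, of p y f] that by (simp add: not_le) qed (simp_all add: open_Compl)
  ultimately show ?thesis using False r by (intro exI[of _ "- cball p (r / 2)"]) auto qed qed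

lemma negative_direction:
 fixes f :: "'a::euclidean_space => real"
 assumes "(f has_derivative (%v. a *. v)) (at x)" "f x = 0" "a *. v < 0"
 shows "EX d>0. ALL t. 0 < t --> t < d --> f (x + t *R v) < 0" proof -
 have "((%t. f (x + t *R v)) has_field_derivative (a *. v)) (at 0)" by (rule has_derivative_inner_D) (use assms in simp)
 from DERIV_neg_dec_right[OF this assms(3)] assms(2) show ?thesis by auto qed

lemma parallel_if_half_space_subset:
 fixes a b :: "'a::real_inner"
 assumes a: "a ~= 0" and sub: "!!v. a *. v < 0 ==> b *. v <= 0"
 shows "EX c>=0. b = c *R a" proof -
 define c where "c = (b *. a) / (a *. a)"
 define w where "w = b - c *R a"
 have aa: "a *. a > 0" using a by simp
 have wa: "w *. a = 0" unfolding w_def c_def using aa by (simp add: inner_diff_left)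
 have "w = 0" proof (rule ccontr)
  assume "w ~= 0"
  hence ww: "w *. w > 0" by simp
  \<comment> \<open>Chosen so that \<open>s *R w - a\<close> lies in the half space while its
    product with \<open>b\<close> is 1.\<close>
  define s where "s = (c * (a *. a) + 1) / (w *. w)"
  have "a *. (s *R w - a) < 0" using wa aa by (simp add: inner_diff_right inner_commute)
  hence "b *. (s *R w - a) <= 0" by (rule sub)
  moreover have "b *. (s *R w - a) = 1" proof -
   have b: "b = c *R a + w" by (simp add: w_def)
   have "b *. (s *R w - a) = s * (w *. w) - c * (a *. a)" unfolding b using wa by (simp add: inner_diff_right inner_diff_left inner_add_left inner_add_right inner_commute)
   thus ?thesis using ww by (simp add: s_def) qed
  ultimately show False by simp qed
 moreover have "0 <= c" proof -
  have "b *. (- a) <= 0" using aa by (intro sub) simp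
  thus ?thesis unfolding c_def using aa by simp qed
 ultimately show ?thesis by (auto simp: w_def) qed

text \<open>A direction in which \<open>f\<close> decreases cannot be one in which \<open>g\<close>
  increases, so the half space criterion applies to the two gradients.\<close>

lemma grad_parallel:
 fixes f g :: "'a::euclidean_space => real"
 assumes f: "(f has_derivative (%v. a *. v)) (at x)" "f x = 0" and g: "(g has_derivative (%v. b *. v)) (at x)" "g x = 0"
  and a: "a ~= 0" and d: "d > 0" and neg: "!!y. dist x y < d ==> f y < 0 ==> g y < 0"
 shows "EX c>=0. b = c *R a" proof (rule parallel_if_half_space_subset[OF a])
 fix v assume av: "a *. v < 0"
 show "b *. v <= 0" proof (rule ccontr)
  assume "~ b *. v <= 0"
  hence "((- b) *. v) < 0" by simp
  moreover have "((%x. - g x) has_derivative (%v. (- b) *. v)) (at x)" using has_derivative_minus[OF g(1)] by simp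
  ultimately obtain d1 where d1: "d1 > 0" "!!t. 0 < t ==> t < d1 ==> - g (x + t *R v) < 0" using negative_direction[of "%x. - g x" "- b" x v] g(2) by auto
  obtain d2 where d2: "d2 > 0" "!!t. 0 < t ==> t < d2 ==> f (x + t *R v) < 0" using negative_direction[OF f av] by auto
  define t where "t = min (min d1 d2) (d / (norm v + 1)) / 2"
  have nv: "norm v + 1 > 0" by (simp add: add_nonneg_pos)
  define m where "m = min (min d1 d2) (d / (norm v + 1))"
  have "m > 0" "m <= d1" "m <= d2" "m <= d / (norm v + 1)" unfolding m_def using d1 d2 d nv by auto
  moreover have "t = m / 2" by (simp add: t_def m_def)
  ultimately have "t > 0" "t < d1" "t < d2" "t < d / (norm v + 1)" by linarith+
  moreover have "t * norm v < d" proof -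
   have "t * norm v <= t * (norm v + 1)" using \<open>t > 0\<close> by simp
   also have "... < d" using \<open>t < d / (norm v + 1)\<close> nv by (simp add: pos_less_divide_eq)
   finally show ?thesis . qed
  ultimately have "g (x + t *R v) < 0" "g (x + t *R v) > 0" using neg[of "x + t *R v"] d1(2)[of t] d2(2)[of t] by (auto simp: dist_norm)
  thus False by simp qed qed

text \<open>\<open>local_defn\<close> prescribes only where its function is negative. Vanishing on
  the frontier follows by continuity: a positive value would keep a neighbourhood free of
  \<open>Om\<close>.\<close>

lemma boundary_value_zero:
 fixes f :: "'a::euclidean_space => real"
 assumes O: "open Om" and x: "x : frontier Om" and B: "open B" "x : B" "continuous_on B f"
  and eq: "Om Int B = {y\<in>B. f y < 0}"
 shows "f x = 0" proof -
 have "x ~: Om" using x O by (simp add: frontier_def interior_open)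
 hence "~ f x < 0" using eq B(2) by blast
 hence "f x >= 0" by simp
 moreover have "f x <= 0" proof (rule ccontr)
  assume "~ f x <= 0"
  hence "x : f -` {0<..} Int B" using B by simp
  moreover have op: "open (f -` {0<..} Int B)" using B(3) continuous_on_open_vimage[OF B(1), of f] open_greaterThan[of "0::real"] by blast
  moreover have "x : closure Om" using x by (simp add: frontier_def)
  ultimately have "(f -` {0<..} Int B) Int Om ~= {}" using open_Int_closure_eq_empty[OF op, of Om] by blast
  then obtain y where "y : Om" "y : B" "f y > 0" by auto
  moreover from this have "f y < 0" using eq by blast
  ultimately show False by simp qed
 ultimately show ?thesis by simp qed

lemma zero_in_frontier:
 fixes f :: "'a::euclidean_space => real"
 assumes O: "open Om" and B: "open B" "x : B" and f: "(f has_derivative (%v. a *. v)) (at x)" "a ~= 0" "f x = 0"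
  and eq: "Om Int B = {y\<in>B. f y < 0}"
 shows "x : frontier Om" proof -
 have "x : Om ==> f x < 0" using eq B(2) by blast
 hence "x ~: Om" using f(3) by auto
 moreover have "x : closure Om" unfolding closure_approachable proof (intro allI impI)
  fix e :: real assume e: "0 < e"
  have "a *. (- a) < 0" using f(2) by simp
  from negative_direction[OF f(1,3) this] obtain d where d: "d > 0" "!!t. 0 < t ==> t < d ==> f (x + t *R (- a)) < 0" by blast
  obtain e' where e': "e' > 0" "ball x e' <= B" using B open_contains_ball by blast
  have na: "norm a > 0" using f(2) by simp
  define t where "t = min d (min e e' / norm a) / 2"
  have t: "t > 0" "t < d" "t < min e e' / norm a" proof -
   define m where "m = min d (min e e' / norm a)"
   have "m > 0" "m <= d" "m <= min e e' / norm a" unfolding m_def using d e e' na by auto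
   moreover have "t = m / 2" by (simp add: t_def m_def)
   ultimately show "t > 0" "t < d" "t < min e e' / norm a" by linarith+ qed
  have tn: "t * norm a < min e e'" using t(3) na by (simp add: pos_less_divide_eq)
  have "x + t *R (- a) : B" using e'(2) tn t(1) by (auto simp: dist_norm)
  hence "x + t *R (- a) : Om" using d(2)[OF t(1,2)] eq by blast
  moreover have "dist (x + t *R (- a)) x < e" using tn t(1) by (simp add: dist_norm)
  ultimately show "EX y:Om. dist y x < e" by blast qed
 ultimately show ?thesis using O by (simp add: frontier_def interior_open) qed

text \<open>All localized summands are nonpositive in \<open>Om\<close> and nonnegative outside, so
  their sum has the right sign. At a frontier point the local functions vanish and their gradients
  are nonnegative multiples of one nonzero vector, at least one summand contributing a positive
  multiple; so the gradients cannot cancel.\<close>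

lemma global_defining_function:
 fixes Om :: "'a::euclidean_space set"
 assumes O: "open Om" "bounded Om" and loc: "!!p. p : frontier Om ==> EX r \<phi>. local_defn Om p r \<phi>"
 shows "EX Ph R. C2_on UNIV Ph & (ALL x. x ~: cball 0 R --> Ph x = 0) & Om = {x. Ph x < 0} & (ALL x:frontier Om. Ph x = 0 & grad Ph x ~= 0)" proof -
 have "EX r \<phi>. r > 0 & C2_on (ball p r) \<phi> & Om Int ball p r = {x\<in>ball p r. \<phi> x < 0} & (ALL x:ball p r Int frontier Om. grad \<phi> x ~= 0)" if "p : closure Om" for p
 proof (cases "p : Om")
  case True
  then obtain r where r: "r > 0" "ball p r <= Om" using O(1) open_contains_ball by blast
  hence "ball p r Int frontier Om = {}" using O(1) by (auto simp: frontier_def interior_open)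
  \<comment> \<open>At interior points the constant \<open>-1\<close> serves as local
    function.\<close>
  with r show ?thesis by (intro exI[of _ r] exI[of _ "%_. -1"]) (auto intro: C2_on_const)
 next
  case False
  hence "p : frontier Om" using that O by (simp add: frontier_def interior_open)
  then obtain r \<phi> where "local_defn Om p r \<phi>" using loc by blast
  thus ?thesis unfolding local_defn_def by (intro exI[of _ r] exI[of _ \<phi>]) simp qed
 hence "ALL p. EX r \<phi>. p : closure Om --> r > 0 & C2_on (ball p r) \<phi> & Om Int ball p r = {x\<in>ball p r. \<phi> x < 0} &
   (ALL x:ball p r Int frontier Om. grad \<phi> x ~= 0)" by blast
 from this[unfolded choice_iff] obtain r \<phi> where rr: "ALL p. p : closure Om --> r p > 0 & C2_on (ball p (r p)) (\<phi> p) &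
   Om Int ball p (r p) = {x\<in>ball p (r p). \<phi> p x < 0} & (ALL x:ball p (r p) Int frontier Om. grad (\<phi> p) x ~= 0)" by blast
 hence r\<phi>: "!!p. p : closure Om ==> r p > 0" "!!p. p : closure Om ==> C2_on (ball p (r p)) (\<phi> p)"
  "!!p. p : closure Om ==> Om Int ball p (r p) = {x\<in>ball p (r p). \<phi> p x < 0}"
  "!!p x. p : closure Om ==> x : ball p (r p) ==> x : frontier Om ==> grad (\<phi> p) x ~= 0" by blast+
 have "compact (closure Om)" using O by simp
 moreover have "!!p. p : closure Om ==> open (ball p (r p / 2))" by simp
 moreover have "closure Om <= (UN p:closure Om. ball p (r p / 2))" using r\<phi>(1) by auto
 ultimately obtain C where C: "C <= closure Om" "finite C" "closure Om <= (UN p:C. ball p (r p / 2))" by (rule compactE_image)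
 define \<psi> where "\<psi> p = localize p (r p) (\<phi> p)" for p
 define Ph where "Ph x = (SUM p:C. \<psi> p x)" for x
 have C2: "C2_on UNIV (\<psi> p)" if "p : C" for p unfolding \<psi>_def using that C r\<phi> by (intro C2_on_localize) auto
 have C2Ph: "C2_on UNIV Ph" unfolding Ph_def by (intro C2_on_sum C C2) auto
 have mem: "x : Om \<longleftrightarrow> \<phi> p x < 0" if "p : C" "x : ball p (r p)" for p x using r\<phi>(3)[of p] C(1) that by blast
 have neg: "\<psi> p x <= 0" if "p : C" "x : Om" for p x proof (cases "x : ball p (r p)")
  case True
  hence "\<phi> p x < 0" using mem that by blast
  thus ?thesis unfolding \<psi>_def localize_def by (auto intro: mult_nonneg_nonpos) qed (simp add: \<psi>_def localize_def)
 have pos: "\<psi> p x >= 0" if "p : C" "x ~: Om" for p x proof (cases "x : ball p (r p)")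
  case True
  hence "~ \<phi> p x < 0" using mem that by blast
  thus ?thesis unfolding \<psi>_def localize_def by auto qed (simp add: \<psi>_def localize_def)
 have bpos: "0 < bump 3 ((2 / r p) *R (x - p))" if "p : C" "x : ball p (r p / 2)" for p x proof (rule bump_pos)
  have "r p > 0" using that C r\<phi> by auto
  moreover have "norm (x - p) < r p / 2" using that by (simp add: dist_norm norm_minus_commute)
  ultimately show "norm ((2 / r p) *R (x - p)) < 1" unfolding norm_scaleR by (simp add: field_simps) qed
 have in_ball: "x : ball p (r p)" if "p : C" "x : ball p (r p / 2)" for p x using that C r\<phi>(1)[of p] by auto
 have Oeq: "Om = {x. Ph x < 0}" proof (intro set_eqI iffI)
  fix x assume x: "x : Om"
  then obtain p where p: "p : C" "x : ball p (r p / 2)" using C closure_subset by blast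
  have "\<phi> p x < 0" using mem[OF p(1) in_ball[OF p]] x by blast
  hence "\<psi> p x < 0" unfolding \<psi>_def localize_def using in_ball[OF p] bpos[OF p] by (auto intro: mult_pos_neg)
  hence "Ph x < 0" unfolding Ph_def using neg[OF _ x] C p by (metis (no_types, lifting) sum.remove add_less_le_mono add_0 sum_nonpos Diff_iff)
  thus "x : {x. Ph x < 0}" by simp
 next
  fix x assume "x : {x. Ph x < 0}"
  hence "Ph x < 0" by simp
  thus "x : Om" unfolding Ph_def using pos sum_nonneg[of C "%p. \<psi> p x"] by (metis not_le) qed
 have contPh: "continuous_on UNIV Ph" using C1_on_continuous[OF C2_on_C1[OF C2Ph]] .
 have bd: "Ph x = 0 & grad Ph x ~= 0" if x: "x : frontier Om" for x proof
  show "Ph x = 0" by (rule boundary_value_zero[OF O(1) x open_UNIV _ contPh]) (use Oeq in auto)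
  have xc: "x : closure Om" using x by (simp add: frontier_def)
  then obtain q where q: "q : C" "x : ball q (r q / 2)" using C by blast
  have qx: "x : ball q (r q)" using in_ball[OF q] .
  have val0: "\<phi> p x = 0" if "p : C" "x : ball p (r p)" for p by (rule boundary_value_zero[OF O(1) x open_ball that(2)])
   (use C that r\<phi>(2,3)[of p] in "auto intro: C1_on_continuous C2_on_C1")
  have hd: "(\<phi> p has_derivative (%v. grad (\<phi> p) x *. v)) (at x)" if "p : C" "x : ball p (r p)" for p
   by (rule C1_on_has_grad[OF C2_on_C1[OF r\<phi>(2)] that(2)]) (use C that in auto)
  define g0 where "g0 = grad (\<phi> q) x"
  have g0: "g0 ~= 0" unfolding g0_def using r\<phi>(4)[OF _ qx x] C q by auto
  have par: "EX c>=0. grad (\<psi> p) x = c *R g0" if p: "p : C" for p proof (cases "x : ball p (r p)")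
   case True
   have "EX c>=0. grad (\<phi> p) x = c *R g0" proof -
   obtain e where e: "e > 0" "ball x e <= ball p (r p) Int ball q (r q)" by (rule openE[of "ball p (r p) Int ball q (r q)" x]) (use True qx in auto)
   have "\<phi> p y < 0" if "dist x y < e" "\<phi> q y < 0" for y proof -
   have "y : ball p (r p)" "y : ball q (r q)" using e that by auto
   thus ?thesis using mem[OF p] mem[OF q(1)] that by blast qed
   from grad_parallel[OF hd[OF q(1) qx] val0[OF q(1) qx] hd[OF p True] val0[OF p True] g0[unfolded g0_def] e(1) this]
   show ?thesis unfolding g0_def by blast qed
   then obtain c where c: "c >= 0" "grad (\<phi> p) x = c *R g0" by blast
   have "((%x. bump 3 ((2 / r p) *R (x - p)) * \<phi> p x) has_derivative
   (%v. bump 3 ((2 / r p) *R (x - p)) * (grad (\<phi> p) x *. v) + (grad (%x. bump 3 ((2 / r p) *R (x - p))) x *. v) * \<phi> p x)) (at x)"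
   by (intro has_derivative_mult hd[OF p True] C1_on_has_grad[OF C2_on_C1[OF C2_on_bump_scaled]]) auto
   hence "((%x. bump 3 ((2 / r p) *R (x - p)) * \<phi> p x) has_derivative (%v. (bump 3 ((2 / r p) *R (x - p)) * c) *R g0 *. v)) (at x)" by (simp add: val0[OF p True] c(2) mult_ac)
   hence "(\<psi> p has_derivative (%v. (bump 3 ((2 / r p) *R (x - p)) * c) *R g0 *. v)) (at x)"
   by (rule has_derivative_transform_within_open[OF _ open_ball True]) (simp add: \<psi>_def localize_def)
   hence "grad (\<psi> p) x = (bump 3 ((2 / r p) *R (x - p)) * c) *R g0" by (rule grad_eqI)
   thus ?thesis using c(1) by (intro exI[of _ "bump 3 ((2 / r p) *R (x - p)) * c"]) simp
  next
   case False
   have rp: "r p > 0" using p C r\<phi> by auto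
   have "x : - cball p (r p / 2)" using False rp by auto
   hence "(\<psi> p has_derivative (%v. 0 *. v)) (at x)" proof (rule has_derivative_transform_within_open[where s="- cball p (r p / 2)" and f="%_. 0", rotated 2])
   show "0 = \<psi> p y" if "y : - cball p (r p / 2)" for y using localize_eq_0[OF rp, of p y "\<phi> p"] that by (simp add: \<psi>_def not_le) qed (simp_all add: open_Compl)
   hence "grad (\<psi> p) x = 0" by (rule grad_eqI)
   thus ?thesis by (intro exI[of _ 0]) simp qed
  then obtain c where c: "!!p. p : C ==> c p >= 0" "!!p. p : C ==> grad (\<psi> p) x = c p *R g0" by metis
  have cq: "c q > 0" proof -
   have "((%x. bump 3 ((2 / r q) *R (x - q)) * \<phi> q x) has_derivative
   (%v. bump 3 ((2 / r q) *R (x - q)) * (grad (\<phi> q) x *. v) + (grad (%x. bump 3 ((2 / r q) *R (x - q))) x *. v) * \<phi> q x)) (at x)"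
   by (intro has_derivative_mult hd[OF q(1) qx] C1_on_has_grad[OF C2_on_C1[OF C2_on_bump_scaled]]) auto
   hence "((%x. bump 3 ((2 / r q) *R (x - q)) * \<phi> q x) has_derivative (%v. (bump 3 ((2 / r q) *R (x - q)) *R g0) *. v)) (at x)" by (simp add: val0[OF q(1) qx] g0_def)
   hence "(\<psi> q has_derivative (%v. (bump 3 ((2 / r q) *R (x - q)) *R g0) *. v)) (at x)"
   by (rule has_derivative_transform_within_open[OF _ open_ball qx]) (simp add: \<psi>_def localize_def)
   hence "grad (\<psi> q) x = bump 3 ((2 / r q) *R (x - q)) *R g0" by (rule grad_eqI)
   hence "c q *R g0 = bump 3 ((2 / r q) *R (x - q)) *R g0" using c(2)[OF q(1)] by simp
   hence "c q = bump 3 ((2 / r q) *R (x - q))" using g0 by simp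
   thus ?thesis using bpos[OF q] by simp qed
  have "(Ph has_derivative (%v. SUM p:C. (grad (\<psi> p) x) *. v)) (at x)" unfolding Ph_def by (intro has_derivative_sum C1_on_has_grad[OF C2_on_C1[OF C2]]) auto
  hence "(Ph has_derivative (%v. ((SUM p:C. c p) *R g0) *. v)) (at x)" by (rule has_derivative_eq_rhs) (simp add: fun_eq_iff c(2) sum_distrib_right)
  hence "grad Ph x = (SUM p:C. c p) *R g0" by (rule grad_eqI)
  moreover have "(SUM p:C. c p) > 0" using C(2) q(1) cq c(1) by (intro sum_pos2[where i=q]) auto
  ultimately show "grad Ph x ~= 0" using g0 by simp qed
 have "EX R. ALL x. x ~: cball 0 R --> Ph x = 0" proof -
  have "bounded (UN p:C. ball p (r p))" using C by (intro bounded_UN) auto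
  then obtain R where R: "!!x. x : (UN p:C. ball p (r p)) ==> norm x <= R" using bounded_iff by metis
  have "Ph x = 0" if "x ~: cball 0 R" for x unfolding Ph_def using R that by (intro sum.neutral) (auto simp: \<psi>_def localize_def)
  thus ?thesis by blast qed
 with C2Ph Oeq bd show ?thesis by blast qed

section \<open>Unit normal, shape operator and well-definedness of the mean curvature\<close>

lemma pd_eq_derivative:
 assumes "(f has_derivative D) (at x)"
 shows "pd f b x = D b" proof -
 have "(f has_derivative (%v. grad f x *. v)) (at x)" using assms by (intro differentiable_has_grad) (auto simp: differentiable_def)
 hence "D = (%v. grad f x *. v)" by (rule has_derivative_unique[OF assms])
 thus ?thesis using pd_eq_inner[OF \<open>(f has_derivative (%v. grad f x *. v)) (at x)\<close>] by simp qed

definition unit_normal :: "('a::euclidean_space => real) => 'a => 'a" where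
 "unit_normal f x = grad f x /R norm (grad f x)"

text \<open>The derivative of the unit normal of the level sets. Its values are orthogonal to the
  normal, and on the frontier its trace is \<open>N - 1\<close> times the mean curvature.\<close>

definition shape_op :: "('a::euclidean_space => real) => 'a => 'a => 'a" where
 "shape_op f x v = (1 / norm (grad f x)) *R (hess f x v - (unit_normal f x *. hess f x v) *R unit_normal f x)"

lemma norm_unit_normal: "grad f x ~= 0 ==> norm (unit_normal f x) = 1" by (simp add: unit_normal_def)

lemma inner_unit_normal_self: "grad f x ~= 0 ==> unit_normal f x *. unit_normal f x = 1" using norm_unit_normal[of f x] by (simp add: dot_square_norm)

lemma grad_eq_norm_unit_normal: "grad f x = norm (grad f x) *R unit_normal f x" by (cases "grad f x = 0") (simp_all add: unit_normal_def)

lemma inner_grad_eq: "grad f x *. v = norm (grad f x) * (unit_normal f x *. v)" by (subst grad_eq_norm_unit_normal) simp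

lemma has_derivative_norm_grad:
 assumes f: "C2_on U f" "x : U" and g: "grad f x ~= 0"
 shows "((%x. norm (grad f x)) has_derivative (%v. unit_normal f x *. hess f x v)) (at x)" proof -
 have "(norm has_derivative (%h. h *. sgn (grad f x))) (at (grad f x))" using g by (rule has_derivative_norm)
 moreover have "sgn (grad f x) = unit_normal f x" by (simp add: unit_normal_def sgn_div_norm)
 ultimately have "(norm has_derivative (%h. unit_normal f x *. h)) (at (grad f x))" by (simp only: inner_commute)
 from has_derivative_compose[OF C2_on_has_hess[OF f] this] show ?thesis . qed

lemma has_derivative_unit_normal:
 assumes f: "C2_on U f" "x : U" and g: "grad f x ~= 0"
 shows "(unit_normal f has_derivative shape_op f x) (at x)" proof -
 define m where "m = norm (grad f x)"
 have m: "m > 0" using g by (simp add: m_def)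
 have "((%x. inverse (norm (grad f x))) has_derivative (%v. - (inverse m * (unit_normal f x *. hess f x v) * inverse m))) (at x)"
  unfolding m_def by (rule Deriv.has_derivative_inverse[OF _ has_derivative_norm_grad[OF f g]]) (use g in simp)
 from has_derivative_scaleR[OF this C2_on_has_hess[OF f]]
 have "(unit_normal f has_derivative (%v. inverse m *R hess f x v + (- (inverse m * (unit_normal f x *. hess f x v) * inverse m)) *R grad f x)) (at x)"
  unfolding unit_normal_def[abs_def] m_def .
 moreover have "inverse m *R hess f x v + (- (inverse m * (unit_normal f x *. hess f x v) * inverse m)) *R grad f x = shape_op f x v" for v proof -
  have "grad f x = m *R unit_normal f x" unfolding m_def by (rule grad_eq_norm_unit_normal)
  hence "(- (inverse m * (unit_normal f x *. hess f x v) * inverse m)) *R grad f x = - ((inverse m * (unit_normal f x *. hess f x v)) *R unit_normal f x)" using m by simp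
  thus ?thesis unfolding shape_op_def m_def[symmetric] by (simp add: scaleR_diff_right divide_inverse) qed
 ultimately show ?thesis by (rule has_derivative_eq_rhs[OF _ ext]) qed

lemma inner_unit_normal_shape_op: "grad f x ~= 0 ==> unit_normal f x *. shape_op f x v = 0" unfolding shape_op_def by (simp add: inner_diff_right inner_unit_normal_self)

lemma linear_shape_op: "linear (shape_op f x)" unfolding shape_op_def
 by (rule linearI) (simp_all add: linear_add[OF linear_hess] linear_scale[OF linear_hess] inner_add_right algebra_simps scaleR_diff_right)

lemma div_normal_eq_tr:
 assumes f: "C2_on U f" "x : U" and g: "grad f x ~= 0"
 shows "div_normal f x = tr (shape_op f x)" unfolding div_normal_def tr_def proof (rule sum.cong[OF refl])
 fix b :: 'a assume b: "b : Basis"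
 have "((%y. unit_normal f y *. b) has_derivative (%v. shape_op f x v *. b)) (at x)" by (intro has_derivative_inner_left has_derivative_unit_normal[OF f g])
 moreover have "(%y. unit_normal f y *. b) = (%y. pd f b y / norm (grad f y))" using b by (simp add: unit_normal_def grad_inner_Basis fun_eq_iff divide_inverse_commute)
 ultimately show "pd (%y. pd f b y / norm (grad f y)) b x = shape_op f x b *. b" using pd_eq_derivative by metis qed

lemma continuous_on_unit_normal:
 assumes f: "C2_on U f" and g: "!!x. x : U ==> grad f x ~= 0"
 shows "continuous_on U (unit_normal f)" unfolding unit_normal_def by (intro continuous_intros C1_on_continuous_grad C2_on_C1[OF f]) (use g in auto)

lemma continuous_on_shape_op:
 assumes f: "C2_on U f" and g: "!!x. x : U ==> grad f x ~= 0"
 shows "continuous_on U (%x. shape_op f x v)" unfolding shape_op_def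
 by (intro continuous_intros C1_on_continuous_grad C2_on_C1[OF f] continuous_on_unit_normal[OF f g] C2_on_continuous_hess[OF f]) (use g in auto)

text \<open>Every tangent direction is approximated by boundary points, by the intermediate value theorem
 along the normal.\<close>

lemma tangent_approximation:
 fixes f :: "'a::euclidean_space => real"
 assumes O: "open Om" and B: "open B" "p : B" and f: "C2_on B f" "!!x. x : B ==> grad f x ~= 0" "f p = 0"
  and eq: "Om Int B = {y\<in>B. f y < 0}" and e: "grad f p *. e = 0" and \<eta>: "\<eta> > 0" and d: "d > 0"
 shows "EX t s. 0 < t & t < d & \<bar>s\<bar> <= \<eta> & p + t *R (e + s *R unit_normal f p) : frontier Om Int B" proof -
 let ?n = "unit_normal f p"
 have fp: "(f has_derivative (%v. grad f p *. v)) (at p)" by (rule C1_on_has_grad[OF C2_on_C1[OF f(1)] B(2)])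
 have gn: "grad f p *. ?n > 0" proof -
  have "grad f p *. ?n = norm (grad f p)" unfolding inner_grad_eq using inner_unit_normal_self[OF f(2)[OF B(2)]] by simp
  thus ?thesis using f(2)[OF B(2)] by simp qed
 have "grad f p *. (e + (- \<eta>) *R ?n) < 0" using gn \<eta> e by (simp add: inner_add_right inner_diff_right)
 from negative_direction[OF fp f(3) this] obtain d1 where
  d1: "d1 > 0" "!!t. 0 < t ==> t < d1 ==> f (p + t *R (e + (- \<eta>) *R ?n)) < 0" by blast
 have "(- grad f p) *. (e + \<eta> *R ?n) < 0" using gn \<eta> e by (simp add: inner_add_right inner_diff_right)
 moreover have "((%x. - f x) has_derivative (%v. (- grad f p) *. v)) (at p)" using has_derivative_minus[OF fp] by simp
 ultimately obtain d2 where
  d2: "d2 > 0" "!!t. 0 < t ==> t < d2 ==> - f (p + t *R (e + \<eta> *R ?n)) < 0" using negative_direction[of "%x. - f x" "- grad f p" p] f(3) by auto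
 obtain r where r: "r > 0" "ball p r <= B" by (rule openE[OF B])
 define k where "k = norm e + \<eta> + 1"
 have k: "k > 0" using \<eta> by (simp add: k_def add_nonneg_pos)
 define t where "t = min (min d1 d2) (min d (r / k)) / 2"
 have t: "0 < t" "t < d1" "t < d2" "t < d" "t < r / k" proof -
  define m where "m = min (min d1 d2) (min d (r / k))"
  have "m > 0" "m <= d1" "m <= d2" "m <= d" "m <= r / k" unfolding m_def using d1 d2 d r k by auto
  moreover have "t = m / 2" by (simp add: t_def m_def)
  ultimately show "0 < t" "t < d1" "t < d2" "t < d" "t < r / k" by linarith+ qed
 have nn: "norm ?n = 1" by (rule norm_unit_normal[OF f(2)[OF B(2)]])
 have inB: "p + t *R (e + s *R ?n) : B" if "\<bar>s\<bar> <= \<eta>" for s proof -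
  have "norm (e + s *R ?n) <= k" using norm_triangle_ineq[of e "s *R ?n"] nn that by (simp add: k_def)
  hence "norm (t *R (e + s *R ?n)) <= t * k" using t(1) by (simp add: mult_left_mono)
  also have "... < r" using t(5) k by (simp add: pos_less_divide_eq)
  finally have "p + t *R (e + s *R ?n) : ball p r" by (simp only: mem_ball dist_norm) (simp add: norm_minus_commute)
  thus ?thesis using r(2) by blast qed
 define q where "q s = f (p + t *R (e + s *R ?n))" for s
 have cq: "continuous_on {- \<eta>..\<eta>} q" unfolding q_def by (intro continuous_on_compose2[OF C1_on_continuous[OF C2_on_C1[OF f(1)]]] continuous_intros) (auto intro!: inB)
 have "q (- \<eta>) <= 0" "0 <= q \<eta>" using d1(2)[OF t(1,2)] d2(2)[OF t(1,3)] by (simp_all add: q_def)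
 then obtain s where s: "- \<eta> <= s" "s <= \<eta>" "q s = 0" using IVT'[of q "- \<eta>" 0 \<eta>] cq \<eta> by auto
 have s': "\<bar>s\<bar> <= \<eta>" using s by simp
 let ?y = "p + t *R (e + s *R ?n)"
 have "?y : frontier Om" by (rule zero_in_frontier[OF O B(1) inB[OF s'] C1_on_has_grad[OF C2_on_C1[OF f(1)] inB[OF s']] f(2)[OF inB[OF s']] _ eq]) (use s(3) in "simp add: q_def")
 thus ?thesis using t s' inB[OF s'] by blast qed

text \<open>The two unit normals agree on the frontier, so the derivative \<open>L\<close> of their
  difference kills every tangent vector, a limit of directions towards frontier points. Hence
  \<open>tr L\<close> is \<open>L ?n *. ?n\<close>, which is zero because both shape operators take
  values orthogonal to the normal.\<close>

lemma div_normal_unique: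
 fixes f g :: "'a::euclidean_space => real"
 assumes O: "open Om" and p: "p : frontier Om" and B: "open B" "p : B"
  and f: "C2_on B f" "!!x. x : B ==> grad f x ~= 0" "Om Int B = {y\<in>B. f y < 0}"
  and g: "C2_on B g" "!!x. x : B ==> grad g x ~= 0" "Om Int B = {y\<in>B. g y < 0}"
 shows "div_normal f p = div_normal g p" proof -
 have f0: "f x = 0" "g x = 0" if "x : frontier Om" "x : B" for x using boundary_value_zero[OF O that(1) B(1) that(2) _ f(3)] boundary_value_zero[OF O that(1) B(1) that(2) _ g(3)]
   C1_on_continuous[OF C2_on_C1[OF f(1)]] C1_on_continuous[OF C2_on_C1[OF g(1)]] by blast+
 have df: "(f has_derivative (%v. grad f x *. v)) (at x)" "(g has_derivative (%v. grad g x *. v)) (at x)" if "x : B" for x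
  using C1_on_has_grad[OF C2_on_C1[OF f(1)] that] C1_on_has_grad[OF C2_on_C1[OF g(1)] that] .
 have same: "unit_normal f x = unit_normal g x" if x: "x : frontier Om" "x : B" for x proof -
  obtain r where r: "r > 0" "ball x r <= B" by (rule openE[OF B(1) x(2)])
  have "EX c>=0. grad g x = c *R grad f x" proof (rule grad_parallel[OF df(1)[OF x(2)] f0(1)[OF x] df(2)[OF x(2)] f0(2)[OF x] f(2)[OF x(2)] r(1)])
   fix y assume "dist x y < r" "f y < 0"
   hence "y : B" using r(2) by auto
   thus "g y < 0" using f(3) g(3) \<open>f y < 0\<close> by blast qed
  then obtain c where c: "c >= 0" "grad g x = c *R grad f x" by blast
  hence "c > 0" using g(2)[OF x(2)] by (cases "c = 0") auto
  thus ?thesis unfolding unit_normal_def c(2) by simp qed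
 let ?n = "unit_normal f p"
 define L where "L v = shape_op f p v - shape_op g p v" for v
 have linL: "linear L" unfolding L_def by (intro linear_compose_sub linear_shape_op)
 have dL: "((%x. unit_normal f x - unit_normal g x) has_derivative L) (at p)"
  unfolding L_def by (intro has_derivative_diff has_derivative_unit_normal[OF f(1) B(2) f(2)[OF B(2)]] has_derivative_unit_normal[OF g(1) B(2) g(2)[OF B(2)]])
 obtain K where K: "K > 0" "!!v. norm (L v) <= K * norm v" using linear_bounded_pos[OF linL] by auto
 have tang: "L e = 0" if e: "grad f p *. e = 0" for e proof (rule ccontr)
  assume "L e ~= 0"
  hence Le: "norm (L e) > 0" by simp
  \<comment> \<open>With \<open>ep\<close> below, the error in the direction and the remainder of
    the derivative each account for at most a quarter of \<open>norm (L e)\<close>, a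
    contradiction.\<close>
  define \<eta> where "\<eta> = min 1 (norm (L e) / (4 * K))"
  have \<eta>: "\<eta> > 0" "\<eta> <= 1" "\<eta> * K <= norm (L e) / 4" unfolding \<eta>_def using Le K by (auto simp: min_def field_simps)
  define ep where "ep = norm (L e) / (4 * (norm e + 1))"
  have ne: "norm e + 1 > 0" by (simp add: add_nonneg_pos)
  have ep: "ep > 0" unfolding ep_def using Le ne by simp
  from dL[unfolded has_derivative_at_alt] ep obtain d where d: "d > 0"
   "!!y. norm (y - p) < d ==> norm ((unit_normal f y - unit_normal g y) - (unit_normal f p - unit_normal g p) - L (y - p)) <= ep * norm (y - p)" by blast
  obtain t s where ts: "0 < t" "t < d / (norm e + 1)" "\<bar>s\<bar> <= \<eta>" "p + t *R (e + s *R ?n) : frontier Om Int B"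
   using tangent_approximation[OF O B f(1,2) f0(1)[OF p B(2)] f(3) e \<eta>(1), of "d / (norm e + 1)"] d(1) ne by auto
  define w where "w = e + s *R ?n"
  have nn: "norm ?n = 1" by (rule norm_unit_normal[OF f(2)[OF B(2)]])
  have nw: "norm w <= norm e + 1" unfolding w_def using norm_triangle_ineq[of e "s *R ?n"] nn ts(3) \<eta>(2) by simp
  let ?y = "p + t *R w"
  have "norm (?y - p) <= t * (norm e + 1)" using nw ts(1) by (simp add: mult_left_mono)
  also have "... < d" using ts(2) ne by (simp add: pos_less_divide_eq)
  finally have "norm ((unit_normal f ?y - unit_normal g ?y) - (unit_normal f p - unit_normal g p) - L (?y - p)) <= ep * norm (?y - p)" by (rule d(2))
  moreover have "unit_normal f ?y = unit_normal g ?y" using ts(4) unfolding w_def by (intro same) auto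
  moreover have "unit_normal f p = unit_normal g p" by (rule same[OF p B(2)])
  ultimately have "norm (L (t *R w)) <= ep * norm (t *R w)" by simp
  hence "t * norm (L w) <= t * (ep * norm w)" using ts(1) by (simp add: linear_scale[OF linL] mult_ac)
  hence Lw: "norm (L w) <= ep * norm w" using ts(1) by simp
  also have "... <= ep * (norm e + 1)" using nw ep by (intro mult_left_mono) auto
  also have "... = norm (L e) / 4" proof -
   have "a / (4 * k) * k = a / 4" if "k > 0" for a k :: real using that by simp
   thus ?thesis unfolding ep_def using ne by blast qed
  finally have 1: "norm (L w) <= norm (L e) / 4" .
  have "L e = L w - s *R L ?n" unfolding w_def by (simp add: linear_add[OF linL] linear_scale[OF linL])
  hence "norm (L e) <= norm (L w) + \<bar>s\<bar> * norm (L ?n)" using norm_triangle_ineq4[of "L w" "s *R L ?n"] by simp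
  also have "\<bar>s\<bar> * norm (L ?n) <= \<eta> * K" using K(2)[of ?n] nn ts(3) by (intro mult_mono) auto
  finally show False using 1 \<eta>(3) Le by linarith qed
 have "tr L = L ?n *. ?n" proof -
  have nn: "?n *. ?n = 1" by (rule inner_unit_normal_self[OF f(2)[OF B(2)]])
  have Lb: "L b = (b *. ?n) *R L ?n" for b proof -
   have "grad f p *. (b - (b *. ?n) *R ?n) = 0" unfolding inner_grad_eq inner_diff_right inner_scaleR_right nn by (simp add: inner_commute)
   from tang[OF this] show ?thesis by (simp add: linear_diff[OF linL] linear_scale[OF linL]) qed
  have "L b *. b = (L ?n *. b) * (?n *. b)" for b unfolding Lb[of b] inner_scaleR_left by (simp only: mult.commute inner_commute)
  hence "tr L = (SUM b:Basis. (L ?n *. b) * (?n *. b))" unfolding tr_def by (intro sum.cong refl)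
  thus ?thesis by (subst euclidean_inner) qed
 also have "... = 0" proof -
  have "shape_op f p ?n *. ?n = 0" "shape_op g p ?n *. ?n = 0" using inner_unit_normal_shape_op[OF f(2)[OF B(2)]] inner_unit_normal_shape_op[OF g(2)[OF B(2)]] same[OF p B(2)]
   by (simp_all add: inner_commute)
  thus ?thesis by (simp add: L_def inner_diff_left) qed
 finally have "tr (shape_op f p) = tr (shape_op g p)" by (simp add: tr_def L_def inner_diff_left sum_subtractf)
 thus ?thesis using div_normal_eq_tr[OF f(1) B(2) f(2)[OF B(2)]] div_normal_eq_tr[OF g(1) B(2) g(2)[OF B(2)]] by simp qed

text \<open>The choice in \<open>mean_curv\<close> ranges over all local defining functions, and
  \<open>div_normal_unique\<close> shows that they give the same value.\<close>

lemma mean_curv_eq: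
 fixes f :: "'a::euclidean_space => real"
 assumes O: "open Om" and p: "p : frontier Om" and f: "local_defn Om p r f"
 shows "mean_curv Om p = div_normal f p / (real DIM('a) - 1)" proof -
 have uniq: "div_normal g p = div_normal f p" if "local_defn Om p r' g" for r' g proof -
  let ?B = "ball p (min r r')"
  have B: "open ?B" "p : ?B" "?B <= ball p r" "?B <= ball p r'" using f that by (auto simp: local_defn_def)
  show ?thesis proof (rule div_normal_unique[OF O p B(1,2)])
   show "C2_on ?B g" "C2_on ?B f" using f that B by (auto simp: local_defn_def intro: C2_on_subset)
   show "grad g x ~= 0" "grad f x ~= 0" if "x : ?B" for x using f \<open>local_defn Om p r' g\<close> B that by (auto simp: local_defn_def)
   have "Om Int ball p r' = {x\<in>ball p r'. g x < 0}" "Om Int ball p r = {x\<in>ball p r. f x < 0}" using f that unfolding local_defn_def by blast+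
   thus "Om Int ?B = {y\<in>?B. g y < 0}" "Om Int ?B = {y\<in>?B. f y < 0}" using B(3,4) by blast+ qed qed
 have ex: "EX h r \<phi>. local_defn Om p r \<phi> & h = div_normal \<phi> p / (real DIM('a) - 1)" using f by blast
 show ?thesis unfolding mean_curv_def using someI_ex[OF ex] uniq by auto qed

section \<open>Geometry of a C2 domain: boundary layers and touching balls\<close>

lemma disjoint_balls_dist:
 fixes x c :: "'a::real_normed_vector"
 assumes "ball x d Int ball c r = {}" "d > 0" "r > 0"
 shows "d + r <= dist x c" proof (rule ccontr)
 assume "~ d + r <= dist x c"
 hence lt: "norm (c - x) < d + r" by (simp add: dist_norm norm_minus_commute)
 define z where "z = x + (d / (d + r)) *R (c - x)"
 have dr: "d + r > 0" using assms by simp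
 have "norm (z - x) < d" proof -
  have "norm (z - x) = d / (d + r) * norm (c - x)" using assms by (simp add: z_def)
  also have "... < d / (d + r) * (d + r)" using lt assms by (intro mult_strict_left_mono) auto
  finally show ?thesis using dr by simp qed
 moreover have "norm (c - z) < r" proof -
  have "c - z = (1 - d / (d + r)) *R (c - x)" by (simp add: z_def algebra_simps)
  also have "1 - d / (d + r) = r / (d + r)" using dr by (simp add: field_simps)
  finally have "norm (c - z) = r / (d + r) * norm (c - x)" using assms by simp
  also have "... < r / (d + r) * (d + r)" using lt assms by (intro mult_strict_left_mono) auto
  finally show ?thesis using dr by simp qed
 ultimately have "z : ball x d Int ball c r" by (simp add: dist_norm norm_minus_commute)
 thus False using assms by simp qed

lemma norm_diff_normal_sq:
 fixes n :: "'a::real_inner"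
 assumes "norm n = 1"
 shows "(norm (w - r *R n))^2 = (norm w)^2 - 2 * r * (w *. n) + r^2" proof -
 have "n *. n = 1" using assms by (simp add: dot_square_norm)
 thus ?thesis unfolding power2_norm_eq_inner by (simp add: inner_diff_left inner_diff_right inner_commute power2_eq_square algebra_simps) qed

lemma norm_normalize_diff_le:
 fixes a b :: "'a::real_inner"
 assumes "m > 0" "m <= norm a" "m <= norm b"
 shows "norm (a /R norm a - b /R norm b) <= 2 / m * norm (a - b)" proof -
 have a: "norm a > 0" and b: "norm b > 0" using assms by linarith+
 have "a /R norm a - b /R norm b = (1 / norm a) *R (a - b) + (1 / norm a - 1 / norm b) *R b" by (simp add: algebra_simps divide_inverse)
 hence "norm (a /R norm a - b /R norm b) <= norm ((1 / norm a) *R (a - b)) + norm ((1 / norm a - 1 / norm b) *R b)" by (simp only: norm_triangle_ineq)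
 also have "norm ((1 / norm a - 1 / norm b) *R b) = \<bar>norm b - norm a\<bar> / norm a" proof -
  have "(1 / norm a - 1 / norm b) * norm b = (norm b - norm a) / norm a" using a b by (simp add: field_simps)
  thus ?thesis using a b by (metis abs_divide abs_mult abs_norm_cancel norm_scaleR) qed
 also have "\<bar>norm b - norm a\<bar> <= norm (a - b)" by (metis norm_minus_commute norm_triangle_ineq3)
 finally have "norm (a /R norm a - b /R norm b) <= norm (a - b) / norm a + norm (a - b) / norm a" using a by (simp add: divide_right_mono add_mono)
 also have "... <= norm (a - b) / m + norm (a - b) / m" using assms a by (intro add_mono divide_left_mono) auto
 finally show ?thesis by simp qed

text \<open>The compact support of \<open>Ph\<close> bounds its Hessian on the whole space, so
  Taylor estimates hold along every segment, including those that leave \<open>Om\<close>.\<close>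

locale C2_domain =
 fixes Om :: "'a::euclidean_space set" and Ph :: "'a => real" and R0 :: real
 assumes open_Om: "open Om" and bounded_Om: "bounded Om" and ne_Om: "Om ~= {}"
  and C2_Ph: "C2_on UNIV Ph" and supp_Ph: "!!x. x ~: cball 0 R0 ==> Ph x = 0"
  and Om_eq: "Om = {x. Ph x < 0}"
  and Ph_frontier: "!!x. x : frontier Om ==> Ph x = 0"
  and grad_Ph_frontier: "!!x. x : frontier Om ==> grad Ph x ~= 0"
begin

abbreviation "Gam == frontier Om"
abbreviation "nG x == norm (grad Ph x)"
abbreviation "sint f == set_integrable lborel Om (f :: 'a => real)"
abbreviation integ :: "('a => real) => real" (binder "IN " 10) where "integ f == set_lebesgue_integral lborel Om f"
abbreviation "nu == unit_normal Ph"

lemma closure_eq: "closure Om = Om Un Gam" using open_Om closure_subset by (auto simp: frontier_def interior_open)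

lemma compact_closure: "compact (closure Om)" using bounded_Om by simp

lemma compact_frontier: "compact Gam" using bounded_Om compact_frontier_bounded by blast

lemma Om_Int_frontier: "Om Int Gam = {}" using open_Om by (auto simp: frontier_def interior_open)

lemma frontier_nonempty: "Gam ~= {}" proof -
 have "Om ~= UNIV" using bounded_Om not_bounded_UNIV by blast
 thus ?thesis using ne_Om frontier_eq_empty by blast qed

lemma has_grad_Ph: "(Ph has_derivative (%v. grad Ph x *. v)) (at x)" by (rule C1_on_has_grad[OF C2_on_C1[OF C2_Ph]]) simp

lemma continuous_Ph: "continuous_on S Ph" using C1_on_continuous[OF C2_on_C1[OF C2_Ph]] continuous_on_subset by blast

lemma compact_layer: "compact {x : closure Om. - t <= Ph x}"
 using compact_Int_closed[OF compact_closure closed_Collect_le[OF continuous_on_const continuous_Ph]] by (simp add: Collect_conj_eq)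

lemma continuous_grad_Ph: "continuous_on S (grad Ph)" using C1_on_continuous_grad[OF C2_on_C1[OF C2_Ph]] continuous_on_subset by blast

lemma norm_nu: "x : Gam ==> norm (nu x) = 1" by (rule norm_unit_normal[OF grad_Ph_frontier])

text \<open>Away from \<open>U\<close> the function \<open>Ph\<close> has a negative maximum on the
  closure. So the sets where \<open>- t <= Ph\<close> can serve as neighbourhoods of the
  frontier.\<close>

lemma boundary_layer:
 assumes U: "open U" "Gam <= U"
 shows "EX t>0. ALL x:closure Om. - t <= Ph x --> x : U" proof (cases "closure Om - U = {}")
 case True
 thus ?thesis by (intro exI[of _ 1]) auto
next
 case False
 have K: "compact (closure Om - U)" using compact_closure U(1) by (rule compact_diff)
 obtain x0 where x0: "x0 : closure Om - U" "!!x. x : closure Om - U ==> Ph x <= Ph x0" using continuous_attains_sup[OF K False continuous_Ph] by metis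
 have "Ph x0 < 0" using x0(1) U(2) closure_eq Om_eq by auto
 thus ?thesis using x0(2) by (intro exI[of _ "- Ph x0 / 2"]) force qed

lemma boundary_layer_bound:
 fixes f :: "'a => real"
 assumes "continuous_on UNIV f" "!!x. x : Gam ==> f x > 0"
 shows "EX t>0. EX c>0. ALL x:closure Om. - t <= Ph x --> c <= f x" proof -
 obtain p where p: "p : Gam" "!!x. x : Gam ==> f p <= f x" using continuous_attains_inf[OF compact_frontier frontier_nonempty] assms(1) continuous_on_subset by (metis subset_UNIV)
 have "open {x. f p / 2 < f x}" using assms(1) by (intro open_Collect_less continuous_on_const)
 moreover have "Gam <= {x. f p / 2 < f x}" using p assms(2) by force
 ultimately obtain t where "t > 0" "ALL x:closure Om. - t <= Ph x --> x : {x. f p / 2 < f x}" using boundary_layer by blast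
 thus ?thesis using assms(2)[OF p(1)] by (intro exI[of _ t] conjI exI[of _ "f p / 2"]) force+ qed

lemma hess_Ph_outside: "x ~: cball 0 R0 ==> hess Ph x v = 0" proof -
 assume x: "x ~: cball 0 R0"
 have "hess Ph x = (%_. 0)" proof (rule hess_eqI[where U="- cball 0 R0" and G="%_. 0"])
  fix y :: 'a assume y: "y : - cball 0 R0"
  have "((%_. 0) has_derivative (%v. 0 *. v)) (at y)" by simp
  thus "(Ph has_derivative (%v. 0 *. v)) (at y)" by (rule has_derivative_transform_within_open[OF _ _ y]) (simp_all add: supp_Ph open_Compl) qed (use x in "auto simp: open_Compl")
 thus ?thesis by simp qed

lemma hess_Ph_bounded: "EX L>0. ALL x v. norm (hess Ph x v) <= L * norm v" proof -
 have "EX B>=0. ALL x. norm (hess Ph x b) <= B" for b proof -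
  have "bounded ((%x. hess Ph x b) ` cball 0 R0)" using C2_on_continuous_hess[OF C2_Ph, of b] by (intro compact_imp_bounded compact_continuous_image) (auto intro: continuous_on_subset)
  then obtain B where B: "B > 0" "!!x. x : cball 0 R0 ==> norm (hess Ph x b) <= B" unfolding bounded_pos by auto
  hence "norm (hess Ph x b) <= B" for x by (cases "x : cball 0 R0") (auto simp: hess_Ph_outside)
  with B(1) show ?thesis by (intro exI[of _ B]) auto qed
 then obtain B where B: "!!b. B b >= 0" "!!b x. norm (hess Ph x b) <= B b" by metis
 have "norm (hess Ph x v) <= (1 + (SUM b:Basis. B b)) * norm v" for x v proof -
  have "hess Ph x v = hess Ph x (SUM b:Basis. (v *. b) *R b)" by (simp add: euclidean_representation)
  also have "... = (SUM b:Basis. (v *. b) *R hess Ph x b)" by (simp add: linear_sum[OF linear_hess] linear_scale[OF linear_hess])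
  finally have e: "hess Ph x v = (SUM b:Basis. (v *. b) *R hess Ph x b)" .
  have "norm (hess Ph x v) <= (SUM b:Basis. norm ((v *. b) *R hess Ph x b))" unfolding e by (rule norm_sum)
  also have "... <= (SUM b:Basis. norm v * B b)" proof (rule sum_mono)
   fix b :: 'a assume "b : Basis"
   thus "norm ((v *. b) *R hess Ph x b) <= norm v * B b" using B(2)[of x b] Basis_le_norm[of b v] by (simp add: mult_mono) qed
  also have "... = (SUM b:Basis. B b) * norm v" by (simp add: sum_distrib_left mult.commute)
  also have "... <= (1 + (SUM b:Basis. B b)) * norm v" by (intro mult_right_mono) auto
  finally show ?thesis . qed
 moreover have "1 + (SUM b:(Basis::'a set). B b) > 0" using B(1) by (simp add: add_pos_nonneg sum_nonneg)
 ultimately show ?thesis by blast qed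

lemma grad_Ph_Lipschitz: "EX L>0. ALL x y. norm (grad Ph x - grad Ph y) <= L * norm (x - y)" proof -
 obtain L where L: "L > 0" "!!x v. norm (hess Ph x v) <= L * norm v" using hess_Ph_bounded by blast
 have "norm (grad Ph x - grad Ph y) <= L * norm (x - y)" for x y proof (rule differentiable_bound[where S=UNIV and f'="hess Ph"])
  show "(grad Ph has_derivative hess Ph z) (at z within UNIV)" for z using C2_on_has_hess[OF C2_Ph] by simp
  show "onorm (hess Ph z) <= L" for z by (rule onorm_le) (rule L(2)) qed auto
 with L(1) show ?thesis by blast qed

lemma Ph_Taylor:
 assumes L: "!!x y. norm (grad Ph x - grad Ph y) <= L * norm (x - y)" and L0: "L > 0"
 shows "\<bar>Ph y - Ph x - grad Ph x *. (y - x)\<bar> <= L * (norm (y - x))^2" proof -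
 define q where "q t = Ph (x + t *R (y - x))" for t
 have "EX z. 0 < z & z < 1 & q 1 - q 0 = (1 - 0) * (grad Ph (x + z *R (y - x)) *. (y - x))" by (rule MVT2) (auto simp: q_def intro: has_derivative_inner_D has_grad_Ph)
 then obtain z where z: "0 < z" "z < 1" "Ph y - Ph x = grad Ph (x + z *R (y - x)) *. (y - x)" unfolding q_def by auto
 hence "\<bar>Ph y - Ph x - grad Ph x *. (y - x)\<bar> = \<bar>(grad Ph (x + z *R (y - x)) - grad Ph x) *. (y - x)\<bar>" by (simp add: inner_diff_left)
 also have "... <= norm (grad Ph (x + z *R (y - x)) - grad Ph x) * norm (y - x)" by (rule Cauchy_Schwarz_ineq2)
 also have "... <= (L * norm (z *R (y - x))) * norm (y - x)" using L[of "x + z *R (y - x)" x] by (intro mult_right_mono) auto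
 also have "... <= (L * norm (y - x)) * norm (y - x)" using z L0 by (intro mult_right_mono mult_left_mono) (auto simp: mult_left_le_one_le)
 finally show ?thesis by (simp add: power2_eq_square mult.assoc) qed

lemma grad_Ph_layer: "EX t>0. EX m>0. ALL x:closure Om. - t <= Ph x --> m <= nG x"
 by (rule boundary_layer_bound) (use grad_Ph_frontier in "auto intro!: continuous_intros continuous_grad_Ph")

definition exterior_radius :: "real => bool" where
 "exterior_radius \<rho> \<longleftrightarrow> \<rho> > 0 & (ALL p:Gam. ball (p + \<rho> *R nu p) \<rho> Int Om = {})"

lemma exterior_radius_exists: "EX \<rho>. exterior_radius \<rho>" proof -
 obtain L where L: "L > 0" "!!x y. norm (grad Ph x - grad Ph y) <= L * norm (x - y)" using grad_Ph_Lipschitz by blast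
 obtain t m where m: "t > 0" "m > 0" "!!x. x : closure Om ==> - t <= Ph x ==> m <= nG x" using grad_Ph_layer by blast
 \<comment> \<open>In a ball of this radius touching at \<open>p\<close> from outside, the linear
   growth of \<open>Ph\<close> with slope at least \<open>m\<close> beats the Taylor error
   \<open>L * |x - p|^2\<close>.\<close>
 define \<rho> where "\<rho> = m / (2 * L)"
 have \<rho>: "\<rho> > 0" using L m by (simp add: \<rho>_def)
 have "x ~: Om" if p: "p : Gam" and x: "x : ball (p + \<rho> *R nu p) \<rho>" for p x proof
  assume "x : Om"
  hence "Ph x < 0" using Om_eq by simp
  moreover have "Ph p = 0" by (rule Ph_frontier[OF p])
  moreover have "Ph x - Ph p - grad Ph p *. (x - p) >= - (L * (norm (x - p))^2)" using Ph_Taylor[OF L(2,1), of x p] by linarith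
  ultimately have 1: "grad Ph p *. (x - p) < L * (norm (x - p))^2" by linarith
  have mp: "m <= nG p" using m(1) m(3)[of p] p Ph_frontier[OF p] closure_eq by simp
  have "norm ((x - p) - \<rho> *R nu p) < \<rho>" using x by (simp add: dist_norm norm_minus_commute algebra_simps)
  hence "(norm ((x - p) - \<rho> *R nu p))^2 < \<rho>^2" by (simp add: power_strict_mono)
  hence 2: "(norm (x - p))^2 < 2 * \<rho> * ((x - p) *. nu p)" unfolding norm_diff_normal_sq[OF norm_nu[OF p]] by simp
  have "L * (norm (x - p))^2 <= L * (2 * \<rho> * ((x - p) *. nu p))" using 2 L by (intro mult_left_mono) auto
  also have "... = m * ((x - p) *. nu p)" using L by (simp add: \<rho>_def)
  also have "... <= nG p * ((x - p) *. nu p)" proof (rule mult_right_mono[OF mp])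
   have "0 < 2 * \<rho> * ((x - p) *. nu p)" using 2 zero_le_power2[of "norm (x - p)"] by linarith
   thus "0 <= (x - p) *. nu p" using \<rho> by (simp add: zero_less_mult_iff) qed
  also have "... = grad Ph p *. (x - p)" by (simp add: inner_grad_eq inner_commute)
  finally show False using 1 by linarith qed
 thus ?thesis using \<rho> unfolding exterior_radius_def by blast qed

text \<open>The given ball and the exterior ball at \<open>p\<close> are disjoint, so their centres
  are at least the sum of the radii apart. As both have \<open>p\<close> on their spheres, the
  triangle inequality is an equality, which fixes the direction.\<close>

lemma interior_ball_center:
 assumes p: "p : Gam" and d: "d > 0" "ball x d <= Om" "dist x p = d"
 shows "x = p - d *R nu p" proof -
 obtain \<rho> where \<rho>: "\<rho> > 0" "ball (p + \<rho> *R nu p) \<rho> Int Om = {}" using exterior_radius_exists p unfolding exterior_radius_def by blast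
 have "d + \<rho> <= dist x (p + \<rho> *R nu p)" using d \<rho> by (intro disjoint_balls_dist) auto
 moreover have "dist x (p + \<rho> *R nu p) = norm ((x - p) - \<rho> *R nu p)" by (simp add: dist_norm algebra_simps)
 ultimately have "(d + \<rho>)^2 <= (norm ((x - p) - \<rho> *R nu p))^2" using d \<rho> by (intro power_mono) auto
 also have "... = d^2 - 2 * \<rho> * ((x - p) *. nu p) + \<rho>^2" unfolding norm_diff_normal_sq[OF norm_nu[OF p]] using d by (simp add: dist_norm)
 finally have "\<rho> * ((x - p) *. nu p) <= \<rho> * (- d)" by (simp add: power2_eq_square algebra_simps)
 hence le: "(x - p) *. nu p <= - d" using \<rho>(1) by (rule mult_left_le_imp_le)
 have "(norm ((x - p) - (- d) *R nu p))^2 = d^2 - 2 * (- d) * ((x - p) *. nu p) + (- d)^2" unfolding norm_diff_normal_sq[OF norm_nu[OF p]] using d by (simp add: dist_norm)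
 also have "... = 2 * d * (d + (x - p) *. nu p)" by (simp add: power2_eq_square algebra_simps)
 also have "... <= 0" using le d(1) by (intro mult_nonneg_nonpos) auto
 finally have "(x - p) - (- d) *R nu p = 0" by simp
 thus ?thesis by (simp add: algebra_simps add_eq_0_iff) qed

lemma ball_subset_if_dist_frontier:
 assumes x: "x : Om" and d: "!!p. p : Gam ==> d <= dist x p"
 shows "ball x d <= Om" proof (rule ccontr)
 assume "~ ball x d <= Om"
 hence "ball x d - Om ~= {}" by auto
 hence d0: "d > 0" by (metis Diff_empty ball_eq_empty empty_Diff not_le)
 have "connected (ball x d)" by simp
 moreover have "ball x d Int Om ~= {}" proof -
  have "x : ball x d Int Om" using x d0 by simp
  thus ?thesis by blast qed
 ultimately have "ball x d Int Gam ~= {}" using \<open>ball x d - Om ~= {}\<close> by (rule connected_Int_frontier)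
 then obtain p where "p : Gam" "dist x p < d" by auto
 with d show False by fastforce qed

lemma nearest_frontier_point:
 assumes x: "x : Om"
 shows "EX p:Gam. 0 < dist x p & (ALL q:Gam. dist x p <= dist x q) & x = p - dist x p *R nu p & ball x (dist x p) <= Om" proof -
 have "continuous_on Gam (%p. dist x p)" by (intro continuous_intros)
 from continuous_attains_inf[OF compact_frontier frontier_nonempty this]
 obtain p where p: "p : Gam" "!!q. q : Gam ==> dist x p <= dist x q" by blast
 have pos: "dist x p > 0" using x p Om_Int_frontier by auto
 have b: "ball x (dist x p) <= Om" by (rule ball_subset_if_dist_frontier[OF x p(2)])
 show ?thesis using p pos b interior_ball_center[OF p(1) pos b refl] by (intro bexI[of _ p] conjI ballI) qed

lemma dist_frontier_le_Ph:
 "EX t>0. EX C>0. ALL x:Om. - t <= Ph x --> (EX p:Gam. norm (x - p) <= C * (- Ph x))" proof -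
 obtain L where L: "L > 0" "!!x y. norm (grad Ph x - grad Ph y) <= L * norm (x - y)" using grad_Ph_Lipschitz by blast
 obtain t m where m: "t > 0" "m > 0" "!!x. x : closure Om ==> - t <= Ph x ==> m <= nG x" using grad_Ph_layer by blast
 \<comment> \<open>Within this distance the quadratic Taylor error is at most half of the linear
   decrease of \<open>Ph\<close> along the inner normal.\<close>
 define r where "r = m / (2 * L)"
 have r: "r > 0" using m L by (simp add: r_def)
 have 1: "open (UN p:Gam. ball p r)" by (intro open_UN ballI open_ball)
 have 2: "Gam <= (UN p:Gam. ball p r)" proof
  fix p assume "p : Gam"
  moreover have "p : ball p r" using r by simp
  ultimately show "p : (UN p:Gam. ball p r)" by (rule UN_I) qed
 obtain t' where t': "t' > 0" "!!x. x : closure Om ==> - t' <= Ph x ==> x : (UN p:Gam. ball p r)" using boundary_layer[OF 1 2] by blast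
 have "EX p:Gam. norm (x - p) <= (2 / m) * (- Ph x)" if x: "x : Om" "- t' <= Ph x" for x proof -
  obtain p where p: "p : Gam" "dist x p > 0" "!!q. q : Gam ==> dist x p <= dist x q" "x = p - dist x p *R nu p" "ball x (dist x p) <= Om"
   using nearest_frontier_point[OF x(1)] by (elim bexE conjE) blast
  obtain q where q: "q : Gam" "dist q x < r" using t'(2)[of x] x closure_eq by auto
  define d where "d = dist x p"
  have dr: "d < r" using p(3)[OF q(1)] q(2) by (simp add: d_def dist_commute)
  have d0: "d > 0" using p(2) by (simp add: d_def)
  have "x = p - d *R nu p" using p(4) unfolding d_def .
  hence xp: "x - p = - (d *R nu p)" by simp
  have mp: "m <= nG p" using m(1) m(3)[of p] p(1) Ph_frontier[OF p(1)] closure_eq by simp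
  have nrm: "norm (x - p) = d" unfolding d_def by (simp add: dist_norm)
  have "nu p *. nu p = 1" using norm_nu[OF p(1)] by (simp add: dot_square_norm)
  hence g: "grad Ph p *. (x - p) = - (nG p * d)" unfolding xp inner_grad_eq by simp
  have "Ph x <= grad Ph p *. (x - p) + L * d^2" using Ph_Taylor[OF L(2,1), of x p] Ph_frontier[OF p(1)] unfolding nrm by linarith
  also have "... <= - (m * d) + L * d^2" unfolding g using mp d0 by (simp add: mult_right_mono)
  also have "... = - (d * (m - L * d))" by (simp add: power2_eq_square algebra_simps)
  also have "... <= - (d * (m / 2))" proof -
   have "L * d <= m / 2" using dr L by (simp add: r_def field_simps)
   thus ?thesis using d0 by simp qed
  finally have "d * (m / 2) <= - Ph x" by simp
  hence "d <= (2 / m) * (- Ph x)" using m(2) by (simp add: field_simps)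
  thus ?thesis using p(1) nrm by auto qed
 thus ?thesis using t'(1) m(2) by (intro exI[of _ t'] conjI exI[of _ "2 / m"]) auto qed

lemma nu_Lipschitz:
 "EX t>0. EX C>0. ALL x:closure Om. ALL y:closure Om. - t <= Ph x --> - t <= Ph y --> norm (nu x - nu y) <= C * norm (x - y)" proof -
 obtain L where L: "L > 0" "!!x y. norm (grad Ph x - grad Ph y) <= L * norm (x - y)" using grad_Ph_Lipschitz by blast
 obtain t m where m: "t > 0" "m > 0" "!!x. x : closure Om ==> - t <= Ph x ==> m <= nG x" using grad_Ph_layer by blast
 have "norm (nu x - nu y) <= (2 / m * L) * norm (x - y)"
  if "x : closure Om" "y : closure Om" "- t <= Ph x" "- t <= Ph y" for x y proof -
  have "norm (nu x - nu y) <= 2 / m * norm (grad Ph x - grad Ph y)" unfolding unit_normal_def by (rule norm_normalize_diff_le) (use m that in auto)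
  also have "... <= 2 / m * (L * norm (x - y))" using m L(2) by (intro mult_left_mono) auto
  finally show ?thesis by simp qed
 thus ?thesis using m L by (intro exI[of _ t] conjI exI[of _ "2 / m * L"]) auto qed

lemma local_defn_Ph: "p : Gam ==> EX r. local_defn Om p r Ph" proof -
 assume p: "p : Gam"
 have "open {x. grad Ph x ~= 0}" by (intro open_Collect_neq continuous_grad_Ph continuous_on_const)
 then obtain r where r: "r > 0" "ball p r <= {x. grad Ph x ~= 0}" by (rule openE[of _ p]) (use grad_Ph_frontier[OF p] in auto)
 have "local_defn Om p r Ph" unfolding local_defn_def using r Om_eq C2_on_subset[OF C2_Ph] by auto
 thus ?thesis by blast qed

lemma mean_curv_eq_tr: "p : Gam ==> mean_curv Om p = tr (shape_op Ph p) / (real DIM('a) - 1)"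
 using local_defn_Ph[of p] mean_curv_eq[OF open_Om, of p] div_normal_eq_tr[OF C2_Ph _ grad_Ph_frontier] by auto

end

section \<open>The torsion function: regularity inside and Lipschitz bound up to the
  boundary\<close>

lemma grad_bound_Lipschitz:
 fixes f :: "'a::euclidean_space => real"
 assumes S: "convex S" and f: "!!w. w : S ==> (f has_derivative (%v. g w *. v)) (at w)"
  and B: "!!w. w : S ==> norm (g w) <= B" and xy: "x : S" "y : S"
 shows "\<bar>f x - f y\<bar> <= B * norm (x - y)" proof -
 have "norm (f x - f y) <= B * norm (x - y)" proof (rule differentiable_bound[OF S _ _ xy, where f'="%w v. g w *. v"])
  fix w assume w: "w : S"
  show "(f has_derivative (%v. g w *. v)) (at w within S)" by (rule has_derivative_at_withinI[OF f[OF w]])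
  show "onorm (%v. g w *. v) <= B" proof (rule onorm_le)
   fix v show "norm (g w *. v) <= B * norm v" using Cauchy_Schwarz_ineq2[of "g w" v] mult_right_mono[OF B[OF w] norm_ge_zero[of v]] by simp qed qed
 thus ?thesis by simp qed

locale torsion = C2_domain +
 fixes u :: "'a::euclidean_space => real"
 assumes C2_u: "C2_on Om u" and cont_u: "continuous_on (closure Om) u"
  and lap_u: "!!x. x : Om ==> lap u x = real DIM('a)"
  and u_frontier: "!!x. x : frontier Om ==> u x = 0"
begin

lemma has_grad_u: "x : Om ==> (u has_derivative (%v. grad u x *. v)) (at x)" by (rule C1_on_has_grad[OF C2_on_C1[OF C2_u]])

lemma has_hess_u: "x : Om ==> (grad u has_derivative hess u x) (at x)" by (rule C2_on_has_hess[OF C2_u])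

definition h :: "'a => 'a => real" where
 "h z y = (norm (y - z))^2 / 2 - u y"

lemma has_grad_h: "(h z has_derivative (%v. ((y - z) - grad u y) *. v)) (at y)" if "y : Om" proof -
 have lin: "((%y. y - z) has_derivative (%v. v)) (at y)" by (auto intro!: derivative_eq_intros)
 have "((%y. ((y - z) *. (y - z)) * (1/2)) has_derivative (%v. ((y - z) *. v + v *. (y - z)) * (1/2))) (at y)" by (intro has_derivative_mult_left has_derivative_inner lin)
 from has_derivative_diff[OF this has_grad_u[OF that]]
 have *: "((%y. ((y - z) *. (y - z)) * (1/2) - u y) has_derivative (%v. ((y - z) *. v + v *. (y - z)) * (1/2) - grad u y *. v)) (at y)" .
 have half: "(b + b) * (1/2) - a = b - a" for a b :: real by simp
 have "((y - z) *. v + v *. (y - z)) * (1/2) - grad u y *. v = ((y - z) - grad u y) *. v" for v unfolding inner_commute[of v "y - z"] half by (rule inner_diff_left[symmetric])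
 with * show ?thesis unfolding h_def[abs_def] power2_norm_eq_inner by simp qed

lemma has_hess_h: "((%y. (y - z) - grad u y) has_derivative (%v. v - hess u y v)) (at y)" if "y : Om" by (intro has_derivative_diff has_hess_u that) (auto intro!: derivative_eq_intros)

lemma C2_h: "C2_on Om (h z)" by (rule C2_onI[OF open_Om has_grad_h has_hess_h]) (auto intro!: continuous_intros C2_on_continuous_hess[OF C2_u])

lemma hess_h: "y : Om ==> hess (h z) y v = v - hess u y v" by (subst hess_eqI[OF open_Om _ has_grad_h has_hess_h]) auto

lemma lap_h: "lap (h z) y = 0" if y: "y : Om" proof -
 have "lap (h z) y = tr (%v. v - hess u y v)" unfolding lap_eq_tr_hess tr_def using hess_h[OF y] by simp
 also have "... = real DIM('a) - tr (hess u y)" by (simp add: tr_def inner_diff_left sum_subtractf)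
 finally show ?thesis using lap_u[OF y] by (simp add: lap_eq_tr_hess) qed

text \<open>\<open>u\<close> is given as C2 only. More regularity comes from the harmonic function
  \<open>h 0\<close>, which differs from \<open>- u\<close> by a polynomial.\<close>

lemma pd_u: assumes b: "b : Basis"
 shows "C2_on Om (pd u b)" and "x : Om ==> lap (pd u b) x = 0" proof -
 have pdh: "pd (h 0) b y = y *. b - pd u b y" if "y : Om" for y using pd_eq_inner[OF has_grad_h[OF that, of 0], of b] pd_eq_inner[OF has_grad_u[OF that], of b] by (simp add: inner_diff_left)
 have C: "C2_on Om (pd (h 0) b)" using mean_value_property_imp_C2[OF open_Om] mean_value_property_pd[OF open_Om _ b]
   harmonic_mean_value_property[OF open_Om C2_h lap_h] by blast
 have 1: "(pd u b has_derivative (%v. (b - grad (pd (h 0) b) y) *. v)) (at y)" if y: "y : Om" for y proof (rule has_derivative_transform_within_open[OF _ open_Om y])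
  show "((%y. y *. b - pd (h 0) b y) has_derivative (%v. (b - grad (pd (h 0) b) y) *. v)) (at y)"
   using has_derivative_diff[OF has_derivative_inner_left[OF has_derivative_ident, of b] C1_on_has_grad[OF C2_on_C1[OF C] y]] by (simp add: inner_diff_right inner_commute)
 qed (simp add: pdh)
 have 2: "((%y. b - grad (pd (h 0) b) y) has_derivative (%v. - hess (pd (h 0) b) y v)) (at y)" if "y : Om" for y
  using has_derivative_diff[OF has_derivative_const C2_on_has_hess[OF C that], of b] by simp
 show "C2_on Om (pd u b)" by (rule C2_onI[OF open_Om 1 2]) (auto intro!: continuous_intros C2_on_continuous_hess[OF C])
 show "lap (pd u b) x = 0" if "x : Om" proof -
  have "hess (pd u b) x = (%v. - hess (pd (h 0) b) x v)" by (rule hess_eqI[OF open_Om that 1 2[OF that]])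
  thus ?thesis using lap_pd_eq_0[OF open_Om C2_h lap_h b that, of 0] by (simp add: lap_eq_tr_hess tr_def sum_negf) qed qed

text \<open>The exterior ball comparison with centre \<open>p + \<rho> *R nu p\<close>, rewritten at
  \<open>p\<close> with one constant for all \<open>p\<close>. In tangential directions the bound is
  quadratic in the distance, and the tangential estimates live on this gain.\<close>

lemma boundary_decay:
 "EX \<rho>>0. EX K>0. ALL p:Gam. ALL x:closure Om. (norm (x - p))^2 >= 2 * \<rho> * ((x - p) *. nu p) &
   \<bar>u x\<bar> <= K * ((norm (x - p))^2 - 2 * \<rho> * ((x - p) *. nu p)) & \<rho> <= norm (x - (p + \<rho> *R nu p))" proof -
 obtain \<rho> where \<rho>: "\<rho> > 0" "!!p. p : Gam ==> ball (p + \<rho> *R nu p) \<rho> Int Om = {}" using exterior_radius_exists unfolding exterior_radius_def by blast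
 obtain R where R: "!!x. x : closure Om ==> norm x <= R" using compact_imp_bounded[OF compact_closure] bounded_iff by blast
 obtain K where K: "K > 0" "!!c x. ball c \<rho> Int Om = {} ==> (ALL x:Om. dist c x <= 2 * R + \<rho>) ==>
  x : closure Om ==> \<bar>u x\<bar> <= K * ((norm (x - c))^2 - \<rho>^2)"
  using exterior_ball_estimate[OF open_Om bounded_Om C2_u cont_u lap_u u_frontier \<rho>(1), of "2 * R + \<rho>"] by blast
 have "(norm (x - p))^2 >= 2 * \<rho> * ((x - p) *. nu p) &
   \<bar>u x\<bar> <= K * ((norm (x - p))^2 - 2 * \<rho> * ((x - p) *. nu p)) & \<rho> <= norm (x - (p + \<rho> *R nu p))"
  if p: "p : Gam" and x: "x : closure Om" for p x proof -
  let ?c = "p + \<rho> *R nu p"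
  have pc: "p : closure Om" using p closure_eq by blast
  have far: "dist ?c y <= 2 * R + \<rho>" if "y : Om" for y proof -
   have "y : closure Om" using that closure_eq by blast
   hence "norm (p - y) <= 2 * R" using norm_triangle_ineq4[of p y] R[OF pc] R[of y] by linarith
   moreover have "norm (?c - y) <= norm (p - y) + norm (\<rho> *R nu p)" using norm_triangle_ineq[of "p - y" "\<rho> *R nu p"] by (simp add: algebra_simps)
   ultimately show ?thesis using \<rho>(1) norm_nu[OF p] by (simp add: dist_norm) qed
  have sq: "(norm (x - ?c))^2 - \<rho>^2 = (norm (x - p))^2 - 2 * \<rho> * ((x - p) *. nu p)" using norm_diff_normal_sq[OF norm_nu[OF p], of "x - p" \<rho>] by (simp add: diff_diff_add)
  have "closure Om <= - ball ?c \<rho>" using \<rho>(2)[OF p] by (intro closure_minimal) (auto simp: closed_Compl)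
  hence ge: "\<rho> <= norm (x - ?c)" using x by (auto simp: dist_norm norm_minus_commute)
  hence "\<rho>^2 <= (norm (x - ?c))^2" using \<rho>(1) by (intro power_mono) auto
  thus ?thesis using K(2)[OF \<rho>(2)[OF p] _ x] far sq ge by simp qed
 thus ?thesis using \<rho>(1) K(1) by blast qed

lemma boundary_Lipschitz: "EX C>0. ALL p:Gam. ALL x:closure Om. \<bar>u x\<bar> <= C * norm (x - p)" proof -
 obtain \<rho> K where b: "\<rho> > 0" "K > 0" "!!p x. p : Gam ==> x : closure Om ==>
   \<bar>u x\<bar> <= K * ((norm (x - p))^2 - 2 * \<rho> * ((x - p) *. nu p))" using boundary_decay by blast
 obtain R where R: "!!x. x : closure Om ==> norm x <= R" using compact_imp_bounded[OF compact_closure] bounded_iff by blast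
 have "\<bar>u x\<bar> <= (K * (2 * \<bar>R\<bar> + 2 * \<rho>)) * norm (x - p)" if p: "p : Gam" and x: "x : closure Om" for p x proof -
  have pc: "p : closure Om" using p closure_eq by blast
  have 1: "norm (x - p) <= 2 * \<bar>R\<bar>" using norm_triangle_ineq4[of x p] R[OF pc] R[OF x] by linarith
  have "\<bar>(x - p) *. nu p\<bar> <= norm (x - p)" using Cauchy_Schwarz_ineq2[of "x - p" "nu p"] norm_nu[OF p] by simp
  hence "- ((x - p) *. nu p) <= norm (x - p)" by linarith
  from mult_left_mono[OF this, of "2 * \<rho>"]
  have "- (2 * \<rho> * ((x - p) *. nu p)) <= 2 * \<rho> * norm (x - p)" using b(1) by simp
  moreover have "(norm (x - p))^2 <= 2 * \<bar>R\<bar> * norm (x - p)" unfolding power2_eq_square using 1 by (intro mult_right_mono) auto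
  ultimately have "(norm (x - p))^2 - 2 * \<rho> * ((x - p) *. nu p) <= (2 * \<bar>R\<bar> + 2 * \<rho>) * norm (x - p)" by (simp add: distrib_right)
  hence "K * ((norm (x - p))^2 - 2 * \<rho> * ((x - p) *. nu p)) <= K * ((2 * \<bar>R\<bar> + 2 * \<rho>) * norm (x - p))" using b(2) by (intro mult_left_mono) auto
  thus ?thesis using b(3)[OF p x] by (simp add: mult.assoc) qed
 moreover have "K * (2 * \<bar>R\<bar> + 2 * \<rho>) > 0" using b by (simp add: add_nonneg_pos)
 ultimately show ?thesis by blast qed

text \<open>On the ball of half the distance \<open>d\<close> to the frontier the harmonic function
  \<open>h x\<close> is of order \<open>d\<close>, and the interior gradient bound divides by
  \<open>d\<close>. With \<open>x\<close> itself as base point the gradient of \<open>h x\<close> at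
  \<open>x\<close> is \<open>- grad u x\<close>.\<close>

lemma grad_u_bounded: "EX M>0. ALL x:Om. norm (grad u x) <= M" proof -
 let ?N = "real DIM('a)"
 have N: "?N >= 1" using DIM_positive[where 'a='a] by (simp add: Suc_le_eq)
 obtain C where C: "C > 0" "!!p x. p : Gam ==> x : closure Om ==> \<bar>u x\<bar> <= C * norm (x - p)" using boundary_Lipschitz by blast
 obtain R where R: "!!x. x : closure Om ==> norm x <= R" using compact_imp_bounded[OF compact_closure] bounded_iff by blast
 let ?G = "grad_bound_const TYPE('a)"
 have G: "?G >= 0" unfolding grad_bound_const_def by (intro divide_nonneg_pos mult_nonneg_nonneg measure_nonneg bump_int_pos) auto
 define M where "M = ?G * (2 * ?N) * (2 * C + 2 * \<bar>R\<bar>) + 1"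
 have "norm (grad u x) <= M" if x: "x : Om" for x proof -
  obtain p where p: "p : Gam" "0 < dist x p" "ball x (dist x p) <= Om" using nearest_frontier_point[OF x] by blast
  define d where "d = dist x p"
  have d0: "d > 0" using p by (simp add: d_def)
  have dR: "d <= 2 * \<bar>R\<bar>" proof -
   have "x : closure Om" "p : closure Om" using x p closure_eq by auto
   thus ?thesis unfolding d_def dist_norm using norm_triangle_ineq4[of x p] R[of x] R[of p] by linarith qed
  define f where "f = h x"
  note f1 = has_grad_h[of _ x, folded f_def] and C2f = C2_h[of x, folded f_def] and harm = lap_h[of _ x, folded f_def]
  define r where "r = d / (2 * ?N)"
  have r: "r > 0" using d0 N by (simp add: r_def)
  have rd: "?N * r = d / 2" using N by (simp add: r_def)
  have sub: "cball x (?N * r) <= Om" unfolding rd using p(3) d0 by (fold d_def) (auto simp: subset_eq)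
  have "norm (grad f x) <= ?G / r * (2 * C * d + d * \<bar>R\<bar> * 2)" proof (rule harmonic_gradient_bound[OF open_Om C2f harm r sub])
   fix y assume y: "y : cball x (?N * r)"
   hence yd: "norm (y - x) <= d / 2" unfolding rd by (simp add: dist_norm norm_minus_commute)
   have yc: "y : closure Om" using y sub closure_eq by blast
   have "norm (y - p) <= 2 * d" using norm_triangle_ineq[of "y - x" "x - p", simplified] yd d0 unfolding d_def dist_norm by linarith
   hence "\<bar>u y\<bar> <= C * (2 * d)" using C(2)[OF p(1) yc] C(1) by (smt (verit) mult_left_mono)
   moreover have "(norm (y - x))^2 / 2 <= d * (2 * \<bar>R\<bar>)" proof -
   have "(norm (y - x))^2 <= d * d" unfolding power2_eq_square using yd d0 by (intro mult_mono) auto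
   also have "... <= d * (2 * \<bar>R\<bar>)" using dR d0 by (intro mult_left_mono) auto
   finally show ?thesis using zero_le_power2[of "norm (y - x)"] by linarith qed
   moreover have "0 <= (norm (y - x))^2 / 2" by simp
   ultimately show "\<bar>f y\<bar> <= 2 * C * d + d * \<bar>R\<bar> * 2" unfolding f_def h_def by linarith qed
  also have "... = ?G * (2 * ?N) * (2 * C + 2 * \<bar>R\<bar>)" unfolding r_def using d0 N by (simp add: field_simps)
  finally have "norm (grad f x) <= M - 1" by (simp add: M_def)
  moreover have "grad f x = - grad u x" using grad_eqI[OF f1[OF x]] by simp
  ultimately show ?thesis by simp qed
 moreover have "M > 0" unfolding M_def using G C N by (intro add_nonneg_pos mult_nonneg_nonneg) auto
 ultimately show ?thesis by blast qed

text \<open>\<open>Om\<close> need not be convex. Two close points lie in a common ball inside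
  \<open>Om\<close>; otherwise both values are compared with the value 0 at a nearest frontier
  point.\<close>

lemma u_Lipschitz: "EX C>0. ALL x:closure Om. ALL y:closure Om. \<bar>u x - u y\<bar> <= C * norm (x - y)" proof -
 obtain C where C: "C > 0" "!!p x. p : Gam ==> x : closure Om ==> \<bar>u x\<bar> <= C * norm (x - p)" using boundary_Lipschitz by blast
 obtain M where M: "M > 0" "!!x. x : Om ==> norm (grad u x) <= M" using grad_u_bounded by blast
 have "\<bar>u x - u y\<bar> <= (M + 3 * C) * norm (x - y)" if x: "x : closure Om" and y: "y : closure Om" for x y proof (cases "x : Om")
  case False
  hence "x : Gam" using x closure_eq by blast
  hence "\<bar>u x - u y\<bar> <= C * norm (x - y)" using C(2)[OF _ y, of x] u_frontier[of x] by (simp add: norm_minus_commute)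
  also have "... <= (M + 3 * C) * norm (x - y)" using M C by (intro mult_right_mono) auto
  finally show ?thesis .
 next
  case True
  obtain p where p: "p : Gam" "0 < dist x p" "ball x (dist x p) <= Om" using nearest_frontier_point[OF True] by blast
  show ?thesis proof (cases "norm (x - y) < dist x p")
   case True
   have "\<bar>u x - u y\<bar> <= M * norm (x - y)" by (rule grad_bound_Lipschitz[OF convex_ball has_grad_u M(2)], use p(3) in blast, use p(3) in blast)
   (use True p in "auto simp: dist_norm")
   also have "... <= (M + 3 * C) * norm (x - y)" using M C by (intro mult_right_mono) auto
   finally show ?thesis by simp
  next
   case False
   have "\<bar>u x\<bar> <= C * norm (x - p)" "\<bar>u y\<bar> <= C * norm (y - p)" using C(2)[OF p(1)] x y by auto
   moreover have xp: "norm (x - p) <= norm (x - y)" using False by (simp add: dist_norm)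
   moreover have "norm (y - p) <= norm (x - y) + norm (x - p)" using norm_triangle_ineq[of "y - x" "x - p"] by (simp add: norm_minus_commute)
   ultimately have "\<bar>u x\<bar> <= C * norm (x - y)" "\<bar>u y\<bar> <= C * (2 * norm (x - y))" using C(1) by (smt (verit) mult_left_mono)+
   hence "\<bar>u x - u y\<bar> <= 3 * C * norm (x - y)" by linarith
   also have "... <= (M + 3 * C) * norm (x - y)" using M C by (intro mult_right_mono) auto
   finally show ?thesis . qed qed
 moreover have "M + 3 * C > 0" using M C by simp
 ultimately show ?thesis by blast qed

end

section \<open>A barrier for difference quotients and decay of the tangential gradient\<close>

lemma tr_diff: "tr (%v. L v - M v) = tr L - tr M" by (simp add: tr_def inner_diff_left sum_subtractf)

lemma tr_scaleR: "tr (%v. c *R L v) = c * tr L" by (simp add: tr_def sum_distrib_left)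

lemma tr_id: "tr (%v::'a::euclidean_space. v) = real DIM('a)" by (simp add: tr_def inner_same_Basis)

lemma tr_outer: "tr (%v. (v *. n) *R m) = m *. n" by (subst euclidean_inner[of m n]) (simp add: tr_def inner_commute mult.commute)

lemma norm_orthogonal_part_le_any:
 assumes "norm m = 1"
 shows "norm (Y - (Y *. m) *R m) <= norm (Y - c *R m)" proof (rule power2_le_imp_le)
 have "m *. m = 1" using assms by (simp add: dot_square_norm)
 hence "(norm (Y - c *R m))^2 - (norm (Y - (Y *. m) *R m))^2 = (c - Y *. m)^2"
  unfolding power2_norm_eq_inner by (simp add: inner_diff_left inner_diff_right inner_commute power2_eq_square algebra_simps)
 thus "(norm (Y - (Y *. m) *R m))^2 <= (norm (Y - c *R m))^2" by (smt (verit) zero_le_power2) qed simp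

text \<open>A constant, a linear term in the normal direction and the harmonic quadratic
  \<open>|y|^2 - N (y *. n)^2\<close> of \<open>y = x - p\<close>.\<close>

definition barrier :: "'a::euclidean_space => 'a => real => 'a => real" where
 "barrier p n r x = r^2 + (2 * ((x - p) *. (x - p) - real DIM('a) * ((x - p) *. n)^2) - 2 * real DIM('a) * r * ((x - p) *. n)) / r^2"

definition barrier_grad :: "'a::euclidean_space => 'a => real => 'a => 'a" where
 "barrier_grad p n r x = (1 / r^2) *R (4 *R ((x - p) - (real DIM('a) * ((x - p) *. n)) *R n) - (2 * real DIM('a) * r) *R n)"

lemma barrier_has_grad: "(barrier p n r has_derivative (%v. barrier_grad p n r x *. v)) (at x)" unfolding barrier_def barrier_grad_def divide_inverse
 by (auto intro!: derivative_eq_intros simp: fun_eq_iff algebra_simps inner_commute)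

lemma barrier_has_hess:
 "(barrier_grad p n r has_derivative (%v. (4 / r^2) *R (v - real DIM('a) *R ((v *. n) *R n)))) (at (x::'a::euclidean_space))" proof -
 have "((%x. 4 *R ((x - p) - (real DIM('a) * ((x - p) *. n)) *R n) - (2 * real DIM('a) * r) *R n) has_derivative (%v. 4 *R (v - real DIM('a) *R ((v *. n) *R n)))) (at x)"
  by (auto intro!: derivative_eq_intros)
 from has_derivative_scaleR_right[OF this, of "1 / r^2"] show ?thesis unfolding barrier_grad_def by simp qed

text \<open>For \<open>y <= 0\<close> the linear term compensates the negative square of the normal
  component \<open>y\<close>. For \<open>y > 0\<close> the exterior ball condition bounds
  \<open>y\<close> by \<open>|x - p|^2 / (2 \<rho>)\<close>, and the restriction on \<open>r\<close>
  makes this sufficient.\<close>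

lemma barrier_ge:
 fixes p n x :: "'a::euclidean_space"
 assumes n: "norm n = 1" and \<rho>: "\<rho> > 0" and r: "0 < r" "r <= \<rho> / (2 * real DIM('a))"
  and x: "norm (x - p) <= r" "2 * \<rho> * ((x - p) *. n) <= (norm (x - p))^2"
 shows "r^2 + (norm (x - p))^2 / r^2 <= barrier p n r x" proof -
 let ?N = "real DIM('a)"
 define Q where "Q = norm (x - p)"
 define y where "y = (x - p) *. n"
 have N: "?N > 0" by simp
 have y: "\<bar>y\<bar> <= r" using Cauchy_Schwarz_ineq2[of "x - p" n] n x by (simp add: y_def)
 have "0 <= Q^2 - 2 * ?N * y^2 - 2 * ?N * r * y" proof (cases "y <= 0")
  case True
  have "2 * ?N * (- y) * (- y) <= 2 * ?N * (- y) * r" using True y N by (intro mult_left_mono mult_nonneg_nonneg) auto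
  hence "2 * ?N * y^2 + 2 * ?N * r * y <= 0" by (simp add: power2_eq_square algebra_simps)
  thus ?thesis using zero_le_power2[of Q] by linarith
 next
  case False
  have "2 * ?N * y * y <= 2 * ?N * y * r" using False y by (intro mult_left_mono mult_nonneg_nonneg) auto
  moreover have "4 * ?N * r * y <= 2 * \<rho> * y" using r N False by (intro mult_right_mono) (auto simp: field_simps)
  moreover have "2 * \<rho> * y <= Q^2" using x(2) by (simp add: y_def Q_def)
  ultimately show ?thesis by (simp add: power2_eq_square algebra_simps) qed
 hence "Q^2 / r^2 <= (2 * (Q^2 - ?N * y^2) - 2 * ?N * r * y) / r^2" using r by (intro divide_right_mono) (auto simp: algebra_simps)
 thus ?thesis by (simp add: barrier_def y_def Q_def power2_norm_eq_inner) qed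

context torsion
begin

lemma nu_Lipschitz_frontier: "EX L>0. ALL x:Gam. ALL y:Gam. norm (nu x - nu y) <= L * norm (x - y)" proof -
 obtain t L where t: "t > 0" "L > 0" "!!x y. x : closure Om ==> y : closure Om ==> - t <= Ph x ==> - t <= Ph y ==> norm (nu x - nu y) <= L * norm (x - y)" using nu_Lipschitz by blast
 have "norm (nu x - nu y) <= L * norm (x - y)" if "x : Gam" "y : Gam" for x y using t that Ph_frontier closure_eq by (intro t(3)) auto
 thus ?thesis using t(2) by blast qed

text \<open>The difference \<open>u (x + h *R e) - u x\<close> is harmonic and has boundary values,
  which \<open>grad u\<close> lacks. On the frontier of \<open>S\<close> either one of the two
  points lies on \<open>Gam\<close>, where \<open>boundary_decay\<close> and the near tangency of
  \<open>e\<close> give order \<open>h * (h + Q)\<close>, or \<open>Q = r\<close>, where the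
  Lipschitz bound gives order \<open>h\<close> and the barrier is at least 1.\<close>

lemma difference_quotient_bound:
 "EX C>0. EX r\<^sub>0>0. ALL p:Gam. ALL e r h. norm e = 1 & e *. nu p = 0 & 0 < r & r <= r\<^sub>0 & 0 < h & h <= r^2 -->
   (ALL x:Om. x + h *R e : Om & norm (x - p) < r --> \<bar>u (x + h *R e) - u x\<bar> <= C * h * barrier p (nu p) r x)" proof -
 let ?N = "real DIM('a)"
 obtain \<rho> K where b: "\<rho> > 0" "K > 0" "!!p x. p : Gam ==> x : closure Om ==> 2 * \<rho> * ((x - p) *. nu p) <= (norm (x - p))^2"
   "!!p x. p : Gam ==> x : closure Om ==> \<bar>u x\<bar> <= K * ((norm (x - p))^2 - 2 * \<rho> * ((x - p) *. nu p))" using boundary_decay by blast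
 obtain L where L: "L > 0" "!!x y. x : Gam ==> y : Gam ==> norm (nu x - nu y) <= L * norm (x - y)" using nu_Lipschitz_frontier by blast
 obtain A where A: "A > 0" "!!x y. x : closure Om ==> y : closure Om ==> \<bar>u x - u y\<bar> <= A * norm (x - y)" using u_Lipschitz by blast
 define C where "C = 2 * K * (1 + 2 * \<rho> * L) + A"
 have C0: "C > 0" using b L A by (auto simp: C_def intro!: add_pos_pos mult_pos_pos)
 have "\<bar>u (x + h *R e) - u x\<bar> <= C * h * barrier p (nu p) r x"
  if p: "p : Gam" and e: "norm e = 1" "e *. nu p = 0" and r: "0 < r" "r <= \<rho> / (2 * ?N)" and h: "0 < h" "h <= r^2"
   and x: "x : Om" "x + h *R e : Om" "norm (x - p) < r" for p e r h x proof -
  let ?B = "barrier p (nu p) r"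
  define S where "S = Om Int {x. x + h *R e : Om} Int ball p r"
  have shift: "open {x. x + h *R e : Om}" "closed {x. x + h *R e : closure Om}"
   using continuous_open_vimage[OF open_Om, of "%x. x + h *R e"] continuous_closed_vimage[of "closure Om" "%x. x + h *R e"] by (auto simp: vimage_def intro!: continuous_intros)
  have S: "open S" "bounded S" unfolding S_def using open_Om shift bounded_Om by (auto intro: open_Int bounded_Int)
  have "closure S <= closure Om Int {x. x + h *R e : closure Om} Int cball p r" unfolding S_def using closure_subset[of Om] shift(2) by (intro closure_minimal closed_Int) auto
  hence clS: "y : closure Om" "y + h *R e : closure Om" "norm (y - p) <= r" if "y : closure S" for y using that by (auto simp: dist_norm norm_minus_commute)
  have Bge: "r^2 + (norm (y - p))^2 / r^2 <= ?B y" if "y : closure S" for y using barrier_ge[OF norm_nu[OF p] b(1) r clS(3)[OF that] b(3)[OF p clS(1)[OF that]]] .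
  have fr: "\<bar>u (y + h *R e) - u y\<bar> <= C * h * ?B y" if y: "y : frontier S" for y proof -
   have yc: "y : closure S" and yS: "y ~: S" using y S(1) by (auto simp: frontier_def interior_open)
   define Q where "Q = norm (y - p)"
   have BQ: "r^2 + Q^2 / r^2 <= ?B y" using Bge[OF yc] by (simp add: Q_def)
   \<comment> \<open>The arithmetic-geometric mean inequality. With \<open>h <= r^2\<close> it
     bounds \<open>h + Q\<close> by twice the barrier, which explains the term \<open>r^2\<close> in
     the barrier and the restriction on \<open>h\<close>.\<close>
   have "2 * Q <= r^2 + Q^2 / r^2" using sum_squares_bound[of r "Q / r"] r by (simp add: power_divide)
   hence hQ: "h + Q <= 2 * ?B y" "0 <= ?B y" using BQ h zero_le_power2[of r] zero_le_divide_iff[of "Q^2" "r^2"] by (smt (verit) norm_ge_zero Q_def zero_le_power2)+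
   have bnd: "\<bar>e *. nu q\<bar> <= L * (h + Q)" if q: "q : Gam" "norm (q - p) <= h + Q" for q proof -
   have "\<bar>e *. nu q\<bar> = \<bar>e *. (nu q - nu p)\<bar>" using e by (simp add: inner_diff_right)
   also have "... <= norm (nu q - nu p)" using Cauchy_Schwarz_ineq2[of e "nu q - nu p"] e by simp
   also have "... <= L * norm (q - p)" by (rule L(2)[OF q(1) p])
   also have "... <= L * (h + Q)" using q L by (intro mult_left_mono) auto
   finally show ?thesis . qed
   have main: "K * (h^2 + 2 * \<rho> * (h * \<bar>e *. nu q\<bar>)) <= C * h * ?B y" if q: "q : Gam" "norm (q - p) <= h + Q" for q proof -
   have "h^2 + 2 * \<rho> * (h * \<bar>e *. nu q\<bar>) <= h * (h + Q) + 2 * \<rho> * (h * (L * (h + Q)))"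
   using h b(1) bnd[OF q] by (intro add_mono mult_left_mono) (auto simp: power2_eq_square Q_def)
   also have "... = h * (1 + 2 * \<rho> * L) * (h + Q)" by (simp add: algebra_simps)
   also have "... <= h * (1 + 2 * \<rho> * L) * (2 * ?B y)" using h b L hQ by (intro mult_left_mono) auto
   finally have "K * (h^2 + 2 * \<rho> * (h * \<bar>e *. nu q\<bar>)) <= K * (h * (1 + 2 * \<rho> * L) * (2 * ?B y))" using b by (intro mult_left_mono) auto
   also have "... <= C * h * ?B y" using mult_nonneg_nonneg[of "A * h" "?B y"] A h hQ by (simp add: C_def algebra_simps)
   finally show ?thesis . qed
   have "y : Gam | y + h *R e : Gam | Q = r" using yS clS[OF yc] closure_eq by (auto simp: S_def Q_def dist_norm norm_minus_commute)
   then consider "y : Gam" | "y + h *R e : Gam" | "Q = r" by blast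
   thus ?thesis proof cases
   case 1
   have "\<bar>u (y + h *R e) - u y\<bar> <= K * (h^2 - 2 * \<rho> * (h * (e *. nu y)))" using b(4)[OF 1 clS(2)[OF yc]] u_frontier[OF 1] e h by simp
   also have "... <= K * (h^2 + 2 * \<rho> * (h * \<bar>e *. nu y\<bar>))"
   using b h mult_left_mono[of "- (e *. nu y)" "\<bar>e *. nu y\<bar>" "2 * \<rho> * h"] by (intro mult_left_mono) auto
   also have "... <= C * h * ?B y" using h by (intro main 1) (simp add: Q_def)
   finally show ?thesis .
   next
   case 2
   have "\<bar>u (y + h *R e) - u y\<bar> <= K * (h^2 + 2 * \<rho> * (h * (e *. nu (y + h *R e))))" using b(4)[OF 2 clS(1)[OF yc]] u_frontier[OF 2] e h by simp
   also have "... <= K * (h^2 + 2 * \<rho> * (h * \<bar>e *. nu (y + h *R e)\<bar>))"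
   using b h mult_left_mono[of "e *. nu (y + h *R e)" "\<bar>e *. nu (y + h *R e)\<bar>" "2 * \<rho> * h"] by (intro mult_left_mono) auto
   also have "... <= C * h * ?B y" using norm_triangle_ineq[of "y - p" "h *R e"] h e by (intro main 2) (simp add: Q_def algebra_simps)
   finally show ?thesis .
   next
   case 3
   have "\<bar>u (y + h *R e) - u y\<bar> <= A * h * 1" using A(2)[OF clS(2) clS(1), OF yc yc] e h by simp
   also have "... <= A * h * ?B y" using BQ 3 r A h zero_le_power2[of r] by (intro mult_left_mono) auto
   also have "... <= C * h * ?B y" using hQ h b L by (intro mult_right_mono) (auto simp: C_def)
   finally show ?thesis . qed qed
  have "\<sigma> * (u (x + h *R e) - u x) - C * h * ?B x <= 0" if \<sigma>: "\<sigma> = 1 | \<sigma> = -1" for \<sigma>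
  proof (rule maximum_principle[OF S, where f="%x. \<sigma> * (u (x + h *R e) - u x) - C * h * ?B x"
   and G="%x. \<sigma> *R (grad u (x + h *R e) - grad u x) - (C * h) *R barrier_grad p (nu p) r x"
   and H="%x v. \<sigma> *R (hess u (x + h *R e) v - hess u x v) - (C * h) *R ((4 / r^2) *R (v - ?N *R ((v *. nu p) *R nu p)))"])
   have "continuous_on (closure S) (%x. u (x + h *R e))" by (rule continuous_on_compose2[OF cont_u]) (use clS in "auto intro!: continuous_intros")
   moreover have "continuous_on (closure S) u" using continuous_on_subset[OF cont_u] clS(1) by blast
   moreover have "continuous_on (closure S) ?B" by (rule has_derivative_continuous_on) (rule has_derivative_at_withinI[OF barrier_has_grad])
   ultimately show "continuous_on (closure S) (%x. \<sigma> * (u (x + h *R e) - u x) - C * h * ?B x)" by (intro continuous_intros)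
  next
   fix y assume "y : S"
   hence y: "y : Om" "y + h *R e : Om" by (auto simp: S_def)
   have sh: "((%y. y + h *R e) has_derivative (%v. v)) (at y)" by (auto intro!: derivative_eq_intros)
   have "((%x. \<sigma> * (u (x + h *R e) - u x) - C * h * ?B x) has_derivative
   (%v. \<sigma> * (grad u (y + h *R e) *. v - grad u y *. v) - C * h * (barrier_grad p (nu p) r y *. v))) (at y)" using has_derivative_compose[OF sh has_grad_u[OF y(2)]]
   by (intro has_derivative_diff has_derivative_mult_right has_grad_u y barrier_has_grad) auto
   thus "((%x. \<sigma> * (u (x + h *R e) - u x) - C * h * ?B x) has_derivative (%v. (\<sigma> *R (grad u (y + h *R e) - grad u y) - (C * h) *R barrier_grad p (nu p) r y) *. v)) (at y)"
   by (simp add: inner_diff_left)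
   show "((%x. \<sigma> *R (grad u (x + h *R e) - grad u x) - (C * h) *R barrier_grad p (nu p) r x) has_derivative
   (%v. \<sigma> *R (hess u (y + h *R e) v - hess u y v) - (C * h) *R ((4 / r^2) *R (v - ?N *R ((v *. nu p) *R nu p))))) (at y)" using has_derivative_compose[OF sh has_hess_u[OF y(2)]]
   by (intro has_derivative_diff has_derivative_scaleR_right has_hess_u y barrier_has_hess) auto
   have "tr (hess u (y + h *R e)) = ?N" "tr (hess u y) = ?N" using lap_u y by (auto simp: lap_eq_tr_hess)
   moreover have "nu p *. nu p = 1" using norm_nu[OF p] by (simp add: dot_square_norm)
   ultimately show "0 <= tr (%v. \<sigma> *R (hess u (y + h *R e) v - hess u y v) - (C * h) *R ((4 / r^2) *R (v - ?N *R ((v *. nu p) *R nu p))))"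
   by (simp only: tr_diff tr_scaleR tr_id tr_outer) simp
  next
   fix y assume "y : frontier S"
   from fr[OF this] \<sigma> show "\<sigma> * (u (y + h *R e) - u y) - C * h * ?B y <= 0" by (auto simp: abs_le_iff)
  next
   show "x : S" using x by (auto simp: S_def dist_norm norm_minus_commute) qed
  from this[of 1] this[of "-1"] show ?thesis by (simp add: abs_le_iff) qed
 thus ?thesis using C0 b(1) by (intro exI[of _ C] conjI exI[of _ "\<rho> / (2 * ?N)"]) auto qed

text \<open>On the normal through \<open>p\<close> the barrier is at most
  \<open>r^2 + 2 N s / r\<close>; the derivative is reached as the step \<open>h\<close> tends to
  0.\<close>

lemma tangential_derivative_bound:
 "EX C>0. EX r\<^sub>0>0. ALL p:Gam. ALL e r s. norm e = 1 & e *. nu p = 0 & 0 < s & s < r & r <= r\<^sub>0 & p - s *R nu p : Om -->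
   \<bar>grad u (p - s *R nu p) *. e\<bar> <= C * (r^2 + 2 * real DIM('a) * s / r)" proof -
 let ?N = "real DIM('a)"
 obtain C r\<^sub>0 where C: "C > 0" "r\<^sub>0 > 0" and C3: "ALL p:Gam. ALL e r h. norm e = 1 & e *. nu p = 0 & 0 < r & r <= r\<^sub>0 & 0 < h & h <= r^2 -->
   (ALL x:Om. x + h *R e : Om & norm (x - p) < r --> \<bar>u (x + h *R e) - u x\<bar> <= C * h * barrier p (nu p) r x)" using difference_quotient_bound by metis
 have "\<bar>grad u (p - s *R nu p) *. e\<bar> <= C * (r^2 + 2 * ?N * s / r)"
  if p: "p : Gam" and e: "norm e = 1" "e *. nu p = 0" and s: "0 < s" "s < r" "r <= r\<^sub>0" and x: "p - s *R nu p : Om" for p e r s proof -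
  let ?x = "p - s *R nu p"
  have nn: "nu p *. nu p = 1" using norm_nu[OF p] by (simp add: dot_square_norm)
  have "barrier p (nu p) r ?x = r^2 + (2 * (s^2 - ?N * s^2) + 2 * ?N * r * s) / r^2" by (simp add: barrier_def nn power2_eq_square)
  also have "... <= r^2 + (2 * ?N * r * s) / r^2" using s DIM_positive[where 'a='a] by (intro add_left_mono divide_right_mono) (auto simp: Suc_le_eq mult_le_cancel_right1)
  also have "... = r^2 + 2 * ?N * s / r" using s by (simp add: power2_eq_square)
  finally have B: "barrier p (nu p) r ?x <= r^2 + 2 * ?N * s / r" .
  have "((%h. u (?x + h *R e)) has_field_derivative (grad u ?x *. e)) (at 0 within {0<..})" using has_derivative_inner_D[of u "grad u ?x" ?x 0 e] has_grad_u[OF x] by simp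
  hence lim: "((%h. \<bar>(u (?x + h *R e) - u ?x) / h\<bar>) \<longlongrightarrow> \<bar>grad u ?x *. e\<bar>) (at_right 0)" by (intro tendsto_rabs) (simp add: has_field_derivative_iff)
  obtain ep where ep: "ep > 0" "ball ?x ep <= Om" using open_Om x open_contains_ball by blast
  have "eventually (%h. h < min ep (r^2)) (at_right (0::real))" using ep s by (intro order_tendstoD(2)[OF tendsto_ident_at]) simp
  moreover have "eventually (%h. 0 < h) (at_right (0::real))" by (simp add: eventually_at_right_less)
  ultimately have "eventually (%h. \<bar>(u (?x + h *R e) - u ?x) / h\<bar> <= C * (r^2 + 2 * ?N * s / r)) (at_right 0)" proof eventually_elim
   case (elim h)
   have "?x + h *R e : ball ?x ep" using elim e by (simp add: dist_norm)
   hence "\<bar>u (?x + h *R e) - u ?x\<bar> <= C * h * barrier p (nu p) r ?x" using ep s e elim x norm_nu[OF p] by (intro C3[rule_format, OF p _ x]) auto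
   also have "... <= C * h * (r^2 + 2 * ?N * s / r)" using B C elim by (intro mult_left_mono) auto
   finally show ?case using elim by (simp add: abs_divide divide_le_eq mult_ac) qed
  thus ?thesis by (rule tendsto_upperbound[OF lim]) simp qed
 thus ?thesis using C(1,2) by blast qed

text \<open>Points with \<open>- (dl ^ 3) <= Ph x\<close> have depth \<open>s\<close> of order
  \<open>dl^3\<close>, and the choice \<open>r = dl\<close> balances \<open>r^2\<close> and
  \<open>s / r\<close> at order \<open>dl^2\<close>. Replacing the normal at the nearest frontier
  point by the one at \<open>x\<close> stays within this order.\<close>

lemma tangential_gradient_bound:
 "EX C>0. EX dl0>0. ALL dl. 0 < dl & dl <= dl0 --> (ALL x:Om. - (dl ^ 3) <= Ph x -->
   norm (grad u x - (grad u x *. nu x) *R nu x) <= C * dl^2)" proof -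
 let ?N = "real DIM('a)"
 obtain C r\<^sub>0 where C: "C > 0" "r\<^sub>0 > 0" and C3: "ALL p:Gam. ALL e r s. norm e = 1 & e *. nu p = 0 & 0 < s & s < r & r <= r\<^sub>0 & p - s *R nu p : Om -->
   \<bar>grad u (p - s *R nu p) *. e\<bar> <= C * (r^2 + 2 * ?N * s / r)" using tangential_derivative_bound by metis
 obtain t1 L where L: "t1 > 0" "L > 0" "!!x y. x : closure Om ==> y : closure Om ==> - t1 <= Ph x ==> - t1 <= Ph y ==> norm (nu x - nu y) <= L * norm (x - y)" using nu_Lipschitz by blast
 obtain t2 D where D: "t2 > 0" "D > 0" "!!x. x : Om ==> - t2 <= Ph x ==> EX p:Gam. norm (x - p) <= D * (- Ph x)" using dist_frontier_le_Ph by blast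
 obtain t3 m where m: "t3 > 0" "m > 0" "!!x. x : closure Om ==> - t3 <= Ph x ==> m <= nG x" using grad_Ph_layer by blast
 obtain M where M: "M > 0" "!!x. x : Om ==> norm (grad u x) <= M" using grad_u_bounded by blast
 \<comment> \<open>The last entry ensures \<open>s < dl\<close>, as
   \<open>tangential_derivative_bound\<close> requires of \<open>s\<close> and
   \<open>r = dl\<close>.\<close>
 define dl0 where "dl0 = Min {1, t1, t2, t3, r\<^sub>0, 1 / (2 * D)}"
 have dl0: "dl0 > 0" "dl0 <= 1" "dl0 <= t1" "dl0 <= t2" "dl0 <= t3" "dl0 <= r\<^sub>0" "dl0 <= 1 / (2 * D)" using L D m C by (auto simp: dl0_def)
 define C' where "C' = C * (1 + 2 * ?N * D) + M * L * D"
 have "norm (grad u x - (grad u x *. nu x) *R nu x) <= C' * dl^2"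
  if dl: "0 < dl" "dl <= dl0" and x: "x : Om" "- (dl ^ 3) <= Ph x" for dl x proof -
  have d3: "dl ^ 3 = dl^2 * dl" by (simp add: power2_eq_square power3_eq_cube)
  have d2: "dl^2 <= 1" "dl^2 <= dl" using dl dl0 power_decreasing[of 1 2 dl] by (auto simp: power_le_one)
  have d3': "dl ^ 3 <= dl0" "dl ^ 3 <= dl^2" using dl dl0 power_decreasing[of 1 3 dl] power_decreasing[of 2 3 dl] by auto
  obtain p where p: "p : Gam" "0 < dist x p" "!!q. q : Gam ==> dist x p <= dist x q" "x = p - dist x p *R nu p" using nearest_frontier_point[OF x(1)] by blast
  define s where "s = dist x p"
  have xs: "p - s *R nu p = x" "s > 0" using p by (auto simp: s_def)
  obtain q where q: "q : Gam" "norm (x - q) <= D * (- Ph x)" using D(3)[OF x(1)] x(2) d3' dl0 by force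
  have "s <= norm (x - q)" using p(3)[OF q(1)] by (simp add: s_def dist_norm)
  also have "... <= D * dl ^ 3" using q(2) D x(2) by (smt (verit) mult_left_mono)
  finally have sD: "s <= D * dl ^ 3" .
  have "D * dl ^ 3 <= D * (dl * dl0)" unfolding d3 using D dl d2 by (intro mult_left_mono) (auto simp: mult_mono power2_eq_square)
  also have "... <= D * (dl * (1 / (2 * D)))" using D dl dl0 by (intro mult_left_mono) auto
  also have "... < dl" using D dl by simp
  finally have sdl: "s < dl" using sD by linarith
  let ?Y = "grad u x" and ?n = "nu p" and ?m = "nu x"
  have pc: "p : closure Om" "x : closure Om" using p(1) x closure_eq by auto
  have "grad Ph x ~= 0" using m(3)[OF pc(2)] x(2) d3' dl0 m by force
  hence m1: "norm ?m = 1" by (rule norm_unit_normal)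
  have n1: "norm ?n = 1" by (rule norm_nu[OF p(1)])
  define Tn where "Tn = ?Y - (?Y *. ?n) *R ?n"
  have Tn: "norm Tn <= C * (1 + 2 * ?N * D) * dl^2" proof (cases "Tn = 0")
   case True thus ?thesis using C D dl by simp
  next
   case False
   have nn: "?n *. ?n = 1" using n1 by (simp add: dot_square_norm)
   have Tnn: "Tn *. ?n = 0" unfolding Tn_def by (simp add: inner_diff_left nn)
   hence YT: "?Y *. Tn = Tn *. Tn" unfolding Tn_def by (simp add: inner_diff_left inner_commute)
   have "\<bar>grad u (p - s *R ?n) *. (Tn /R norm Tn)\<bar> <= C * (dl^2 + 2 * ?N * s / dl)" using False Tnn xs sdl dl dl0 x by (intro C3[rule_format, OF p(1)]) auto
   moreover have "?Y *. (Tn /R norm Tn) = norm Tn" using False YT by (simp add: dot_square_norm power2_eq_square)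
   moreover have "s / dl <= D * dl^2" using sD dl unfolding d3 by (simp add: divide_le_eq mult.assoc)
   hence "C * (dl^2 + 2 * ?N * (s / dl)) <= C * (dl^2 + 2 * ?N * (D * dl^2))" using C by (intro mult_left_mono add_left_mono) auto
   ultimately show ?thesis unfolding xs by (simp add: algebra_simps) qed
  have "norm (?Y - (?Y *. ?m) *R ?m) <= norm (?Y - (?Y *. ?n) *R ?m)" by (rule norm_orthogonal_part_le_any[OF m1])
  also have "?Y - (?Y *. ?n) *R ?m = Tn + (?Y *. ?n) *R (?n - ?m)" by (simp add: Tn_def algebra_simps)
  also have "norm ... <= norm Tn + \<bar>?Y *. ?n\<bar> * norm (?n - ?m)" using norm_triangle_ineq[of Tn] by (metis norm_scaleR)
  also have "... <= C * (1 + 2 * ?N * D) * dl^2 + M * (L * (D * dl^2))" proof (intro add_mono Tn mult_mono)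
   show "\<bar>?Y *. ?n\<bar> <= M" using Cauchy_Schwarz_ineq2[of ?Y ?n] n1 M(2)[OF x(1)] by simp
   have "norm (?n - ?m) <= L * norm (p - x)" using x(2) d3' dl0 L Ph_frontier[OF p(1)] by (intro L(3) pc) auto
   also have "... <= L * (D * dl^2)" proof (rule mult_left_mono)
   have "norm (p - x) <= D * dl ^ 3" using sD by (simp add: s_def dist_norm norm_minus_commute)
   also have "... <= D * dl^2" using d3' D by (intro mult_left_mono) auto
   finally show "norm (p - x) <= D * dl^2" . qed (use L in simp)
   finally show "norm (?n - ?m) <= L * (D * dl^2)" . qed (use M L D in auto)
  finally show ?thesis by (simp add: C'_def algebra_simps) qed
 moreover have "C' > 0" using C M L D by (auto simp: C'_def intro!: add_pos_pos mult_pos_pos add_pos_nonneg)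
 ultimately show ?thesis using dl0(1) by blast qed

end

section \<open>Cutoffs by the defining function and the volume of boundary layers\<close>

lemma set_integrable_compact_support:
 fixes f :: "'a::euclidean_space => real"
 assumes K: "compact K" "K <= U" and f: "continuous_on K f" "!!x. x : U ==> x ~: K ==> f x = 0"
 shows "set_integrable lborel U f" proof -
 have "(%x. indicator K x *R f x) = (%x. indicator U x *R f x)" using K(2) f(2) by (auto simp: fun_eq_iff indicator_def)
 thus ?thesis using borel_integrable_compact[OF K(1) f(1)] by (simp add: set_integrable_def) qed

lemma set_integral_subset_support:
 fixes f :: "'a::euclidean_space => real"
 assumes "U <= V" "!!x. x : V ==> x ~: U ==> f x = 0"
 shows "(LINT x:V|M. f x) = (LINT x:U|M. f x)" unfolding set_lebesgue_integral_def using assms by (intro Bochner_Integration.integral_cong) (auto simp: indicator_def)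

lemma set_integral_sum':
 fixes f :: "'i => 'a => real"
 assumes "!!i. i : I ==> set_integrable M A (f i)"
 shows "(LINT x:A|M. (SUM i:I. f i x)) = (SUM i:I. LINT x:A|M. f i x)" using assms unfolding set_lebesgue_integral_def set_integrable_def
 by (simp add: sum_distrib_left Bochner_Integration.integral_sum)

lemma tr_add: "tr (%v. L v + M v) = tr L + tr M" by (simp add: tr_def inner_add_left sum.distrib)

lemma tr_outer': "tr (%v. (n *. v) *R m) = m *. n" using tr_outer[of n m] by (simp add: inner_commute)

text \<open>A C2 step, 0 up to 1 and 1 from 2 on. The outer cube bounds its derivative by 9 times
  the square root of the step, which later allows the Hessian in error terms to be absorbed.\<close>

definition smooth_step :: "real => real" where
 "smooth_step s = pos_pow 3 (1 - pos_pow 3 (2 - s))"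

definition smooth_step' :: "real => real" where
 "smooth_step' s = 9 * (pos_pow 2 (1 - pos_pow 3 (2 - s)) * pos_pow 2 (2 - s))"

lemma DERIV_pos_pow_comp:
 assumes "(f has_field_derivative D) (at x)"
 shows "((%x. pos_pow (Suc (Suc n)) (f x)) has_field_derivative (real (Suc (Suc n)) * pos_pow (Suc n) (f x)) * D) (at x)" by (rule DERIV_chain2[OF DERIV_pos_pow assms])

lemma DERIV_smooth_step: "(smooth_step has_field_derivative smooth_step' s) (at s)" proof -
 have "((%s. 2 - s) has_field_derivative -1) (at s)" by (auto intro!: derivative_eq_intros)
 from DERIV_pos_pow_comp[OF this, of 1]
 have "((%s. 1 - pos_pow 3 (2 - s)) has_field_derivative 0 - (3 * pos_pow 2 (2 - s) * -1)) (at s)" by (intro DERIV_diff DERIV_const) (simp add: numeral_2_eq_2 numeral_3_eq_3)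
 from DERIV_pos_pow_comp[OF this, of 1] show ?thesis by (simp add: smooth_step_def[abs_def] smooth_step'_def numeral_2_eq_2 numeral_3_eq_3 mult_ac) qed

definition smooth_step'' :: "real => real" where
 "smooth_step'' s = 9 * (2 * pos_pow 1 (1 - pos_pow 3 (2 - s)) * (3 * pos_pow 2 (2 - s)) * pos_pow 2 (2 - s)
   + 2 * pos_pow 1 (2 - s) * -1 * pos_pow 2 (1 - pos_pow 3 (2 - s)))"

lemma DERIV_smooth_step': "(smooth_step' has_field_derivative smooth_step'' s) (at s)" proof -
 have 1: "((%s. 2 - s) has_field_derivative -1) (at s)" by (auto intro!: derivative_eq_intros)
 from DERIV_pos_pow_comp[OF this, of 1]
 have "((%s. 1 - pos_pow 3 (2 - s)) has_field_derivative 0 - (3 * pos_pow 2 (2 - s) * -1)) (at s)" by (intro DERIV_diff DERIV_const) (simp add: numeral_2_eq_2 numeral_3_eq_3)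
 from DERIV_cmult[OF DERIV_mult[OF DERIV_pos_pow_comp[OF this, of 0] DERIV_pos_pow_comp[OF 1, of 0]], of 9]
 show ?thesis by (simp add: smooth_step''_def smooth_step'_def[abs_def] numeral_2_eq_2 numeral_3_eq_3) qed

lemma continuous_on_smooth_step'': "continuous_on S smooth_step''" unfolding smooth_step''_def[abs_def] by (intro continuous_intros)

lemma smooth_step_eq:
 "s <= 1 ==> smooth_step s = 0" "s >= 2 ==> smooth_step s = 1"
 "s <= 1 ==> smooth_step' s = 0" "s >= 2 ==> smooth_step' s = 0" proof -
 have 1: "1 <= pos_pow 3 (2 - s)" if "s <= 1" using one_le_power[of "2 - s" 3] that by (simp add: pos_pow_def)
 show "s <= 1 ==> smooth_step s = 0" "s <= 1 ==> smooth_step' s = 0" using 1 by (auto simp: smooth_step_def smooth_step'_def pos_pow_def[of _ "1 - _"])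
 show "s >= 2 ==> smooth_step s = 1" "s >= 2 ==> smooth_step' s = 0" by (auto simp: smooth_step_def smooth_step'_def pos_pow_def) qed

lemma smooth_step_bounds: "0 <= smooth_step s" "smooth_step s <= 1" "0 <= smooth_step' s" "smooth_step' s <= 9 * sqrt (smooth_step s)" proof -
 show "0 <= smooth_step s" "0 <= smooth_step' s" by (auto simp: smooth_step_def smooth_step'_def)
 define a where "a = max 0 (1 - pos_pow 3 (2 - s))"
 define b where "b = max 0 (2 - s)"
 have a: "0 <= a" "a <= 1" using pos_pow_nonneg[of 3 "2 - s"] by (auto simp: a_def)
 have s: "smooth_step s = a ^ 3" "smooth_step' s = 9 * (a^2 * b^2)" by (auto simp: smooth_step_def smooth_step'_def pos_pow_def a_def b_def)
 show "smooth_step s <= 1" using a by (simp add: s power_le_one)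
 show "smooth_step' s <= 9 * sqrt (smooth_step s)" proof (cases "s <= 1")
  case True
  thus ?thesis by (simp add: smooth_step_eq)
 next
  case False
  hence "0 <= b" "b <= 1" by (auto simp: b_def)
  hence "a^2 * b^2 <= a^2 * 1" by (intro mult_left_mono) (auto simp: power_le_one)
  moreover have "a^2 <= sqrt (a ^ 3)" proof (rule real_le_rsqrt)
   show "(a^2)^2 <= a ^ 3" using power_decreasing[of 3 4 a] a by (simp flip: power_mult) qed
  ultimately show ?thesis by (simp add: s) qed qed

context C2_domain
begin

lemma tr_hess_Ph_integrable: "integrable lborel (%x. tr (hess Ph x))" by (rule integrable_continuous_compact_support[of _ "cball 0 R0"])
   (auto simp: tr_def hess_Ph_outside intro!: continuous_intros C2_on_continuous_hess[OF C2_Ph])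

text \<open>The total divergence of \<open>arctan (Ph x / ep) *R grad Ph x\<close> is zero. One of
  its two terms is at least \<open>m^2 / (2 * ep)\<close> on the layer and nonnegative elsewhere;
  the other is bounded by \<open>pi / 2\<close> times the absolute Laplacian of \<open>Ph\<close>,
  whose integral does not involve \<open>ep\<close>.\<close>

lemma layer_volume:
 assumes m: "m > 0"
 shows "EX C>0. ALL ep>0. compact {x. \<bar>Ph x\<bar> <= ep & m <= nG x} & measure lborel {x. \<bar>Ph x\<bar> <= ep & m <= nG x} <= C * ep" proof -
 define A where "A = (\<integral>x. pi / 2 * \<bar>tr (hess Ph x)\<bar> \<partial>lborel)"
 have iA: "integrable lborel (%x. pi / 2 * \<bar>tr (hess Ph x)\<bar>)" using tr_hess_Ph_integrable by simp
 have A0: "A >= 0" unfolding A_def by (intro Bochner_Integration.integral_nonneg) auto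
 have "compact {x. \<bar>Ph x\<bar> <= ep & m <= nG x} & measure lborel {x. \<bar>Ph x\<bar> <= ep & m <= nG x} <= (2 * A / m^2 + 1) * ep" if ep: "ep > 0" for ep proof -
  let ?S = "{x. \<bar>Ph x\<bar> <= ep & m <= nG x}"
  have "closed ?S" by (intro closed_Collect_conj closed_Collect_le continuous_intros continuous_Ph continuous_grad_Ph)
  moreover have "?S <= cball 0 R0" proof
   fix x assume x: "x : ?S"
   show "x : cball 0 R0" proof (rule ccontr)
   assume "x ~: cball 0 R0"
   hence "x : - cball 0 R0" by simp
   have "((%x. Ph x) has_derivative (%v. 0 *. v)) (at x)"
   by (rule has_derivative_transform_within_open[of "%_. 0" _ _ _ "- cball 0 R0"]) (use \<open>x : - cball 0 R0\<close> supp_Ph in auto)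
   hence "grad Ph x = 0" by (intro grad_eqI) simp
   thus False using x m by simp qed qed
  ultimately have cS: "compact ?S" using compact_Int_closed[of "cball 0 R0" ?S] by (simp add: Int_absorb1)
  have fin: "emeasure lborel ?S < \<infinity>" by (rule emeasure_bounded_finite[OF compact_imp_bounded[OF cS]])
  define g where "g x = (nG x)^2 / (ep * (1 + (Ph x / ep)^2))" for x
  define F' where "F' x v = (((1 / (ep * (1 + (Ph x / ep)^2))) *R grad Ph x) *. v) *R grad Ph x + arctan (Ph x / ep) *R hess Ph x v" for x v
  have p: "0 < 1 + (Ph x / ep)^2" for x using zero_le_power2[of "Ph x / ep"] by linarith
  have der: "((%x. arctan (Ph x / ep) *R grad Ph x) has_derivative F' x) (at x)" for x proof -
   have "((%x. Ph x / ep) has_derivative (%v. (grad Ph x *. v) / ep)) (at x)" using has_derivative_mult_left[OF has_grad_Ph[of x], of "1 / ep"] by simp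
   from DERIV_compose_FDERIV[OF DERIV_arctan this]
   have "((%x. arctan (Ph x / ep)) has_derivative (%v. (grad Ph x *. v) / ep * inverse (1 + (Ph x / ep)^2))) (at x)" .
   from has_derivative_scaleR[OF this C2_on_has_hess[OF C2_Ph, of x]]
   show ?thesis by (rule has_derivative_eq_rhs) (auto simp: F'_def fun_eq_iff field_simps) qed
  have trF: "tr (F' x) = g x + arctan (Ph x / ep) * tr (hess Ph x)" for x unfolding F'_def[abs_def] by (simp only: tr_add tr_scaleR tr_outer') (simp add: g_def power2_norm_eq_inner)
  have cF: "continuous_on UNIV (%x. F' x v)" for v
   unfolding F'_def using p ep by (intro continuous_intros continuous_Ph continuous_grad_Ph C2_on_continuous_hess[OF C2_Ph]) (auto simp: less_imp_neq[symmetric])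
  have out: "arctan (Ph x / ep) *R grad Ph x = 0" if "x ~: cball 0 R0" for x using supp_Ph[OF that] by simp
  note zero = integral_tr_zero[of UNIV "cball 0 R0", OF open_UNIV compact_cball subset_UNIV der cF out]
  have i1: "integrable lborel (%x. tr (F' x))" and z1: "(\<integral>x. tr (F' x) \<partial>lborel) = 0" using zero by (auto simp: set_integrable_def set_lebesgue_integral_def)
  have ar: "\<bar>arctan (Ph x / ep) * tr (hess Ph x)\<bar> <= pi / 2 * \<bar>tr (hess Ph x)\<bar>" for x
   unfolding abs_mult using arctan_bounded[of "Ph x / ep"] by (intro mult_right_mono) auto
  have S_le: "indicator ?S x * (m^2 / (2 * ep)) <= tr (F' x) + pi / 2 * \<bar>tr (hess Ph x)\<bar>" for x proof -
   have "indicator ?S x * (m^2 / (2 * ep)) <= g x" proof (cases "x : ?S")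
   case True
   have "(Ph x / ep)^2 <= 1" using True ep by (simp add: power_divide abs_square_le_1 flip: abs_le_square_iff)
   moreover have "m^2 <= (nG x)^2" using True m by (intro power_mono) auto
   ultimately have "m^2 / (ep * 2) <= g x" unfolding g_def using ep p[of x] by (intro frac_le mult_left_mono mult_pos_pos) auto
   thus ?thesis using True by (simp add: mult.commute)
   next
   case False thus ?thesis using ep p[of x] by (simp add: g_def) qed
   thus ?thesis using ar[of x] unfolding trF by linarith qed
  have "measure lborel ?S * (m^2 / (2 * ep)) = (\<integral>x. indicator ?S x * (m^2 / (2 * ep)) \<partial>lborel)" by simp
  also have "... <= (\<integral>x. tr (F' x) + pi / 2 * \<bar>tr (hess Ph x)\<bar> \<partial>lborel)"
   using i1 iA cS S_le by (intro integral_mono Bochner_Integration.integrable_add integrable_mult_left integrable_real_indicator)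

   (use fin in "auto simp: borel_compact")
  also have "... = A" using i1 iA z1 by (simp add: A_def)
  finally have "measure lborel ?S <= 2 * A / m^2 * ep" using m ep by (simp add: field_simps)
  thus ?thesis using cS ep by (simp add: distrib_right) qed
 moreover have "2 * A / m^2 + 1 > 0" using A0 by (intro add_nonneg_pos) auto
 ultimately show ?thesis by blast qed

definition cutoff :: "real => 'a => real" where
 "cutoff ep x = smooth_step (- Ph x / ep)"

text \<open>The derivative of \<open>cutoff\<close> with respect to \<open>- Ph\<close>, hence
  nonnegative for \<open>ep > 0\<close>; \<open>cutoff''\<close> follows the same
  convention.\<close>

definition cutoff' :: "real => 'a => real" where
 "cutoff' ep x = smooth_step' (- Ph x / ep) / ep"

definition cutoff'' :: "real => 'a => real" where
 "cutoff'' ep x = smooth_step'' (- Ph x / ep) / ep^2"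

lemma cutoff_has_grad: "(cutoff ep has_derivative (%v. ((- cutoff' ep x) *R grad Ph x) *. v)) (at x)"
 and cutoff'_has_grad: "(cutoff' ep has_derivative (%v. ((- cutoff'' ep x) *R grad Ph x) *. v)) (at x)" proof -
 have 1: "((%x. - Ph x / ep) has_derivative (%v. - ((grad Ph x *. v) / ep))) (at x)" using has_derivative_minus[OF has_derivative_mult_left[OF has_grad_Ph[of x], of "1 / ep"]] by simp
 show "(cutoff ep has_derivative (%v. ((- cutoff' ep x) *R grad Ph x) *. v)) (at x)"
  using DERIV_compose_FDERIV[OF DERIV_smooth_step 1] by (simp add: cutoff_def[abs_def] cutoff'_def mult.commute)
 show "(cutoff' ep has_derivative (%v. ((- cutoff'' ep x) *R grad Ph x) *. v)) (at x)" using has_derivative_mult_left[OF DERIV_compose_FDERIV[OF DERIV_smooth_step' 1], of "1 / ep"]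
  by (simp add: cutoff'_def[abs_def] cutoff''_def power2_eq_square mult_ac) qed

lemma continuous_cutoff: "continuous_on S (cutoff ep)" "continuous_on S (cutoff' ep)" "continuous_on S (cutoff'' ep)" proof -
 show "continuous_on S (cutoff ep)" "continuous_on S (cutoff' ep)" by (rule has_derivative_continuous_on[OF has_derivative_at_withinI[OF cutoff_has_grad]]
   has_derivative_continuous_on[OF has_derivative_at_withinI[OF cutoff'_has_grad]])+
 show "continuous_on S (cutoff'' ep)" unfolding cutoff''_def[abs_def] divide_inverse
  by (intro continuous_intros continuous_on_compose2[OF continuous_on_smooth_step''[of UNIV]] continuous_Ph) auto qed

lemma cutoff_eq:
 assumes "ep > 0"
 shows "- ep <= Ph x ==> cutoff ep x = 0" "- ep <= Ph x ==> cutoff' ep x = 0" "Ph x <= - (2 * ep) ==> cutoff' ep x = 0" "Ph x <= - (2 * ep) ==> cutoff ep x = 1"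
 using assms smooth_step_eq[of "- Ph x / ep"] by (auto simp: cutoff_def cutoff'_def field_simps)

lemma cutoff_bounds:
 assumes "ep > 0"
 shows "0 <= cutoff ep x" "cutoff ep x <= 1" "0 <= cutoff' ep x" "cutoff' ep x <= 9 / ep * sqrt (cutoff ep x)" "cutoff' ep x <= 9 / ep" proof -
 show "0 <= cutoff ep x" "cutoff ep x <= 1" "0 <= cutoff' ep x" using assms by (auto simp: cutoff_def cutoff'_def smooth_step_bounds)
 show 1: "cutoff' ep x <= 9 / ep * sqrt (cutoff ep x)" using assms smooth_step_bounds(4)[of "- Ph x / ep"] by (simp add: cutoff_def cutoff'_def divide_right_mono)
 have "9 / ep * sqrt (cutoff ep x) <= 9 / ep * 1" using assms smooth_step_bounds by (intro mult_left_mono) (auto simp: cutoff_def)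
 with 1 show "cutoff' ep x <= 9 / ep" by simp qed

definition inner_part :: "real => 'a set" where
 "inner_part ep = {x : closure Om. Ph x <= - ep}"

lemma inner_part: assumes "ep > 0" shows "compact (inner_part ep)" "inner_part ep <= Om"
 "x : Om ==> x ~: inner_part ep ==> cutoff ep x = 0" "x : Om ==> x ~: inner_part ep ==> cutoff' ep x = 0" proof -
 have "inner_part ep = closure Om Int {x. Ph x <= - ep}" by (auto simp: inner_part_def)
 moreover have "closed {x. Ph x <= - ep}" by (intro closed_Collect_le continuous_Ph continuous_on_const)
 ultimately show "compact (inner_part ep)" using compact_Int_closed[OF compact_closure] by simp
 show "inner_part ep <= Om" using assms Ph_frontier closure_eq by (force simp: inner_part_def)
 show "x : Om ==> x ~: inner_part ep ==> cutoff ep x = 0" "x : Om ==> x ~: inner_part ep ==> cutoff' ep x = 0" using closure_eq by (auto simp: inner_part_def intro!: cutoff_eq(1,2) assms)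
qed

lemma cutoff'_support:
 assumes "ep > 0"
 shows "compact (inner_part ep Int {x. - (2 * ep) <= Ph x})"
  and "x : Om ==> x ~: inner_part ep Int {x. - (2 * ep) <= Ph x} ==> cutoff' ep x = 0" proof -
 show "compact (inner_part ep Int {x. - (2 * ep) <= Ph x})" by (intro compact_Int_closed inner_part assms closed_Collect_le continuous_Ph continuous_on_const)
 show "cutoff' ep x = 0" if "x : Om" "x ~: inner_part ep Int {x. - (2 * ep) <= Ph x}"
  using inner_part(4)[OF assms that(1)] cutoff_eq(3)[OF assms, of x] that by (cases "- (2 * ep) <= Ph x") auto qed

lemma set_integrable_cutoff:
 assumes ep: "ep > 0" and f: "continuous_on Om f"
 shows "sint (%x. cutoff ep x * f x)" "sint (%x. cutoff' ep x * f x)" using inner_part[OF ep] continuous_on_subset[OF f inner_part(2)[OF ep]]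
 by (auto intro!: set_integrable_compact_support[OF inner_part(1,2)[OF ep]] continuous_intros continuous_cutoff)

end

section \<open>Integral identities and Reilly's inequality with cutoffs\<close>

context torsion
begin

definition hess_sq :: "'a => real" where
 "hess_sq x = (SUM b:Basis. (norm (grad (pd u b) x))^2)"

lemma hess_sq_nonneg: "0 <= hess_sq x" unfolding hess_sq_def by (intro sum_nonneg) auto

lemma continuous_on_hess_sq: "continuous_on Om hess_sq" unfolding hess_sq_def[abs_def] by (intro continuous_intros C1_on_continuous_grad C2_on_C1 pd_u)

lemma continuous_on_grad_u: "continuous_on Om (grad u)" by (rule C1_on_continuous_grad[OF C2_on_C1[OF C2_u]])

lemma norm_hess_u_le: "norm (hess u x v) <= sqrt (hess_sq x) * norm v" proof (rule power2_le_imp_le)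
 have "(norm (hess u x v))^2 = (SUM b:Basis. (grad (pd u b) x *. v)^2)" unfolding power2_norm_eq_inner euclidean_inner[of "hess u x v" "hess u x v"]
  by (simp add: hess_inner_Basis power2_eq_square)
 also have "... <= (SUM b:Basis. (norm (grad (pd u b) x))^2 * (norm v)^2)" by (intro sum_mono) (metis Cauchy_Schwarz_ineq2 abs_ge_zero power2_abs power_mono power_mult_distrib)
 also have "... = (sqrt (hess_sq x) * norm v)^2" using hess_sq_nonneg[of x] by (simp add: power_mult_distrib) (simp add: hess_sq_def sum_distrib_right)
 finally show "(norm (hess u x v))^2 <= (sqrt (hess_sq x) * norm v)^2" . qed (simp add: hess_sq_nonneg)

text \<open>The divergence of \<open>cutoff ep x *R grad u x\<close> integrates to zero; the left
  side is the flux through a diffuse boundary.\<close>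

lemma flux_identity:
 assumes ep: "ep > 0"
 shows "(IN x. cutoff' ep x * (grad Ph x *. grad u x)) = real DIM('a) * (IN x. cutoff ep x)" proof -
 let ?F' = "%x v. cutoff ep x *R hess u x v + (((- cutoff' ep x) *R grad Ph x) *. v) *R grad u x"
 have t: "tr (?F' x) = cutoff ep x * real DIM('a) - cutoff' ep x * (grad Ph x *. grad u x)" if "x : Om" for x
  using lap_u[OF that] by (simp only: tr_add tr_scaleR tr_outer' lap_eq_tr_hess) (simp add: inner_commute)
 have "(IN x. tr (?F' x)) = 0" by (rule integral_tr_zero(2)[OF open_Om inner_part(1,2)[OF ep] has_derivative_scaleR[OF cutoff_has_grad has_hess_u]])
   (auto intro!: continuous_intros continuous_cutoff
   C2_on_continuous_hess[OF C2_u] continuous_grad_Ph continuous_on_grad_u simp: inner_part[OF ep])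
 also have "(IN x. tr (?F' x)) = (IN x. cutoff ep x * real DIM('a) - cutoff' ep x * (grad Ph x *. grad u x))" by (rule set_lebesgue_integral_cong) (use open_Om t in auto)
 also have "... = (IN x. cutoff ep x * real DIM('a)) - (IN x. cutoff' ep x * (grad Ph x *. grad u x))"
  by (intro set_integral_diff set_integrable_cutoff[OF ep] continuous_intros continuous_grad_Ph continuous_on_grad_u)
 finally show ?thesis by (simp add: mult.commute) qed

text \<open>Each \<open>pd u b\<close> is harmonic, so the divergence of \<open>cutoff ep\<close>
  times \<open>pd u b\<close> times its gradient consists of the squared gradient and a cutoff term.
  Summation over \<open>b\<close> and symmetry of the Hessian give the right side.\<close>

lemma energy_identity:
 assumes ep: "ep > 0"
 shows "(IN x. cutoff ep x * hess_sq x) = (IN x. cutoff' ep x * (grad Ph x *. hess u x (grad u x)))" proof -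
 have c: "continuous_on Om (pd u b)" "continuous_on Om (grad (pd u b))" if "b : Basis" for b using C1_on_continuous C1_on_continuous_grad C2_on_C1[OF pd_u(1)[OF that]] by auto
 have 1: "(IN x. cutoff ep x * (norm (grad (pd u b) x))^2) = (IN x. cutoff' ep x * (pd u b x * (grad Ph x *. grad (pd u b) x)))"
  if b: "b : Basis" for b proof -
  let ?g = "grad (pd u b)"
  let ?F' = "%x v. (cutoff ep x * pd u b x) *R hess (pd u b) x v + ((cutoff ep x *R ?g x + (- (pd u b x * cutoff' ep x)) *R grad Ph x) *. v) *R ?g x"
  have t: "tr (?F' x) = cutoff ep x * (norm (?g x))^2 - cutoff' ep x * (pd u b x * (grad Ph x *. ?g x))" if "x : Om" for x using pd_u(2)[OF b that]
   by (simp only: tr_add tr_scaleR tr_outer' lap_eq_tr_hess) (simp add: inner_commute inner_add_right inner_diff_right power2_norm_eq_inner mult_ac)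
  have "(IN x. tr (?F' x)) = 0" proof (rule integral_tr_zero(2)[OF open_Om inner_part(1,2)[OF ep], of "%x. (cutoff ep x * pd u b x) *R ?g x"])
   fix x assume x: "x : Om"
   from has_derivative_scaleR[OF has_derivative_mult[OF cutoff_has_grad C1_on_has_grad[OF C2_on_C1[OF pd_u(1)[OF b]] x]]
   C2_on_has_hess[OF pd_u(1)[OF b] x]]
   show "((%x. (cutoff ep x * pd u b x) *R ?g x) has_derivative ?F' x) (at x)" by (rule has_derivative_eq_rhs) (auto simp: fun_eq_iff inner_add_left inner_diff_left algebra_simps)
  qed (auto intro!: continuous_intros continuous_cutoff c b C2_on_continuous_hess[OF pd_u(1)] continuous_grad_Ph simp: inner_part[OF ep])
  also have "(IN x. tr (?F' x)) = (IN x. cutoff ep x * (norm (?g x))^2 - cutoff' ep x * (pd u b x * (grad Ph x *. ?g x)))" by (rule set_lebesgue_integral_cong) (use open_Om t in auto)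
  also have "... = (IN x. cutoff ep x * (norm (?g x))^2) - (IN x. cutoff' ep x * (pd u b x * (grad Ph x *. ?g x)))"
   by (intro set_integral_diff set_integrable_cutoff[OF ep] continuous_intros continuous_grad_Ph c b)
  finally show ?thesis by simp qed
 have "(IN x. cutoff ep x * hess_sq x) = (SUM b:Basis. IN x. cutoff ep x * (norm (grad (pd u b) x))^2)" unfolding hess_sq_def sum_distrib_left
  by (intro set_integral_sum' set_integrable_cutoff[OF ep] continuous_intros c) auto
 also have "... = (SUM b:Basis. IN x. cutoff' ep x * (pd u b x * (grad Ph x *. grad (pd u b) x)))" using 1 by simp
 also have "... = (IN x. (SUM b:Basis. cutoff' ep x * (pd u b x * (grad Ph x *. grad (pd u b) x))))"
  by (intro set_integral_sum'[symmetric] set_integrable_cutoff[OF ep] continuous_intros continuous_grad_Ph c) auto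
 also have "... = (IN x. cutoff' ep x * (grad Ph x *. hess u x (grad u x)))" proof (rule set_lebesgue_integral_cong)
  show "ALL x. x : Om --> (SUM b:Basis. cutoff' ep x * (pd u b x * (grad Ph x *. grad (pd u b) x))) = cutoff' ep x * (grad Ph x *. hess u x (grad u x))" proof (intro allI impI)
   fix x assume x: "x : Om"
   have "grad Ph x *. hess u x (grad u x) = hess u x (grad Ph x) *. grad u x" using hess_symmetric[OF C2_u open_Om x, of "grad u x" "grad Ph x"] by (simp add: inner_commute)
   also have "... = (SUM b:Basis. (grad (pd u b) x *. grad Ph x) * pd u b x)" by (subst euclidean_inner) (simp add: hess_inner_Basis grad_inner_Basis)
   finally show "(SUM b:Basis. cutoff' ep x * (pd u b x * (grad Ph x *. grad (pd u b) x))) = cutoff' ep x * (grad Ph x *. hess u x (grad u x))"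
   by (simp add: sum_distrib_left inner_commute mult_ac) qed qed (use open_Om in auto)
 finally show ?thesis . qed

end

lemma tr_rank_one:
 fixes l :: "'a::euclidean_space => real"
 assumes "linear l"
 shows "tr (%v. l v *R m) = l m" proof -
 have "l m = l (SUM b:Basis. (m *. b) *R b)" by (simp add: euclidean_representation)
 also have "... = (SUM b:Basis. (m *. b) * l b)" by (simp add: linear_sum[OF assms] linear_cmul[OF assms])
 finally show ?thesis by (simp add: tr_def mult.commute) qed

context torsion
begin

abbreviation "normal_deriv x == grad u x *. nu x"
abbreviation "tangential_grad x == grad u x - normal_deriv x *R nu x"

definition normal_deriv' :: "'a => 'a => real" where
 "normal_deriv' x v = grad u x *. shape_op Ph x v + hess u x v *. nu x"

lemma has_derivative_normal_deriv:
 assumes "x : Om" "grad Ph x ~= 0"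
 shows "((%x. normal_deriv x) has_derivative normal_deriv' x) (at x)" unfolding normal_deriv'_def[abs_def]
 by (rule has_derivative_inner[OF has_hess_u[OF assms(1)] has_derivative_unit_normal[OF C2_Ph UNIV_I assms(2)]])

text \<open>The derivative of a tangential field in the layer, as \<open>boundary_divergence\<close>
  shows; its vanishing total divergence replaces the divergence theorem on the level surfaces of
  \<open>Ph\<close>.\<close>

definition flux_deriv :: "real => 'a => 'a => 'a" where
 "flux_deriv ep x v = (cutoff' ep x * nG x * normal_deriv x) *R (hess u x v - (normal_deriv x *R shape_op Ph x v + normal_deriv' x v *R nu x))
   + (cutoff' ep x * nG x * normal_deriv' x v + (cutoff' ep x * (nu x *. hess Ph x v) + (((- cutoff'' ep x) *R grad Ph x) *. v) * nG x) * normal_deriv x) *R tangential_grad x"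

text \<open>Adding this divergence cancels the second normal derivative of \<open>u\<close>. There
  remain Reilly's boundary terms in \<open>w\<close> and terms linear in \<open>T\<close>;
  \<open>cutoff''\<close> drops out because \<open>T\<close> is orthogonal to
  \<open>grad Ph x\<close>.\<close>

lemma boundary_divergence:
 fixes ep :: real
 assumes x: "x : Om" "grad Ph x ~= 0"
 defines "T == tangential_grad x" and "w == normal_deriv x" and "q == cutoff' ep x" and "g == nG x"
 shows "((%x. (cutoff' ep x * nG x * normal_deriv x) *R tangential_grad x) has_derivative flux_deriv ep x) (at x)"
  and "q * (grad Ph x *. hess u x (grad u x)) + tr (flux_deriv ep x) =
   q * g * (real DIM('a) * w - tr (shape_op Ph x) * w^2)
   + q * (2 * g * normal_deriv' x T + w * (nu x *. hess Ph x T) - g * (T *. shape_op Ph x (grad u x)))" proof -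
 let ?l = "%v. cutoff' ep x * nG x * normal_deriv' x v + (cutoff' ep x * (nu x *. hess Ph x v) + (((- cutoff'' ep x) *R grad Ph x) *. v) * nG x) * normal_deriv x"
 let ?Y = "grad u x"
 note w' = has_derivative_normal_deriv[OF x]
 note l = has_derivative_mult[OF has_derivative_mult[OF cutoff'_has_grad[of ep] has_derivative_norm_grad[OF C2_Ph UNIV_I x(2)]] w']
 show "((%x. (cutoff' ep x * nG x * normal_deriv x) *R tangential_grad x) has_derivative flux_deriv ep x) (at x)" unfolding flux_deriv_def[abs_def]
  by (intro has_derivative_scaleR[OF l] has_derivative_diff has_hess_u x w' has_derivative_scaleR has_derivative_unit_normal[OF C2_Ph] UNIV_I)
 have lin: "linear ?l" by (rule bounded_linear.linear[OF has_derivative_bounded_linear[OF l]])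
 have lw: "linear (normal_deriv' x)" by (rule bounded_linear.linear[OF has_derivative_bounded_linear[OF w']])
 have nn: "nu x *. nu x = 1" by (rule inner_unit_normal_self[OF x(2)])
 have nT: "nu x *. T = 0" unfolding T_def by (simp add: inner_diff_right nn inner_commute)
 have Y: "?Y = w *R nu x + T" by (simp add: T_def w_def)
 have tr1: "tr (flux_deriv ep x) = q * g * w * (tr (hess u x) - (w * tr (shape_op Ph x) + normal_deriv' x (nu x))) + ?l T"
  by (simp only: flux_deriv_def[abs_def] tr_add tr_diff tr_scaleR tr_rank_one[OF lin] tr_rank_one[OF lw] q_def g_def w_def T_def)
 have lT: "?l T = q * g * normal_deriv' x T + q * (nu x *. hess Ph x T) * w" unfolding inner_scaleR_left inner_grad_eq[of Ph] nT by (simp add: q_def g_def w_def)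
 have "normal_deriv' x ?Y = w * normal_deriv' x (nu x) + normal_deriv' x T" by (subst Y) (simp add: linear_add[OF lw] linear_cmul[OF lw])
 moreover have "normal_deriv' x ?Y = T *. shape_op Ph x ?Y + hess u x ?Y *. nu x" proof -
  have "?Y *. shape_op Ph x ?Y = w * (nu x *. shape_op Ph x ?Y) + T *. shape_op Ph x ?Y" using Y by (metis inner_add_left inner_scaleR_left)
  thus ?thesis unfolding normal_deriv'_def inner_unit_normal_shape_op[OF x(2)] by simp qed
 moreover have "grad Ph x *. hess u x ?Y = g * (hess u x ?Y *. nu x)" unfolding inner_grad_eq[of Ph] g_def by (simp add: inner_commute)
 ultimately have AY: "grad Ph x *. hess u x ?Y = g * (w * normal_deriv' x (nu x) + normal_deriv' x T - T *. shape_op Ph x ?Y)" by simp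
 have trh: "tr (hess u x) = real DIM('a)" using lap_u[OF x(1)] by (simp add: lap_eq_tr_hess)
 show "q * (grad Ph x *. hess u x (grad u x)) + tr (flux_deriv ep x) =
   q * g * (real DIM('a) * w - tr (shape_op Ph x) * w^2)
   + q * (2 * g * normal_deriv' x T + w * (nu x *. hess Ph x T) - g * (T *. shape_op Ph x (grad u x)))" unfolding tr1 lT AY trh by (simp add: algebra_simps power2_eq_square) qed

lemma layer_exists:
 assumes H: "!!p. p : Gam ==> tr (shape_op Ph p) > 0"
 shows "EX t>0. EX m>0. ALL x:closure Om. - t <= Ph x --> m <= nG x & 0 < tr (shape_op Ph x)" proof -
 obtain t m where m: "t > 0" "m > 0" "!!x. x : closure Om ==> - t <= Ph x ==> m <= nG x" using grad_Ph_layer by blast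
 let ?V = "{x. grad Ph x ~= 0}"
 have oV: "open ?V" by (intro open_Collect_neq continuous_grad_Ph continuous_on_const)
 have "continuous_on ?V (%x. tr (shape_op Ph x))" unfolding tr_def by (intro continuous_intros continuous_on_shape_op[OF C2_on_subset[OF C2_Ph]]) auto
 from continuous_open_preimage[OF this oV, of "{0<..}"] have "open (?V Int (%x. tr (shape_op Ph x)) -` {0<..})" by simp
 moreover have "Gam <= ?V Int (%x. tr (shape_op Ph x)) -` {0<..}" using H grad_Ph_frontier by blast
 ultimately have "EX t>0. ALL x:closure Om. - t <= Ph x --> x : ?V Int (%x. tr (shape_op Ph x)) -` {0<..}" by (rule boundary_layer)
 then obtain s where s: "s > 0" "!!x. x : closure Om ==> - s <= Ph x ==> 0 < tr (shape_op Ph x)" by force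
 show ?thesis proof (rule exI[of _ "min t s"], intro conjI exI[of _ m] ballI impI)
  fix x assume x: "x : closure Om" "- min t s <= Ph x"
  show "m <= nG x" using m(3)[OF x(1)] x(2) by simp
  show "0 < tr (shape_op Ph x)" using s(2)[OF x(1)] x(2) by simp qed (use m s in auto) qed

text \<open>The hypothesis \<open>q <= e * sqrt \<eta>\<close>, met by \<open>cutoff'\<close> and
  \<open>cutoff\<close>, lets the term linear in the Hessian norm \<open>a\<close> be absorbed into
  \<open>\<kappa> * (\<eta> * a^2)\<close>.\<close>

lemma young_cutoff:
 fixes q \<tau> C e a \<eta> \<kappa> :: real
 assumes "0 <= q" "q <= e * sqrt \<eta>" "q <= e" "0 <= \<tau>" "0 <= C" "0 <= a" "0 <= \<eta>" "\<kappa> > 0" "0 <= e"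
 shows "q * (\<tau> * C * (1 + a)) <= \<kappa> * (\<eta> * a^2) + ((e * \<tau> * C)^2 / (4 * \<kappa>) + e * \<tau> * C)" proof -
 define X where "X = e * \<tau> * C"
 define y where "y = sqrt \<eta> * a"
 have "0 <= (2 * \<kappa> * y - X)^2 / (4 * \<kappa>)" using assms by simp
 also have "... = \<kappa> * y^2 - X * y + X^2 / (4 * \<kappa>)" using assms by (simp add: field_simps power2_eq_square)
 finally have "X * y <= \<kappa> * y^2 + X^2 / (4 * \<kappa>)" by simp
 moreover have "y^2 = \<eta> * a^2" using assms by (simp add: y_def power_mult_distrib)
 ultimately have 1: "X * y <= \<kappa> * (\<eta> * a^2) + X^2 / (4 * \<kappa>)" by simp
 have "q * (\<tau> * C * (1 + a)) = q * (\<tau> * C * a) + q * (\<tau> * C)" by (simp add: algebra_simps)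
 also have "... <= e * sqrt \<eta> * (\<tau> * C * a) + e * (\<tau> * C)" using assms by (intro add_mono mult_right_mono) auto
 also have "... = X * y + e * \<tau> * C" by (simp add: X_def y_def)
 finally show ?thesis using 1 unfolding X_def by linarith qed

text \<open>Every term contains \<open>T\<close> once and the Hessian of \<open>u\<close> at most
  once, hence the factor \<open>\<tau>\<close> and the linear growth in
  \<open>sqrt (hess_sq x)\<close>.\<close>

lemma boundary_term_bound:
 assumes x: "x : Om" "grad Ph x ~= 0"
  and B: "nG x <= B" "norm (grad u x) <= M" "!!v. norm (shape_op Ph x v) <= s * norm v" "!!v. norm (hess Ph x v) <= L * norm v"
   "norm (tangential_grad x) <= \<tau>" "0 <= s" "0 <= L"
 defines "T == tangential_grad x" and "w == normal_deriv x" and "g == nG x"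
 shows "2 * g * normal_deriv' x T + w * (nu x *. hess Ph x T) - g * (T *. shape_op Ph x (grad u x))
   <= \<tau> * (2 * B + 3 * B * s * M + M * L) * (1 + sqrt (hess_sq x))" proof -
 let ?Y = "grad u x" and ?a = "sqrt (hess_sq x)"
 have n1: "norm (nu x) = 1" by (rule norm_unit_normal[OF x(2)])
 have B0: "0 <= B" "0 <= M" "0 <= \<tau>" using B norm_ge_zero order_trans by blast+
 have T: "norm T <= \<tau>" using B by (simp add: T_def)
 have w: "\<bar>w\<bar> <= M" using Cauchy_Schwarz_ineq2[of ?Y "nu x"] n1 B by (simp add: w_def)
 have a0: "0 <= ?a" by (simp add: hess_sq_nonneg)
 have "\<bar>normal_deriv' x T\<bar> <= norm ?Y * norm (shape_op Ph x T) + norm (hess u x T) * norm (nu x)"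
  unfolding normal_deriv'_def using Cauchy_Schwarz_ineq2[of ?Y "shape_op Ph x T"] Cauchy_Schwarz_ineq2[of "hess u x T" "nu x"] by linarith
 also have "... <= M * (s * \<tau>) + (?a * \<tau>) * 1" using T B(2) B0 a0 n1 order_trans[OF B(3) mult_left_mono[OF T B(6)]] order_trans[OF norm_hess_u_le mult_left_mono[OF T a0]]
  by (intro add_mono mult_mono) auto
 finally have "2 * g * normal_deriv' x T <= 2 * B * (M * (s * \<tau>) + ?a * \<tau>)"
  using B B0 a0 by (intro order_trans[OF mult_left_mono[of _ "M * (s * \<tau>) + ?a * \<tau>"] mult_right_mono]) (auto simp: g_def)
 moreover have "\<bar>w * (nu x *. hess Ph x T)\<bar> <= M * (L * \<tau>)"
  unfolding abs_mult using Cauchy_Schwarz_ineq2[of "nu x" "hess Ph x T"] n1 order_trans[OF B(4) mult_left_mono[OF T B(7)]] B0 by (intro mult_mono w) auto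
 moreover have "\<bar>g * (T *. shape_op Ph x ?Y)\<bar> <= B * (\<tau> * (s * M))" unfolding abs_mult
  using order_trans[OF Cauchy_Schwarz_ineq2[of T "shape_op Ph x ?Y"] mult_mono[OF T order_trans[OF B(3) mult_left_mono[OF B(2) B(6)]]]] B B0 by (intro mult_mono) (auto simp: g_def)
 ultimately have "2 * g * normal_deriv' x T + w * (nu x *. hess Ph x T) - g * (T *. shape_op Ph x ?Y)
  <= 2 * B * (M * (s * \<tau>) + ?a * \<tau>) + M * (L * \<tau>) + B * (\<tau> * (s * M))" by linarith
 also have "... <= 2 * B * (M * (s * \<tau>) + ?a * \<tau>) + M * (L * \<tau>) + B * (\<tau> * (s * M)) + \<tau> * (2 * B + (3 * B * s * M + M * L) * ?a)"
  using B0 B a0 by (auto intro!: add_nonneg_nonneg mult_nonneg_nonneg)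
 also have "... = \<tau> * (2 * B + 3 * B * s * M + M * L) * (1 + ?a)" by (simp add: algebra_simps)
 finally show ?thesis . qed

end

context torsion
begin

text \<open>\<open>dl\<close> measures the layer and \<open>\<kappa>\<close> the share of the
  Hessian integral given up to absorb errors. Both stay free here and are coupled only when the
  layer shrinks.\<close>

lemma reilly_inequality:
 assumes H: "!!p. p : Gam ==> tr (shape_op Ph p) > 0" and N1: "DIM('a) >= 2"
 shows "EX C>0. EX dl0>0. ALL dl \<kappa>. 0 < dl & dl <= dl0 & 0 < \<kappa> --> (1 - \<kappa>) * (IN x. cutoff (dl ^ 3 / 2) x * hess_sq x)
   + (real DIM('a) - 2) * (real DIM('a) * (IN x. cutoff (dl ^ 3 / 2) x))
  <= (real DIM('a) - 1)^2 * (IN x. cutoff' (dl ^ 3 / 2) x * (nG x / tr (shape_op Ph x))) + C * (dl^2 + dl / \<kappa>)" proof -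
 let ?N = "real DIM('a)"
 obtain t m where t: "t > 0" "m > 0" "!!x. x : closure Om ==> - t <= Ph x ==> m <= nG x & 0 < tr (shape_op Ph x)" using layer_exists[OF H] by blast
 obtain C1 dl1 where C1: "C1 > 0" "dl1 > 0" "!!dl x. 0 < dl & dl <= dl1 ==> x : Om ==> - (dl ^ 3) <= Ph x ==> norm (tangential_grad x) <= C1 * dl^2" using tangential_gradient_bound by blast
 obtain C3 where C3: "C3 > 0" "!!ep. ep > 0 ==> compact {x. \<bar>Ph x\<bar> <= ep & m <= nG x} & measure lborel {x. \<bar>Ph x\<bar> <= ep & m <= nG x} <= C3 * ep"
  using layer_volume[OF t(2)] by blast
 obtain L where L: "L > 0" "!!x v. norm (hess Ph x v) <= L * norm v" using hess_Ph_bounded by blast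
 obtain M where M: "M > 0" "!!x. x : Om ==> norm (grad u x) <= M" using grad_u_bounded by blast
 have "bounded (grad Ph ` closure Om)" by (rule compact_imp_bounded[OF compact_continuous_image[OF continuous_grad_Ph compact_closure]])
 then obtain B where B: "B > 0" "!!x. x : closure Om ==> nG x <= B" by (auto simp: bounded_pos)
 define s where "s = 2 * L / m"
 have s0: "s >= 0" using L t by (simp add: s_def)
 have s: "norm (shape_op Ph x v) <= s * norm v" if x: "x : closure Om" "- t <= Ph x" for x v proof -
  have mx: "m <= nG x" using t(3)[OF x] by simp
  hence nx: "norm (nu x) = 1" using t(2) by (intro norm_unit_normal) auto
  have "norm (hess Ph x v - (nu x *. hess Ph x v) *R nu x) <= norm (hess Ph x v) + \<bar>nu x *. hess Ph x v\<bar> * norm (nu x)"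
   using norm_triangle_ineq4[of "hess Ph x v" "(nu x *. hess Ph x v) *R nu x"] by simp
  also have "... <= 2 * (L * norm v)" using L(2)[of x v] Cauchy_Schwarz_ineq2[of "nu x" "hess Ph x v"] nx by simp
  finally have "norm (shape_op Ph x v) <= (1 / nG x) * (2 * (L * norm v))" unfolding shape_op_def norm_scaleR by (simp add: divide_right_mono)
  also have "... <= (1 / m) * (2 * (L * norm v))" using mx t L by (intro mult_right_mono frac_le) auto
  finally show ?thesis by (simp add: s_def) qed
 define C2 where "C2 = 2 * B + 3 * B * s * M + M * L"
 have C2: "C2 >= 0" using B M L s0 by (simp add: C2_def)
 define C where "C = ((18 * C1 * C2)^2 / 4 + 18 * C1 * C2) * C3 + 1"
 define dl0 where "dl0 = Min {1, dl1, t / 2}"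
 have dl0: "dl0 > 0" "dl0 <= 1" "dl0 <= dl1" "dl0 <= t / 2" using t C1 by (auto simp: dl0_def)
 have "(1 - \<kappa>) * (IN x. cutoff (dl ^ 3 / 2) x * hess_sq x)
   + (?N - 2) * (?N * (IN x. cutoff (dl ^ 3 / 2) x))
  <= (?N - 1)^2 * (IN x. cutoff' (dl ^ 3 / 2) x * (nG x / tr (shape_op Ph x))) + C * (dl^2 + dl / \<kappa>)"
  if dl: "0 < dl" "dl <= dl0" and \<kappa>: "0 < \<kappa>" for dl \<kappa> proof -
  \<comment> \<open>\<open>cutoff'\<close> lives where \<open>- 2 * ep <= Ph <= - ep\<close>, hence
    in the layer of depth \<open>dl ^ 3\<close> of the tangential bound.\<close>
  define ep where "ep = dl ^ 3 / 2"
  have ep: "ep > 0" using dl by (simp add: ep_def)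
  have ept: "2 * ep < t" using power_decreasing[of 1 3 dl] dl dl0 t by (simp add: ep_def)
  define U where "U = Om Int {x. - t < Ph x}"
  have U: "open U" "U <= Om" "U : sets borel" using open_Om open_Collect_less[OF continuous_on_const continuous_Ph, of "- t"] by (auto simp: U_def)
  have Ug: "grad Ph x ~= 0" if "x : U" for x using t(2) t(3)[of x] that closure_eq by (force simp: U_def)
  define K where "K = inner_part ep Int {x. - (2 * ep) <= Ph x}"
  note K = cutoff'_support(1)[OF ep, folded K_def] and q0 = cutoff'_support(2)[OF ep, folded K_def]
  have KU: "K <= U" using inner_part(2)[OF ep] ept by (force simp: K_def U_def)
  have qU: "cutoff' ep x = 0" if "x : Om" "x ~: U" for x using q0[of x] that KU by blast
  let ?S = "{x. \<bar>Ph x\<bar> <= dl ^ 3 & m <= nG x}"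
  have S: "compact ?S" "measure lborel ?S <= C3 * dl ^ 3" using C3(2)[of "dl ^ 3"] dl by auto
  have KS: "K <= ?S" proof
   fix x assume x: "x : K"
   hence "Ph x <= - ep" "- (2 * ep) <= Ph x" "x : closure Om" by (auto simp: K_def inner_part_def)
   thus "x : ?S" using t(3)[of x] ep ept by (auto simp: ep_def) qed
  define \<tau> where "\<tau> = C1 * dl^2"
  \<comment> \<open>The constant left over by \<open>young_cutoff\<close> with slope
    \<open>9 / ep\<close>; it is integrated over \<open>?S\<close>, whose volume is at most
    \<open>C3 * dl ^ 3\<close>.\<close>
  define E where "E = (9 / ep * \<tau> * C2)^2 / (4 * \<kappa>) + 9 / ep * \<tau> * C2"
  have E0: "E >= 0" using ep \<kappa> C2 C1 by (simp add: E_def \<tau>_def)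
  let ?J = "%x. cutoff' ep x * (nG x / tr (shape_op Ph x))"
  let ?F = "%x. (cutoff' ep x * nG x * normal_deriv x) *R tangential_grad x"
  note C2U = C2_on_subset[OF C2_Ph subset_UNIV, of U]
  have cU: "continuous_on U nu" "continuous_on U (%x. shape_op Ph x v)" "continuous_on U (grad u)" "continuous_on U (%x. hess u x v)"
   "continuous_on U (%x. hess Ph x v)" for v using continuous_on_unit_normal[OF C2U Ug] continuous_on_shape_op[OF C2U Ug] continuous_on_subset[OF continuous_on_grad_u U(2)]
   continuous_on_subset[OF C2_on_continuous_hess[OF C2_u] U(2)] C2_on_continuous_hess[OF C2U] by auto
  have trS: "continuous_on U (%x. tr (shape_op Ph x))" unfolding tr_def by (intro continuous_intros cU)
  have der: "(?F has_derivative flux_deriv ep x) (at x)" if "x : U" for x by (rule boundary_divergence(1)[OF subsetD[OF U(2) that] Ug[OF that]])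
  have cF: "continuous_on U (%x. flux_deriv ep x v)" for v unfolding flux_deriv_def normal_deriv'_def by (intro continuous_intros continuous_cutoff continuous_grad_Ph cU)
  have F0: "?F x = 0" if "x : U" "x ~: K" for x using q0[of x] that U(2) by auto
  note zero = integral_tr_zero[OF U(1) K KU der cF F0]
  have iA: "sint (%x. cutoff ep x * hess_sq x)" by (rule set_integrable_cutoff(1)[OF ep continuous_on_hess_sq])
  have cAY: "continuous_on Om (%x. grad Ph x *. hess u x (grad u x))" proof (rule continuous_on_cong[THEN iffD1, OF refl])
   show "continuous_on Om (%x. SUM b:Basis. (grad Ph x *. b) * (grad (pd u b) x *. grad u x))"
   by (intro continuous_intros continuous_grad_Ph continuous_on_grad_u C1_on_continuous_grad C2_on_C1 pd_u) qed (subst euclidean_inner, simp add: hess_inner_Basis)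
  have iAY: "sint (%x. cutoff' ep x * (grad Ph x *. hess u x (grad u x)))" by (rule set_integrable_cutoff(2)[OF ep cAY])
  have iY: "sint (%x. cutoff' ep x * (grad Ph x *. grad u x))" by (intro set_integrable_cutoff(2)[OF ep] continuous_intros continuous_grad_Ph continuous_on_grad_u)
  have iJ: "sint ?J" proof (rule set_integrable_compact_support[OF K])
   have "tr (shape_op Ph x) ~= 0" if "x : K" for x using t(3)[of x] subsetD[OF KU that] closure_eq by (force simp: U_def)
   thus "continuous_on K ?J" by (intro continuous_intros continuous_cutoff continuous_grad_Ph continuous_on_subset[OF trS KU]) auto qed (use KU U q0 in auto)
  have iS: "sint (%x. E * indicator ?S x)" by (intro set_integrable_mult_right) (use S open_Om emeasure_bounded_finite[OF compact_imp_bounded[OF S(1)]] in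
   \<open>auto simp: set_integrable_def borel_compact indicator_inter_arith[symmetric] simp flip: indicator_inter_arith intro!: integrable_real_indicator
   order_le_less_trans[OF emeasure_mono[of "_ Int ?S" ?S]]\<close>)
  have iU: "set_integrable lborel U f" if "sint f" for f :: "'a => real" by (rule set_integrable_subset[OF that]) (use U in auto)
  let ?R = "%x. (?N - 1)^2 * ?J x - (?N - 2) * (cutoff' ep x * (grad Ph x *. grad u x)) + \<kappa> * (cutoff ep x * hess_sq x) + E * indicator ?S x"
  have iR: "sint ?R" by (intro set_integral_add set_integral_diff set_integrable_mult_right iJ iY iA iS)
  have pt: "cutoff' ep x * (grad Ph x *. hess u x (grad u x)) + tr (flux_deriv ep x) <= ?R x" if xU: "x : U" for x proof -
   let ?q = "cutoff' ep x" and ?g = "nG x" and ?w = "normal_deriv x" and ?k = "tr (shape_op Ph x)"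
   have x: "x : Om" "x : closure Om" "- t <= Ph x" using xU closure_eq by (auto simp: U_def)
   have k0: "?k > 0" using t(3)[OF x(2,3)] by simp
   have q: "?q >= 0" by (rule cutoff_bounds(3)[OF ep])
   \<comment> \<open>The completed square trades \<open>?w^2\<close> for the reciprocal of
     \<open>?k\<close>, which carries the mean curvature, and a multiple of \<open>?w\<close>, which
     \<open>flux_identity\<close> evaluates.\<close>
   have "(?k * ?w - (?N - 1))^2 / ?k >= 0" using k0 by simp
   hence "?N * ?w - ?k * ?w^2 <= (?N - 1)^2 / ?k - (?N - 2) * ?w" using k0 by (simp add: field_simps power2_eq_square)
   hence "?q * ?g * (?N * ?w - ?k * ?w^2) <= ?q * ?g * ((?N - 1)^2 / ?k - (?N - 2) * ?w)" using q by (intro mult_left_mono) auto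
   also have "... = (?N - 1)^2 * ?J x - (?N - 2) * (?q * (grad Ph x *. grad u x))" unfolding inner_grad_eq[of Ph] by (simp add: algebra_simps inner_commute)
   finally have 1: "?q * ?g * (?N * ?w - ?k * ?w^2) <= (?N - 1)^2 * ?J x - (?N - 2) * (?q * (grad Ph x *. grad u x))" .
   let ?T = "2 * ?g * normal_deriv' x (tangential_grad x) + ?w * (nu x *. hess Ph x (tangential_grad x)) - ?g * (tangential_grad x *. shape_op Ph x (grad u x))"
   have 2: "?q * ?T <= \<kappa> * (cutoff ep x * hess_sq x) + E * indicator ?S x" proof (cases "x : K")
   case False
   thus ?thesis using q0[OF x(1)] \<kappa> E0 cutoff_bounds(1)[OF ep, of x] hess_sq_nonneg[of x] by simp
   next
   case True
   hence xS: "x : ?S" using KS by blast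
   have T: "norm (tangential_grad x) <= \<tau>" unfolding \<tau>_def using True dl dl0 by (intro C1(3) x) (auto simp: K_def ep_def)
   have "?T <= \<tau> * C2 * (1 + sqrt (hess_sq x))" unfolding C2_def by (rule boundary_term_bound[OF x(1) Ug[OF xU] B(2)[OF x(2)] M(2)[OF x(1)] s[OF x(2,3)] L(2) T s0 less_imp_le[OF L(1)]])
   hence "?q * ?T <= ?q * (\<tau> * C2 * (1 + sqrt (hess_sq x)))" using q by (intro mult_left_mono)
   also have "... <= \<kappa> * (cutoff ep x * (sqrt (hess_sq x))^2) + E"
   unfolding E_def by (rule young_cutoff) (use cutoff_bounds[OF ep, of x] C1 C2 \<kappa> ep in "auto simp: \<tau>_def hess_sq_nonneg")
   finally show ?thesis using xS hess_sq_nonneg[of x] by simp qed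
   have "?q * (grad Ph x *. hess u x (grad u x)) + tr (flux_deriv ep x) = ?q * ?g * (?N * ?w - ?k * ?w^2) + ?q * ?T" by (rule boundary_divergence(2)[OF x(1) Ug[OF xU]])
   with 1 2 show ?thesis by linarith qed
  have "(IN x. cutoff ep x * hess_sq x) = (LINT x:U|lborel. cutoff' ep x * (grad Ph x *. hess u x (grad u x)))"
   unfolding energy_identity[OF ep] by (intro set_integral_subset_support U) (simp add: qU)
  also have "... = (LINT x:U|lborel. cutoff' ep x * (grad Ph x *. hess u x (grad u x)) + tr (flux_deriv ep x))" using set_integral_add(2)[OF iU[OF iAY] zero(1)] zero(2) by simp
  also have "... <= (LINT x:U|lborel. ?R x)" by (rule set_integral_mono[OF set_integral_add(1)[OF iU[OF iAY] zero(1)] iU[OF iR] pt])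
  also have "... = (LINT x:U|lborel. (?N - 1)^2 * ?J x - (?N - 2) * (cutoff' ep x * (grad Ph x *. grad u x)))
   + (LINT x:U|lborel. \<kappa> * (cutoff ep x * hess_sq x) + E * indicator ?S x)" unfolding add.assoc
   by (intro set_integral_add(2) set_integral_diff set_integral_add set_integrable_mult_right iU iJ iY iA iS)
  also have "(LINT x:U|lborel. (?N - 1)^2 * ?J x - (?N - 2) * (cutoff' ep x * (grad Ph x *. grad u x)))
   = (IN x. (?N - 1)^2 * ?J x - (?N - 2) * (cutoff' ep x * (grad Ph x *. grad u x)))" by (rule set_integral_subset_support[symmetric, OF U(2)]) (simp add: qU)
  also have "... = (IN x. (?N - 1)^2 * ?J x) - (IN x. (?N - 2) * (cutoff' ep x * (grad Ph x *. grad u x)))" by (intro set_integral_diff(2) set_integrable_mult_right iJ iY)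
  also have "... = (?N - 1)^2 * (IN x. ?J x) - (?N - 2) * (?N * (IN x. cutoff ep x))" by (simp only: set_integral_mult_right flux_identity[OF ep])
  also have "(LINT x:U|lborel. \<kappa> * (cutoff ep x * hess_sq x) + E * indicator ?S x) <= (IN x. \<kappa> * (cutoff ep x * hess_sq x) + E * indicator ?S x)" proof -
   have "sint (%x. \<kappa> * (cutoff ep x * hess_sq x) + E * indicator ?S x)" by (intro set_integral_add set_integrable_mult_right iA iS)
   thus ?thesis using iU[of "%x. \<kappa> * (cutoff ep x * hess_sq x) + E * indicator ?S x"] U(2) \<kappa> E0 cutoff_bounds(1)[OF ep] hess_sq_nonneg
   unfolding set_lebesgue_integral_def set_integrable_def by (intro integral_mono) (auto simp: indicator_def) qed
  also have "... = (IN x. \<kappa> * (cutoff ep x * hess_sq x)) + (IN x. E * indicator ?S x)" by (intro set_integral_add(2) set_integrable_mult_right iA iS)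
  also have "... = \<kappa> * (IN x. cutoff ep x * hess_sq x) + (IN x. E * indicator ?S x)" by (simp only: set_integral_mult_right)
  also have "(IN x. E * indicator ?S x) <= E * measure lborel ?S" proof -
   have "integrable lborel (indicator ?S :: 'a => real)" by (rule integrable_real_indicator) (use S(1) emeasure_bounded_finite[OF compact_imp_bounded[OF S(1)]] in "auto simp: borel_compact")
   hence "(IN x. E * indicator ?S x) <= (LINT x|lborel. E * indicator ?S x)" using iS E0 unfolding set_lebesgue_integral_def set_integrable_def
   by (intro integral_mono integrable_mult_right) (auto split: split_indicator)
   thus ?thesis by simp qed
  also have "E * measure lborel ?S <= E * (C3 * dl ^ 3)" using S E0 by (intro mult_left_mono)
  also have "... <= C * (dl^2 + dl / \<kappa>)" proof -
   \<comment> \<open>\<open>9 / ep\<close> is \<open>18 / dl ^ 3\<close> and \<open>\<tau>\<close>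
     is \<open>C1 * dl^2\<close>. The square of their product, times the volume of the layer, is of
     order \<open>dl\<close>.\<close>
   have X: "9 / ep * \<tau> * C2 = 18 * C1 * C2 / dl" using dl by (simp add: ep_def \<tau>_def power2_eq_square power3_eq_cube)
   have "E * (C3 * dl ^ 3) = (18 * C1 * C2)^2 / 4 * C3 * (dl / \<kappa>) + 18 * C1 * C2 * C3 * dl^2"
   unfolding E_def X using dl \<kappa> by (simp add: field_simps power2_eq_square power3_eq_cube)
   also have "... <= C * (dl / \<kappa>) + C * dl^2"
   using C1 C2 C3 dl \<kappa> by (intro add_mono mult_right_mono) (auto simp: C_def distrib_right intro!: add_nonneg_nonneg mult_nonneg_nonneg)
   finally show ?thesis by (simp add: algebra_simps) qed
  finally show ?thesis unfolding ep_def[symmetric] by (simp add: algebra_simps) qed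
 moreover have "C > 0" unfolding C_def using C1 C2 C3 by (intro add_nonneg_pos mult_nonneg_nonneg) auto
 ultimately show ?thesis using dl0(1) by blast qed

end

section \<open>The flux through the layer against Hausdorff measure\<close>

lemma nn_integral_le_hausdorff:
 fixes g :: "'a::euclidean_space => ennreal"
 assumes g[measurable]: "g : borel_measurable borel" and A: "bounded A" and e: "norm e = 1"
  and dim: "DIM('a) >= 2" and s1: "s1 >= 0" and c: "c > 0"
  and supp: "!!x. g x ~= 0 ==> EX s:{0..s1}. x + s *R e : A"
  and line: "!!x. (II s. g (x + s *R e)) <= ennreal c"
 shows "(II x. g x) <= ennreal c * hausdorff_outer (real DIM('a) - 1) A" proof -
 let ?I = "II x. g x"
 \<comment> \<open>For each piece of a cover \<open>nn_integral_le_by_lines\<close> returns exactly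
   the summand of the Hausdorff content, so no dimensional factor is lost. Any one scale of covers
   would do, since each content is below the outer measure.\<close>
 have "?I / ennreal c <= hausdorff_content (real DIM('a) - 1) 1 A" unfolding hausdorff_content_def proof (rule INF_greatest)
  fix C :: "nat => 'a set" assume "C : {C. A <= (\<Union>i. C i) & (ALL i. bounded (C i) & diameter (C i) <= 1)}"
  hence C: "A <= (\<Union>i. C i)" "!!i. bounded (C i)" by auto
  \<comment> \<open>Closing the pieces within \<open>A\<close> makes them compact without increasing
    diameters, so that the sets \<open>Z i\<close> below are Borel.\<close>
  define K where "K i = closure (C i Int A)" for i
  have K: "compact (K i)" for i using A by (simp add: K_def compact_closure bounded_Int)
  have dK: "diameter (K i) <= diameter (C i)" for i using A C(2)[of i] by (simp add: K_def diameter_closure bounded_Int diameter_subset)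
  define Z where "Z i = (%z. snd z - fst z *R e) ` ({0..s1} \<times> K i)" for i
  have "compact (Z i)" for i unfolding Z_def by (intro compact_continuous_image compact_Times K continuous_intros) auto
  hence Z[measurable]: "Z i : sets borel" for i by (simp add: borel_compact)
  have Zhit: "EX s:{0..s1}. x + s *R e : K i" if "x : Z i" for x i using that by (force simp: Z_def)
  have hitZ: "x : Z i" if "s : {0..s1}" "x + s *R e : K i" for x s i using that by (auto simp: Z_def intro!: image_eqI[of _ _ "(s, x + s *R e)"])
  have "?I <= (II x. (\<Sum>i. g x * indicator (Z i) x))" proof (rule nn_integral_mono)
   fix x
   show "g x <= (\<Sum>i. g x * indicator (Z i) x)" proof (cases "g x = 0")
   case False
   then obtain s where s: "s : {0..s1}" "x + s *R e : A" using supp by blast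
   then obtain i where "x + s *R e : C i" using C(1) by blast
   hence "x + s *R e : K i" using s(2) closure_subset[of "C i Int A"] by (auto simp: K_def)
   hence "g x = g x * indicator (Z i) x" using hitZ[OF s(1)] by simp
   also have "... <= (\<Sum>i. g x * indicator (Z i) x)" proof -
   define G where "G j = g x * indicator (Z j) x" for j
   show ?thesis using sum_le_suminf[of G "{i}"] unfolding G_def[symmetric] by simp qed
   finally show ?thesis . qed simp qed
  also have "... = (\<Sum>i. II x. g x * indicator (Z i) x)" by (rule nn_integral_suminf) simp
  also have "... <= (\<Sum>i. ennreal c * ennreal (unit_ball_vol (real DIM('a) - 1) * (diameter (C i) / 2) powr (real DIM('a) - 1)))" proof (rule suminf_le)
   fix i
   have d0: "diameter (C i) >= 0" by (rule diameter_ge_0[OF C(2)])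
   have "(II x. g x * indicator (Z i) x) <= ennreal (c * (unit_ball_vol (real (DIM('a) - 1)) * (diameter (C i) / 2) ^ (DIM('a) - 1)))"
   proof (rule nn_integral_le_by_lines[OF _ K dK e dim d0 s1 less_imp_le[OF c]])
   show "(II s. g (x + s *R e) * indicator (Z i) (x + s *R e)) <= ennreal c" for x by (rule order_trans[OF nn_integral_mono line]) (auto simp: indicator_def)
   qed (use Zhit in "auto simp: indicator_def split: if_splits")
   also have "(diameter (C i) / 2) ^ (DIM('a) - 1) = (diameter (C i) / 2) powr (real DIM('a) - 1)"
   using d0 dim by (cases "diameter (C i) = 0") (auto simp: powr_realpow[symmetric] of_nat_diff power_0_left)
   finally show "(II x. g x * indicator (Z i) x) <= ennreal c * ennreal (unit_ball_vol (real DIM('a) - 1) * (diameter (C i) / 2) powr (real DIM('a) - 1))"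
   using c dim by (simp add: ennreal_mult' of_nat_diff) qed auto
  also have "... = ennreal c * (\<Sum>i. ennreal (unit_ball_vol (real DIM('a) - 1) * (diameter (C i) / 2) powr (real DIM('a) - 1)))" by simp
  finally show "?I / ennreal c <= (\<Sum>i. ennreal (unit_ball_vol (real DIM('a) - 1) * (diameter (C i) / 2) powr (real DIM('a) - 1)))" using c by (intro divide_le_posI_ennreal) auto qed
 also have "... <= hausdorff_outer (real DIM('a) - 1) A" by (rule hausdorff_content_le_outer) simp
 finally have "ennreal c * (?I / ennreal c) <= ennreal c * hausdorff_outer (real DIM('a) - 1) A" by (rule mult_left_mono) simp
 thus ?thesis using c by (simp add: ennreal_times_divide mult.commute[of "ennreal c" ?I] mult_divide_eq_ennreal) qed

lemma line_Int_cball: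
 fixes e :: "'a::euclidean_space"
 assumes "norm e = 1"
 shows "EX a b. {s. x + s *R e : cball p r} = {a..b}" proof -
 let ?I = "{s. x + s *R e : cball p r}"
 have "?I = (%s. x + s *R e) -` cball p r" by auto
 moreover have "convex ((%s. x + s *R e) -` cball p r)" unfolding convex_alt proof (intro ballI allI impI, goal_cases)
  case (1 s s' k)
  have "x + ((1 - k) *R s + k *R s') *R e = (1 - k) *R (x + s *R e) + k *R (x + s' *R e)" by (simp add: algebra_simps)
  thus ?case using 1 convex_cball[of p r, unfolded convex_alt] by simp qed
 moreover have "closed ((%s. x + s *R e) -` cball p r)" by (intro continuous_closed_vimage continuous_intros) auto
 moreover have "bounded ?I" proof (rule boundedI)
  fix s assume "s : ?I"
  hence "norm (x + s *R e - p) <= r" by (simp add: dist_norm norm_minus_commute)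
  thus "norm s <= r + norm (x - p)" using norm_triangle_ineq4[of "x + s *R e - p" "x - p"] assms by (simp add: algebra_simps) qed
 ultimately have "connected ?I & compact ?I" by (simp add: convex_connected compact_eq_bounded_closed)
 thus ?thesis by (simp only: connected_compact_interval_1) qed

context C2_domain
begin

abbreviation "\<sigma> == surface_measure Gam"

lemma surface_eq: "\<sigma> = restrict_space (hausdorff_measure (real DIM('a) - 1)) Gam" by (rule surface_measure_eq) (simp add: borel_closed)

lemma space_\<sigma>: "space \<sigma> = Gam" by (simp add: surface_eq space_restrict_space)

lemma measurable_\<sigma>: "continuous_on Gam f ==> f : borel_measurable \<sigma>" using borel_measurable_continuous_on_restrict[of Gam f]
  measurable_cong_sets[of \<sigma> "restrict_space borel Gam" borel borel] by (simp add: surface_eq sets_restrict_space)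

lemma emeasure_\<sigma>: "A : sets borel ==> A <= Gam ==> emeasure \<sigma> A = hausdorff_outer (real DIM('a) - 1) A"
 unfolding surface_eq by (subst emeasure_restrict_space) (auto simp: emeasure_hausdorff_measure borel_closed)

text \<open>On a small patch \<open>grad Ph\<close> is nearly parallel to \<open>e\<close>, so up to
  the factor \<open>c\<close> the density \<open>cutoff' * nG\<close> integrates along lines in
  direction \<open>e\<close> to the variation of \<open>cutoff\<close>, at most 1. Points of the
  layer reach \<open>Gam\<close> along \<open>e\<close> within length \<open>s1\<close>, over which
  \<open>f\<close> changes by less than \<open>\<zeta>\<close>. Applied to the superlevel sets of
  \<open>f\<close>, this gives the bound.\<close>

lemma flux_patch:
 fixes f :: "'a => real"
 assumes t: "t > 0" and e: "norm e = 1" and \<rho>: "\<rho> > 0" and c: "c > 0"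
  and cone: "!!x. x : cball p (2 * \<rho>) ==> 0 < grad Ph x *. e" "!!x. x : cball p (2 * \<rho>) ==> nG x <= c * (grad Ph x *. e)"
  and f: "continuous_on {x : closure Om. - t <= Ph x} f" "!!x. x : closure Om ==> - t <= Ph x ==> 0 <= f x & f x <= 1 / 2"
   "!!x. x : closure Om ==> - t <= Ph x ==> x ~: ball p \<rho> ==> f x = 0"
  and fin: "finite_measure \<sigma>" and dim: "DIM('a) >= 2" and \<zeta>: "0 < \<zeta>" "\<zeta> <= 1 / 2"
 shows "\<forall>\<^sub>F ep in at_right 0. (IN x. cutoff' ep x * (nG x * f x)) <= c * ((\<integral>x. f x \<partial>\<sigma>) + \<zeta> * measure \<sigma> Gam)" proof -
 interpret \<sigma>: finite_measure \<sigma> by (rule fin)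
 define K where "K = {x : closure Om. - t <= Ph x}"
 have K: "compact K" unfolding K_def by (rule compact_layer)
 have GamK: "Gam <= K" using Ph_frontier t closure_eq by (auto simp: K_def)
 have fK: "continuous_on K f" using f(1) by (simp add: K_def)
 obtain d where d: "d > 0" "!!x y. x : K ==> y : K ==> dist x y < d ==> dist (f x) (f y) < \<zeta>"
  using compact_uniformly_continuous[OF fK K] \<zeta>(1) unfolding uniformly_continuous_on_def by (metis dist_commute)
 have ne: "cball p (2 * \<rho>) ~= {}" and cg: "continuous_on (cball p (2 * \<rho>)) (%x. grad Ph x *. e)" using \<rho> by (auto intro!: continuous_intros continuous_grad_Ph)
 from continuous_attains_inf[OF compact_cball ne cg]
 obtain y where y: "y : cball p (2 * \<rho>)" "ALL x:cball p (2 * \<rho>). grad Ph y *. e <= grad Ph x *. e" by blast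
 define m where "m = grad Ph y *. e"
 have m: "m > 0" "!!x. x : cball p (2 * \<rho>) ==> m <= grad Ph x *. e" using cone y by (auto simp: m_def)
 \<comment> \<open>The three entries keep the layer where \<open>- t <= Ph\<close>, the shifted
   points inside \<open>cball p (2 * \<rho>)\<close>, and the shift below the continuity modulus
   \<open>d\<close>.\<close>
 define ep0 where "ep0 = Min {t / 2, \<rho> * m / 2, d * m / 2}"
 have ep0: "ep0 > 0" using t \<rho> m d by (auto simp: ep0_def)
 define F where "F x = indicator K x *R f x" for x
 have [measurable]: "F : borel_measurable borel" unfolding F_def by (rule borel_measurable_continuous_on_indicator[OF borel_compact[OF K] fK])
 have F01: "0 <= F x" "F x <= 1 / 2" for x using f(2)[of x] by (auto simp: F_def K_def indicator_def)
 \<comment> \<open>\<open>f\<close> on the frontier, raised by \<open>\<zeta>\<close> to absorb the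
   shift. As \<open>f\<close> and \<open>\<zeta>\<close> are at most 1/2, the layer cake formula
   with levels up to 1 applies.\<close>
 define F2 where "F2 x = (if x : Gam then f x + \<zeta> else 0)" for x
 have f\<sigma>: "f : borel_measurable \<sigma>" by (rule measurable_\<sigma>[OF continuous_on_subset[OF fK GamK]])
 have F2m: "F2 : borel_measurable \<sigma>"
  by (rule measurable_cong[THEN iffD1, OF _ borel_measurable_add[OF f\<sigma> borel_measurable_const[of \<zeta>]]]) (simp add: F2_def space_\<sigma>)
 have F201: "0 <= F2 x" "F2 x <= 1" for x using f(2)[of x] GamK \<zeta> by (auto simp: F2_def K_def)
 have if\<sigma>: "integrable \<sigma> f" using f(2) GamK by (intro \<sigma>.integrable_const_bound[of _ "1/2"] f\<sigma>) (auto simp: space_\<sigma> K_def subset_iff intro!: AE_I2)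
 have [measurable]: "ball p \<rho> : sets borel" "Om : sets borel" using open_Om by auto
 have main: "(IN x. cutoff' ep x * (nG x * f x)) <= c * ((\<integral>x. f x \<partial>\<sigma>) + \<zeta> * measure \<sigma> Gam)"
  if "ep : {0<..<ep0}" for ep proof -
  have ep: "ep > 0" "2 * ep < t" "2 * ep / m < \<rho>" "2 * ep / m < d" using that m by (auto simp: ep0_def field_simps)
  define s1 where "s1 = 2 * ep / m"
  have s1: "s1 >= 0" using ep m by (simp add: s1_def)
  have hit: "EX s:{0..s1}. x + s *R e : Gam" if x: "x : Om" "x : ball p \<rho>" "- (2 * ep) <= Ph x" for x proof -
   have in2: "x + s *R e : cball p (2 * \<rho>)" if "0 <= s" "s <= s1" for s
   using norm_triangle_ineq[of "x - p" "s *R e"] x(2) that ep e by (simp add: dist_norm norm_minus_commute s1_def algebra_simps)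
   have "0 <= Ph (x + s1 *R e)" proof (cases "s1 = 0")
   case True thus ?thesis using ep m by (simp add: s1_def)
   next
   case False
   hence s10: "0 < s1" using s1 by simp
   obtain z where z: "0 < z" "z < s1" "Ph (x + s1 *R e) - Ph (x + 0 *R e) = (s1 - 0) * (grad Ph (x + z *R e) *. e)"
   using MVT2[OF s10, of "%s. Ph (x + s *R e)" "%s. grad Ph (x + s *R e) *. e"] has_derivative_inner_D[OF has_grad_Ph] by blast
   have "s1 * m <= s1 * (grad Ph (x + z *R e) *. e)" using z s1 by (intro mult_left_mono m in2) auto
   thus ?thesis using z(3) x(3) m by (simp add: s1_def) qed
   hence out: "x + s1 *R e ~: Om" by (simp add: Om_eq)
   have con: "connected ((%s. x + s *R e) ` {0..s1})" by (intro connected_continuous_image continuous_intros) simp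
   have "x : (%s. x + s *R e) ` {0..s1}" using s1 by (intro image_eqI[of _ _ 0]) auto
   moreover have "x + s1 *R e : (%s. x + s *R e) ` {0..s1}" using s1 by (intro image_eqI[of _ _ s1]) auto
   ultimately have "(%s. x + s *R e) ` {0..s1} Int Gam ~= {}" using x(1) out by (intro connected_Int_frontier[OF con]) auto
   thus ?thesis by auto qed
  define h where "h x = ennreal (cutoff' ep x * nG x) * indicator (Om Int ball p \<rho>) x" for x
  have [measurable]: "cutoff' ep : borel_measurable borel" "grad Ph : borel_measurable borel" by (auto intro!: borel_measurable_continuous_onI continuous_cutoff continuous_grad_Ph)
  have hm[measurable]: "h : borel_measurable borel" unfolding h_def by measurable
  define M where "M = density lborel h"
  have "AE x in lborel. h x ~= \<infinity>" by (simp add: h_def indicator_def)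
  hence sM: "sigma_finite_measure M" unfolding M_def by (subst sigma_finite_measure.sigma_finite_iff_density_finite[OF sigma_finite_lborel]) auto
  have hline: "(II s. h (x + s *R e)) <= ennreal c" for x proof -
   obtain a b where ab: "{s. x + s *R e : cball p \<rho>} = {a..b}" using line_Int_cball[OF e] by blast
   show ?thesis proof (cases "a <= b")
   case True
   have in1: "x + s *R e : cball p (2 * \<rho>)" if "a <= s" "s <= b" for s proof -
   have "s : {s. x + s *R e : cball p \<rho>}" unfolding ab using that by simp
   thus ?thesis using \<rho> by simp qed
   let ?g = "%s. cutoff' ep (x + s *R e) * (grad Ph (x + s *R e) *. e)"
   have D: "((%s. - cutoff ep (x + s *R e)) has_field_derivative ?g s) (at s)" for s using DERIV_minus[OF has_derivative_inner_D[OF cutoff_has_grad]] by simp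
   have "(II s. h (x + s *R e)) <= (II s. ennreal c * (ennreal (?g s) * indicator {a..b} s))" proof (rule nn_integral_mono)
   fix s
   show "h (x + s *R e) <= ennreal c * (ennreal (?g s) * indicator {a..b} s)" proof (cases "x + s *R e : ball p \<rho>")
   case False thus ?thesis by (simp add: h_def)
   next
   case True
   hence "s : {s. x + s *R e : cball p \<rho>}" by simp
   hence s: "s : {a..b}" unfolding ab .
   have "cutoff' ep (x + s *R e) * norm (grad Ph (x + s *R e)) <= cutoff' ep (x + s *R e) * (c * (grad Ph (x + s *R e) *. e))"
   using s by (intro mult_left_mono cone in1 cutoff_bounds(3)[OF ep(1)]) auto
   thus ?thesis using s c by (auto simp: h_def indicator_def mult_ac simp flip: ennreal_mult' intro!: ennreal_leI) qed qed
   also have "... = ennreal c * (II s. ennreal (?g s) * indicator {a..b} s)" by (intro nn_integral_cmult) measurable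
   also have "(II s. ennreal (?g s) * indicator {a..b} s) = ennreal (- cutoff ep (x + b *R e) - - cutoff ep (x + a *R e))"
   proof (rule nn_integral_FTC_Icc[where f="?g" and F="%s. - cutoff ep (x + s *R e)", OF _ _ _ True])
   show "(%s. ?g s) : borel_measurable borel" by measurable
   show "0 <= ?g s" if "s : {a..b}" for s using cone(1)[OF in1, of s] that cutoff_bounds(3)[OF ep(1)] by simp qed (rule D)
   also have "ennreal c * ... <= ennreal c * ennreal 1"
   using cutoff_bounds(1)[OF ep(1), of "x + b *R e"] cutoff_bounds(2)[OF ep(1), of "x + a *R e"] by (intro mult_left_mono ennreal_leI) auto
   finally show ?thesis by simp
   next
   case False
   have "h (x + s *R e) = 0" for s proof -
   have "s ~: {s. x + s *R e : cball p \<rho>}" unfolding ab using False by simp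
   thus ?thesis by (auto simp: h_def indicator_def) qed
   thus ?thesis by simp qed qed
  have level: "emeasure M {x : space M. \<tau> < F x} <= ennreal c * emeasure \<sigma> {x : space \<sigma>. \<tau> < F2 x}" if \<tau>: "0 < \<tau>" for \<tau> proof -
   define A where "A = {x : Gam. \<tau> < F2 x}"
   have "{x : space \<sigma>. \<tau> < F2 x} : sets \<sigma>" using F2m by measurable
   hence A: "A : sets borel" "A <= Gam" by (auto simp: A_def space_\<sigma> surface_eq sets_restrict_space borel_closed)
   have "emeasure M {x : space M. \<tau> < F x} = (II x. h x * indicator {x. \<tau> < F x} x)" unfolding M_def by (subst emeasure_density) (auto simp: indicator_def)
   also have "... <= ennreal c * hausdorff_outer (real DIM('a) - 1) A" proof (rule nn_integral_le_hausdorff[OF _ _ e dim s1 c])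
   show "bounded A" using A(2) compact_imp_bounded[OF compact_frontier] bounded_subset by blast
   show "(II s. h (x + s *R e) * indicator {x. \<tau> < F x} (x + s *R e)) <= ennreal c" for x by (rule order_trans[OF nn_integral_mono hline]) (auto simp: indicator_def)
   next
   fix x assume "h x * indicator {x. \<tau> < F x} x ~= 0"
   hence x: "x : Om" "x : ball p \<rho>" "cutoff' ep x ~= 0" "\<tau> < F x" by (auto simp: h_def indicator_def split: if_splits)
   have Phx: "- (2 * ep) <= Ph x" using cutoff_eq(3)[OF ep(1), of x] x(3) by linarith
   hence xK: "x : K" using x(1) ep closure_eq by (auto simp: K_def)
   obtain s where s: "s : {0..s1}" "x + s *R e : Gam" using hit[OF x(1,2) Phx] by blast
   have "dist x (x + s *R e) < d" using s e ep by (simp add: dist_norm s1_def)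
   hence "dist (f x) (f (x + s *R e)) < \<zeta>" using s GamK by (intro d(2) xK) auto
   hence "\<tau> < F2 (x + s *R e)" using x(4) xK s(2) by (auto simp: F_def F2_def dist_real_def)
   thus "EX s:{0..s1}. x + s *R e : A" using s by (auto simp: A_def) qed measurable
   also have "hausdorff_outer (real DIM('a) - 1) A = emeasure \<sigma> {x : space \<sigma>. \<tau> < F2 x}" using emeasure_\<sigma>[OF A] by (simp add: A_def space_\<sigma>)
   finally show ?thesis . qed
  have "(\<integral>\<^sup>+x. ennreal (F x) \<partial>M) = (\<integral>\<^sup>+\<tau>. indicator {0<..<1} \<tau> * emeasure M {x\<in>space M. \<tau> < F x} \<partial>lborel)"
   by (rule nn_integral_layer_cake[OF sM]) (use F01(1) order_trans[OF F01(2), of 1] in "auto simp: M_def")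
  also have "... <= (\<integral>\<^sup>+\<tau>. ennreal c * (indicator {0<..<1} \<tau> * emeasure \<sigma> {x\<in>space \<sigma>. \<tau> < F2 x}) \<partial>lborel)"
   using level by (intro nn_integral_mono) (auto simp: indicator_def)
  also have "... = ennreal c * (\<integral>\<^sup>+\<tau>. indicator {0<..<1} \<tau> * emeasure \<sigma> {x\<in>space \<sigma>. \<tau> < F2 x} \<partial>lborel)"
  proof (rule nn_integral_cmult)
   have "mono (%\<tau>. - (measure \<sigma> {x\<in>space \<sigma>. \<tau> < F2 x}))" using F2m by (intro monoI) (auto intro!: \<sigma>.finite_measure_mono)
   hence "(%\<tau>. - (- measure \<sigma> {x\<in>space \<sigma>. \<tau> < F2 x})) : borel_measurable borel" by (intro borel_measurable_uminus borel_measurable_mono)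
   thus "(%\<tau>. indicator {0<..<1} \<tau> * emeasure \<sigma> {x\<in>space \<sigma>. \<tau> < F2 x}) : borel_measurable lborel" unfolding \<sigma>.emeasure_eq_measure by simp qed
  also have "(\<integral>\<^sup>+\<tau>. indicator {0<..<1} \<tau> * emeasure \<sigma> {x\<in>space \<sigma>. \<tau> < F2 x} \<partial>lborel) = (\<integral>\<^sup>+x. ennreal (F2 x) \<partial>\<sigma>)"
   by (rule nn_integral_layer_cake[symmetric]) (use F2m F201 \<sigma>.sigma_finite_measure_axioms in auto)
  also have "... = (\<integral>\<^sup>+x. ennreal (f x + \<zeta>) \<partial>\<sigma>)" by (intro nn_integral_cong) (simp add: F2_def space_\<sigma>)
  also have "... = ennreal ((\<integral>x. f x \<partial>\<sigma>) + \<zeta> * measure \<sigma> Gam)"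
   using if\<sigma> f(2) GamK \<zeta> by (subst nn_integral_eq_integral) (auto simp: space_\<sigma> K_def subset_iff mult.commute intro!: AE_I2)
  finally have le: "(\<integral>\<^sup>+x. ennreal (F x) \<partial>M) <= ennreal (c * ((\<integral>x. f x \<partial>\<sigma>) + \<zeta> * measure \<sigma> Gam))"
   using c by (simp add: ennreal_mult')
  have eq: "indicator Om x *R (cutoff' ep x * (nG x * f x)) = indicator Om x * (cutoff' ep x * (nG x * (indicator (ball p \<rho>) x * F x)))" for x proof (cases "x : Om & cutoff' ep x ~= 0")
   case True
   hence "- (2 * ep) <= Ph x" "x : closure Om" using cutoff_eq(3)[OF ep(1), of x] closure_eq by (linarith, blast)
   thus ?thesis using f(3)[of x] ep by (auto simp: F_def K_def indicator_def) qed auto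
  have "(IN x. cutoff' ep x * (nG x * f x)) = (\<integral>x. indicator Om x * (cutoff' ep x * (nG x * (indicator (ball p \<rho>) x * F x))) \<partial>lborel)"
   unfolding set_lebesgue_integral_def eq ..
  also have "... = enn2real (II x. ennreal (indicator Om x * (cutoff' ep x * (nG x * (indicator (ball p \<rho>) x * F x)))))"
   using F01 cutoff_bounds(3)[OF ep(1)] by (intro integral_eq_nn_integral AE_I2) (auto intro!: mult_nonneg_nonneg)
  also have "(II x. ennreal (indicator Om x * (cutoff' ep x * (nG x * (indicator (ball p \<rho>) x * F x))))) = (\<integral>\<^sup>+x. ennreal (F x) \<partial>M)"
   unfolding M_def using F01 cutoff_bounds(3)[OF ep(1)] by (subst nn_integral_density) (auto intro!: nn_integral_cong simp: h_def indicator_def mult.assoc simp flip: ennreal_mult)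
  also have "enn2real ... <= c * ((\<integral>x. f x \<partial>\<sigma>) + \<zeta> * measure \<sigma> Gam)" proof (rule enn2real_leI[OF _ le])
   have "0 <= (\<integral>x. f x \<partial>\<sigma>)" using f(2) GamK by (intro Bochner_Integration.integral_nonneg_AE AE_I2) (auto simp: space_\<sigma> K_def subset_iff)
   thus "0 <= c * ((\<integral>x. f x \<partial>\<sigma>) + \<zeta> * measure \<sigma> Gam)" using c \<zeta> by simp qed
  finally show ?thesis . qed
 show ?thesis by (rule eventually_at_rightI[OF main ep0]) qed

end

lemma finite_maximal_separated:
 fixes S :: "'a::metric_space set"
 assumes bd: "!!X. X <= S ==> finite X ==> (!!x y. x : X ==> y : X ==> x ~= y ==> d <= dist x y) ==> real (card X) <= B" and d: "d > 0"
 shows "EX X<=S. finite X & (ALL x:X. ALL y:X. x ~= y --> d <= dist x y) & (ALL p:S. EX x:X. dist x p < d)" proof -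
 define P where "P X \<longleftrightarrow> X <= S & finite X & (ALL x:X. ALL y:X. x ~= y --> d <= dist x y)" for X
 have "P {}" by (simp add: P_def)
 moreover have "card X < Suc (nat \<lceil>B\<rceil>)" if "P X" for X proof -
  have "real (card X) <= B" using that unfolding P_def by (intro bd) auto
  thus ?thesis by linarith qed
 ultimately obtain X where X: "P X" "!!Y. P Y ==> card Y <= card X" using ex_has_greatest_nat[of P "{}" card "Suc (nat \<lceil>B\<rceil>)"] by (metis less_imp_le)
 have "EX x:X. dist x p < d" if p: "p : S" for p proof (rule ccontr)
  assume "~ (EX x:X. dist x p < d)"
  hence far: "!!x. x : X ==> d <= dist x p" by (auto simp: not_less)
  hence "p ~: X" using d by force
  moreover have "P (insert p X)" using X(1) p far unfolding P_def by (auto simp: dist_commute)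
  ultimately show False using X(2)[of "insert p X"] X(1) by (simp add: P_def) qed
 thus ?thesis using X(1) unfolding P_def by blast qed

context C2_domain
begin

text \<open>The balls of radius \<open>r\<close> about the points are disjoint and lie in the layer
  where \<open>|Ph| <= (B + L) * r\<close>, whose volume is of order \<open>r\<close>; comparing
  volumes bounds their number.\<close>

lemma separated_card:
 "EX C>=0. EX r\<^sub>0>0. ALL r X. 0 < r & r <= r\<^sub>0 & X <= Gam & finite X & (ALL x:X. ALL y:X. x ~= y --> 2 * r <= dist x y) -->
   real (card X) * r ^ (DIM('a) - 1) <= C" proof -
 obtain t m where m: "t > 0" "m > 0" "!!x. x : closure Om ==> - t <= Ph x ==> m <= nG x" using grad_Ph_layer by blast
 obtain L where L: "L > 0" "!!x y. norm (grad Ph x - grad Ph y) <= L * norm (x - y)" using grad_Ph_Lipschitz by blast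
 have "bounded (grad Ph ` Gam)" by (rule compact_imp_bounded[OF compact_continuous_image[OF continuous_grad_Ph compact_frontier]])
 then obtain B where B: "B > 0" "!!x. x : Gam ==> nG x <= B" by (auto simp: bounded_pos)
 obtain C where C: "C > 0" "!!ep. ep > 0 ==> compact {x. \<bar>Ph x\<bar> <= ep & m / 2 <= nG x} & measure lborel {x. \<bar>Ph x\<bar> <= ep & m / 2 <= nG x} <= C * ep"
  using layer_volume[of "m / 2"] m by auto
 define r\<^sub>0 where "r\<^sub>0 = min 1 (m / (2 * L))"
 have r\<^sub>0: "r\<^sub>0 > 0" using m L by (simp add: r\<^sub>0_def)
 let ?\<omega> = "unit_ball_vol (real DIM('a))"
 have \<omega>: "?\<omega> > 0" by simp
 have "real (card X) * r ^ (DIM('a) - 1) <= C * (B + L) / ?\<omega>"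
  if r: "0 < r" "r <= r\<^sub>0" and X: "X <= Gam" "finite X" "ALL x:X. ALL y:X. x ~= y --> 2 * r <= dist x y" for r X proof -
  have r1: "r <= 1" "r * L <= m / 2" using r L by (auto simp: r\<^sub>0_def field_simps)
  let ?S = "{x. \<bar>Ph x\<bar> <= (B + L) * r & m / 2 <= nG x}"
  have S: "compact ?S" "measure lborel ?S <= C * ((B + L) * r)" using C(2)[of "(B + L) * r"] B L r by auto
  have sub: "ball y r <= ?S" if y: "y : X" for y proof
   fix x assume "x : ball y r"
   hence xy: "norm (x - y) <= r" by (simp add: dist_norm norm_minus_commute)
   have yG: "y : Gam" "y : closure Om" using y X closure_eq by auto
   have "\<bar>Ph x\<bar> <= \<bar>grad Ph y *. (x - y)\<bar> + L * (norm (x - y))^2" using Ph_Taylor[OF L(2,1), of x y] Ph_frontier[OF yG(1)] by simp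
   also have "... <= B * r + L * r" proof (intro add_mono mult_left_mono)
   show "\<bar>grad Ph y *. (x - y)\<bar> <= B * r" by (rule order_trans[OF Cauchy_Schwarz_ineq2 mult_mono[OF B(2)[OF yG(1)] xy]]) (use B in auto)
   have "(norm (x - y))^2 <= r * 1" unfolding power2_eq_square using xy r r1 by (intro mult_mono) auto
   thus "(norm (x - y))^2 <= r" by simp qed (use L in simp)
   finally have 1: "\<bar>Ph x\<bar> <= (B + L) * r" by (simp add: algebra_simps)
   have "nG y <= nG x + L * norm (x - y)" using norm_triangle_ineq4[of "grad Ph x" "grad Ph x - grad Ph y"] L(2)[of x y] by simp
   also have "L * norm (x - y) <= m / 2" using mult_left_mono[OF xy, of L] L r1 unfolding mult.commute[of r L] by linarith
   finally have "m / 2 <= nG x" using m(3)[OF yG(2)] Ph_frontier[OF yG(1)] m(1) by simp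
   with 1 show "x : ?S" by simp qed
  have dis: "disjoint_family_on (%y. ball y r) X" unfolding disjoint_family_on_def proof (intro ballI impI, rule ccontr)
   fix x y assume xy: "x : X" "y : X" "x ~= y" and "ball x r Int ball y r ~= {}"
   then obtain z where "dist x z < r" "dist y z < r" by auto
   hence "dist x y < 2 * r" using dist_triangle2[of x y z] by linarith
   thus False using X(3) xy by force qed
  have "real (card X) * (?\<omega> * r ^ DIM('a)) = (SUM y:X. measure lborel (ball y r))" using r by (simp add: content_ball)
  also have "... = measure lborel (UN y:X. ball y r)" by (rule measure_finite_Union[symmetric, OF X(2) _ dis])
   (auto intro!: less_imp_neq emeasure_bounded_finite[unfolded infinity_ennreal_def])
  also have "... <= measure lborel ?S" proof (rule measure_mono_fmeasurable)
   show "(UN y:X. ball y r) : sets lborel" using open_UN[of X "%y. ball y r"] by (simp add: borel_open)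
   show "?S : fmeasurable lborel" by (rule fmeasurableI) (use borel_compact[OF S(1)] emeasure_bounded_finite[OF compact_imp_bounded[OF S(1)]] in simp_all) qed (use sub in blast)
  also have "... <= C * ((B + L) * r)" by (rule S(2))
  finally have "real (card X) * r ^ (DIM('a) - 1) * (?\<omega> * r) <= (C * (B + L) / ?\<omega>) * (?\<omega> * r)" using \<omega> power_Suc[of r "DIM('a) - 1"] by (simp add: mult_ac)
  thus ?thesis using \<omega> r by (meson mult_le_cancel_right_pos mult_pos_pos) qed
 moreover have "C * (B + L) / ?\<omega> >= 0" using C B L \<omega> by (intro divide_nonneg_pos) auto
 ultimately show ?thesis using r\<^sub>0 by blast qed

text \<open>A maximal subset of \<open>Gam\<close> with distances at least \<open>2 * r\<close>
  yields a cover by balls of diameter at most \<open>4 * r\<close>, in number of order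
  \<open>r^(1 - N)\<close>. Finiteness makes bounded continuous functions integrable over
  \<open>Gam\<close>.\<close>

lemma finite_surface:
 assumes dim: "DIM('a) >= 2"
 shows "finite_measure \<sigma>" proof -
 let ?s = "real DIM('a) - 1"
 obtain C r\<^sub>0 where C: "C >= 0" "r\<^sub>0 > 0" and sep: "ALL r X. 0 < r & r <= r\<^sub>0 & X <= Gam & finite X & (ALL x:X. ALL y:X. x ~= y --> 2 * r <= dist x y) -->
   real (card X) * r ^ (DIM('a) - 1) <= C" using separated_card by metis
 define W where "W = unit_ball_vol ?s * 2 ^ (DIM('a) - 1) * C"
 have content: "hausdorff_content ?s (4 * r) Gam <= ennreal W" if r: "0 < r" "r <= r\<^sub>0" for r proof -
  have "real (card X) <= C / r ^ (DIM('a) - 1)" if "X <= Gam" "finite X" "!!x y. x : X ==> y : X ==> x ~= y ==> 2 * r <= dist x y" for X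
   using sep[rule_format, of r X] that r by (simp add: field_simps)
  then obtain X where X: "X <= Gam" "finite X" "ALL x:X. ALL y:X. x ~= y --> 2 * r <= dist x y" "!!p. p : Gam ==> EX x:X. dist x p < 2 * r"
   using finite_maximal_separated[of Gam "2 * r" "C / r ^ (DIM('a) - 1)"] r by auto
  obtain y where y: "bij_betw y {0..<card X} X" using ex_bij_betw_nat_finite[OF X(2)] by blast
  define D where "D i = (if i < card X then ball (y i) (2 * r) else {})" for i
  have dD: "diameter (D i) <= 4 * r" for i using r by (auto simp: D_def)
  have "hausdorff_content ?s (4 * r) Gam <= (\<Sum>i. ennreal (unit_ball_vol ?s * (diameter (D i) / 2) powr ?s))" proof (rule hausdorff_content_le)
   show "Gam <= (\<Union>i. D i)" proof
   fix p assume "p : Gam"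
   then obtain x where x: "x : X" "dist x p < 2 * r" using X(4) by blast
   hence "x : y ` {0..<card X}" using bij_betw_imp_surj_on[OF y] by simp
   then obtain i where "i < card X" "y i = x" by auto
   hence "p : D i" using x by (simp add: D_def)
   thus "p : (\<Union>i. D i)" by blast qed qed (use dD in "auto simp: D_def")
  also have "... = (\<Sum>i<card X. ennreal (unit_ball_vol ?s * (diameter (D i) / 2) powr ?s))" by (rule suminf_finite) (use dim in "auto simp: D_def")
  also have "... <= (\<Sum>i<card X. ennreal (unit_ball_vol ?s * (2 * r) ^ (DIM('a) - 1)))" proof (intro sum_mono ennreal_leI mult_left_mono)
   fix i
   have "0 <= diameter (D i)" by (intro diameter_ge_0) (auto simp: D_def)
   hence "(diameter (D i) / 2) powr ?s <= (2 * r) powr ?s" using dD[of i] dim by (intro powr_mono2) auto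
   also have "(2 * r) powr ?s = (2 * r) powr real (DIM('a) - 1)" using dim by (simp add: of_nat_diff)
   also have "... = (2 * r) ^ (DIM('a) - 1)" by (rule powr_realpow) (use r in simp)
   finally show "(diameter (D i) / 2) powr ?s <= (2 * r) ^ (DIM('a) - 1)" . qed (use dim in auto)
  also have "... = ennreal (unit_ball_vol ?s * 2 ^ (DIM('a) - 1) * (real (card X) * r ^ (DIM('a) - 1)))" using r dim by (subst sum_ennreal) (auto simp: power_mult_distrib mult_ac)
  also have "... <= ennreal W" unfolding W_def using sep[rule_format, of r X] X(1,2,3) r dim by (intro ennreal_leI mult_left_mono) auto
  finally show ?thesis . qed
 have "hausdorff_outer ?s Gam <= ennreal W" unfolding hausdorff_outer_def proof (rule SUP_least)
  fix dl :: real assume "dl : {0<..}"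
  hence dl: "dl > 0" by simp
  define r where "r = min r\<^sub>0 (dl / 4)"
  have "hausdorff_content ?s dl Gam <= hausdorff_content ?s (4 * r) Gam" by (rule hausdorff_content_antimono) (simp add: r_def)
  also have "... <= ennreal W" using C dl by (intro content) (auto simp: r_def)
  finally show "hausdorff_content ?s dl Gam <= ennreal W" . qed
 hence "emeasure \<sigma> (space \<sigma>) ~= \<infinity>" using emeasure_\<sigma>[of Gam] by (auto simp: space_\<sigma> borel_closed top_unique)
 thus ?thesis by (rule finite_measureI) qed

text \<open>The patches are glued by the functions \<open>w p / s\<close>, on a thinner layer where
  the sum \<open>s\<close> of the bumps is positive. The bound is one-sided, which is the direction
  that the deficit estimate needs.\<close>

lemma flux_limit:
 fixes F :: "'a => real"
 assumes t: "t > 0" and dim: "DIM('a) >= 2" and \<zeta>: "0 < \<zeta>"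
  and F: "continuous_on {x : closure Om. - t <= Ph x} F" "!!x. x : closure Om ==> - t <= Ph x ==> 0 <= F x & F x <= 1 / 2"
 shows "\<forall>\<^sub>F ep in at_right 0. (IN x. cutoff' ep x * (nG x * F x)) <= (\<integral>x. F x \<partial>\<sigma>) + \<zeta>" proof -
 interpret \<sigma>: finite_measure \<sigma> by (rule finite_surface[OF dim])
 have Gamc: "x : closure Om & - t' <= Ph x" if "x : Gam" "t' >= 0" for x t' using that Ph_frontier closure_eq by auto
 define I where "I = (\<integral>x. F x \<partial>\<sigma>)"
 have I0: "I >= 0" unfolding I_def proof (intro Bochner_Integration.integral_nonneg_AE AE_I2)
  fix x assume "x : space \<sigma>"
  thus "0 <= F x" using F(2)[of x] Gamc[of x t] t by (simp add: space_\<sigma>) qed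
 \<comment> \<open>Chosen so that \<open>c * I <= I + \<zeta> / 2\<close>.\<close>
 define c where "c = 1 + \<zeta> / (2 * (I + 1))"
 have c: "c > 1" using \<zeta> I0 by (simp add: c_def)
 have "EX \<rho>>0. ALL x:cball p (2 * \<rho>). 0 < grad Ph x *. nu p & nG x <= c * (grad Ph x *. nu p)" if p: "p : Gam" for p proof -
  have "open {x. nG x < c * (grad Ph x *. nu p)}" by (intro open_Collect_less continuous_intros continuous_grad_Ph)
  moreover have "grad Ph p *. nu p = nG p" unfolding inner_grad_eq[of Ph] using inner_unit_normal_self[OF grad_Ph_frontier[OF p]] by simp
  hence "p : {x. nG x < c * (grad Ph x *. nu p)}" using c grad_Ph_frontier[OF p] by simp
  ultimately obtain r where r: "r > 0" "cball p r <= {x. nG x < c * (grad Ph x *. nu p)}" using open_contains_cball by blast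
  have "0 < grad Ph x *. nu p & nG x <= c * (grad Ph x *. nu p)" if "x : cball p (2 * (r / 2))" for x proof -
   have "nG x < c * (grad Ph x *. nu p)" using r(2) that by auto
   moreover from this have "0 < c * (grad Ph x *. nu p)" using norm_ge_zero[of "grad Ph x"] by linarith
   ultimately show ?thesis using c by (simp add: zero_less_mult_iff) qed
  thus ?thesis using r(1) by (intro exI[of _ "r / 2"]) auto qed
 then obtain \<rho> where \<rho>: "!!p. p : Gam ==> 0 < \<rho> p" "!!p x. p : Gam ==> x : cball p (2 * \<rho> p) ==> 0 < grad Ph x *. nu p & nG x <= c * (grad Ph x *. nu p)" by metis
 obtain P where P: "P <= Gam" "finite P" "Gam <= (UN p:P. ball p (\<rho> p))" by (rule compactE_image[OF compact_frontier, of Gam "%p. ball p (\<rho> p)"]) (use \<rho>(1) in auto)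
 define w where "w p x = bump 1 ((x - p) /R \<rho> p)" for p x
 have w: "0 <= w p x" "continuous_on S (w p)" "p : P ==> x ~: ball p (\<rho> p) ==> w p x = 0" "p : P ==> x : ball p (\<rho> p) ==> 0 < w p x" for p x S proof -
  show "0 <= w p x" by (simp add: w_def)
  show "continuous_on S (w p)" unfolding w_def[abs_def] by (intro continuous_intros)
  assume "p : P"
  hence "\<rho> p > 0" using P \<rho> by blast
  thus "x ~: ball p (\<rho> p) ==> w p x = 0" "x : ball p (\<rho> p) ==> 0 < w p x"
   unfolding w_def by (auto intro!: bump_eq_0 bump_pos simp only: norm_scaleR_inverse mem_ball dist_norm norm_minus_commute[of p x] not_less le_divide_eq_1_pos divide_less_eq_1_pos) qed
 define s where "s x = (SUM p:P. w p x)" for x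
 have cs: "continuous_on S s" for S unfolding s_def[abs_def] by (intro continuous_intros w)
 have "Gam <= {x. 0 < s x}" proof
  fix x assume "x : Gam"
  then obtain p where "p : P" "x : ball p (\<rho> p)" using P(3) by blast
  thus "x : {x. 0 < s x}" unfolding s_def using P(2) w by (auto intro!: sum_pos2) qed
 from boundary_layer[OF open_Collect_less[OF continuous_on_const cs] this]
 obtain t1 where t1: "t1 > 0" "!!x. x : closure Om ==> - t1 <= Ph x ==> 0 < s x" by blast
 define t2 where "t2 = min t t1"
 have t2: "t2 > 0" using t t1 by (simp add: t2_def)
 let ?K = "{x : closure Om. - t2 <= Ph x}"
 have F2: "0 <= F x" "F x <= 1 / 2" "0 < s x" if "x : ?K" for x using F(2)[of x] t1(2)[of x] that by (auto simp: t2_def)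
 define f where "f p x = F x * (w p x / s x)" for p x
 have w_le: "w p x <= s x" if "p : P" for p x unfolding s_def using P(2) that w by (intro member_le_sum) auto
 have fc: "continuous_on ?K (f p)" for p unfolding f_def[abs_def] using F2(3) by (intro continuous_intros w cs continuous_on_subset[OF F(1)]) (auto simp: t2_def less_imp_neq[symmetric])
 have fb: "0 <= f p x & f p x <= 1 / 2" if "p : P" "x : ?K" for p x proof -
  have "w p x / s x <= 1" "0 <= w p x / s x" using F2(3)[OF that(2)] w_le[OF that(1)] w by auto
  hence "0 <= F x * (w p x / s x)" "F x * (w p x / s x) <= 1 / 2 * 1" using F2[OF that(2)] by (intro mult_nonneg_nonneg mult_mono; simp)+
  thus ?thesis unfolding f_def by (metis mult.right_neutral) qed
 have fF: "F x = (SUM p:P. f p x)" if "x : ?K" for x using F2(3)[OF that] by (simp add: f_def sum_distrib_left[symmetric] sum_divide_distrib[symmetric]) (simp add: s_def)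
 \<comment> \<open>Makes the shift errors of all patches together at most
   \<open>\<zeta> / 2\<close>.\<close>
 define \<zeta>\<^sub>1 where "\<zeta>\<^sub>1 = min (1 / 2) (\<zeta> / (2 * (c * (real (card P) * measure \<sigma> Gam) + 1)))"
 have pos: "0 <= c * (real (card P) * measure \<sigma> Gam)" using c by simp
 have \<zeta>\<^sub>1: "\<zeta>\<^sub>1 > 0" "\<zeta>\<^sub>1 <= 1 / 2" using \<zeta> pos by (simp_all only: \<zeta>\<^sub>1_def min.cobounded1) (simp add: add_nonneg_pos)
 have \<zeta>P: "c * (real (card P) * measure \<sigma> Gam) * \<zeta>\<^sub>1 <= \<zeta> / 2" proof -
  let ?X = "c * (real (card P) * measure \<sigma> Gam)"
  have "?X * \<zeta>\<^sub>1 <= ?X * (\<zeta> / (2 * (?X + 1)))" using pos by (intro mult_left_mono) (auto simp: \<zeta>\<^sub>1_def)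
  also have "... <= \<zeta> / 2" using pos \<zeta> by (simp add: field_simps)
  finally show ?thesis . qed
 have "\<forall>\<^sub>F ep in at_right 0. ALL p:P. (IN x. cutoff' ep x * (nG x * f p x)) <= c * ((\<integral>x. f p x \<partial>\<sigma>) + \<zeta>\<^sub>1 * measure \<sigma> Gam)"
 proof (rule eventually_ball_finite[OF P(2)], intro ballI)
  fix p assume p: "p : P"
  hence pG: "p : Gam" using P(1) by blast
  show "\<forall>\<^sub>F ep in at_right 0. (IN x. cutoff' ep x * (nG x * f p x)) <= c * ((\<integral>x. f p x \<partial>\<sigma>) + \<zeta>\<^sub>1 * measure \<sigma> Gam)"
   by (rule flux_patch[OF t2 norm_nu[OF pG] \<rho>(1)[OF pG] _ _ _ fc _ _ \<sigma>.finite_measure_axioms dim \<zeta>\<^sub>1])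
   (use c \<rho>(2)[OF pG] fb[OF p] w(3)[OF p] in "auto simp: f_def") qed
 moreover have "\<forall>\<^sub>F ep in at_right 0. ep : {0<..<t2 / 2}" using t2 by (intro eventually_at_right_real) simp
 ultimately show ?thesis proof eventually_elim
  case (elim ep)
  hence ep: "ep > 0" "2 * ep < t2" by auto
  let ?K' = "inner_part ep Int {x. - (2 * ep) <= Ph x}"
  note K' = cutoff'_support(1)[OF ep(1)] and q0 = cutoff'_support(2)[OF ep(1)]
  have K'K: "?K' <= ?K" using ep by (auto simp: inner_part_def)
  have int: "sint (%x. cutoff' ep x * (nG x * f p x))" for p by (rule set_integrable_compact_support[OF K'])
   (use inner_part(2)[OF ep(1)] q0 in "auto intro!: continuous_intros continuous_cutoff continuous_grad_Ph continuous_on_subset[OF fc K'K]")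
  have "(IN x. cutoff' ep x * (nG x * F x)) = (IN x. SUM p:P. cutoff' ep x * (nG x * f p x))" proof (rule set_lebesgue_integral_cong, goal_cases)
   case 2
   show ?case proof (intro allI impI)
   fix x assume x: "x : Om"
   show "cutoff' ep x * (nG x * F x) = (SUM p:P. cutoff' ep x * (nG x * f p x))" proof (cases "x : ?K'")
   case True
   hence "x : ?K" using K'K by blast
   from fF[OF this] show ?thesis by (simp add: sum_distrib_left) qed (simp add: q0[OF x]) qed qed (use open_Om in simp)
  also have "... = (SUM p:P. IN x. cutoff' ep x * (nG x * f p x))" by (rule set_integral_sum'[OF int])
  also have "... <= (SUM p:P. c * ((\<integral>x. f p x \<partial>\<sigma>) + \<zeta>\<^sub>1 * measure \<sigma> Gam))" using elim(1) by (intro sum_mono) auto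
  also have "... = c * (SUM p:P. \<integral>x. f p x \<partial>\<sigma>) + c * (real (card P) * measure \<sigma> Gam) * \<zeta>\<^sub>1"
   by (simp add: sum_distrib_left[symmetric] sum.distrib algebra_simps)
  also have "(SUM p:P. \<integral>x. f p x \<partial>\<sigma>) = (\<integral>x. (SUM p:P. f p x) \<partial>\<sigma>)" proof (rule Bochner_Integration.integral_sum[symmetric])
   fix p assume p: "p : P"
   have "Gam <= ?K" using Gamc t2 by auto
   thus "integrable \<sigma> (f p)" using fb[OF p]
   by (intro \<sigma>.integrable_const_bound[of _ "1/2"] measurable_\<sigma> continuous_on_subset[OF fc]) (auto simp: space_\<sigma> intro!: AE_I2) qed
  also have "... = I" unfolding I_def proof (rule Bochner_Integration.integral_cong[OF refl])
   fix x assume "x : space \<sigma>"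
   hence "x : ?K" using Gamc[of x t2] t2 by (simp add: space_\<sigma>)
   from fF[OF this] show "(SUM p:P. f p x) = F x" by simp qed
  also have "c * I + c * (real (card P) * measure \<sigma> Gam) * \<zeta>\<^sub>1 <= (I + \<zeta> / 2) + \<zeta> / 2" proof (rule add_mono[OF _ \<zeta>P])
   show "c * I <= I + \<zeta> / 2" using I0 \<zeta> by (simp add: c_def field_simps) qed
  finally show ?case by (simp add: I_def) qed qed

end

section \<open>Harmonic functions of finite energy and a Poincare inequality\<close>

lemma lebesgue_lborel:
 fixes f :: "'a::euclidean_space => real"
 assumes S: "S : sets borel" and f: "continuous_on S f"
 shows "set_integrable lebesgue S f \<longleftrightarrow> set_integrable lborel S f"
  and "(LINT x:S|lebesgue. f x) = (LINT x:S|lborel. f x)"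
  and "set_borel_measurable lebesgue S f" using borel_measurable_continuous_on_indicator[OF S f]
 by (auto simp: set_integrable_def set_lebesgue_integral_def set_borel_measurable_def integrable_completion integral_completion
   intro: measurable_completion)

lemma L2_iff:
 fixes f :: "'a::euclidean_space => real"
 assumes "S : sets borel" "continuous_on S f"
 shows "L2 S f \<longleftrightarrow> set_integrable lborel S (%x. (f x)^2)"
 unfolding L2_def using lebesgue_lborel(3)[OF assms] lebesgue_lborel(1)[OF assms(1) continuous_on_power[OF assms(2)]] by simp

lemma norm_grad_sq: "(norm (grad f x))^2 = (SUM b:Basis. (pd f b x)^2)" unfolding power2_norm_eq_inner by (subst euclidean_inner) (simp add: grad_inner_Basis power2_eq_square)

context C2_domain
begin

lemma Om_borel [simp]: "Om : sets borel" using open_Om by simp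

text \<open>The class \<open>harmonic_W12\<close>, restated with the Borel measure and the full
  gradient; see \<open>harmonic_W12_iff\<close>.\<close>

definition harm :: "('a => real) => bool" where
 "harm v \<longleftrightarrow> C2_on Om v & (ALL x:Om. lap v x = 0) & sint (%x. (v x)^2) & sint (%x. (norm (grad v x))^2)"

definition energy :: "('a => real) => real" where
 "energy v = (IN x. (norm (grad v x))^2)"

lemma energy_nonneg: "0 <= energy v" unfolding energy_def set_lebesgue_integral_def by (intro Bochner_Integration.integral_nonneg) auto

lemma pd_sq_integrable:
 assumes "C1_on Om v" "sint (%x. (norm (grad v x))^2)" and b: "b : Basis"
 shows "sint (%x. (pd v b x)^2)" proof -
 have "continuous_on Om (%x. (pd v b x)^2)" using assms by (auto simp: C1_on_def intro!: continuous_intros)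
 from borel_measurable_continuous_on_indicator[OF Om_borel this]
 have m: "(%x. indicator Om x *R (pd v b x)^2) : borel_measurable lborel" by simp
 have "(pd v b x)^2 <= (norm (grad v x))^2" for x unfolding norm_grad_sq using b by (intro member_le_sum) auto
 thus ?thesis unfolding set_integrable_def by (intro Bochner_Integration.integrable_bound[OF assms(2)[unfolded set_integrable_def] m]) (auto simp: indicator_def) qed

lemma energy_eq_sum:
 assumes "C1_on Om v" "sint (%x. (norm (grad v x))^2)"
 shows "energy v = (SUM b:Basis. IN x. (pd v b x)^2)" unfolding energy_def norm_grad_sq by (rule set_integral_sum') (rule pd_sq_integrable[OF assms])

lemma harmonic_W12_iff: "harmonic_W12 Om v \<longleftrightarrow> harm v" proof (cases "C2_on Om v")
 case True
 note C1 = C2_on_C1[OF True]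
 have c: "continuous_on Om v" "!!b. b : Basis ==> continuous_on Om (pd v b)" using C1_on_continuous[OF C1] C1 by (auto simp: C1_on_def)
 have "sint (%x. (norm (grad v x))^2)" if "ALL b:Basis. sint (%x. (pd v b x)^2)"
  using that unfolding norm_grad_sq set_integrable_def sum_distrib_left scaleR_sum_right by (intro Bochner_Integration.integrable_sum) auto
 hence "(ALL b:Basis. sint (%x. (pd v b x)^2)) \<longleftrightarrow> sint (%x. (norm (grad v x))^2)" using pd_sq_integrable[OF C1] by blast
 thus ?thesis using c by (auto simp: harmonic_W12_def harm_def L2_iff) qed (simp add: harmonic_W12_def harm_def)

lemma harm_mvp:
 assumes "harm v"
 shows "mean_value_property Om v" "b : Basis ==> mean_value_property Om (pd v b)" proof -
 show "mean_value_property Om v" using assms by (intro harmonic_mean_value_property open_Om) (auto simp: harm_def)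
 thus "b : Basis ==> mean_value_property Om (pd v b)" by (rule mean_value_property_pd[OF open_Om]) qed

lemma harm_grad_bound:
 assumes v: "harm v" and r: "r > 0" "cball x (real DIM('a) * r) <= Om"
 shows "(norm (grad v x))^2 <= energy v / (bump_int TYPE('a) * r ^ DIM('a))" proof -
 have C1: "C1_on Om v" using v by (auto simp: harm_def intro: C2_on_C1)
 have i: "sint (%x. (norm (grad v x))^2)" using v by (simp add: harm_def)
 show ?thesis unfolding norm_grad_sq energy_eq_sum[OF C1 i] sum_divide_distrib by (intro sum_mono mean_value_square_le[OF harm_mvp(2)[OF v] open_Om r] pd_sq_integrable[OF C1 i]) qed

text \<open>The mean value inequality for the partial derivatives bounds the gradient pointwise by
  the energy, and thereby the oscillation on a small ball.\<close>

lemma harm_local_bound: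
 assumes x: "x : Om"
 shows "EX r>0. EX C>=0. ball x r <= Om & (ALL v. harm v --> (ALL y:ball x r. ALL y':ball x r. (v y)^2 <= 2 * (v y')^2 + C * energy v))" proof -
 let ?N = "real DIM('a)"
 obtain R where R: "R > 0" "cball x R <= Om" using open_Om x open_contains_cball by blast
 define r where "r = R / (2 * ?N)"
 have N: "?N >= 1" using DIM_positive[where 'a='a] by (simp add: Suc_le_eq)
 have r: "r > 0" "?N * r = R / 2" "r <= R / 2" using R N by (auto simp: r_def field_simps)
 define K where "K = 1 / (bump_int TYPE('a) * r ^ DIM('a))"
 have K: "K >= 0" using bump_int_pos[where 'a='a] r by (simp add: K_def)
 have "(v y)^2 <= 2 * (v y')^2 + 2 * K * (2 * r)^2 * energy v" if v: "harm v" and y: "y : ball x r" "y' : ball x r" for v y y' proof -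
  let ?g = "sqrt (K * energy v)"
  have gb: "norm (grad v w) <= ?g" if w: "w : ball x r" for w proof -
   have "cball w (?N * r) <= cball x R" proof
   fix q assume "q : cball w (?N * r)"
   thus "q : cball x R" using w r dist_triangle[of x q w] by simp qed
   hence "(norm (grad v w))^2 <= energy v / (bump_int TYPE('a) * r ^ DIM('a))" using R by (intro harm_grad_bound[OF v r(1)]) blast
   hence "(norm (grad v w))^2 <= K * energy v" by (simp add: K_def)
   thus ?thesis by (rule real_le_rsqrt) qed
  have sub: "ball x r <= Om" using r R by (auto simp: subset_eq)
  have "\<bar>v y - v y'\<bar> <= ?g * norm (y - y')" by (rule grad_bound_Lipschitz[OF convex_ball _ gb y], rule C1_on_has_grad[of Om]) (use v sub in "auto simp: harm_def intro: C2_on_C1")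
  also have "... <= ?g * (2 * r)" using y norm_triangle_ineq4[of "y - x" "y' - x"] K energy_nonneg[of v] by (intro mult_left_mono) (auto simp: dist_norm norm_minus_commute)
  finally have "(v y - v y')^2 <= (?g * (2 * r))^2" by (intro abs_le_square_iff[THEN iffD1]) simp
  also have "... = K * (2 * r)^2 * energy v" using K energy_nonneg[of v] by (simp add: power_mult_distrib)
  finally have "(v y - v y')^2 <= K * (2 * r)^2 * energy v" .
  moreover have "(v y)^2 <= 2 * (v y')^2 + 2 * (v y - v y')^2" using zero_le_power2[of "2 * v y' - v y"] by (simp add: power2_eq_square algebra_simps)
  ultimately show ?thesis by linarith qed
 moreover have "ball x r <= Om" using r R by (auto simp: subset_eq)
 ultimately show ?thesis using r(1) K by (intro exI[of _ r] conjI exI[of _ "2 * K * (2 * r)^2"]) auto qed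

text \<open>Starting from the zero at \<open>z\<close>, the local bounds are chained through
  \<open>Om\<close>, which is where connectedness enters; compactness makes the constant uniform on
  \<open>K\<close>.\<close>

lemma harm_interior_bound:
 assumes con: "connected Om" and z: "z : Om" and K: "compact K" "K <= Om"
 shows "EX C>=0. ALL v. harm v & v z = 0 --> (ALL y:K. (v y)^2 <= C * energy v)" proof -
 let ?P = "%x. EX C>=0. ALL v. harm v & v z = 0 --> (v x)^2 <= C * energy v"
 have step: "?P y" if *: "ALL v. harm v --> (v y)^2 <= 2 * (v x)^2 + C * energy v" "C >= 0" and "?P x" for x y C proof -
  obtain C' where C': "C' >= 0" "!!v. harm v & v z = 0 ==> (v x)^2 <= C' * energy v" using \<open>?P x\<close> by blast
  have "(v y)^2 <= (2 * C' + C) * energy v" if "harm v & v z = 0" for v using *(1)[rule_format, of v] C'(2)[OF that] that by (simp add: distrib_right)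
  thus ?thesis using C' *(2) by (intro exI[of _ "2 * C' + C"]) auto qed
 have P: "?P x" if x: "x : Om" for x proof (rule connected_induction_simple[OF con z x])
  show "?P z" by (intro exI[of _ 0]) auto
  fix x assume "x : Om"
  then obtain r C where r: "r > 0" "C >= 0" "ball x r <= Om" "ALL v. harm v --> (ALL y:ball x r. ALL y':ball x r. (v y)^2 <= 2 * (v y')^2 + C * energy v)" using harm_local_bound by blast
  show "EX T. openin (top_of_set Om) T & x : T & (ALL x:T. ALL y:T. ?P x --> ?P y)" proof (intro exI[of _ "ball x r"] conjI ballI impI)
   show "openin (top_of_set Om) (ball x r)" using r open_Om by (simp add: openin_open_eq)
  next
   fix a b assume "a : ball x r" "b : ball x r" "?P a"
   thus "?P b" using r by (intro step[of b a C]) auto qed (use r in simp) qed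
 have "EX r>0. EX C>=0. ALL v. harm v & v z = 0 --> (ALL y:ball x r. (v y)^2 <= C * energy v)" if x: "x : K" for x proof -
  obtain r C where r: "r > 0" "C >= 0" "ALL v. harm v --> (ALL y:ball x r. ALL y':ball x r. (v y)^2 <= 2 * (v y')^2 + C * energy v)" using harm_local_bound[of x] x K by blast
  obtain C' where C': "C' >= 0" "ALL v. harm v & v z = 0 --> (v x)^2 <= C' * energy v" using P[of x] x K by blast
  have "(v y)^2 <= (2 * C' + C) * energy v" if v: "harm v & v z = 0" and y: "y : ball x r" for v y proof -
   have "(v y)^2 <= 2 * (v x)^2 + C * energy v" using r(1,3) v y by force
   thus ?thesis using C'(2)[rule_format, OF v] by (simp add: distrib_right) qed
  thus ?thesis using r C' by (intro exI[of _ r] conjI exI[of _ "2 * C' + C"]) auto qed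
 then obtain r C where rC: "!!x. x : K ==> r x > 0" "!!x. x : K ==> (0::real) <= C x"
  "!!x v y. x : K ==> harm v & v z = 0 ==> y : ball x (r x) ==> (v y)^2 <= C x * energy v" by metis
 obtain X where X: "X <= K" "finite X" "K <= (UN x:X. ball x (r x))" by (rule compactE_image[OF K(1), of K "%x. ball x (r x)"]) (use rC(1) in auto)
 have "(v y)^2 <= (SUM x:X. C x) * energy v" if v: "harm v & v z = 0" and y: "y : K" for v y proof -
  obtain x where x: "x : X" "y : ball x (r x)" using X y by blast
  have "(v y)^2 <= C x * energy v" using x X v by (intro rC(3)) auto
  also have "... <= (SUM x:X. C x) * energy v" using X rC(2) x by (intro mult_right_mono member_le_sum energy_nonneg) auto
  finally show ?thesis . qed
 moreover have "0 <= (SUM x:X. C x)" using X rC(2) by (intro sum_nonneg) auto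
 ultimately show ?thesis by blast qed

end

context C2_domain
begin

lemma cutoff_integral_limit:
 assumes e: "e \<longlonglongrightarrow> 0" "!!n. e n > 0" and f: "sint f"
 shows "(%n. IN x. cutoff (e n) x * f x) \<longlonglongrightarrow> (IN x. f x)" unfolding set_lebesgue_integral_def
proof (rule integral_dominated_convergence[where w="%x. norm (indicator Om x *R f x)"])
 have m: "(%x. indicator Om x *R f x) : borel_measurable lborel" using f by (auto simp: set_integrable_def)
 thus "(%x. indicator Om x *R f x) : borel_measurable lborel" .
 have "(%x. cutoff (e n) x * (indicator Om x *R f x)) : borel_measurable lborel" for n
  using m borel_measurable_continuous_onI[OF continuous_cutoff(1)[of UNIV "e n"]] by (intro borel_measurable_times) simp_all
 thus "(%x. indicator Om x *R (cutoff (e n) x * f x)) : borel_measurable lborel" for n by (simp add: mult_ac)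
 show "integrable lborel (%x. norm (indicator Om x *R f x))" using f by (simp only: set_integrable_def integrable_norm)
 show "AE x in lborel. norm (indicator Om x *R (cutoff (e n) x * f x)) <= norm (indicator Om x *R f x)" for n
  using cutoff_bounds(1,2)[OF e(2)] by (intro AE_I2) (auto simp: indicator_def abs_mult intro!: mult_left_le_one_le)
 show "AE x in lborel. (%n. indicator Om x *R (cutoff (e n) x * f x)) \<longlonglongrightarrow> indicator Om x *R f x" proof (intro AE_I2)
  fix x
  show "(%n. indicator Om x *R (cutoff (e n) x * f x)) \<longlonglongrightarrow> indicator Om x *R f x" proof (cases "x : Om")
   case True
   hence "0 < - Ph x / 2" by (simp add: Om_eq)
   from order_tendstoD(2)[OF e(1) this] have "\<forall>\<^sub>F n in sequentially. indicator Om x *R (cutoff (e n) x * f x) = indicator Om x *R f x"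
   by eventually_elim (simp add: cutoff_eq(4)[OF e(2)])
   thus ?thesis by (rule tendsto_eventually) qed simp qed qed

text \<open>The source of \<open>mu0 > 0\<close>. The field integrated is \<open>grad Ph\<close>
  times \<open>cutoff e\<close>, \<open>Ph\<close> and the square of \<open>v\<close>. Near the
  frontier its divergence is dominated by \<open>(nG x)^2\<close> times the square of
  \<open>v\<close>; the factor \<open>Ph\<close> makes the other terms small and gives the
  \<open>cutoff'\<close> term a good sign. The interior is left to
  \<open>harm_interior_bound\<close>.\<close>

lemma poincare:
 assumes con: "connected Om" and z: "z : Om"
 shows "EX C>0. ALL v. harm v & v z = 0 --> (IN x. (v x)^2) <= C * energy v" proof -
 obtain t m where m: "t > 0" "m > 0" "!!x. x : closure Om ==> - t <= Ph x ==> m <= nG x" using grad_Ph_layer by blast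
 obtain L where L: "L > 0" "!!x v. norm (hess Ph x v) <= L * norm v" using hess_Ph_bounded by blast
 define A where "A = real DIM('a) * L"
 have A: "\<bar>tr (hess Ph x)\<bar> <= A" "A > 0" for x proof -
  have "\<bar>hess Ph x b *. b\<bar> <= L" if "b : Basis" for b using Cauchy_Schwarz_ineq2[of "hess Ph x b" b] L(2)[of x b] that by simp
  thus "\<bar>tr (hess Ph x)\<bar> <= A" unfolding tr_def A_def by (intro order_trans[OF sum_abs] sum_bounded_above) auto qed (use L in "simp add: A_def")
 have "bounded (grad Ph ` closure Om)" "bounded (Ph ` closure Om)" by (intro compact_imp_bounded compact_continuous_image continuous_grad_Ph continuous_Ph compact_closure)+
 then obtain B S where B: "B > 0" "!!x. x : Om ==> nG x <= B" and S: "S > 0" "!!x. x : Om ==> - Ph x <= S" using closure_subset[of Om] unfolding bounded_pos by (force simp: abs_le_iff)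
 \<comment> \<open>So thin a layer that the term with \<open>tr (hess Ph x)\<close> uses at most a
   quarter of \<open>m^2\<close> times the square of \<open>v\<close>.\<close>
 define s where "s = min t (m^2 / (4 * A))"
 have s: "s > 0" "s <= t" "s * A <= m^2 / 4" using m A(2) by (auto simp: s_def min_def field_simps)
 obtain K where K: "K >= 0" "!!v y. harm v & v z = 0 ==> y : inner_part s ==> (v y)^2 <= K * energy v" using harm_interior_bound[OF con z inner_part(1,2)[OF s(1)]] by blast
 define C1 where "C1 = 2 * S^2 * B^2 / m^2 + S * B"
 define C2 where "C2 = m^2 / 4 + S * (B + A)"
 define C where "C = (C1 + C2 * K * measure lborel Om) * (4 / m^2)"
 have C12: "C1 >= 0" "C2 >= 0" using S B A(2) by (auto simp: C1_def C2_def)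
 have main: "(IN x. cutoff e x * (v x)^2) <= C * energy v" if v: "harm v" "v z = 0" and e: "e > 0" for v e proof -
  have vg: "(v has_derivative (%w. grad v x *. w)) (at x)" if "x : Om" for x using v that by (intro C1_on_has_grad[of Om] C2_on_C1) (auto simp: harm_def)
  have cv: "continuous_on Om v" "continuous_on Om (grad v)" using v C1_on_continuous C1_on_continuous_grad C2_on_C1 unfolding harm_def by blast+
  let ?F = "%x. (cutoff e x * (Ph x * (v x * v x))) *R grad Ph x"
  let ?G = "%x. (cutoff e x * Ph x * 2 * v x) *R grad v x + (cutoff e x * (v x)^2 - cutoff' e x * Ph x * (v x)^2) *R grad Ph x"
  let ?F' = "%x w. (cutoff e x * Ph x * (v x)^2) *R hess Ph x w + (?G x *. w) *R grad Ph x"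
  have der: "(?F has_derivative ?F' x) (at x)" if x: "x : Om" for x proof -
   from has_derivative_scaleR[OF has_derivative_mult[OF cutoff_has_grad has_derivative_mult[OF has_grad_Ph has_derivative_mult[OF vg vg]]] C2_on_has_hess[OF C2_Ph UNIV_I], OF x x]
   show ?thesis by (rule has_derivative_eq_rhs) (auto simp: fun_eq_iff inner_add_left inner_diff_left power2_eq_square algebra_simps) qed
  note zero = integral_tr_zero[OF open_Om inner_part(1,2)[OF e] der]
  have cF: "continuous_on Om (%x. ?F' x w)" for w by (intro continuous_intros continuous_cutoff continuous_grad_Ph continuous_Ph cv C2_on_continuous_hess[OF C2_on_subset[OF C2_Ph]]) simp
  have out: "?F x = 0" if "x : Om" "x ~: inner_part e" for x using inner_part(3)[OF e that] by simp
  have i1: "sint (%x. tr (?F' x))" and z1: "(IN x. tr (?F' x)) = 0" using zero[OF _ cF out] by auto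
  have trF: "tr (?F' x) = cutoff e x * Ph x * (v x)^2 * tr (hess Ph x) + cutoff e x * Ph x * 2 * v x * (grad Ph x *. grad v x)
   + (cutoff e x * (v x)^2 - cutoff' e x * Ph x * (v x)^2) * (nG x)^2" for x by (simp only: tr_add tr_scaleR tr_outer') (simp add: inner_add_right power2_norm_eq_inner)
  have pt: "m^2 / 4 * (cutoff e x * (v x)^2) <= tr (?F' x) + (C1 * (norm (grad v x))^2 + C2 * K * energy v)" if x: "x : Om" for x proof -
   let ?c = "cutoff e x" and ?s = "- Ph x" and ?a = "\<bar>v x\<bar>" and ?g = "norm (grad v x)"
   have c: "0 <= ?c" "?c <= 1" by (rule cutoff_bounds[OF e])+
   have s0: "0 < ?s" "?s <= S" using x S by (auto simp: Om_eq)
   have "cutoff' e x * ?s * (v x)^2 * (nG x)^2 >= 0" using s0 cutoff_bounds(3)[OF e] by (intro mult_nonneg_nonneg) auto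
   moreover have "?c * (?s * (v x)^2 * tr (hess Ph x)) <= ?c * (?s * ?a^2 * A)" proof -
   have "?a^2 * tr (hess Ph x) <= ?a^2 * A" using A(1)[of x] by (intro mult_left_mono) auto
   from mult_left_mono[OF mult_left_mono[OF this, of ?s], of ?c] show ?thesis using c s0 by (simp add: mult.assoc) qed
   moreover have "?c * (?s * 2 * (v x * (grad Ph x *. grad v x))) <= ?c * (?s * 2 * (?a * (B * ?g)))" proof (intro mult_left_mono)
   have "v x * (grad Ph x *. grad v x) <= ?a * \<bar>grad Ph x *. grad v x\<bar>" unfolding abs_mult[symmetric] by simp
   also have "... <= ?a * (B * ?g)" by (intro mult_left_mono order_trans[OF Cauchy_Schwarz_ineq2] mult_right_mono B x) auto
   finally show "v x * (grad Ph x *. grad v x) <= ?a * (B * ?g)" . qed (use c s0 in auto)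
   ultimately have 1: "tr (?F' x) >= ?c * (?a^2 * (nG x)^2 - (?s * ?a^2 * A + ?s * 2 * (?a * (B * ?g))))" unfolding trF by (simp add: algebra_simps)
   show ?thesis proof (cases "- s <= Ph x")
   case True
   have "m <= nG x" using m(3)[of x] x True s closure_subset by auto
   hence "?a^2 * m^2 <= ?a^2 * (nG x)^2" using m by (intro mult_left_mono power_mono) auto
   moreover have "?s * ?a^2 * A <= ?a^2 * (m^2 / 4)" using mult_right_mono[of ?s s A] True A(2) s mult_left_mono[of "?s * A" "m^2 / 4" "?a^2"] by (simp add: mult_ac)
   moreover have "?s * 2 * (?a * (B * ?g)) <= ?a^2 * (m^2 / 2) + C1 * ?g^2" proof -
   \<comment> \<open>Young's inequality spends another half on the cross term, so that a quarter
     remains.\<close>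
   have "0 <= (m * ?a - 2 * S * B * ?g / m)^2 / 2" by simp
   also have "... = ?a^2 * (m^2 / 2) - S * 2 * (?a * (B * ?g)) + 2 * S^2 * B^2 / m^2 * ?g^2" using m by (simp add: power2_eq_square field_simps)
   finally have "S * 2 * (?a * (B * ?g)) <= ?a^2 * (m^2 / 2) + 2 * S^2 * B^2 / m^2 * ?g^2" by linarith
   moreover have "?s * 2 * (?a * (B * ?g)) <= S * 2 * (?a * (B * ?g))" using s0 B by (intro mult_right_mono) auto
   moreover have "0 <= S * B * ?g^2" using S B by simp
   ultimately show ?thesis unfolding C1_def distrib_right by linarith qed
   ultimately have "?a^2 * (m^2 / 4) - C1 * ?g^2 <= ?a^2 * (nG x)^2 - (?s * ?a^2 * A + ?s * 2 * (?a * (B * ?g)))" by linarith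
   from order_trans[OF mult_left_mono[OF this c(1)] 1]
   have "?c * (?a^2 * (m^2 / 4)) - ?c * (C1 * ?g^2) <= tr (?F' x)" by (simp add: right_diff_distrib)
   moreover have "?c * (C1 * ?g^2) <= C1 * ?g^2" using c C12 by (intro mult_left_le_one_le) auto
   moreover have "0 <= C2 * K * energy v" using C12 K energy_nonneg[of v] by simp
   ultimately show ?thesis by (simp add: mult_ac)
   next
   case False
   have "2 * (?a * ?g) <= ?a^2 + ?g^2" using sum_squares_bound[of ?a ?g] by simp
   hence "?s * A * ?a^2 + ?s * B * (2 * (?a * ?g)) <= S * A * ?a^2 + S * B * (?a^2 + ?g^2)" using s0 A(2) B by (intro add_mono mult_mono mult_right_mono) auto
   hence "?s * ?a^2 * A + ?s * 2 * (?a * (B * ?g)) <= S * (B + A) * ?a^2 + S * B * ?g^2" by (simp add: algebra_simps)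
   moreover have "0 <= ?a^2 * (nG x)^2" by simp
   ultimately have 2: "- (S * (B + A) * ?a^2 + S * B * ?g^2) <= ?a^2 * (nG x)^2 - (?s * ?a^2 * A + ?s * 2 * (?a * (B * ?g)))" by linarith
   have 3: "?c * (S * (B + A) * ?a^2 + S * B * ?g^2) <= S * (B + A) * ?a^2 + S * B * ?g^2" using c S A(2) B by (intro mult_left_le_one_le add_nonneg_nonneg) auto
   have 4: "m^2 / 4 * (?c * ?a^2) <= m^2 / 4 * ?a^2" using c by (intro mult_left_mono mult_left_le_one_le) auto
   have "?a^2 <= K * energy v" using K(2)[of v x] v x False closure_subset by (auto simp: inner_part_def)
   from mult_left_mono[OF this C12(2)] have 5: "C2 * ?a^2 <= C2 * K * energy v" by (simp add: mult.assoc)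
   have 6: "S * B * ?g^2 <= C1 * ?g^2" by (intro mult_right_mono) (auto simp: C1_def)
   have 7: "C2 * ?a^2 = m^2 / 4 * ?a^2 + S * (B + A) * ?a^2" by (simp add: C2_def distrib_right)
   have 8: "- (?c * (S * (B + A) * ?a^2 + S * B * ?g^2)) <= tr (?F' x)" using order_trans[OF mult_left_mono[OF 2 c(1)] 1] unfolding mult_minus_right .
   show ?thesis using 3 4 5 6 7 8 unfolding power2_abs by linarith qed qed
  have fin: "emeasure lborel Om < \<infinity>" using emeasure_bounded_finite[OF bounded_Om] .
  have ig: "sint (%x. C1 * (norm (grad v x))^2)" using v by (auto simp: harm_def)
  have ic: "sint (%x. C2 * K * energy v)" using fin unfolding set_integrable_def by (intro integrable_scaleR_left integrable_real_indicator) auto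
  have "(IN x. m^2 / 4 * (cutoff e x * (v x)^2)) <= (IN x. tr (?F' x) + (C1 * (norm (grad v x))^2 + C2 * K * energy v))"
   by (rule set_integral_mono) (use i1 ig ic pt in "auto intro!: set_integral_add set_integrable_mult_right set_integrable_cutoff(1)[OF e] continuous_intros cv")
  also have "... = (IN x. C1 * (norm (grad v x))^2) + (IN x. C2 * K * energy v)" using set_integral_add(2)[OF i1 set_integral_add(1)[OF ig ic]] set_integral_add(2)[OF ig ic] z1 by simp
  also have "... = (C1 + C2 * K * measure lborel Om) * energy v" using fin by (simp add: energy_def set_lebesgue_integral_def algebra_simps)
  finally show ?thesis using m unfolding set_integral_mult_right by (simp add: C_def field_simps) qed
 have "(IN x. (v x)^2) <= (C + 1) * energy v" if v: "harm v & v z = 0" for v proof -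
  have "(%n. IN x. cutoff (1 / (real n + 1)) x * (v x)^2) \<longlonglongrightarrow> (IN x. (v x)^2)" using v LIMSEQ_inverse_real_of_nat
   by (intro cutoff_integral_limit) (auto simp: harm_def inverse_eq_divide add.commute)
  hence "(IN x. (v x)^2) <= C * energy v" by (rule LIMSEQ_le_const2) (use main v in auto)
  thus ?thesis using energy_nonneg[of v] by (simp add: distrib_right) qed
 moreover have "C + 1 > 0" using C12 K by (auto simp: C_def intro!: add_nonneg_pos mult_nonneg_nonneg add_nonneg_nonneg)
 ultimately show ?thesis by blast qed

end

context C2_domain
begin

lemma set_integrable_continuous_closure:
 fixes f :: "'a => real"
 assumes "continuous_on (closure Om) f"
 shows "sint f" by (rule set_integrable_subset[OF borel_integrable_compact[OF compact_closure assms, folded set_integrable_def]]) (auto intro: subsetD[OF closure_subset])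

lemma harm_scale:
 assumes v: "harm v"
 shows "harm (%x. c * v x)" "energy (%x. c * v x) = c^2 * energy v" proof -
 have C: "C2_on Om v" using v by (simp add: harm_def)
 have 1: "((%x. c * v x) has_derivative (%w. (c *R grad v x) *. w)) (at x)" if "x : Om" for x using has_derivative_mult_right[OF C1_on_has_grad[OF C2_on_C1[OF C] that], of c] by simp
 have 2: "((%x. c *R grad v x) has_derivative (%w. c *R hess v x w)) (at x)" if "x : Om" for x by (intro has_derivative_scaleR_right C2_on_has_hess[OF C that])
 have g: "(norm (grad (%x. c * v x) x))^2 = c^2 * (norm (grad v x))^2" if "x : Om" for x unfolding grad_eqI[OF 1[OF that]] by (simp add: power_mult_distrib)
 have i: "sint (%x. (norm (grad (%x. c * v x) x))^2) \<longleftrightarrow> sint (%x. c^2 * (norm (grad v x))^2)" by (rule set_integrable_cong) (use g in auto)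
 show "energy (%x. c * v x) = c^2 * energy v" unfolding energy_def set_integral_mult_right[symmetric] by (rule set_lebesgue_integral_cong) (use g in auto)
 have "lap (%x. c * v x) x = 0" if "x : Om" for x proof -
  have "hess (%x. c * v x) x = (%w. c *R hess v x w)" by (rule hess_eqI[OF open_Om that 1 2[OF that]])
  thus ?thesis using v that by (simp add: lap_eq_tr_hess tr_scaleR harm_def) qed
 moreover have "C2_on Om (%x. c * v x)" by (rule C2_onI[OF open_Om 1 2]) (auto intro!: continuous_intros C2_on_continuous_hess[OF C])
 ultimately show "harm (%x. c * v x)" using v i unfolding harm_def power_mult_distrib by auto qed

lemma mu0_eq: "mu0 Om z = Inf {energy v |v. harm v & (IN x. (v x)^2) = 1 & v z = 0}" proof -
 have "(LINT x:Om|lebesgue. (norm (grad v x))^2) = energy v" "(LINT x:Om|lebesgue. (v x)^2) = (IN x. (v x)^2)" if "harm v" for v unfolding energy_def using that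
  by (intro lebesgue_lborel(2) Om_borel continuous_intros C1_on_continuous_grad C1_on_continuous C2_on_C1; simp add: harm_def)+
 thus ?thesis unfolding mu0_def harmonic_W12_iff by (intro arg_cong[of _ _ Inf] Collect_cong ex_cong1) auto qed

text \<open>An \<open>Inf\<close> over an empty set would carry no information, so a competitor has
  to be exhibited; the Poincare inequality bounds all competitors from below. The second claim is
  the definition after normalisation, with L2 norm 0 treated apart.\<close>

lemma mu0_poincare:
 assumes con: "connected Om" and z: "z : Om"
 shows "mu0 Om z > 0" "harm v ==> v z = 0 ==> mu0 Om z * (IN x. (v x)^2) <= energy v" proof -
 let ?Q = "%v. IN x. (v x)^2"
 let ?S = "{energy v |v. harm v & ?Q v = 1 & v z = 0}"
 obtain C where C: "C > 0" "!!v. harm v & v z = 0 ==> ?Q v <= C * energy v" using poincare[OF con z] by blast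
 have unit: "energy v / ?Q v : ?S" if v: "harm v" "v z = 0" "?Q v > 0" for v proof -
  let ?c = "1 / sqrt (?Q v)"
  have "?Q (%x. ?c * v x) = ?c^2 * ?Q v" unfolding power_mult_distrib by (rule set_integral_mult_right)
  hence "?Q (%x. ?c * v x) = 1" using v by (simp add: power_divide)
  moreover have "energy (%x. ?c * v x) = energy v / ?Q v" using harm_scale(2)[OF v(1), of ?c] v by (simp add: power_divide)
  ultimately show ?thesis using harm_scale(1)[OF v(1), of ?c] v(2) by (intro CollectI exI[of _ "%x. ?c * v x"]) auto qed
 obtain b :: 'a where b: "b : Basis" using nonempty_Basis by blast
 \<comment> \<open>A linear function vanishing at \<open>z\<close>: the competitor, once
   normalised.\<close>
 define l where "l y = (y - z) *. b" for y
 have l1: "(l has_derivative (%w. b *. w)) (at x)" for x unfolding l_def[abs_def] by (auto intro!: derivative_eq_intros simp: inner_commute)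
 have "harm l" proof -
  have C2: "C2_on Om l" by (rule C2_onI[OF open_Om l1, of "%_ _. 0"]) auto
  moreover have "hess l x = (%_. 0)" for x by (rule hess_eqI[OF open_UNIV UNIV_I l1]) auto
  moreover have "sint (%x. (l x)^2)" unfolding l_def by (intro set_integrable_continuous_closure continuous_intros)
  moreover have "sint (%x. (norm (grad l x))^2)" unfolding grad_eqI[OF l1] by (intro set_integrable_continuous_closure continuous_intros)
  ultimately show ?thesis by (simp add: harm_def lap_eq_tr_hess tr_def) qed
 moreover have lz: "l z = 0" by (simp add: l_def)
 moreover have "?Q l > 0" proof (rule ccontr)
  assume neg: "~ ?Q l > 0"
  obtain R where R: "R > 0" "cball z R <= Om" using open_Om z open_contains_cball by blast
  define y where "y = z + (R / 2) *R b"
  define r where "r = R / (2 * real DIM('a))"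
  have r: "r > 0" "real DIM('a) * r = R / 2" using R by (auto simp: r_def)
  have "cball y (real DIM('a) * r) <= cball z R" proof
   fix q assume "q : cball y (real DIM('a) * r)"
   thus "q : cball z R" using dist_triangle[of z q y] b R r by (simp add: y_def dist_norm) qed
  hence "(l y)^2 <= ?Q l / (bump_int TYPE('a) * r ^ DIM('a))" using R \<open>harm l\<close> by (intro mean_value_square_le[OF harm_mvp(1) open_Om r(1)]) (auto simp: harm_def)
  also have "... <= 0" using neg bump_int_pos[where 'a='a] r by (intro divide_nonpos_pos) auto
  finally show False using b R by (simp add: y_def l_def) qed
 ultimately have ne: "?S ~= {}" using unit by blast
 have "1 / C <= mu0 Om z" unfolding mu0_eq proof (rule cInf_greatest[OF ne])
  fix e assume "e : ?S"
  then obtain v where "e = energy v" "harm v" "?Q v = 1" "v z = 0" by blast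
  thus "1 / C <= e" using C(2)[of v] C(1) by (simp add: divide_le_eq mult.commute) qed
 thus pos: "mu0 Om z > 0" using C(1) by (meson less_le_trans zero_less_divide_1_iff)
 show "mu0 Om z * ?Q v <= energy v" if v: "harm v" "v z = 0" proof (cases "?Q v > 0")
  case True
  have "bdd_below ?S" by (rule bdd_belowI[of _ 0]) (use energy_nonneg in auto)
  hence "mu0 Om z <= energy v / ?Q v" unfolding mu0_eq by (intro cInf_lower unit v True)
  thus ?thesis using True by (simp add: le_divide_eq)
 next
  case False
  hence "mu0 Om z * ?Q v <= 0" using pos by (intro mult_nonneg_nonpos) auto
  thus ?thesis using energy_nonneg[of v] by linarith qed qed

end

section \<open>Shrinking the layer: the Hessian bounded by the deficit\<close>

context torsion
begin

text \<open>Integrability of \<open>hess_sq\<close> is not known beforehand. It comes out of the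
  limit, taken by Fatou's lemma, together with the bound.\<close>

lemma hess_sq_deficit:
 assumes H: "!!p. p : Gam ==> tr (shape_op Ph p) > 0" and dim: "DIM('a) >= 2"
 shows "sint hess_sq"
  "(IN x. hess_sq x) <= (real DIM('a) - 1)^2 * (\<integral>x. 1 / tr (shape_op Ph x) \<partial>\<sigma>) - (real DIM('a) - 2) * (real DIM('a) * measure lborel Om)" proof -
 let ?N = "real DIM('a)" and ?V = "measure lborel Om"
 define I where "I = (\<integral>x. 1 / tr (shape_op Ph x) \<partial>\<sigma>)"
 obtain t m where t: "t > 0" "m > 0" "!!x. x : closure Om ==> - t <= Ph x ==> m <= nG x & 0 < tr (shape_op Ph x)" using layer_exists[OF H] by blast
 let ?K = "{x : closure Om. - t <= Ph x}" and ?g = "%x. 1 / tr (shape_op Ph x)"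
 have g: "continuous_on ?K ?g" unfolding tr_def[abs_def] using t by (intro continuous_intros continuous_on_shape_op[OF C2_on_subset[OF C2_Ph]]) (force simp: tr_def)+
 obtain B where B: "B > 0" "!!x. x : ?K ==> ?g x <= B" using compact_imp_bounded[OF compact_continuous_image[OF g compact_layer]] unfolding bounded_pos by (auto simp: abs_le_iff)
 obtain C dl0 where C: "C > 0" "dl0 > 0" and rei: "ALL dl \<kappa>. 0 < dl & dl <= dl0 & 0 < \<kappa> -->
  (1 - \<kappa>) * (IN x. cutoff (dl ^ 3 / 2) x * hess_sq x) + (?N - 2) * (?N * (IN x. cutoff (dl ^ 3 / 2) x))
  <= (?N - 1)^2 * (IN x. cutoff' (dl ^ 3 / 2) x * (nG x / tr (shape_op Ph x))) + C * (dl^2 + dl / \<kappa>)"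
  by (rule exE[OF reilly_inequality[OF H dim]], assumption, elim exE conjE, rule that)
 define k where "k n = 1 / (real n + 2)" for n
 have k: "0 < k n" "k n < 1" for n by (auto simp: k_def)
 have k0: "k \<longlonglongrightarrow> 0" using LIMSEQ_Suc[OF LIMSEQ_inverse_real_of_nat] by (simp add: k_def[abs_def] inverse_eq_divide add.commute)
 \<comment> \<open>This couples \<open>dl = (k n)^2\<close> with \<open>\<kappa> = k n\<close>, so
   that \<open>\<kappa>\<close> and \<open>dl / \<kappa>\<close> both tend to 0.\<close>
 define e where "e n = ((k n)^2) ^ 3 / 2" for n
 have "e \<longlonglongrightarrow> 0" unfolding e_def by (auto intro!: tendsto_eq_intros k0)
 moreover have "e n > 0" for n using k(1)[of n] by (simp add: e_def)
 ultimately have e: "e \<longlonglongrightarrow> 0" "!!n. e n > 0" by auto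
 define A where "A n = (IN x. cutoff (e n) x * hess_sq x)" for n
 define E where "E n = (IN x. cutoff (e n) x)" for n
 have i1: "sint (%_. 1 :: real)" by (intro set_integrable_continuous_closure continuous_intros)
 have V: "(IN x. (1 :: real)) = ?V" by (simp add: set_lebesgue_integral_def)
 have E: "E \<longlonglongrightarrow> ?V" using cutoff_integral_limit[OF e i1] unfolding E_def V by simp
 have Fatou: "(II x. ennreal (indicator Om x * hess_sq x)) <= ennreal ((?N - 1)^2 * (I + \<zeta>) - (?N - 2) * (?N * ?V))"
  "0 <= (?N - 1)^2 * (I + \<zeta>) - (?N - 2) * (?N * ?V)" if \<zeta>: "\<zeta> > 0" for \<zeta> proof -
  have "\<forall>\<^sub>F ep in at_right 0. (IN x. cutoff' ep x * (nG x * (?g x / (2 * B)))) <= (\<integral>x. ?g x / (2 * B) \<partial>\<sigma>) + \<zeta> / (2 * B)"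
  proof (rule flux_limit[OF t(1) dim])
   show "continuous_on ?K (%x. ?g x / (2 * B))" using B by (intro continuous_intros g) auto
   \<comment> \<open>Division by \<open>2 * B\<close> brings the integrand below 1/2, the range of
     \<open>flux_limit\<close>; linearity undoes it afterwards.\<close>
   show "0 <= ?g x / (2 * B) & ?g x / (2 * B) <= 1 / 2" if "x : closure Om" "- t <= Ph x" for x using t(3)[OF that] B(2)[of x] that B(1) by (auto simp: field_simps)
  qed (use \<zeta> B in simp)
  hence "\<forall>\<^sub>F ep in at_right 0. (IN x. cutoff' ep x * (nG x / tr (shape_op Ph x))) <= I + \<zeta>" proof eventually_elim
   case (elim ep)
   have "cutoff' ep x * (nG x * (?g x / (2 * B))) = (1 / (2 * B)) * (cutoff' ep x * (nG x / tr (shape_op Ph x)))" for x by simp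
   hence "(IN x. cutoff' ep x * (nG x * (?g x / (2 * B)))) = (1 / (2 * B)) * (IN x. cutoff' ep x * (nG x / tr (shape_op Ph x)))" by (simp only: set_integral_mult_right)
   moreover have "(\<integral>x. ?g x / (2 * B) \<partial>\<sigma>) + \<zeta> / (2 * B) = (1 / (2 * B)) * (I + \<zeta>)"
   unfolding I_def integral_divide_zero by (simp add: add_divide_distrib)
   ultimately have "(1 / (2 * B)) * (IN x. cutoff' ep x * (nG x / tr (shape_op Ph x))) <= (1 / (2 * B)) * (I + \<zeta>)" using elim by (simp only:)
   thus ?case by (rule mult_le_cancel_left_pos[THEN iffD1, rotated]) (use B(1) in simp) qed
  moreover have "filterlim e (at_right 0) sequentially" by (simp add: filterlim_at e less_imp_neq[OF e(2), symmetric])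
  ultimately have J: "\<forall>\<^sub>F n in sequentially. (IN x. cutoff' (e n) x * (nG x / tr (shape_op Ph x))) <= I + \<zeta>" by (rule eventually_compose_filterlim)
  define r where "r n = ((?N - 1)^2 * (I + \<zeta>) + C * (((k n)^2)^2 + k n) - (?N - 2) * (?N * E n)) / (1 - k n)" for n
  have "(%n. (k n)^2) \<longlonglongrightarrow> 0" by (auto intro!: tendsto_eq_intros k0)
  from order_tendstoD(2)[OF this C(2)] J
  have A_le: "\<forall>\<^sub>F n in sequentially. A n <= r n" proof eventually_elim
   case (elim n)
   have "(1 - k n) * A n + (?N - 2) * (?N * E n) <= (?N - 1)^2 * (IN x. cutoff' (e n) x * (nG x / tr (shape_op Ph x))) + C * (((k n)^2)^2 + (k n)^2 / k n)"
   unfolding A_def E_def e_def using elim k[of n] by (intro rei[rule_format]) auto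
   moreover have "(?N - 1)^2 * (IN x. cutoff' (e n) x * (nG x / tr (shape_op Ph x))) <= (?N - 1)^2 * (I + \<zeta>)" by (rule mult_left_mono[OF elim(2)]) simp
   moreover have "(k n)^2 / k n = k n" using k[of n] by (simp add: power2_eq_square)
   ultimately have "A n * (1 - k n) <= (?N - 1)^2 * (I + \<zeta>) + C * (((k n)^2)^2 + k n) - (?N - 2) * (?N * E n)" by (simp add: mult.commute)
   thus ?case using k[of n] by (simp add: r_def le_divide_eq) qed
  have R: "r \<longlonglongrightarrow> (?N - 1)^2 * (I + \<zeta>) - (?N - 2) * (?N * ?V)" unfolding r_def by (auto intro!: tendsto_eq_intros k0 E)
  have A0: "0 <= A n" for n unfolding A_def set_lebesgue_integral_def using cutoff_bounds(1)[OF e(2)] hess_sq_nonneg by (intro Bochner_Integration.integral_nonneg) simp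
  show "0 <= (?N - 1)^2 * (I + \<zeta>) - (?N - 2) * (?N * ?V)" proof (rule tendsto_lowerbound[OF R _ sequentially_bot])
   show "\<forall>\<^sub>F n in sequentially. 0 <= r n" using A_le by eventually_elim (rule order_trans[OF A0]) qed
  let ?u = "%n x. ennreal (indicator Om x * (cutoff (e n) x * hess_sq x))"
  have um: "?u n : borel_measurable lborel" for n
   using borel_measurable_continuous_on_indicator[OF Om_borel continuous_on_mult[OF continuous_cutoff(1) continuous_on_hess_sq], of "e n"] by simp
  have "(II x. ennreal (indicator Om x * hess_sq x)) = (II x. liminf (%n. ?u n x))" proof (rule nn_integral_cong)
   fix x
   have "(%n. ?u n x) \<longlonglongrightarrow> ennreal (indicator Om x * hess_sq x)" proof (cases "x : Om")
   case True
   hence "0 < - Ph x / 2" by (simp add: Om_eq)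
   from order_tendstoD(2)[OF e(1) this] have "\<forall>\<^sub>F n in sequentially. ?u n x = ennreal (indicator Om x * hess_sq x)" by eventually_elim (simp add: cutoff_eq(4)[OF e(2)])
   thus ?thesis by (rule tendsto_eventually) qed simp
   thus "ennreal (indicator Om x * hess_sq x) = liminf (%n. ?u n x)" by (rule lim_imp_Liminf[OF sequentially_bot, symmetric]) qed
  also have "... <= liminf (%n. II x. ?u n x)" by (rule nn_integral_liminf[OF um])
  also have "(%n. II x. ?u n x) = (%n. ennreal (A n))" proof
   fix n
   show "(II x. ?u n x) = ennreal (A n)" unfolding A_def set_lebesgue_integral_def real_scaleR_def
   using set_integrable_cutoff(1)[OF e(2) continuous_on_hess_sq] cutoff_bounds(1)[OF e(2)] hess_sq_nonneg by (intro nn_integral_eq_integral AE_I2) (auto simp: set_integrable_def) qed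
  also have "liminf (%n. ennreal (A n)) <= ennreal ((?N - 1)^2 * (I + \<zeta>) - (?N - 2) * (?N * ?V))" proof -
   have "\<forall>\<^sub>F n in sequentially. ennreal (A n) <= ennreal (r n)" using A_le by eventually_elim (rule ennreal_leI)
   from Liminf_mono[OF this] show ?thesis unfolding lim_imp_Liminf[OF sequentially_bot tendsto_ennrealI[OF R]] . qed
  finally show "(II x. ennreal (indicator Om x * hess_sq x)) <= ennreal ((?N - 1)^2 * (I + \<zeta>) - (?N - 2) * (?N * ?V))" . qed
 have m: "(%x. indicator Om x * hess_sq x) : borel_measurable lborel" using borel_measurable_continuous_on_indicator[OF Om_borel continuous_on_hess_sq] by simp
 have "(II x. ennreal (norm (indicator Om x * hess_sq x))) < \<infinity>" using Fatou[of 1] hess_sq_nonneg by (simp add: abs_mult le_less_trans)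
 thus int: "sint hess_sq" unfolding set_integrable_def real_scaleR_def by (rule integrableI_bounded[OF m])
 let ?L = "IN x. hess_sq x"
 show "?L <= (?N - 1)^2 * (\<integral>x. 1 / tr (shape_op Ph x) \<partial>\<sigma>) - (?N - 2) * (?N * ?V)" proof (rule field_le_epsilon)
  fix \<eta> :: real assume "\<eta> > 0"
  hence \<eta>: "\<eta> / (?N - 1)^2 > 0" using dim by simp
  have "ennreal ?L <= ennreal ((?N - 1)^2 * (I + \<eta> / (?N - 1)^2) - (?N - 2) * (?N * ?V))"
   using Fatou(1)[OF \<eta>] int hess_sq_nonneg unfolding set_lebesgue_integral_def set_integrable_def real_scaleR_def by (subst nn_integral_eq_integral[symmetric]) auto
  hence "?L <= (?N - 1)^2 * (I + \<eta> / (?N - 1)^2) - (?N - 2) * (?N * ?V)" using Fatou(2)[OF \<eta>] by simp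
  also have "... = (?N - 1)^2 * I - (?N - 2) * (?N * ?V) + \<eta>" using dim by (simp add: distrib_left)
  finally show "?L <= (?N - 1)^2 * (\<integral>x. 1 / tr (shape_op Ph x) \<partial>\<sigma>) - (?N - 2) * (?N * ?V) + \<eta>" by (simp add: I_def) qed qed

end

section \<open>Sobolev data of harmonic functions and comparison of the two radii\<close>

context C2_domain
begin

lemma set_integrable_of_square:
 fixes f :: "'a => real"
 assumes f: "continuous_on Om f" and g: "sint g" "!!x. x : Om ==> (f x)^2 <= g x"
 shows "sint f" "sint (%x. (f x)^2)" proof -
 have m: "(%x. indicator Om x *R k x) : borel_measurable lborel" if "continuous_on Om k" for k :: "'a => real" using borel_measurable_continuous_on_indicator[OF Om_borel that] by simp
 show "sint (%x. (f x)^2)" unfolding set_integrable_def by (rule Bochner_Integration.integrable_bound[OF g(1)[unfolded set_integrable_def] m[OF continuous_on_power[OF f]]])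
   (use g(2) in "force simp: indicator_def intro!: AE_I2")
 have 1: "sint (%x. 1 + g x)" by (intro set_integral_add(1) g set_integrable_continuous_closure continuous_intros)
 have le: "\<bar>f x\<bar> <= 1 + g x" if "x : Om" for x using g(2)[OF that] sum_squares_bound[of "\<bar>f x\<bar>" 1] by (simp add: power2_eq_square)
 show "sint f" unfolding set_integrable_def by (rule Bochner_Integration.integrable_bound[OF 1[unfolded set_integrable_def] m[OF f]]) (use le in "force simp: indicator_def intro!: AE_I2")
qed

lemma smooth_C1: "smooth_on UNIV \<phi> ==> C1_on UNIV \<phi>" unfolding smooth_on_def C1_on_def proof (intro conjI ballI)
 assume s: "ALL bs. set bs <= Basis --> (ALL x:UNIV. pdl \<phi> bs differentiable at x)"
 show "\<phi> differentiable at x" for x using s[rule_format, of "[]"] by simp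
 show "continuous_on UNIV (pd \<phi> b)" if "b : Basis" for b using s[rule_format, of "[b]"] that by (intro continuous_at_imp_continuous_on ballI differentiable_imp_continuous_within) auto
qed

lemma weak_pd_classical:
 assumes f: "C1_on Om f" and i: "sint f" "sint (pd f b)" and b: "b : Basis"
 shows "weak_pd Om f b (pd f b)" unfolding weak_pd_def proof (intro conjI allI impI)
 have c: "continuous_on Om f" "continuous_on Om (pd f b)" using C1_on_continuous[OF f] f b by (auto simp: C1_on_def)
 show "set_integrable lebesgue Om f" "set_integrable lebesgue Om (pd f b)" using i lebesgue_lborel(1)[OF Om_borel] c by auto
 fix \<phi> assume "test_fun Om \<phi>"
 define K where "K = closure {x. \<phi> x ~= 0}"
 have \<phi>: "C1_on UNIV \<phi>" and K: "compact K" "K <= Om" using \<open>test_fun Om \<phi>\<close> by (simp_all add: test_fun_def smooth_C1 K_def)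
 have sub: "{x. \<phi> x ~= 0} <= K" unfolding K_def by (rule closure_subset)
 have out: "\<phi> x = 0" "grad \<phi> x = 0" if "x ~: K" for x proof -
  show "\<phi> x = 0" using that sub by blast
  have "((%x. \<phi> x) has_derivative (%v. 0 *. v)) (at x)" by (rule has_derivative_transform_within_open[of "%_. 0" _ _ _ "- K"]) (use that sub K(1) in "auto intro: compact_imp_closed")
  thus "grad \<phi> x = 0" by (intro grad_eqI) simp qed
 have c\<phi>: "continuous_on S \<phi>" "continuous_on S (grad \<phi>)" for S using C1_on_continuous[OF \<phi>] C1_on_continuous_grad[OF \<phi>] continuous_on_subset by blast+
 have cg: "continuous_on Om (grad f)" by (rule C1_on_continuous_grad[OF f])
 let ?F' = "%x v. ((f x *R grad \<phi> x + \<phi> x *R grad f x) *. v) *R b"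
 have der: "((%x. (f x * \<phi> x) *R b) has_derivative ?F' x) (at x)" if "x : Om" for x
  using has_derivative_scaleR_left[OF has_derivative_mult[OF C1_on_has_grad[OF f that] C1_on_has_grad[OF \<phi> UNIV_I]], of b]
  by (rule has_derivative_eq_rhs) (auto simp: fun_eq_iff inner_add_left mult.commute)
 have z: "(IN x. tr (?F' x)) = 0" proof (rule integral_tr_zero(2)[OF open_Om K der])
  show "continuous_on Om (%x. ?F' x v)" for v by (intro continuous_on_scaleR continuous_on_inner continuous_on_add continuous_on_const c(1) c\<phi> cg) qed (simp_all add: out)
 have t: "tr (?F' x) = f x * pd \<phi> b x + pd f b x * \<phi> x" for x unfolding tr_outer' inner_add_right inner_scaleR_right inner_commute[of b "grad _ x"] grad_inner_Basis[OF b] by simp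
 have pdc: "continuous_on S (pd \<phi> b)" for S using \<phi> b continuous_on_subset[of UNIV "pd \<phi> b" S] by (simp add: C1_on_def)
 have pd0: "pd \<phi> b x = 0" if "x ~: K" for x using out(2)[OF that] grad_inner_Basis[OF b, of \<phi> x] by simp
 have 1: "sint (%x. f x * pd \<phi> b x)" "sint (%x. pd f b x * \<phi> x)"
  by (rule set_integrable_compact_support[OF K]; use out pd0 in "auto intro!: continuous_intros pdc c\<phi> continuous_on_subset[OF c(1) K(2)] continuous_on_subset[OF c(2) K(2)]")+
 show "(LINT x:Om|lebesgue. f x * pd \<phi> b x) = - (LINT x:Om|lebesgue. pd f b x * \<phi> x)" using set_integral_add(2)[OF 1] z unfolding t
  by (subst (1 2) lebesgue_lborel(2)[OF Om_borel]) (auto intro!: continuous_intros c c\<phi> pdc) qed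

lemma harm_L2:
 assumes v: "harm v"
 shows "L2 Om v" "b : Basis ==> L2 Om (pd v b)" "b : Basis ==> weak_pd Om v b (pd v b)"
  "(LINT x:Om|lebesgue. (v x)^2) = (IN x. (v x)^2)" "(SUM b:Basis. LINT x:Om|lebesgue. (pd v b x)^2) = energy v" proof -
 have C1: "C1_on Om v" and i: "sint (%x. (v x)^2)" "sint (%x. (norm (grad v x))^2)" using v C2_on_C1 by (auto simp: harm_def)
 have c: "continuous_on Om v" "b : Basis ==> continuous_on Om (pd v b)" for b using C1_on_continuous[OF C1] C1 by (auto simp: C1_on_def)
 note ip = pd_sq_integrable[OF C1 i(2)]
 show "L2 Om v" "b : Basis ==> L2 Om (pd v b)" using i ip c by (simp_all add: L2_iff)
 show "b : Basis ==> weak_pd Om v b (pd v b)"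
  using set_integrable_of_square(1)[OF c(1) i(1) order_refl] set_integrable_of_square(1)[OF c(2) ip order_refl] by (intro weak_pd_classical C1) auto
 show "(LINT x:Om|lebesgue. (v x)^2) = (IN x. (v x)^2)" by (intro lebesgue_lborel(2) Om_borel continuous_intros c)
 show "(SUM b:Basis. LINT x:Om|lebesgue. (pd v b x)^2) = energy v" unfolding energy_eq_sum[OF C1 i(2)] by (intro sum.cong refl lebesgue_lborel(2) Om_borel continuous_intros c) qed

lemma harm_W22:
 assumes v: "harm v" "!!b. b : Basis ==> harm (pd v b)"
 shows "W22_data Om v (pd v) (%b. pd (pd v b))"
  "W22_norm Om v (pd v) (%b. pd (pd v b)) = sqrt ((IN x. (v x)^2) + energy v + (SUM b:Basis. energy (pd v b)))"
 using harm_L2[OF v(1)] harm_L2[OF v(2)] by (auto simp: W22_data_def W22_norm_def)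

lemma harm_const: "harm (%_. k)" "energy (%_. k) = 0" proof -
 have 1: "((%_. k) has_derivative (%w. 0 *. w)) (at x)" for x :: 'a by simp
 have g: "grad (%_. k) x = 0" for x :: 'a by (rule grad_eqI[OF 1])
 have h: "hess (%_. k) x = (%_. 0)" for x :: 'a by (rule hess_eqI[OF open_UNIV UNIV_I 1]) auto
 have "C2_on Om (%_. k)" by (rule C2_onI[OF open_Om 1, of "%_ _. 0"]) auto
 moreover have "sint (%_. k^2)" by (intro set_integrable_continuous_closure continuous_intros)
 ultimately show "harm (%_. k)" by (simp add: harm_def g h lap_eq_tr_hess tr_def set_integrable_def)
 show "energy (%_. k) = 0" by (simp add: energy_def g set_lebesgue_integral_def) qed

lemma measure_ball_le: "ball x r <= Om ==> measure lborel (ball x r) <= measure lborel Om"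
 using emeasure_bounded_finite[OF bounded_Om] by (intro measure_mono_fmeasurable) (auto simp: fmeasurable_def)

lemma volume_pos: "measure lborel Om > 0" proof -
 obtain x where "x : Om" using ne_Om by blast
 then obtain e where e: "e > 0" "ball x e <= Om" using open_Om open_contains_ball by blast
 have "0 < measure lborel (ball x e)" using e by (simp add: content_ball)
 thus ?thesis using measure_ball_le[OF e(2)] by linarith qed

text \<open>The constant function 1 has positive \<open>W22_norm\<close>, so a negative
  \<open>c\<close> would make its Hoelder bound negative.\<close>

lemma sobolev_const_nonneg:
 assumes c: "sobolev_holder_const Om \<gamma> c"
 shows "c >= 0" proof (rule ccontr)
 assume neg: "~ c >= 0"
 have pd0: "pd (%_. 1 :: real) b = (%_. 0)" for b :: 'a by (simp add: pd_def fun_eq_iff)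
 have pd00: "pd (%_. 0 :: real) b = (%_. 0)" for b :: 'a by (simp add: pd_def fun_eq_iff)
 have D: "W22_data Om (%_. 1) (pd (%_. 1)) (%b. pd (pd (%_. 1) b))"
  and n: "W22_norm Om (%_. 1) (pd (%_. 1)) (%b. pd (pd (%_. 1) b)) = sqrt (measure lborel Om)" using harm_W22[of "%_. 1"] harm_const by (simp_all add: pd0 pd00 set_lebesgue_integral_def)
 from c[unfolded sobolev_holder_const_def, rule_format, OF D, unfolded n]
 obtain w where w: "!!x y. x : closure Om ==> y : closure Om ==> \<bar>w x - w y\<bar> <= c * sqrt (measure lborel Om) * dist x y powr \<gamma>" by blast
 obtain x where x: "x : Om" using ne_Om by blast
 obtain y where y: "y : Gam" using frontier_nonempty by blast
 have "dist x y > 0" using x y Om_Int_frontier by auto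
 hence "c * sqrt (measure lborel Om) * dist x y powr \<gamma> < 0" using neg volume_pos by (intro mult_neg_pos) (auto simp: mult_less_0_iff)
 thus False using w[of x y] x y closure_eq by (smt (verit) UnCI abs_ge_zero) qed

end

context torsion
begin

text \<open>If the minimum were attained on the frontier, \<open>u\<close> would vanish in
  \<open>Om\<close>, against \<open>lap_u\<close>.\<close>

lemma torsion_min: "EX z:Om. grad u z = 0" proof -
 have ne: "closure Om ~= {}" using ne_Om by simp
 obtain z where z: "z : closure Om" "!!x. x : closure Om ==> u z <= u x" using continuous_attains_inf[OF compact_closure ne cont_u] by blast
 have "z : Om" proof (rule ccontr)
  assume "z ~: Om"
  hence "u z = 0" using z(1) closure_eq u_frontier by blast
  hence 0: "u x = 0" if "x : Om" for x using z(2)[of x] torsion_nonpos[OF open_Om bounded_Om C2_u cont_u lap_u u_frontier, of x] that closure_eq by auto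
  obtain x where x: "x : Om" using ne_Om by blast
  have "hess u x b *. b <= 0" for b by (rule second_derivative_at_max[OF open_Om x has_grad_u has_hess_u[OF x]]) (simp_all add: 0 x)
  hence "tr (hess u x) <= 0" unfolding tr_def by (intro sum_nonpos)
  thus False using lap_u[OF x] by (simp add: lap_eq_tr_hess) qed
 moreover have "(%v. grad u z *. v) = (%v. 0)" by (rule differential_zero_maxmin[OF \<open>z : Om\<close> open_Om has_grad_u[OF \<open>z : Om\<close>]]) (use z(2) closure_eq in auto)
 hence "grad u z *. grad u z = 0" by meson
 ultimately show ?thesis by auto qed

text \<open>The Hessian of \<open>v z\<close> is the identity minus that of \<open>u\<close>. Its
  squared norm is \<open>N - 2 N + hess_sq\<close>, because the trace of the Hessian of
  \<open>u\<close> is \<open>N\<close>; this is the sum of the energies before integration.\<close>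

lemma deviation_harm:
 assumes i: "sint hess_sq"
 defines "v == %z y. h z y - h z z"
 shows "harm (v z)" "b : Basis ==> harm (pd (v z) b)" "z : Om ==> pd (v z) b z = - pd u b z"
  "(SUM b:Basis. energy (pd (v z) b)) = (IN x. hess_sq x) - real DIM('a) * measure lborel Om" proof -
 let ?N = "real DIM('a)"
 have 1: "(v z has_derivative (%w. ((y - z) - grad u y) *. w)) (at y)" if "y : Om" for y
  unfolding v_def using has_derivative_diff[OF has_grad_h[OF that, of z] has_derivative_const[of "h z z"]] by simp
 have C2: "C2_on Om (v z)" by (rule C2_onI[OF open_Om 1 has_hess_h]) (auto intro!: continuous_intros C2_on_continuous_hess[OF C2_u])
 have lap: "lap (v z) y = 0" if y: "y : Om" for y proof -
  have "hess (v z) y = (%w. w - hess u y w)" by (rule hess_eqI[OF open_Om y 1 has_hess_h[OF y]])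
  thus ?thesis using lap_u[OF y] by (simp add: lap_eq_tr_hess tr_diff tr_id) qed
 have cv: "continuous_on (closure Om) (v z)" unfolding v_def h_def by (intro continuous_intros cont_u) auto
 have pdv: "pd (v z) b y = (y - z) *. b - pd u b y" if "y : Om" for y b using pd_eq_inner[OF 1[OF that], of b] pd_eq_inner[OF has_grad_u[OF that], of b] by (simp add: inner_diff_left)
 show "z : Om ==> pd (v z) b z = - pd u b z" by (simp add: pdv)
 obtain M where M: "M > 0" "!!x. x : Om ==> norm (grad u x) <= M" using grad_u_bounded by blast
 have le: "(norm (grad (v z) y))^2 <= (norm (y - z) + M)^2" if "y : Om" for y
  unfolding grad_eqI[OF 1[OF that]] using M(2)[OF that] norm_triangle_ineq4[of "y - z" "grad u y"] by (intro power_mono) auto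
 have "sint (%y. (norm (y - z) + M)^2)" by (intro set_integrable_continuous_closure continuous_intros)
 from set_integrable_of_square(2)[OF continuous_on_norm[OF C1_on_continuous_grad[OF C2_on_C1[OF C2]]] this le]
 have "sint (%y. (norm (grad (v z) y))^2)" by simp
 moreover have "sint (%y. (v z y)^2)" by (intro set_integrable_continuous_closure continuous_intros cv)
 ultimately show hv: "harm (v z)" using C2 lap by (simp add: harm_def)
 have gpd: "grad (pd (v z) b) y = b - grad (pd u b) y" if b: "b : Basis" and y: "y : Om" for b y proof (rule grad_eqI, rule has_derivative_transform_within_open[OF _ open_Om y])
  show "((%y. (y - z) *. b - pd u b y) has_derivative (%w. (b - grad (pd u b) y) *. w)) (at y)" using C1_on_has_grad[OF C2_on_C1[OF pd_u(1)[OF b]] y]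
   by (auto intro!: derivative_eq_intros simp: inner_diff_right inner_commute) qed (simp add: pdv)
 have g2: "(norm (grad (pd (v z) b) y))^2 = 1 - 2 * pd (pd u b) b y + (norm (grad (pd u b) y))^2" if b: "b : Basis" and y: "y : Om" for b y
  unfolding gpd[OF b y] power2_norm_eq_inner grad_inner_Basis[OF b, of "pd u b", symmetric] using b by (simp add: inner_diff_left inner_diff_right inner_commute)
 have sum_g2: "(SUM b:Basis. (norm (grad (pd (v z) b) y))^2) = hess_sq y - ?N" if "y : Om" for y
  using lap_u[OF that] by (simp add: g2 that hess_sq_def lap_def sum.distrib sum_subtractf flip: sum_distrib_left)
 have C2pd: "C2_on Om (pd (v z) b)" if "b : Basis" for b by (rule mean_value_property_imp_C2[OF open_Om harm_mvp(2)[OF hv that]])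
 have ig: "sint (%y. (norm (grad (pd (v z) b) y))^2)" if b: "b : Basis" for b proof (rule set_integrable_of_square(2)[OF _ i])
  show "continuous_on Om (%y. norm (grad (pd (v z) b) y))" by (intro continuous_intros C1_on_continuous_grad C2_on_C1 C2pd b)
  fix y assume y: "y : Om"
  have "(norm (grad (pd (v z) b) y))^2 <= (SUM b:Basis. (norm (grad (pd (v z) b) y))^2)" using b by (intro member_le_sum) auto
  thus "(norm (grad (pd (v z) b) y))^2 <= hess_sq y" unfolding sum_g2[OF y] by simp qed
 show "harm (pd (v z) b)" if b: "b : Basis" for b unfolding harm_def using C2pd[OF b] ig[OF b] lap_pd_eq_0[OF open_Om C2 lap b]
   pd_sq_integrable[OF C2_on_C1[OF C2] _ b] hv by (auto simp: harm_def)
 have "(SUM b:Basis. energy (pd (v z) b)) = (IN y. (SUM b:Basis. (norm (grad (pd (v z) b) y))^2))" unfolding energy_def by (rule set_integral_sum'[OF ig, symmetric])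
 also have "... = (IN y. hess_sq y - ?N)" by (rule set_lebesgue_integral_cong) (use sum_g2 in auto)
 also have "... = (IN x. hess_sq x) - (IN x. ?N)" by (intro set_integral_diff(2) i set_integrable_continuous_closure continuous_intros)
 finally show "(SUM b:Basis. energy (pd (v z) b)) = (IN x. hess_sq x) - ?N * measure lborel Om" by (simp add: set_lebesgue_integral_def mult.commute) qed

text \<open>The point of the closure farthest from \<open>z\<close> lies on the frontier, so a ball
  of radius \<open>\<rho>\<close> contains \<open>Om\<close>. This later replaces a division by the
  outer radius by the volume.\<close>

lemma volume_le:
 assumes z: "!!x. x : Gam ==> dist x z <= \<rho>"
 shows "0 <= \<rho>" "measure lborel Om <= unit_ball_vol (real DIM('a)) * \<rho> ^ DIM('a)" proof -
 have ne: "closure Om ~= {}" using ne_Om by simp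
 have "continuous_on (closure Om) (%x. dist x z)" by (intro continuous_intros)
 from continuous_attains_sup[OF compact_closure ne this]
 obtain q where q: "q : closure Om" "!!x. x : closure Om ==> dist x z <= dist q z" by blast
 have "q ~: Om" proof
  assume "q : Om"
  then obtain e where e: "e > 0" "cball q e <= Om" using open_Om open_contains_cball by blast
  obtain b :: 'a where b: "b : Basis" using nonempty_Basis by blast
  \<comment> \<open>A unit direction in which the distance to \<open>z\<close> does not decrease to
    first order; the choice of sign also covers \<open>q = z\<close>.\<close>
  obtain w :: 'a where w: "norm w = 1" "(q - z) *. w >= 0" proof (cases "(q - z) *. b >= 0")
   case True thus ?thesis using that[of b] b by simp
  next
   case False thus ?thesis using that[of "- b"] b by simp qed
  have "q + e *R w : cball q e" using w e by (simp add: dist_norm)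
  hence "q + e *R w : closure Om" using e(2) closure_subset by blast
  hence "norm (q + e *R w - z) <= norm (q - z)" using q(2)[of "q + e *R w"] by (simp add: dist_norm)
  hence "(norm ((q - z) + e *R w))^2 <= (norm (q - z))^2" by (intro power_mono) (auto simp: algebra_simps)
  moreover have "(norm ((q - z) + e *R w))^2 = (norm (q - z))^2 + 2 * e * ((q - z) *. w) + e^2"
   using w unfolding power2_norm_eq_inner by (simp add: inner_add_left inner_add_right inner_commute norm_eq_1 power2_eq_square)
  moreover have "2 * e * ((q - z) *. w) >= 0" "e^2 > 0" using e w by auto
  ultimately show False by linarith qed
 hence qG: "dist q z <= \<rho>" using q(1) closure_eq z by blast
 thus \<rho>: "0 <= \<rho>" using zero_le_dist[of q z] by linarith
 have "Om <= cball z \<rho>" using q(2) qG closure_eq by (fastforce simp: dist_commute)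
 hence "measure lborel Om <= measure lborel (cball z \<rho>)" using emeasure_bounded_finite[OF bounded_cball, of z \<rho>] by (intro measure_mono_fmeasurable) (auto simp: fmeasurable_def)
 thus "measure lborel Om <= unit_ball_vol (real DIM('a)) * \<rho> ^ DIM('a)" using \<rho> by (simp add: content_cball) qed

lemma interior_sphere_point:
 assumes ri: "interior_sphere_radius Om r" and p: "p : Gam" and s: "0 < s" "s <= r"
 shows "ball (p - s *R nu p) s <= Om" proof -
 obtain y where y: "ball y r <= Om" "cball y r Int Gam = {p}" using ri p unfolding interior_sphere_radius_def by blast
 have "p : cball y r" "p ~: ball y r" using y p Om_Int_frontier by blast+
 hence "dist y p = r" by simp
 hence y2: "y = p - r *R nu p" using interior_ball_center[OF p _ y(1)] s by auto
 have "dist y (p - s *R nu p) = r - s" unfolding y2 dist_norm using norm_nu[OF p] s norm_scaleR[of "s - r" "nu p"] by (simp add: algebra_simps)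
 hence "w : ball y r" if "w : ball (p - s *R nu p) s" for w using dist_triangle[of y w "p - s *R nu p"] that by simp
 thus ?thesis using y(1) by blast qed

text \<open>The farthest and the nearest frontier point are moved inward by \<open>s\<close>. At the
  two new points the mean value inequality on balls of radius \<open>s\<close> bounds
  \<open>h z - h z z\<close> by a multiple of \<open>M * s\<close>, and \<open>u\<close> is at most
  \<open>M * s\<close> in absolute value; so their squared distances to \<open>z\<close> differ by
  that order only.\<close>

lemma radius_compare:
 assumes ri: "interior_sphere_radius Om r" and s: "0 < s" "s <= r / 4" and z: "z : Om" and v: "harm (%y. h z y - h z z)"
  and e: "e : Gam" "!!x. x : Gam ==> dist x z <= dist e z" and i: "i : Gam" "!!x. x : Gam ==> dist i z <= dist x z"
  and M: "!!x. x : Om ==> norm (grad u x) <= M"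
  and Q: "(IN x. (h z x - h z z)^2) <= M^2 * s ^ (DIM('a) + 2)"
 shows "(dist e z - dist i z) * dist e z <= 8 * (1 + sqrt ((2 * real DIM('a)) ^ DIM('a) / bump_int TYPE('a))) * (M * s)" proof -
 let ?N = "real DIM('a)" and ?K = "bump_int TYPE('a)" and ?v = "%y. h z y - h z z"
 let ?c = "sqrt ((2 * ?N) ^ DIM('a) / ?K)"
 have K: "?K > 0" by (rule bump_int_pos)
 have N: "?N >= 1" using DIM_positive[where 'a='a] by (simp add: Suc_le_eq)
 have M0: "M >= 0" using M[OF z] norm_ge_zero order_trans by blast
 have sub: "ball (p - s *R nu p) s <= Om" if "p : Gam" for p using interior_sphere_point[OF ri that] s ri by (simp add: interior_sphere_radius_def)
 have vb: "\<bar>?v y\<bar> <= ?c * (M * s)" if y: "ball y s <= Om" for y proof -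
  have r: "s / (2 * ?N) > 0" "?N * (s / (2 * ?N)) = s / 2" using s N by auto
  have "cball y (?N * (s / (2 * ?N))) <= Om" using y s unfolding r(2) by (auto simp: subset_eq)
  hence "(?v y)^2 <= (IN x. (?v x)^2) / (?K * (s / (2 * ?N)) ^ DIM('a))" using v by (intro mean_value_square_le[OF harm_mvp(1)[OF v] open_Om r(1)]) (auto simp: harm_def)
  also have "... <= (M^2 * s ^ (DIM('a) + 2)) / (?K * (s / (2 * ?N)) ^ DIM('a))" using K r by (intro divide_right_mono Q) auto
  also have "... = (?c * (M * s))^2" using K s N by (simp add: power_mult_distrib power_divide power_add power2_eq_square field_simps)
  finally have "\<bar>?v y\<bar> <= \<bar>?c * (M * s)\<bar>" by (simp only: abs_le_square_iff)
  also have "... = ?c * (M * s)" using K M0 s by (intro abs_of_nonneg mult_nonneg_nonneg real_sqrt_ge_zero divide_nonneg_pos) auto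
  finally show ?thesis . qed
 have ub: "\<bar>u (p - s *R nu p)\<bar> <= M * s" if p: "p : Gam" for p proof -
  let ?y = "p - s *R nu p"
  have yO: "?y : Om" using sub[OF p] s by auto
  have cl: "closure (ball ?y s) = cball ?y s" using s by (simp add: closure_ball)
  have cs: "cball ?y s <= closure Om" using closure_mono[OF sub[OF p]] unfolding cl .
  have ubw: "\<bar>u ?y - u w\<bar> <= M * s" if "w : cball ?y s" for w proof (rule continuous_le_on_closure[of "ball ?y s" "%w. \<bar>u ?y - u w\<bar>"])
   show "continuous_on (closure (ball ?y s)) (%w. \<bar>u ?y - u w\<bar>)" unfolding cl by (intro continuous_intros continuous_on_subset[OF cont_u cs])
   fix w assume w: "w : ball ?y s"
   have "\<bar>u ?y - u w\<bar> <= M * norm (?y - w)" by (rule grad_bound_Lipschitz[OF convex_ball has_grad_u M _ w]) (use sub[OF p] s in auto)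
   also have "... <= M * s" using w M0 by (intro mult_left_mono) (auto simp: dist_norm)
   finally show "\<bar>u ?y - u w\<bar> <= M * s" . qed (use that cl in simp)
  have "p : cball ?y s" using norm_nu[OF p] s by (simp add: dist_norm)
  from ubw[OF this] show ?thesis by (simp add: u_frontier[OF p]) qed
 let ?e = "e - s *R nu e" and ?i = "i - s *R nu i"
 have "dist z i > 0" using i(1) z Om_Int_frontier by auto
 moreover have "ball z (dist z i) <= Om" by (rule ball_subset_if_dist_frontier[OF z]) (use i(2) in "simp add: dist_commute")
 \<comment> \<open>The ball about \<open>z\<close> touches the frontier at its nearest point
   \<open>i\<close>, so \<open>z\<close> lies on the inner normal there; the moved point then has
   distance exactly \<open>|dist i z - s|\<close> from \<open>z\<close>.\<close>
 ultimately have iz: "z = i - dist z i *R nu i" using interior_ball_center[OF i(1)] by blast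
 have ni: "(norm (?i - z))^2 = (dist i z - s)^2" proof -
  have "?i - z = (i - z) - s *R nu i" by simp
  also have "i - z = dist z i *R nu i" using arg_cong[OF iz, of "%x. i - x"] by simp
  also have "dist z i *R nu i - s *R nu i = (dist i z - s) *R nu i" by (simp add: dist_commute scaleR_diff_left)
  finally have "?i - z = (dist i z - s) *R nu i" .
  thus ?thesis using norm_nu[OF i(1)] by (simp add: power_mult_distrib) qed
 \<comment> \<open>\<open>Om\<close> contains a ball of radius \<open>r\<close> and lies in one of
   radius \<open>dist e z\<close>. Together with \<open>s <= r / 4\<close> this gives
   \<open>dist e z - 2 * s >= dist e z / 2\<close>, the source of the factor \<open>dist e z\<close>
   in the claim.\<close>
 have re: "r <= dist e z" proof -
  obtain y where y: "ball y r <= Om" using ri e(1) unfolding interior_sphere_radius_def by blast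
  have r0: "r > 0" using s by linarith
  have "?thesis" if "~ ?thesis" proof -
   have "measure lborel (ball y r) <= measure lborel Om" by (rule measure_ball_le[OF y])
   also have "... <= unit_ball_vol ?N * dist e z ^ DIM('a)" by (rule volume_le(2)[OF e(2)])
   finally have "r ^ DIM('a) <= dist e z ^ DIM('a)" using r0 by (simp add: content_ball)
   thus ?thesis by (rule power_le_imp_le_base[of _ "DIM('a) - 1", simplified]) simp qed
  thus ?thesis by blast qed
 have "dist e z - s <= norm (?e - z)" using norm_triangle_ineq2[of "e - z" "s *R nu e"] norm_nu[OF e(1)] s by (simp add: dist_norm algebra_simps)
 hence ne: "(dist e z - s)^2 <= (norm (?e - z))^2" using re s by (intro power_mono) auto
 have ei: "dist i z <= dist e z" using i e by blast
 have "(dist e z - dist i z) * (dist e z / 2) <= (dist e z - dist i z) * (dist e z + dist i z - 2 * s)" using ei re s zero_le_dist[of i z] by (intro mult_left_mono) linarith+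
 also have "... = (dist e z - s)^2 - (dist i z - s)^2" by (simp add: power2_eq_square algebra_simps)
 also have "... <= (norm (?e - z))^2 - (norm (?i - z))^2" using ne ni by simp
 also have "... = 2 * (?v ?e - ?v ?i + u ?e - u ?i)" by (simp add: h_def)
 also have "... <= 2 * (2 * (?c * (M * s)) + 2 * (M * s))" using vb[OF sub[OF e(1)]] vb[OF sub[OF i(1)]] ub[OF e(1)] ub[OF i(1)] by (intro mult_left_mono) (auto simp: abs_le_iff)
 finally show ?thesis by (simp add: algebra_simps) qed

text \<open>\<open>u\<close> vanishes on the frontier, so half the difference of the squared radii
  is a difference of two values of \<open>h z\<close>, to which the Hoelder bound applies.\<close>

lemma sobolev_compare:
 assumes c: "sobolev_holder_const Om \<gamma> c" and \<gamma>: "0 < \<gamma>" and v: "harm (%y. h z y - h z z)" "!!b. b : Basis ==> harm (pd (%y. h z y - h z z) b)"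
  and ei: "e : Gam" "i : Gam"
 shows "((dist e z)^2 - (dist i z)^2) / 2 <= c * sqrt ((IN x. (h z x - h z z)^2) + energy (%y. h z y - h z z)
   + (SUM b:Basis. energy (pd (%y. h z y - h z z) b))) * diameter Om powr \<gamma>" proof -
 let ?v = "%y. h z y - h z z"
 let ?W = "sqrt ((IN x. (?v x)^2) + energy ?v + (SUM b:Basis. energy (pd ?v b)))"
 have W: "W22_data Om ?v (pd ?v) (%b. pd (pd ?v b))" "W22_norm Om ?v (pd ?v) (%b. pd (pd ?v b)) = ?W" by (rule harm_W22[OF v]; assumption)+
 from c[unfolded sobolev_holder_const_def, rule_format, OF W(1), unfolded W(2)]
 obtain w where w: "continuous_on (closure Om) w" "AE x in lebesgue. x : Om --> w x = ?v x"
  "!!x y. x : closure Om ==> y : closure Om ==> \<bar>w x - w y\<bar> <= c * ?W * dist x y powr \<gamma>" by blast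
 have cv: "continuous_on (closure Om) ?v" unfolding h_def by (intro continuous_intros cont_u) auto
 have cd: "continuous_on (closure Om) (%x. w x - ?v x)" by (intro continuous_intros w(1) cv)
 \<comment> \<open>The Hoelder bound concerns a continuous representative \<open>w\<close>. The set
   where it differs from \<open>?v\<close> is open and negligible, hence empty; continuity extends
   the equality to the closure.\<close>
 have "{x : Om. w x - ?v x ~= 0} = {}" proof (rule ccontr)
  assume ne: "{x : Om. w x - ?v x ~= 0} ~= {}"
  have "open (Om Int (%x. w x - ?v x) -` (- {0}))" by (rule continuous_open_preimage[OF continuous_on_subset[OF cd closure_subset] open_Om]) auto
  moreover have "Om Int (%x. w x - ?v x) -` (- {0}) = {x : Om. w x - ?v x ~= 0}" by auto
  ultimately have "~ negligible {x : Om. w x - ?v x ~= 0}" using open_not_negligible[OF _ ne] by simp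
  moreover obtain S where "negligible S" "{x. ~ (x : Om --> w x = ?v x)} <= S" using w(2) unfolding eventually_ae_filter_negligible by blast
  hence "negligible {x : Om. w x - ?v x ~= 0}" by (elim negligible_subset) auto
  ultimately show False by blast qed
 hence eq: "w x = ?v x" if "x : closure Om" for x using continuous_constant_on_closure[OF cd, of 0 x] that by auto
 have cl: "e : closure Om" "i : closure Om" using ei closure_eq by auto
 have "((dist e z)^2 - (dist i z)^2) / 2 = w e - w i"
  using u_frontier[OF ei(1)] u_frontier[OF ei(2)] by (simp add: eq[OF cl(1)] eq[OF cl(2)] h_def[of z e] h_def[of z i] dist_norm diff_divide_distrib)
 also have "... <= c * ?W * dist e i powr \<gamma>" using w(3)[OF cl] by linarith
 also have "... <= c * ?W * diameter Om powr \<gamma>" proof (intro mult_left_mono powr_mono2)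
  have "dist e i <= diameter (closure Om)" using cl bounded_Om by (intro diameter_bounded_bound) auto
  thus "dist e i <= diameter Om" by (simp add: diameter_closure bounded_Om)
  show "0 <= c * ?W" using sobolev_const_nonneg[OF c] energy_nonneg by (intro mult_nonneg_nonneg real_sqrt_ge_zero add_nonneg_nonneg sum_nonneg) (auto simp: set_lebesgue_integral_def)
 qed (use \<gamma> in auto)
 finally show ?thesis . qed

end

section \<open>Constants and the two stability estimates\<close>

lemma radius_division:
 fixes X Y V w \<rho> :: real
 assumes "X * \<rho> <= Y" "V <= w * \<rho>" "V > 0" "\<rho> > 0" "Y >= 0"
 shows "X <= Y * (w / V)" proof -
 have "X <= Y * (1 / \<rho>)" using assms by (simp add: le_divide_eq)
 also have "... <= Y * (w / V)" using assms by (intro mult_left_mono) (auto simp: divide_le_eq le_divide_eq mult.commute)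
 finally show ?thesis . qed

text \<open>Here \<open>e <= E / \<mu>\<close> and \<open>q <= E / \<mu>^2\<close>, so the sum is at
  most \<open>E (1 + 1 / \<mu>)^2\<close>; this is the origin of the factor
  \<open>(1 + \<mu>) / \<mu>\<close>.\<close>

lemma sqrt_energy_le:
 fixes \<mu> q e E :: real
 assumes "\<mu> > 0" "\<mu> * q <= e" "\<mu> * e <= E" "E >= 0"
 shows "sqrt (q + e + E) <= sqrt E * ((1 + \<mu>) / \<mu>)" proof (rule real_le_lsqrt)
 have e: "e <= E / \<mu>" using assms by (simp add: le_divide_eq mult.commute)
 have "q <= e / \<mu>" using assms by (simp add: le_divide_eq mult.commute)
 also have "... <= E / \<mu> / \<mu>" using e assms by (intro divide_right_mono) auto
 finally have "q + e + E <= E / \<mu> / \<mu> + E / \<mu> + E" using e by linarith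
 also have "... <= E * ((1 + \<mu>) / \<mu>)^2" using assms by (simp add: field_simps power2_eq_square)
 finally show "q + e + E <= (sqrt E * ((1 + \<mu>) / \<mu>))^2" by (simp only: power_mult_distrib real_sqrt_pow2[OF assms(4)]) qed (use assms in auto)

text \<open>\<open>M * s\<close> for the radius \<open>s\<close> at which
  \<open>M^2 * s^(N + 2)\<close> equals the L2 bound \<open>k * D / \<mu>^2\<close>, sorted into
  factors.\<close>

lemma optimal_radius_powr:
 fixes M \<mu> D k N :: real
 assumes "M > 0" "\<mu> > 0" "D > 0" "k > 0" "N > 0"
 shows "M * ((k * D / \<mu>^2) / M^2) powr (1 / (N + 2)) = k powr (1 / (N + 2)) * (M powr (N / (N + 2)) / \<mu> powr (2 / (N + 2))) * D powr (1 / (N + 2))" proof -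
 let ?p = "1 / (N + 2)"
 have sq: "(x^2) powr ?p = x powr (2 / (N + 2))" if "x > 0" for x :: real using that powr_powr[of x 2 ?p] by (simp add: powr_numeral)
 have "M powr (N / (N + 2)) = M powr (1 - 2 / (N + 2))" using assms by (simp add: field_simps)
 also have "... = M / M powr (2 / (N + 2))" using assms by (simp add: powr_diff)
 finally have M: "M powr (N / (N + 2)) = M / M powr (2 / (N + 2))" .
 show ?thesis using assms by (simp add: M powr_divide powr_mult sq mult_ac) qed

text \<open>The 2 comes from the halved squares, the root of \<open>N - 1\<close> from the energy
  bound \<open>(N - 1) * deficit\<close>, and the ball volume from trading the outer radius for the
  volume of \<open>Om\<close>.\<close>

definition planar_const :: "'a::euclidean_space itself => real" where
 "planar_const _ = 2 * sqrt (real DIM('a) - 1) * unit_ball_vol (real DIM('a)) powr (1 / real DIM('a))"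

text \<open>The first line is the constant of \<open>radius_compare\<close>, the second has the
  factor \<open>N - 1\<close> from inside the optimal radius and the ball volume as in
  \<open>planar_const\<close>.\<close>

definition general_const :: "'a::euclidean_space itself => real" where
 "general_const _ = 8 * (1 + sqrt ((2 * real DIM('a)) ^ DIM('a) / bump_int TYPE('a)))
   * (real DIM('a) - 1) powr (1 / (real DIM('a) + 2)) * unit_ball_vol (real DIM('a)) powr (1 / real DIM('a))"

text \<open>The threshold below which the optimal radius is at most \<open>r / 4\<close>.\<close>

definition deficit_const :: "'a::euclidean_space itself => real" where
 "deficit_const _ = 1 / ((real DIM('a) - 1) * 4 ^ (DIM('a) + 2))"

context torsion
begin

definition deficit :: real where
 "deficit = surface_integral Gam (%x. 1 / mean_curv Om x) - real DIM('a) * measure lebesgue Om"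

lemma volume: "measure lebesgue Om = measure lborel Om" by simp

lemma stability:
 assumes dim: "DIM('a) >= 2" and con: "connected Om" and H: "!!p. p : Gam ==> mean_curv Om p > 0"
 defines "N == real DIM('a)" and "M == (SUP x\<in>Om. norm (grad u x))" and "V == measure lebesgue Om"
 obtains z where "z : Om"
  "!!\<gamma> c. 0 < \<gamma> ==> sobolev_holder_const Om \<gamma> c ==> (SUP x\<in>Gam. dist x z) - (INF x\<in>Gam. dist x z)
   <= (planar_const TYPE('a) * c * diameter Om powr \<gamma> / V powr (1 / N) * ((1 + mu0 Om z) / mu0 Om z)) * deficit powr (1 / 2)"
  "!!r. interior_sphere_radius Om r ==> deficit < deficit_const TYPE('a) * (mu0 Om z)^2 * M^2 * r powr (N + 2) ==> (SUP x\<in>Gam. dist x z) - (INF x\<in>Gam. dist x z)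
   <= (general_const TYPE('a) * M powr (N / (N + 2)) / (mu0 Om z powr (2 / (N + 2)) * V powr (1 / N))) * deficit powr (1 / (N + 2))" proof -
 have N2: "N >= 2" using dim by (simp add: N_def)
 have trp: "tr (shape_op Ph p) > 0" if "p : Gam" for p using H[OF that] mean_curv_eq_tr[OF that] dim by (simp add: zero_less_divide_iff)
 obtain z where z: "z : Om" "grad u z = 0" using torsion_min by blast
 let ?v = "%y. h z y - h z z" and ?\<mu> = "mu0 Om z" and ?D = deficit
 let ?Q = "IN x. (?v x)^2" and ?E = "SUM b:Basis. energy (pd ?v b)"
 have i: "sint hess_sq" by (rule hess_sq_deficit(1)[OF trp dim])
 have hv: "harm ?v" by (rule deviation_harm(1)[OF i])
 have hpd: "harm (pd ?v b)" if "b : Basis" for b by (rule deviation_harm(2)[OF i that])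
 have \<mu>: "?\<mu> > 0" by (rule mu0_poincare(1)[OF con z(1)])
 have E0: "?E >= 0" by (intro sum_nonneg energy_nonneg)
 have "surface_integral Gam (%x. 1 / mean_curv Om x) = (\<integral>x. (N - 1) * (1 / tr (shape_op Ph x)) \<partial>\<sigma>)"
  unfolding surface_integral_def by (intro Bochner_Integration.integral_cong) (auto simp: space_\<sigma> mean_curv_eq_tr N_def)
 also have "... = (N - 1) * (\<integral>x. 1 / tr (shape_op Ph x) \<partial>\<sigma>)" by (rule integral_mult_right_zero)
 finally have DI: "?D = (N - 1) * (\<integral>x. 1 / tr (shape_op Ph x) \<partial>\<sigma>) - N * V" by (simp only: deficit_def N_def V_def)
 \<comment> \<open>Since \<open>1 / mean_curv\<close> is \<open>N - 1\<close> times the reciprocal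
   trace, the bound of the Hessian integral minus \<open>N * V\<close> is exactly
   \<open>(N - 1)\<close> times the deficit.\<close>
 have "(N - 1) * ?D = (N - 1)^2 * (\<integral>x. 1 / tr (shape_op Ph x) \<partial>\<sigma>) - (N - 2) * (N * V) - N * V" unfolding DI by (simp add: power2_eq_square algebra_simps)
 moreover have "?E <= (N - 1)^2 * (\<integral>x. 1 / tr (shape_op Ph x) \<partial>\<sigma>) - (N - 2) * (N * V) - N * V"
  using hess_sq_deficit(2)[OF trp dim] deviation_harm(4)[OF i, of z] unfolding N_def V_def volume by simp
 ultimately have ED: "?E <= (N - 1) * ?D" by simp
 hence D0: "?D >= 0" using E0 N2 by (smt (verit) mult_pos_neg)
 have "?\<mu> * energy ?v = (SUM b:Basis. ?\<mu> * (IN x. (pd ?v b x)^2))" using hv by (subst energy_eq_sum) (auto simp: harm_def sum_distrib_left intro: C2_on_C1)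
 also have "... <= ?E" proof (rule sum_mono)
  fix b :: 'a assume b: "b : Basis"
  \<comment> \<open>The critical point makes the partial derivatives of \<open>?v\<close> vanish at
    \<open>z\<close>, so that the inequality for \<open>mu0\<close> covers them.\<close>
  have "pd u b z = 0" using pd_eq_inner[OF has_grad_u[OF z(1)], of b] z(2) by simp
  thus "?\<mu> * (IN x. (pd ?v b x)^2) <= energy (pd ?v b)" using deviation_harm(3)[OF i z(1), of b] by (intro mu0_poincare(2)[OF con z(1) hpd[OF b]]) simp qed
 finally have en: "?\<mu> * energy ?v <= ?E" .
 have Qe: "?\<mu> * ?Q <= energy ?v" by (rule mu0_poincare(2)[OF con z(1) hv]) simp
 have cd: "continuous_on Gam (%x. dist x z)" by (intro continuous_intros)
 obtain e where e: "e : Gam" "!!x. x : Gam ==> dist x z <= dist e z" using continuous_attains_sup[OF compact_frontier frontier_nonempty cd] by blast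
 obtain i where i: "i : Gam" "!!x. x : Gam ==> dist i z <= dist x z" using continuous_attains_inf[OF compact_frontier frontier_nonempty cd] by blast
 have \<rho>: "(SUP x\<in>Gam. dist x z) = dist e z" "(INF x\<in>Gam. dist x z) = dist i z" using e i by (auto intro!: cSup_eq_maximum cInf_eq_minimum)
 have \<rho>e: "dist e z > 0" using e(1) z(1) Om_Int_frontier by auto
 let ?w = "unit_ball_vol N powr (1 / N)" and ?V = "V powr (1 / N)"
 have V0: "V > 0" unfolding V_def volume by (rule volume_pos)
 \<comment> \<open>A lower bound for the outer radius; dividing by the radius later produces the
   factor \<open>1 / ?V\<close>.\<close>
 have "?V <= (unit_ball_vol N * dist e z ^ DIM('a)) powr (1 / N)" using volume_le(2)[OF e(2)] V0 N2 by (intro powr_mono2) (auto simp: V_def N_def)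
 also have "... = ?w * dist e z" using \<rho>e N2 by (simp add: powr_mult N_def powr_powr flip: powr_realpow)
 finally have VR: "?V <= ?w * dist e z" .
 have V': "?V > 0" using V0 by simp
 show thesis proof (rule that[OF z(1)])
  fix \<gamma> c assume \<gamma>: "0 < \<gamma>" and c: "sobolev_holder_const Om \<gamma> c"
  have c0: "c >= 0" by (rule sobolev_const_nonneg[OF c])
  let ?Y = "2 * (c * (sqrt ((N - 1) * ?D) * ((1 + ?\<mu>) / ?\<mu>)) * diameter Om powr \<gamma>)"
  have "(dist e z - dist i z) * dist e z <= (dist e z)^2 - (dist i z)^2" using mult_right_mono[OF i(2)[OF e(1)] zero_le_dist[of i z]] by (simp add: power2_eq_square algebra_simps)
  also have "... <= 2 * (c * sqrt (?Q + energy ?v + ?E) * diameter Om powr \<gamma>)" using sobolev_compare[OF c \<gamma> hv hpd e(1) i(1)] by simp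
  also have "... <= ?Y" proof (intro mult_left_mono mult_right_mono)
   have "sqrt (?Q + energy ?v + ?E) <= sqrt ?E * ((1 + ?\<mu>) / ?\<mu>)" by (rule sqrt_energy_le[OF \<mu> Qe en E0])
   also have "... <= sqrt ((N - 1) * ?D) * ((1 + ?\<mu>) / ?\<mu>)" using ED \<mu> by (intro mult_right_mono) auto
   finally show "sqrt (?Q + energy ?v + ?E) <= sqrt ((N - 1) * ?D) * ((1 + ?\<mu>) / ?\<mu>)" . qed (use c0 in auto)
  finally have "dist e z - dist i z <= ?Y * (?w / ?V)" using c0 D0 \<mu> N2 by (intro radius_division[OF _ VR V' \<rho>e]) auto
  thus "(SUP x\<in>Gam. dist x z) - (INF x\<in>Gam. dist x z)
   <= (planar_const TYPE('a) * c * diameter Om powr \<gamma> / V powr (1 / N) * ((1 + ?\<mu>) / ?\<mu>)) * ?D powr (1 / 2)"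
   unfolding \<rho> planar_const_def N_def[symmetric] powr_half_sqrt[OF D0] real_sqrt_mult by (simp add: mult_ac)
 next
  fix r assume r: "interior_sphere_radius Om r" and small: "?D < deficit_const TYPE('a) * ?\<mu>^2 * M^2 * r powr (N + 2)"
  have r0: "r > 0" using r by (simp add: interior_sphere_radius_def)
  have bdd: "bdd_above ((%x. norm (grad u x)) ` Om)" using grad_u_bounded by (auto simp: bdd_above_def)
  have M: "norm (grad u x) <= M" if "x : Om" for x unfolding M_def by (rule cSUP_upper[OF that bdd])
  \<comment> \<open>With \<open>?D >= 0\<close> the strict smallness condition excludes
    \<open>M = 0\<close>.\<close>
  have M0: "M > 0" proof -
   have "M ~= 0" using small D0 by auto
   moreover have "M >= 0" using M[OF z(1)] norm_ge_zero order_trans by blast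
   ultimately show ?thesis by simp qed
  define C where "C = 8 * (1 + sqrt ((2 * real DIM('a)) ^ DIM('a) / bump_int TYPE('a)))"
  have C0: "C > 0" using bump_int_pos[where 'a='a] by (auto simp: C_def intro!: mult_pos_pos add_pos_nonneg)
  let ?Y = "(N - 1) * ?D / ?\<mu>^2"
  have "energy ?v <= ?E / ?\<mu>" using en \<mu> by (simp add: le_divide_eq mult.commute)
  hence "?Q <= ?E / ?\<mu> / ?\<mu>" using Qe \<mu> by (smt (verit) divide_right_mono le_divide_eq mult.commute)
  also have "... <= ?Y" unfolding divide_divide_eq_left power2_eq_square using ED by (intro divide_right_mono) auto
  finally have QY: "?Q <= ?Y" .
  have main: "(dist e z - dist i z) * dist e z <= C * (M * s)" if "0 < s" "s <= r / 4" "?Y <= M^2 * s ^ (DIM('a) + 2)" for s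
   unfolding C_def by (rule radius_compare[OF r that(1,2) z(1) hv e i M order_trans[OF QY that(3)]])
  show "(SUP x\<in>Gam. dist x z) - (INF x\<in>Gam. dist x z)
   <= (general_const TYPE('a) * M powr (N / (N + 2)) / (?\<mu> powr (2 / (N + 2)) * V powr (1 / N))) * ?D powr (1 / (N + 2))" proof (cases "?D = 0")
   case True
   \<comment> \<open>For deficit 0 the optimal radius would be 0. Instead every small
     \<open>s\<close> is admissible, and the claimed bound is 0 because
     \<open>0 powr _ = 0\<close>.\<close>
   have "(dist e z - dist i z) * dist e z <= 0 + \<eta>" if \<eta>: "\<eta> > 0" for \<eta> proof -
   define s where "s = min (r / 4) (\<eta> / (C * M))"
   have s: "0 < s" "s <= r / 4" "C * (M * s) <= \<eta>" using r0 \<eta> C0 M0 by (auto simp: s_def min_def field_simps)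
   have "?Y <= M^2 * s ^ (DIM('a) + 2)" using s True by simp
   from main[OF s(1,2) this] s(3) show ?thesis by simp qed
   hence "(dist e z - dist i z) * dist e z <= 0" by (rule field_le_epsilon)
   hence "dist e z - dist i z <= 0" using \<rho>e by (simp add: mult_le_0_iff)
   thus ?thesis unfolding \<rho> by (simp add: True)
  next
   case False
   hence D: "?D > 0" using D0 by simp
   have N_eq: "N + 2 = real (DIM('a) + 2)" by (simp add: N_def)
   \<comment> \<open>The optimal radius, the least \<open>s\<close> allowed by \<open>main\<close>:
     there \<open>?Y = M^2 * s ^ (DIM('a) + 2)\<close>.\<close>
   define s where "s = (?Y / M^2) powr (1 / (N + 2))"
   have YM: "?Y / M^2 > 0" using D \<mu> M0 N2 by simp
   have s0: "s > 0" unfolding s_def powr_gt_zero by (rule less_imp_neq[OF YM, symmetric])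
   have "s ^ (DIM('a) + 2) = s powr (N + 2)" by (simp only: N_eq powr_realpow[OF s0])
   moreover have "1 / (N + 2) * (N + 2) = 1" using N2 by simp
   ultimately have sp: "s ^ (DIM('a) + 2) = ?Y / M^2" by (simp only: s_def powr_powr powr_one[OF less_imp_le[OF YM]])
   have rp: "r powr (N + 2) = r ^ (DIM('a) + 2)" by (simp only: N_eq powr_realpow[OF r0])
   have "?Y / M^2 <= (r / 4) ^ (DIM('a) + 2)" proof -
   have "(N - 1) * ?D <= (N - 1) * (deficit_const TYPE('a) * ?\<mu>^2 * M^2 * r ^ (DIM('a) + 2))" using small N2 unfolding rp by (intro mult_left_mono) auto
   also have "... = ?\<mu>^2 * M^2 * (r / 4) ^ (DIM('a) + 2)" unfolding deficit_const_def N_def[symmetric] power_divide using N2 by simp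
   finally show ?thesis using \<mu> M0 by (simp add: divide_le_eq mult_ac) qed
   hence "s ^ Suc (DIM('a) + 1) <= (r / 4) ^ Suc (DIM('a) + 1)" using sp by simp
   hence s4: "s <= r / 4" by (rule power_le_imp_le_base) (use r0 in simp)
   have "(dist e z - dist i z) * dist e z <= C * (M * s)" by (rule main[OF s0 s4]) (use sp M0 in simp)
   hence "dist e z - dist i z <= C * (M * s) * (?w / ?V)" using C0 M0 s0 by (intro radius_division[OF _ VR V' \<rho>e]) auto
   also have "M * s = (N - 1) powr (1 / (N + 2)) * (M powr (N / (N + 2)) / ?\<mu> powr (2 / (N + 2))) * ?D powr (1 / (N + 2))"
   unfolding s_def using N2 by (intro optimal_radius_powr M0 \<mu> D) auto
   finally show ?thesis unfolding \<rho> general_const_def N_def[symmetric] C_def by (simp add: mult_ac) qed qed qed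

end

theorem theorem4p5:
  assumes dim: "DIM('a::euclidean_space) \<ge> 2"
  shows "\<exists>kN aN. kN > 0 \<and> aN > 0 \<and>
   (\<forall>(\<alpha>::real) (\<Omega>::'a set) u.
      0 < \<alpha> \<and> \<alpha> < 1 \<and> open \<Omega> \<and> connected \<Omega> \<and> bounded \<Omega> \<and> \<Omega> \<noteq> {} \<and>
      connected (frontier \<Omega>) \<and> C2alpha_boundary \<Omega> \<alpha> \<and>
      (\<forall>x\<in>frontier \<Omega>. mean_curv \<Omega> x > 0) \<and>
      C2_on \<Omega> u \<and> continuous_on (closure \<Omega>) u \<and>
      (\<forall>x\<in>\<Omega>. lap u x = real DIM('a)) \<and> (\<forall>x\<in>frontier \<Omega>. u x = 0)
    \<longrightarrow>
     (let N = real DIM('a);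
          M = (SUP x\<in>\<Omega>. norm (grad u x));
          D = surface_integral (frontier \<Omega>) (\<lambda>x. 1 / mean_curv \<Omega> x) - N * measure lebesgue \<Omega>;
          V = measure lebesgue \<Omega>;
          d = diameter \<Omega>
      in \<exists>z\<in>\<Omega>.
        (let \<rho>i = (INF x\<in>frontier \<Omega>. dist x z);
             \<rho>e = (SUP x\<in>frontier \<Omega>. dist x z);
             \<mu> = mu0 \<Omega> z
         in
          ((DIM('a) = 2 \<or> DIM('a) = 3) \<longrightarrow>
             (\<forall>\<gamma> c. (if DIM('a) = 2 then 0 < \<gamma> \<and> \<gamma> < 1 else \<gamma> = 1/2) \<and>
                     sobolev_holder_const \<Omega> \<gamma> c \<longrightarrow>
                \<rho>e - \<rho>i \<le> (kN * c * d powr \<gamma> / V powr (1 / N) * ((1 + \<mu>) / \<mu>)) * D powr (1/2)))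
          \<and>
          (DIM('a) \<ge> 4 \<longrightarrow>
             (\<forall>ri. interior_sphere_radius \<Omega> ri \<and> D < aN * \<mu>\<^sup>2 * M\<^sup>2 * ri powr (N + 2) \<longrightarrow>
                \<rho>e - \<rho>i \<le> (kN * M powr (N / (N + 2)) / (\<mu> powr (2 / (N + 2)) * V powr (1 / N)))
                            * D powr (1 / (N + 2)))))))"
proof -
 \<comment> \<open>In a given dimension only one of the two claims is in force, so \<open>kN\<close>
   is chosen by cases on the dimension.\<close>
 define k where "k = (if DIM('a) >= 4 then general_const TYPE('a) else planar_const TYPE('a))"
 have "unit_ball_vol (real DIM('a)) ~= 0" using unit_ball_vol_pos[of "real DIM('a)"] by (metis less_irrefl of_nat_0_le_iff)
 hence k0: "k > 0" using dim bump_int_pos[where 'a='a] by (auto simp: k_def general_const_def planar_const_def intro!: mult_pos_pos add_pos_nonneg)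
 have a0: "deficit_const TYPE('a) > 0" using dim by (simp add: deficit_const_def)
 show ?thesis proof (rule exI, rule exI, intro conjI allI impI, rule k0, rule a0, goal_cases)
  case (1 \<alpha> Om u)
  hence as: "open Om" "connected Om" "bounded Om" "Om ~= {}" "C2alpha_boundary Om \<alpha>" "!!x. x : frontier Om ==> mean_curv Om x > 0"
   "C2_on Om u" "continuous_on (closure Om) u" "!!x. x : Om ==> lap u x = real DIM('a)" "!!x. x : frontier Om ==> u x = 0" by blast+
  have "EX r \<phi>. local_defn Om p r \<phi>" if "p : frontier Om" for p using as(5) that unfolding C2alpha_boundary_def by blast
  from global_defining_function[OF as(1,3) this]
  obtain Ph R where Ph: "C2_on UNIV Ph" "!!x. x ~: cball 0 R ==> Ph x = 0" "Om = {x. Ph x < 0}"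
   "!!x. x : frontier Om ==> Ph x = 0" "!!x. x : frontier Om ==> grad Ph x ~= 0" by blast
  interpret torsion Om Ph R u by unfold_locales (fact as Ph)+
  show ?case proof (rule stability[OF dim as(2,6)], assumption, goal_cases)
   case z: (1 z)
   show ?case unfolding Let_def deficit_def[symmetric] proof (intro bexI[OF _ z(1)] conjI impI allI, goal_cases)
   case (1 \<gamma> c)
   hence "0 < \<gamma>" by (auto split: if_splits)
   thus ?case using z(2)[of \<gamma> c] 1 by (auto simp: k_def)
   next
   case (2 r)
   thus ?case using z(3)[of r] by (simp add: k_def) qed qed qed qed

end
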